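(* Let $D=(G,\mathcal{O},w)$ be a weighted oriented graph with $G$ connected and of girth at least $5$ (no $3$- or $4$-cycles). Then $I(D)$ is unmixed if and only if $D$ satisfies one of: (a) $G$ is isomorphic to one of $K_1,C_7,Q_{13},P_{13},P_{14}$, and every vertex of $V^{+}$ is a sink; (b) there is an isomorphism $P_{10}\to G$ such that, identifying vertices of $G$ with their labels, every $y\in V^{+}$ that is not a sink satisfies either $y=d_1$ and $N_D^{+}(y)=\{g_1,b_2\}$, or $y=d_2$ and $N_D^{+}(y)=\{g_2,b_1\}$; (c) every vertex of $G$ lies in exactly one member of $S_G\cup C_G$ (i.e. $\{V(H)\mid H\in S_G\cup C_G\}$ is a partition of $V(G)$), no simplex of $D$ has a generating $\star$-semi-forest, and every basic $5$-cycle has the $\star$-property.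
   Context: A weighted oriented graph is a triple $D=(G,\mathcal{O},w)$ with $G$ a finite simple graph with vertex set $\{x_1,\dots,x_n\}$, $\mathcal{O}$ an orientation of its edges, $w:V(G)\to\mathbb{N}$; $E(D)$ is the set of oriented edges. $V^{+}=\{x\mid w(x)>1\}$. $I(D)=(x_ix_j^{w(x_j)}\mid (x_i,x_j)\in E(D))\subseteq K[x_1,\dots,x_n]$, $K$ a field; unmixed means all associated primes have the same height. $N_D^{+}(x)=\{y\mid(x,y)\in E(D)\}$, $N_D^{-}(x)=\{y\mid(y,x)\in E(D)\}$, $N_D(x)=N_D^+(x)\cup N_D^-(x)$. A sink has $N_D^+(x)=\emptyset$, a source $N_D^-(x)=\emptyset$; standing convention: sources have weight $1$. Special graphs: $K_1$ single vertex; $C_7$ the $7$-cycle. $P_{10}$: vertices $a_1,a_2,b_1,b_2,c_1,c_2,d_1,d_2,g_1,g_2$, edges $a_1b_1,b_1d_2,d_2d_1,d_1b_2,b_2a_2,a_1g_1,g_1d_1,g_1c_1,c_1c_2,c_2g_2,g_2a_2,d_2g_2$. $P_{13}$: vertices $a_1,\dots,a_4,b_1,\dots,b_4,c_1,c_2,d_1,d_2,v$, edges $a_1a_2,a_1b_1,a_2b_2,b_1c_1,b_2c_1,c_1c_2,c_2b_3,c_2b_4,a_3b_3,a_4b_4,a_3a_4,b_1d_1,b_3d_1,b_2d_2,b_4d_2,d_1v,d_2v$. $P_{14}$: vertices $a_1,\dots,a_7,b_1,\dots,b_7$, edges $a_ia_{i+1}$ (indices mod $7$), $a_ib_i$ for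 $i=1,\dots,6$, and $b_ib_{i+2}$ (indices mod $7$) for all $i$. $Q_{13}$: vertices $a_1,a_2,b_1,b_2,c_1,c_2,d_1,d_2,g_1,g_2,h,h',v$, edges $a_1a_2,a_1d_1,a_2d_2,d_1h,d_2h,hv,vh',h'g_1,h'g_2,d_1g_1,d_2g_2,g_1b_1,g_2b_2,b_2c_1,c_1d_1,b_1c_2,c_2d_2$. A vertex $v$ is simplicial if $G[N_G[v]]$ is complete; then $G[N_G[v]]$ is a simplex; $S_G$ is the set of simplexes; a simplex of $D$ is the induced weighted oriented subgraph of $D$ on its vertex set. A basic $5$-cycle is an induced $5$-cycle of $G$ with no two adjacent vertices both of degree $\ge3$ in $G$; $C_G$ is the set of them. An induced $5$-cycle $C$ has the $\star$-property if for each $(a,b)\in E(D)$ that is an edge of $C$ with $a\in V^+$, writing $C=(a',a,b,b',c,a')$: ($\star$.1) $(a',a)\in E(D)$ and $w(a')=1$; ($\star$.2) $N_D^-(a)\subseteq N_D(c)$ and $N_D^-(a)\cap V^+\subseteq N_D^-(c)$; ($\star$.3) $N_D(b')\subseteq N_D(a')\cup N_D^+(a)$ and $N_D^-(b')\cap V^+\subseteq N_D^-(a')$. Weighted oriented subgraph: oriented subgraph of $(G,\mathcal{O})$ with restricted weights; $\deg_H(x)$ = number of neighbours in $H$. Oriented path: distinct $(y_1,\dots,y_m)$ with $(y_i,y_{i+1})\in E(D)$; oriented cycle: such a path closed by $(y_m,y_1)\in E(D)$. Unicycle oriented subgraph: weighted oriented subgraph $B$ with exactly one cycle $C$, $C$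 oriented, every vertex off $C$ reached by an oriented path in $B$ from $C$, and $w(x)=1\Rightarrow\deg_B(x)=1$. ROT with parent $v$: acyclic weighted oriented subgraph $T\ni v$, every $x\ne v$ reached by an oriented path in $T$ from $v$, and $w(x)=1$ implies ($\deg_T(x)=1$, $x\ne v$) or ($V(T)=\{v\}=\{x\}$). $\star$-semi-forest: $H=(\bigcup_{i=1}^r T_i)\cup(\bigcup_{j=1}^s B_j)$, $T_i$ ROTs with parents $v_i$, $B_j$ unicycle, vertex sets partitioning $V(H)$, with $W=\{w_1,\dots,w_r\}\subseteq V(D)\setminus V(H)$, $w_i\in N_D(v_i)$ (repetitions allowed), and a partition $W_1,W_2$ of $W$ with $W_1$ stable, $W_2\subseteq V^+$, $(w_i,v_i)\in E(D)$ if $w_i\in W_2$, and $N_D^+(W_2\cup\tilde H)\cap W_1=\emptyset$, $\tilde H=\{x\in V(H)\mid\deg_H(x)\ge2\}\cup\{v_i\mid\deg_H(v_i)=1\}$. A generating $\star$-semi-forest of $K$ is a $\star$-semi-forest $H$ of $D$ with $V(H)=V(K)$.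
   Formalization: Two edge lists are corrected, since with the printed ones the claim fails (those graphs with all weights 1 satisfy (a) but are not unmixed): Q_13 also has the edge c_1c_2, and P_14 has all seven edges a_ib_i, i=1,…,7 (so also a_7b_7). *)

theory Defs
  imports
    "HOL-Library.Poly_Mapping"
    "HOL-Library.Extended_Nat"
    "HOL-Library.Disjoint_Sets"
    "HOL-Algebra.Ideal"
begin

section \<open>Simple graphs\<close>

text \<open>A simple graph is a pair of a vertex set and a set of two-element edges.\<close>

type_synonym 'v sgraph = "'v set \<times> 'v set set"

definition graph_nbrs :: "'v sgraph \<Rightarrow> 'v \<Rightarrow> 'v set" where
  "graph_nbrs G x = {y. {x, y} \<in> snd G}"

definition graph_deg :: "'v sgraph \<Rightarrow> 'v \<Rightarrow> nat" where
  "graph_deg G x = card (graph_nbrs G x)"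

definition graph_induced :: "'v sgraph \<Rightarrow> 'v set \<Rightarrow> 'v sgraph" where
  "graph_induced G X = (fst G \<inter> X, {e \<in> snd G. e \<subseteq> X})"

definition complete_graph :: "'v sgraph \<Rightarrow> bool" where
  "complete_graph G \<longleftrightarrow> (\<forall>x\<in>fst G. \<forall>y\<in>fst G. x \<noteq> y \<longrightarrow> {x, y} \<in> snd G)"

definition connected_graph :: "'v sgraph \<Rightarrow> bool" where
  "connected_graph G \<longleftrightarrow> fst G \<noteq> {} \<and>
     (\<forall>x\<in>fst G. \<forall>y\<in>fst G. (x, y) \<in> {(u, v). {u, v} \<in> snd G}\<^sup>*)"

definition graph_iso :: "'a sgraph \<Rightarrow> 'b sgraph \<Rightarrow> ('a \<Rightarrow> 'b) \<Rightarrow> bool" where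
  "graph_iso G H \<phi> \<longleftrightarrow> bij_betw \<phi> (fst G) (fst H) \<and>
     (\<forall>x\<in>fst G. \<forall>y\<in>fst G. {x, y} \<in> snd G \<longleftrightarrow> {\<phi> x, \<phi> y} \<in> snd H)"

definition isomorphic :: "'a sgraph \<Rightarrow> 'b sgraph \<Rightarrow> bool" where
  "isomorphic G H \<longleftrightarrow> (\<exists>\<phi>. graph_iso G H \<phi>)"

text \<open>The list \<open>[c\<^sub>0, \<dots>, c\<^sub>k]\<close> enumerates the vertices of a cycle; its edge set does not depend on
  the starting point or the direction, so cycles as subgraphs correspond to these edge sets.\<close>

definition cycle_edges :: "'v list \<Rightarrow> 'v set set" where
  "cycle_edges c = {{c ! i, c ! (Suc i mod length c)} | i. i < length c}"

definition is_cycle :: "'v sgraph \<Rightarrow> 'v list \<Rightarrow> bool" where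
  "is_cycle G c \<longleftrightarrow> 3 \<le> length c \<and> distinct c \<and> cycle_edges c \<subseteq> snd G"

text \<open>Girth at least \<open>k\<close>; this includes graphs without cycles.\<close>

definition girth_at_least :: "nat \<Rightarrow> 'v sgraph \<Rightarrow> bool" where
  "girth_at_least k G \<longleftrightarrow> (\<forall>c. is_cycle G c \<longrightarrow> k \<le> length c)"

definition simplicial :: "'v sgraph \<Rightarrow> 'v \<Rightarrow> bool" where
  "simplicial G v \<longleftrightarrow> v \<in> fst G \<and> complete_graph (graph_induced G (insert v (graph_nbrs G v)))"

definition simplexes :: "'v sgraph \<Rightarrow> 'v sgraph set" where
  "simplexes G = {graph_induced G (insert v (graph_nbrs G v)) | v. simplicial G v}"

definition induced_5_cycles :: "'v sgraph \<Rightarrow> 'v sgraph set" where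
  "induced_5_cycles G = {graph_induced G (set c) | c.
     is_cycle G c \<and> length c = 5 \<and> snd (graph_induced G (set c)) = cycle_edges c}"

definition basic_5_cycles :: "'v sgraph \<Rightarrow> 'v sgraph set" where
  "basic_5_cycles G = {C \<in> induced_5_cycles G.
     \<forall>x y. {x, y} \<in> snd C \<longrightarrow> \<not> (3 \<le> graph_deg G x \<and> 3 \<le> graph_deg G y)}"

section \<open>The special graphs\<close>

datatype label = va nat | vb nat | vc nat | vd nat | vg nat | vh | vh' | vv

definition K\<^sub>1 :: "nat sgraph" where
  "K\<^sub>1 = ({0}, {})"

definition C\<^sub>7 :: "nat sgraph" where
  "C\<^sub>7 = ({..<7}, {{i, Suc i mod 7} | i. i < 7})"

definition P\<^sub>1\<^sub>0 :: "label sgraph" where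
  "P\<^sub>1\<^sub>0 =
    ({va 1, va 2, vb 1, vb 2, vc 1, vc 2, vd 1, vd 2, vg 1, vg 2},
     {{va 1, vb 1}, {vb 1, vd 2}, {vd 2, vd 1}, {vd 1, vb 2}, {vb 2, va 2}, {va 1, vg 1},
      {vg 1, vd 1}, {vg 1, vc 1}, {vc 1, vc 2}, {vc 2, vg 2}, {vg 2, va 2}, {vd 2, vg 2}})"

definition P\<^sub>1\<^sub>3 :: "label sgraph" where
  "P\<^sub>1\<^sub>3 =
    ({va 1, va 2, va 3, va 4, vb 1, vb 2, vb 3, vb 4, vc 1, vc 2, vd 1, vd 2, vv},
     {{va 1, va 2}, {va 1, vb 1}, {va 2, vb 2}, {vb 1, vc 1}, {vb 2, vc 1}, {vc 1, vc 2},
      {vc 2, vb 3}, {vc 2, vb 4}, {va 3, vb 3}, {va 4, vb 4}, {va 3, va 4}, {vb 1, vd 1},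
      {vb 3, vd 1}, {vb 2, vd 2}, {vb 4, vd 2}, {vd 1, vv}, {vd 2, vv}})"

text \<open>Indices are read modulo 7 with representatives \<open>1, \<dots>, 7\<close>: the successor of \<open>i\<close> is
  \<open>i mod 7 + 1\<close>. All seven spokes \<open>a\<^sub>i b\<^sub>i\<close> are present, so this is the generalized Petersen graph
  \<open>P(7,2)\<close>. Without the spoke \<open>a\<^sub>7 b\<^sub>7\<close> the graph is not well-covered.\<close>

definition P\<^sub>1\<^sub>4 :: "label sgraph" where
  "P\<^sub>1\<^sub>4 =
    (va ` {1..7} \<union> vb ` {1..7},
     {{va i, va (i mod 7 + 1)} | i. i \<in> {1..7}} \<union>
     {{va i, vb i} | i. i \<in> {1..7}} \<union>
     {{vb i, vb ((i + 1) mod 7 + 1)} | i. i \<in> {1..7}})"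

text \<open>This is the 18-edge well-covered graph of that name in the Finbow--Hartnell--Nowakowski
  classification. Without the edge \<open>c\<^sub>1 c\<^sub>2\<close> the graph is not well-covered.\<close>

definition Q\<^sub>1\<^sub>3 :: "label sgraph" where
  "Q\<^sub>1\<^sub>3 =
    ({va 1, va 2, vb 1, vb 2, vc 1, vc 2, vd 1, vd 2, vg 1, vg 2, vh, vh', vv},
     {{va 1, va 2}, {va 1, vd 1}, {va 2, vd 2}, {vd 1, vh}, {vd 2, vh}, {vh, vv}, {vv, vh'},
      {vh', vg 1}, {vh', vg 2}, {vd 1, vg 1}, {vd 2, vg 2}, {vg 1, vb 1}, {vg 2, vb 2},
      {vb 2, vc 1}, {vc 1, vd 1}, {vb 1, vc 2}, {vc 2, vd 2}, {vc 1, vc 2}})"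

section \<open>Weighted oriented graphs\<close>

record 'v wograph =
  verts :: "'v set"
  arcs :: "('v \<times> 'v) set"
  weight :: "'v \<Rightarrow> nat"

text \<open>The asymmetry condition says that \<^term>\<open>arcs D\<close> is an orientation of a simple graph; in
  particular there are no loops. Weights are positive integers.\<close>

definition weighted_oriented_graph :: "'v wograph \<Rightarrow> bool" where
  "weighted_oriented_graph D \<longleftrightarrow> finite (verts D) \<and> arcs D \<subseteq> verts D \<times> verts D \<and>
     (\<forall>x y. (x, y) \<in> arcs D \<longrightarrow> (y, x) \<notin> arcs D) \<and> (\<forall>x\<in>verts D. 1 \<le> weight D x)"

definition underlying :: "'v wograph \<Rightarrow> 'v sgraph" where
  "underlying D = (verts D, {{x, y} | x y. (x, y) \<in> arcs D})"

definition out_nbrs :: "'v wograph \<Rightarrow> 'v \<Rightarrow> 'v set" where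
  "out_nbrs D x = {y. (x, y) \<in> arcs D}"

definition in_nbrs :: "'v wograph \<Rightarrow> 'v \<Rightarrow> 'v set" where
  "in_nbrs D x = {y. (y, x) \<in> arcs D}"

definition nbrs :: "'v wograph \<Rightarrow> 'v \<Rightarrow> 'v set" where
  "nbrs D x = out_nbrs D x \<union> in_nbrs D x"

definition deg :: "'v wograph \<Rightarrow> 'v \<Rightarrow> nat" where
  "deg D x = card (nbrs D x)"

definition Vplus :: "'v wograph \<Rightarrow> 'v set" where
  "Vplus D = {x \<in> verts D. 1 < weight D x}"

definition sink :: "'v wograph \<Rightarrow> 'v \<Rightarrow> bool" where
  "sink D x \<longleftrightarrow> x \<in> verts D \<and> out_nbrs D x = {}"

definition source :: "'v wograph \<Rightarrow> 'v \<Rightarrow> bool" where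
  "source D x \<longleftrightarrow> x \<in> verts D \<and> in_nbrs D x = {}"

text \<open>Subgraphs are not required to satisfy the convention on sources.\<close>

definition wo_subgraph :: "'v wograph \<Rightarrow> 'v wograph \<Rightarrow> bool" where
  "wo_subgraph H D \<longleftrightarrow> verts H \<subseteq> verts D \<and> arcs H \<subseteq> arcs D \<and> arcs H \<subseteq> verts H \<times> verts H \<and>
     (\<forall>x\<in>verts H. weight H x = weight D x)"

definition wo_induced :: "'v wograph \<Rightarrow> 'v set \<Rightarrow> 'v wograph" where
  "wo_induced D X =
     \<lparr>verts = verts D \<inter> X, arcs = arcs D \<inter> (X \<times> X), weight = weight D\<rparr>"

definition wo_simplexes :: "'v wograph \<Rightarrow> 'v wograph set" where
  "wo_simplexes D = {wo_induced D (fst K) | K. K \<in> simplexes (underlying D)}"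

definition oriented_path :: "'v wograph \<Rightarrow> 'v list \<Rightarrow> bool" where
  "oriented_path D p \<longleftrightarrow> p \<noteq> [] \<and> distinct p \<and> set p \<subseteq> verts D \<and>
     (\<forall>i. Suc i < length p \<longrightarrow> (p ! i, p ! Suc i) \<in> arcs D)"

definition oriented_cycle :: "'v wograph \<Rightarrow> 'v list \<Rightarrow> bool" where
  "oriented_cycle D c \<longleftrightarrow> oriented_path D c \<and> (last c, hd c) \<in> arcs D"

definition reaches :: "'v wograph \<Rightarrow> 'v \<Rightarrow> 'v \<Rightarrow> bool" where
  "reaches D x y \<longleftrightarrow> (\<exists>p. oriented_path D p \<and> hd p = x \<and> last p = y)"

text \<open>The unique cycle of the underlying graph is the underlying cycle of an oriented cycle.\<close>

definition unicycle_subgraph :: "'v wograph \<Rightarrow> 'v wograph \<Rightarrow> bool" where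
  "unicycle_subgraph D B \<longleftrightarrow> wo_subgraph B D \<and>
     (\<exists>c. is_cycle (underlying B) c \<and> oriented_cycle B c \<and>
          (\<forall>c'. is_cycle (underlying B) c' \<longrightarrow> cycle_edges c' = cycle_edges c) \<and>
          (\<forall>y\<in>verts B - set c. \<exists>x\<in>set c. reaches B x y)) \<and>
     (\<forall>x\<in>verts B. weight B x = 1 \<longrightarrow> deg B x = 1)"

text \<open>Root oriented trees; acyclicity refers to the underlying undirected graph.\<close>

definition ROT :: "'v wograph \<Rightarrow> 'v wograph \<Rightarrow> 'v \<Rightarrow> bool" where
  "ROT D T v \<longleftrightarrow> wo_subgraph T D \<and> v \<in> verts T \<and>
     (\<nexists>c. is_cycle (underlying T) c) \<and>
     (\<forall>x\<in>verts T - {v}. reaches T v x) \<and>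
     (\<forall>x\<in>verts T. weight T x = 1 \<longrightarrow>
        (deg T x = 1 \<and> x \<noteq> v) \<or> (verts T = {v} \<and> x = v))"

definition stable_set :: "'v wograph \<Rightarrow> 'v set \<Rightarrow> bool" where
  "stable_set D S \<longleftrightarrow> (\<forall>x\<in>S. \<forall>y\<in>S. (x, y) \<notin> arcs D)"

text \<open>The components are indexed by \<open>{..<r}\<close> and \<open>{..<s}\<close>, where \<open>r\<close> or \<open>s\<close> may be \<open>0\<close>; one of the
  two classes \<open>W\<^sub>1\<close>, \<open>W\<^sub>2\<close> may be empty.\<close>

definition star_semi_forest :: "'v wograph \<Rightarrow> 'v wograph \<Rightarrow> bool" where
  "star_semi_forest D H \<longleftrightarrow> wo_subgraph H D \<and>
     (\<exists>(r::nat) (s::nat) T v B w W\<^sub>1 W\<^sub>2.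
        (\<forall>i<r. ROT D (T i) (v i)) \<and>
        (\<forall>j<s. unicycle_subgraph D (B j)) \<and>
        verts H = (\<Union>i<r. verts (T i)) \<union> (\<Union>j<s. verts (B j)) \<and>
        arcs H = (\<Union>i<r. arcs (T i)) \<union> (\<Union>j<s. arcs (B j)) \<and>
        disjoint_family_on (\<lambda>i. verts (T i)) {..<r} \<and>
        disjoint_family_on (\<lambda>j. verts (B j)) {..<s} \<and>
        (\<forall>i<r. \<forall>j<s. verts (T i) \<inter> verts (B j) = {}) \<and>
        (\<forall>i<r. w i \<in> verts D - verts H \<and> w i \<in> nbrs D (v i)) \<and>
        W\<^sub>1 \<union> W\<^sub>2 = w ` {..<r} \<and> W\<^sub>1 \<inter> W\<^sub>2 = {} \<and>
        stable_set D W\<^sub>1 \<and>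
        W\<^sub>2 \<subseteq> Vplus D \<and>
        (\<forall>i<r. w i \<in> W\<^sub>2 \<longrightarrow> (w i, v i) \<in> arcs D) \<and>
        (let H' = {x \<in> verts H. 2 \<le> deg H x} \<union> {v i | i. i < r \<and> deg H (v i) = 1}
         in (\<Union>x\<in>W\<^sub>2 \<union> H'. out_nbrs D x) \<inter> W\<^sub>1 = {}))"

definition generating_star_semi_forest :: "'v wograph \<Rightarrow> 'v wograph \<Rightarrow> 'v wograph \<Rightarrow> bool" where
  "generating_star_semi_forest D K H \<longleftrightarrow> star_semi_forest D H \<and> verts H = verts K"

text \<open>Here \<^term>\<open>C\<close> is an induced 5-cycle of \<^term>\<open>underlying D\<close>, and the five quantified vertices
  range over all ways of writing it as \<open>(a', a, b, b', c, a')\<close>.\<close>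

definition star_property :: "'v wograph \<Rightarrow> 'v sgraph \<Rightarrow> bool" where
  "star_property D C \<longleftrightarrow>
     (\<forall>a' a b b' c. is_cycle C [a', a, b, b', c] \<and> (a, b) \<in> arcs D \<and> a \<in> Vplus D \<longrightarrow>
        ((a', a) \<in> arcs D \<and> weight D a' = 1) \<and>
        (in_nbrs D a \<subseteq> nbrs D c \<and> in_nbrs D a \<inter> Vplus D \<subseteq> in_nbrs D c) \<and>
        (nbrs D b' \<subseteq> nbrs D a' \<union> out_nbrs D a \<and> in_nbrs D b' \<inter> Vplus D \<subseteq> in_nbrs D a'))"

section \<open>Unmixed ideals and the edge ideal\<close>

definition associated_primes :: "('a, 'b) ring_scheme \<Rightarrow> 'a set \<Rightarrow> 'a set set" where
  "associated_primes R I = {P. primeideal P R \<and>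
     (\<exists>f\<in>carrier R. P = {g \<in> carrier R. g \<otimes>\<^bsub>R\<^esub> f \<in> I})}"

text \<open>Supremum of the lengths \<open>n\<close> of chains \<open>P\<^sub>0 \<subset> \<dots> \<subset> P\<^sub>n = P\<close> of prime ideals.\<close>

definition height :: "('a, 'b) ring_scheme \<Rightarrow> 'a set \<Rightarrow> enat" where
  "height R P = Sup {enat n | n. \<exists>c :: nat \<Rightarrow> 'a set.
     (\<forall>i\<le>n. primeideal (c i) R) \<and> (\<forall>i<n. c i \<subset> c (Suc i)) \<and> c n = P}"

definition unmixed :: "('a, 'b) ring_scheme \<Rightarrow> 'a set \<Rightarrow> bool" where
  "unmixed R I \<longleftrightarrow>
     (\<forall>P\<in>associated_primes R I. \<forall>Q\<in>associated_primes R I. height R P = height R Q)"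

text \<open>A polynomial maps exponent vectors to coefficients, both finitely supported. The ring
  \<open>K[x\<^sub>v | v \<in> V]\<close> consists of those in which only variables from \<open>V\<close> occur.\<close>

definition polynomial_ring :: "'v set \<Rightarrow> (('v \<Rightarrow>\<^sub>0 nat) \<Rightarrow>\<^sub>0 'k::field) ring" where
  "polynomial_ring V =
     \<lparr>carrier = {p. \<forall>m\<in>Poly_Mapping.keys p. Poly_Mapping.keys m \<subseteq> V},
      mult = (*), one = 1, zero = 0, add = (+)\<rparr>"

definition variable :: "'v \<Rightarrow> (('v \<Rightarrow>\<^sub>0 nat) \<Rightarrow>\<^sub>0 'k::field)" where
  "variable v = Poly_Mapping.single (Poly_Mapping.single v 1) 1"

definition edge_ideal :: "'v wograph \<Rightarrow> (('v \<Rightarrow>\<^sub>0 nat) \<Rightarrow>\<^sub>0 'k::field) set" where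
  "edge_ideal D = genideal (polynomial_ring (verts D))
     {variable x * variable y ^ weight D y | x y. (x, y) \<in> arcs D}"

end

theory Submission
  imports Defs
begin

text \<open>The ideal \<open>I(D)\<close> is spanned by monomials. Writing an associated prime as \<open>(I(D) : f)\<close> with as few
  monomials of \<open>f\<close> outside \<open>I(D)\<close> as possible shows that it is generated by the variables of a strong
  vertex cover of \<open>D\<close>, and every strong cover occurs; the height of such a prime is its number of
  variables. Hence \<open>I(D)\<close> is unmixed iff all strong covers have the same size. Complements of maximal
  stable sets are strong covers, so \<open>G\<close> is then well-covered, which is used only in the following form:
  if \<open>A\<close>, \<open>B\<close> are stable and \<open>N[A] \<subseteq> N[B]\<close>, then \<open>|A| \<le> |B|\<close>. By induction, a connected well-covered graph
  of girth at least five has all its vertices in pendant edges and basic 5-cycles, or it is one of \<open>K\<^sub>1\<close>,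
  \<open>C\<^sub>7\<close>, \<open>P\<^sub>1\<^sub>0\<close>, \<open>P\<^sub>1\<^sub>3\<close>, \<open>Q\<^sub>1\<^sub>3\<close>, \<open>P\<^sub>1\<^sub>4\<close> (Finbow, Hartnell and Nowakowski): deleting a closed neighbourhood leaves a
  smaller special graph or \<open>C\<^sub>7\<close>, and the ways to attach a star to a special graph are checked by
  evaluation. The weights enter through strong covers whose complement \<open>S\<close> is not a maximal stable set.
  A non-sink \<open>y\<close> of weight greater than one, with an in-neighbour in \<open>S\<close> and no out-neighbour in \<open>S\<close>, provides
  such covers; excluding them yields the local conditions, and conversely under these conditions a strong
  cover meets each pendant edge in one and each basic 5-cycle in three vertices.\<close>

section \<open>Well-covered graphs of girth at least five\<close>

text \<open>The local argument rests on transversals: choices, for the neighbours of a vertex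
  \<open>y\<close>, of further neighbours that are pairwise non-adjacent. If none exists, a minimal
  obstruction has at most two members, and this alone puts \<open>y\<close> on a pendant edge or a
  basic 5-cycle. If one exists, deleting the closed neighbourhoods of some of its members lowers the
  degree of \<open>y\<close> to any prescribed value and keeps the rest of the transversal.
  Comparing both facts on smaller graphs leaves only degree two. The obstacle is that a special
  component left by a deletion need not be a component of the original graph. Deleted vertices are
  therefore put back one at a time; a vertex that reconnects the component becomes, after another
  deletion, the centre of a star attached to it. The stars that survive lead from C7 to P10 and from
  P10 to P13, Q13 and P14, and none leads further, so the growth stops. On the algebraic side
  \<open>height\<close> speaks of chains of arbitrary primes, which is why variable ideals need a
  dimension count.\<close>

locale girth5 =
  fixes adj :: "'v \<Rightarrow> 'v \<Rightarrow> bool"  (infix "\<sim>" 50)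
  assumes sym: "x \<sim> y \<Longrightarrow> y \<sim> x"
    and no3: "x \<sim> y \<Longrightarrow> y \<sim> z \<Longrightarrow> \<not> x \<sim> z"
    and no4: "x \<sim> a \<Longrightarrow> x \<sim> b \<Longrightarrow> y \<sim> a \<Longrightarrow> y \<sim> b \<Longrightarrow> x \<noteq> y \<Longrightarrow> a = b"
begin

lemma irr: "\<not> x \<sim> x"
  using no3 by blast

lemma comm: "x \<sim> y \<longleftrightarrow> y \<sim> x"
  using sym by blast

lemma no_common: "a \<sim> x \<Longrightarrow> a \<sim> y \<Longrightarrow> \<not> x \<sim> y"
  using no3 sym by blast

lemma no_chord: "a \<sim> b \<Longrightarrow> b \<sim> c \<Longrightarrow> c \<sim> d \<Longrightarrow> a \<noteq> c \<Longrightarrow> b \<noteq> d \<Longrightarrow> \<not> a \<sim> d"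
  using no4[of a b d c] sym by blast

definition nb :: "'v set \<Rightarrow> 'v \<Rightarrow> 'v set" where
  "nb V x = {y \<in> V. x \<sim> y}"

definition cl :: "'v set \<Rightarrow> 'v set" where
  "cl A = {y. y \<in> A \<or> (\<exists>a\<in>A. a \<sim> y)}"

definition indep :: "'v set \<Rightarrow> bool" where
  "indep A \<longleftrightarrow> (\<forall>x\<in>A. \<forall>y\<in>A. \<not> x \<sim> y)"

definition closed :: "'v set \<Rightarrow> 'v set \<Rightarrow> bool" where
  "closed V X \<longleftrightarrow> X \<subseteq> V \<and> (\<forall>x\<in>X. \<forall>y\<in>V. x \<sim> y \<longrightarrow> y \<in> X)"

text \<open>For finite \<open>V\<close> this is equivalent to the usual definition that all maximal stable sets of the subgraph
  induced by \<open>V\<close> have the same cardinality.\<close>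

definition wc :: "'v set \<Rightarrow> bool" where
  "wc V \<longleftrightarrow> finite V \<and> (\<forall>A B. A \<subseteq> V \<longrightarrow> B \<subseteq> V \<longrightarrow> indep A \<longrightarrow> indep B \<longrightarrow>
     V \<inter> cl A \<subseteq> cl B \<longrightarrow> card A \<le> card B)"

lemma wcD: "wc V \<Longrightarrow> A \<subseteq> V \<Longrightarrow> B \<subseteq> V \<Longrightarrow> indep A \<Longrightarrow> indep B \<Longrightarrow> V \<inter> cl A \<subseteq> cl B \<Longrightarrow>
    card A \<le> card B"
  unfolding wc_def by blast

lemma wc_finite: "wc V \<Longrightarrow> finite V"
  unfolding wc_def by blast

lemma nb_iff [simp]: "y \<in> nb V x \<longleftrightarrow> y \<in> V \<and> x \<sim> y"
  unfolding nb_def by simp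

lemma cl_iff: "y \<in> cl A \<longleftrightarrow> y \<in> A \<or> (\<exists>a\<in>A. a \<sim> y)"
  unfolding cl_def by simp

lemma cl_Un: "cl (A \<union> B) = cl A \<union> cl B"
  by (auto simp: cl_def)

lemma indep_Un: "indep (A \<union> B) \<longleftrightarrow> indep A \<and> indep B \<and> (\<forall>a\<in>A. \<forall>b\<in>B. \<not> a \<sim> b)"
  unfolding indep_def using comm by blast

text \<open>Adding \<open>S\<close> to two stable sets outside \<open>cl S\<close> keeps them
  stable, preserves the domination and raises both sizes by \<open>card S\<close>.\<close>

lemma wc_diff:
  assumes "wc V" "S \<subseteq> V" "indep S"
  shows "wc (V - cl S)"
  unfolding wc_def
proof (intro conjI allI impI)
  show "finite (V - cl S)" using assms wc_finite by blast
  fix A B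
  assume *: "A \<subseteq> V - cl S" "B \<subseteq> V - cl S" "indep A" "indep B" "(V - cl S) \<inter> cl A \<subseteq> cl B"
  have fin: "finite A" "finite B" "finite S"
    using * assms wc_finite[OF assms(1)] by (meson Diff_subset finite_subset)+
  have "indep (A \<union> S)" "indep (B \<union> S)"
    using *(1-4) assms(3) unfolding indep_Un by (auto simp: cl_iff comm)
  moreover have "V \<inter> cl (A \<union> S) \<subseteq> cl (B \<union> S)"
    using *(5) by (auto simp: cl_Un)
  ultimately have "card (A \<union> S) \<le> card (B \<union> S)"
    using wcD[OF assms(1), of "A \<union> S" "B \<union> S"] * assms by blast
  moreover have "A \<inter> S = {}" "B \<inter> S = {}" using * by (auto simp: cl_iff)
  ultimately show "card A \<le> card B"
    using fin by (simp add: card_Un_disjoint)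
qed

lemma wc_closed:
  assumes "wc V" "closed V X"
  shows "wc X"
  unfolding wc_def
proof (intro conjI allI impI)
  show "finite X" using assms wc_finite finite_subset unfolding closed_def by blast
  fix A B assume *: "A \<subseteq> X" "B \<subseteq> X" "indep A" "indep B" "X \<inter> cl A \<subseteq> cl B"
  have XV: "X \<subseteq> V" using assms(2) unfolding closed_def by blast
  have "V \<inter> cl A \<subseteq> X"
    using *(1) assms(2) unfolding cl_def closed_def by blast
  then have "V \<inter> cl A \<subseteq> cl B"
    using *(5) by blast
  then show "card A \<le> card B"
    using wcD[OF assms(1), of A B] *(1-4) XV by (meson order_trans)
qed

fun indepl :: "'v list \<Rightarrow> bool" where
  "indepl [] \<longleftrightarrow> True"
| "indepl (x # xs) \<longleftrightarrow> (\<forall>y\<in>set xs. \<not> x \<sim> y) \<and> indepl xs"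

lemma indepl_iff: "indepl xs \<longleftrightarrow> indep (set xs)"
  by (induction xs) (auto simp: indep_def comm irr)

text \<open>All obstructions to well-coveredness are used in this form: a stable set \<open>as\<close> whose closed
  neighbourhood is dominated by a smaller stable set \<open>bs\<close>.\<close>

lemma exchange:
  assumes "wc V" "distinct as" "length bs < length as" "set as \<subseteq> V" "set bs \<subseteq> V"
    and "indepl as" "indepl bs"
    and "\<forall>a\<in>set as. a \<in> set bs \<or> insert a (nb V a) \<subseteq> cl (set bs)"
  shows False
proof -
  have "V \<inter> cl (set as) \<subseteq> cl (set bs)"
    using assms(8) by (fastforce simp: cl_iff)
  then have "card (set as) \<le> card (set bs)"
    using wcD[OF assms(1)] assms(4-7) by (simp add: indepl_iff)
  also have "\<dots> \<le> length bs" by (rule card_length)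
  finally show False using assms(2,3) by (simp add: distinct_card)
qed

section \<open>Transversals and blocked neighbourhoods\<close>

definition far :: "'v set \<Rightarrow> 'v \<Rightarrow> 'v \<Rightarrow> 'v set" where
  "far V y u = nb V u - {y}"

lemma far_iff: "a \<in> far V y u \<longleftrightarrow> a \<in> V \<and> u \<sim> a \<and> a \<noteq> y"
  unfolding far_def by auto

text \<open>For neighbours \<open>J\<close> of \<open>y\<close>, the values form a stable set that
  dominates \<open>J\<close> but not \<open>y\<close>. They are automatically distinct, since in
  girth five the \<open>far\<close> sets of different neighbours are disjoint
  (\<open>far_facts\<close>).\<close>

definition transv :: "'v set \<Rightarrow> 'v \<Rightarrow> 'v set \<Rightarrow> ('v \<Rightarrow> 'v) \<Rightarrow> bool" where
  "transv V y J \<tau> \<longleftrightarrow> (\<forall>u\<in>J. \<tau> u \<in> far V y u) \<and> (\<forall>u\<in>J. \<forall>v\<in>J. \<not> \<tau> u \<sim> \<tau> v)"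

definition blocked :: "'v set \<Rightarrow> 'v \<Rightarrow> 'v set \<Rightarrow> bool" where
  "blocked V y J \<longleftrightarrow> J \<subseteq> nb V y \<and> (\<nexists>\<tau>. transv V y J \<tau>)"

definition min_blocked :: "'v set \<Rightarrow> 'v \<Rightarrow> 'v set \<Rightarrow> bool" where
  "min_blocked V y J \<longleftrightarrow> blocked V y J \<and> (\<forall>J'. J' \<subset> J \<longrightarrow> \<not> blocked V y J')"

lemma far_facts:
  assumes "y \<sim> u" "y \<sim> v" "u \<noteq> v" "a \<in> far V y u"
  shows "\<not> y \<sim> a" "\<not> v \<sim> a" "a \<noteq> v" "a \<noteq> u" "a \<notin> far V y v"
proof -
  have a: "u \<sim> a" "a \<noteq> y" using assms(4) by (auto simp: far_iff)
  show "\<not> y \<sim> a" using no3 assms(1) a by blast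
  show nv: "\<not> v \<sim> a" using no4[of y u v a] a assms sym by blast
  show "a \<noteq> v" using no_common[OF assms(1,2)] a by blast
  show "a \<noteq> u" using a irr by blast
  show "a \<notin> far V y v" using nv by (auto simp: far_iff)
qed

lemma exists_min_blocked:
  assumes "blocked V y J" "finite V"
  obtains J' where "J' \<subseteq> J" "min_blocked V y J'"
proof -
  have "J \<subseteq> V" using assms(1) by (auto simp: blocked_def)
  then have "finite J" using assms(2) finite_subset by blast
  then have "\<exists>J'\<subseteq>J. min_blocked V y J'" using assms(1)
  proof (induction J rule: finite_psubset_induct)
    case (psubset J)
    show ?case
    proof (cases "min_blocked V y J")
      case False
      then obtain J' where "J' \<subset> J" "blocked V y J'"
        using psubset.prems unfolding min_blocked_def by auto
      then obtain J'' where "J'' \<subseteq> J'" "min_blocked V y J''" using psubset.IH by meson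
      then show ?thesis using \<open>J' \<subset> J\<close> by (meson order_trans psubset_imp_subset)
    qed auto
  qed
  then show thesis using that by blast
qed

text \<open>A vertex \<open>t\<close> behind \<open>m\<close> is adjacent to no other neighbour of
  \<open>y\<close>, so deleting its closed neighbourhood costs \<open>y\<close> only
  \<open>m\<close>.\<close>

lemma delete_far:
  assumes "y \<in> V" "m \<in> nb V y" "t \<in> far V y m"
  shows "y \<in> V - cl {t}" "nb (V - cl {t}) y = nb V y - {m}"
    and "u \<in> nb V y - {m} \<Longrightarrow> far (V - cl {t}) y u = {a \<in> far V y u. \<not> t \<sim> a}"
proof -
  have t: "m \<sim> t" "t \<noteq> y" "t \<in> V" using assms(3) by (auto simp: far_iff)
  have ym: "y \<sim> m" using assms(2) by simp
  have nty: "\<not> t \<sim> y" using no3[OF ym t(1)] sym by blast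
  show "y \<in> V - cl {t}" using assms(1) nty t by (auto simp: cl_iff)
  show "nb (V - cl {t}) y = nb V y - {m}"
  proof (intro Set.set_eqI iffI)
    fix u assume "u \<in> nb (V - cl {t}) y"
    then show "u \<in> nb V y - {m}" using t sym by (auto simp: cl_iff)
  next
    fix u assume u: "u \<in> nb V y - {m}"
    then have "\<not> u \<sim> t" "t \<noteq> u" using far_facts[of y m u t V] ym assms(3) by auto
    then show "u \<in> nb (V - cl {t}) y" using u sym by (auto simp: cl_iff)
  qed
  assume u: "u \<in> nb V y - {m}"
  then have "t \<notin> far V y u" using far_facts(5)[of y m u t V] ym assms(3) by auto
  then show "far (V - cl {t}) y u = {a \<in> far V y u. \<not> t \<sim> a}"
    by (auto simp: far_iff cl_iff)
qed

text \<open>A transversal of the remainder extends by the value \<open>t\<close> at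
  \<open>m\<close>. Obstructions thus survive with one member less, which drives the induction on
  their size.\<close>

lemma blocked_delete:
  assumes "y \<in> V" "blocked V y J" "m \<in> J" "t \<in> far V y m"
  shows "blocked (V - cl {t}) y (J - {m})"
  unfolding blocked_def
proof (intro conjI notI)
  have m: "m \<in> nb V y" "J \<subseteq> nb V y" using assms by (auto simp: blocked_def)
  note d = delete_far[OF assms(1) m(1) assms(4)]
  show "J - {m} \<subseteq> nb (V - cl {t}) y" using d(2) m by blast
  assume "\<exists>\<tau>. transv (V - cl {t}) y (J - {m}) \<tau>"
  then obtain \<tau> where \<tau>: "transv (V - cl {t}) y (J - {m}) \<tau>" by blast
  have f: "\<tau> u \<in> far V y u \<and> \<not> t \<sim> \<tau> u" if "u \<in> J - {m}" for u
    using \<tau> d(3)[of u] that m(2) unfolding transv_def by blast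
  have "transv V y J (\<tau>(m := t))"
    using f assms(4) \<tau> unfolding transv_def by (auto simp: irr comm[of _ t])
  then show False using assms(2) unfolding blocked_def by blast
qed

text \<open>Every vertex behind \<open>u\<close> is adjacent to every vertex behind
  \<open>v\<close>, so a second vertex on either side would close a 4-cycle. This yields a 5-cycle
  \<open>y u a b v\<close>. If both \<open>a\<close> and \<open>b\<close> had a further neighbour,
  then in the presence of these two the single vertex \<open>y\<close> could replace
  \<open>u\<close> and \<open>v\<close>.\<close>

lemma blocked_pair:
  assumes "wc V" "y \<in> V" "min_blocked V y {u, v}" "u \<noteq> v"
  obtains a b where "far V y u = {a}" "far V y v = {b}" "a \<sim> b"
    "nb V a = {u, b} \<or> nb V b = {v, a}"
proof -
  have uv: "y \<sim> u" "y \<sim> v" "u \<in> V" "v \<in> V" using assms(3) by (auto simp: min_blocked_def blocked_def)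
  have "{u} \<subset> {u, v}" "{v} \<subset> {u, v}" using assms(4) by auto
  then have "\<not> blocked V y {u}" "\<not> blocked V y {v}"
    using assms(3) unfolding min_blocked_def by simp_all
  then obtain a b where a: "a \<in> far V y u" and b: "b \<in> far V y v"
    using uv unfolding blocked_def transv_def by auto
  have adj: "a' \<sim> b'" if "a' \<in> far V y u" "b' \<in> far V y v" for a' b'
  proof (rule ccontr)
    assume "\<not> a' \<sim> b'"
    then have "transv V y {u, v} (\<lambda>w. if w = u then a' else b')"
      using that assms(4) comm[of b' a'] by (auto simp: transv_def irr)
    then show False using assms(3) unfolding min_blocked_def blocked_def by blast
  qed
  have fu: "far V y u = {a}"
  proof -
    have "a' = a" if "a' \<in> far V y u" for a'
      using no4[of u a' a b] adj[OF that b] adj[OF a b] that a sym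
        far_facts(3)[of y v u b V] uv assms(4) b by (auto simp: far_iff)
    then show ?thesis using a by blast
  qed
  have fv: "far V y v = {b}"
  proof -
    have "b' = b" if "b' \<in> far V y v" for b'
      using no4[of v b' b a] adj[OF a that] adj[OF a b] that b sym
        far_facts(3)[of y u v a V] uv assms(4) a by (auto simp: far_iff)
    then show ?thesis using b by blast
  qed
  have nbu: "nb V u = {y, a}" "nb V v = {y, b}"
    using fu fv uv assms(2) sym by (auto simp: far_def)
  have ab: "a \<sim> b" "u \<sim> a" "v \<sim> b" "a \<in> V" "b \<in> V" "a \<noteq> y" "b \<noteq> y"
    using adj[OF a b] a b by (auto simp: far_iff)
  have "nb V a = {u, b} \<or> nb V b = {v, a}"
  proof (rule ccontr)
    assume "\<not> ?thesis"
    then obtain w z where w: "w \<in> nb V a" "w \<noteq> u" "w \<noteq> b" and z: "z \<in> nb V b" "z \<noteq> v" "z \<noteq> a"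
      using ab uv sym by (auto simp: set_eq_iff)
    have wz: "a \<sim> w" "b \<sim> z" "w \<in> V" "z \<in> V" using w z by auto
    have n: "\<not> w \<sim> z" using no_chord[of w a b z] wz ab w z sym by blast
    have n0: "w \<noteq> z" using no3 wz ab by blast
    have n2: "\<not> w \<sim> u" "\<not> z \<sim> v" "\<not> u \<sim> v"
      using no_common[of a w u] no_common[of b z v] no_common[of y u v] wz ab uv sym by blast+
    have n3: "\<not> w \<sim> y" "\<not> z \<sim> y"
      using no_chord[of w a u y] no_chord[of z b v y] wz ab uv w z sym by blast+
    have n4: "\<not> w \<sim> v" "\<not> z \<sim> u" "w \<noteq> v" "z \<noteq> u"
      using no_chord[of w a b v] no_chord[of z b a u] no_common[of b a v] no_common[of a b u]
        far_facts(3)[OF uv(1,2) assms(4) a] far_facts(3)[OF uv(2,1) assms(4)[symmetric] b]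
        wz ab w z sym by blast+
    show False
      by (rule exchange[OF assms(1), of "[w, z, u, v]" "[w, z, y]"])
        (use n n0 n2 n3 n4 wz ab uv w z assms(2,4) nbu in \<open>auto simp: cl_iff comm\<close>)
  qed
  then show thesis using that fu fv ab by blast
qed

text \<open>A \<open>far\<close> set loses at most one element with \<open>t\<close>, since two
  would close a 4-cycle. As it had at least two, no single member is blocked after the deletion, so
  the minimal obstruction there is a pair and \<open>blocked_pair\<close> describes it.\<close>

lemma thin_pair:
  assumes "wc V" "y \<in> V" "blocked V y J" "m \<in> J" "t \<in> far V y m"
    and ge2: "\<And>u a. u \<in> J \<Longrightarrow> far V y u \<noteq> {a}"
    and ne: "\<And>u. u \<in> J \<Longrightarrow> far V y u \<noteq> {}"
    and le2: "\<And>J'. min_blocked (V - cl {t}) y J' \<Longrightarrow> J' \<subseteq> J - {m} \<Longrightarrow> card J' \<le> 2"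
  obtains i j a b a' b' where "i \<in> J - {m}" "j \<in> J - {m}" "i \<noteq> j"
    "far V y i = {a, b}" "far V y j = {a', b'}" "a \<noteq> b" "a' \<noteq> b'" "t \<sim> b" "t \<sim> b'" "a \<sim> a'"
    "\<And>z. z \<in> V \<Longrightarrow> a \<sim> z \<Longrightarrow> z = i \<or> z = a' \<or> t \<sim> z"
proof -
  let ?W = "V - cl {t}"
  have Jnb: "J \<subseteq> nb V y" using assms(3) by (auto simp: blocked_def)
  have m: "m \<in> nb V y" using Jnb assms(4) by blast
  have t: "t \<in> V" "m \<sim> t" using assms(5) by (auto simp: far_iff)
  note d = delete_far[OF assms(2) m assms(5)]
  have bl: "blocked ?W y (J - {m})" using blocked_delete assms(2-5) by blast
  have wcW: "wc ?W" using wc_diff[OF assms(1), of "{t}"] t irr by (auto simp: indep_def)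
  obtain J' where J': "J' \<subseteq> J - {m}" "min_blocked ?W y J'"
    using exists_min_blocked[OF bl] wc_finite[OF wcW] by blast
  have "finite J'"
    using J' Jnb wc_finite[OF assms(1)] finite_subset[of J' V] by (auto simp: nb_def)
  have farW: "far ?W y u = {a \<in> far V y u. \<not> t \<sim> a}" if "u \<in> J'" for u
    using d(3)[of u] that J'(1) Jnb by blast
  have unique: "c = c'" if "c \<in> far V y u" "c' \<in> far V y u" "t \<sim> c" "t \<sim> c'" "u \<in> J'" for u c c'
  proof -
    have "u \<in> J - {m}" using that(5) J'(1) by blast
    then have "y \<sim> u" "m \<noteq> u" using Jnb by auto
    then have "t \<noteq> u" using far_facts(3)[of y m u t V] m assms(5) by auto
    then show ?thesis using no4[of t c c' u] that by (auto simp: far_iff)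
  qed
  have nonempty: "far ?W y u \<noteq> {}" if "u \<in> J'" for u
  proof
    assume "far ?W y u = {}"
    then have all: "\<forall>c\<in>far V y u. t \<sim> c" using farW[OF that] by blast
    obtain c where "c \<in> far V y u" using ne[of u] \<open>u \<in> J'\<close> J'(1) by blast
    then have "far V y u = {c}" using unique[OF _ _ _ _ that] all by blast
    then show False using ge2 that J'(1) by blast
  qed
  have "card J' \<le> 2" using le2 J' by blast
  moreover have "card J' \<noteq> 0"
  proof
    assume "card J' = 0"
    then have "J' = {}" using \<open>finite J'\<close> by simp
    then show False using J'(2) by (auto simp: min_blocked_def blocked_def transv_def)
  qed
  moreover have "card J' \<noteq> 1"
  proof
    assume "card J' = 1"
    then obtain u where u: "J' = {u}" by (auto simp: card_1_singleton_iff)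
    then obtain c where "c \<in> far ?W y u" using nonempty by blast
    then have "transv ?W y J' (\<lambda>_. c)" using u irr by (auto simp: transv_def)
    then show False using J'(2) by (auto simp: min_blocked_def blocked_def)
  qed
  ultimately have "card J' = 2" by linarith
  then obtain i j where ij: "J' = {i, j}" "i \<noteq> j" by (auto simp: card_2_iff)
  obtain a a' where aa: "far ?W y i = {a}" "far ?W y j = {a'}" "a \<sim> a'"
      "nb ?W a = {i, a'} \<or> nb ?W a' = {j, a}"
    using blocked_pair[OF wcW d(1)] J'(2) ij by metis
  have split: "\<exists>b. far V y u = {c, b} \<and> c \<noteq> b \<and> t \<sim> b" if "far ?W y u = {c}" "u \<in> J'" for u c
  proof -
    have c: "c \<in> far V y u" "\<not> t \<sim> c" using farW[OF that(2)] that(1) by auto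
    then obtain b where b: "b \<in> far V y u" "b \<noteq> c" using ge2[of u c] \<open>u \<in> J'\<close> J'(1) by blast
    have out: "t \<sim> b'" if "b' \<in> far V y u" "b' \<noteq> c" for b'
      using farW[OF \<open>u \<in> J'\<close>] \<open>far ?W y u = {c}\<close> that by blast
    have "far V y u = {c, b}" using unique[OF _ _ _ _ that(2)] out b c by blast
    then show ?thesis using b out by blast
  qed
  obtain b where b: "far V y i = {a, b}" "a \<noteq> b" "t \<sim> b" using split[OF aa(1)] ij by blast
  obtain b' where b': "far V y j = {a', b'}" "a' \<noteq> b'" "t \<sim> b'" using split[OF aa(2)] ij by blast
  have mem: "i \<in> J - {m}" "j \<in> J - {m}" using ij J' by auto
  have thin: "z = p \<or> z = q \<or> t \<sim> z" if "nb ?W c = {p, q}" "z \<in> V" "c \<sim> z" "\<not> t \<sim> c" for c p q z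
    using that sym by (auto simp: set_eq_iff cl_iff)
  have nt: "\<not> t \<sim> a" "\<not> t \<sim> a'" using aa(1,2) farW ij by blast+
  from aa(4) show thesis
  proof
    assume *: "nb ?W a = {i, a'}"
    show thesis
    proof (rule that[OF mem ij(2) b(1) b'(1) b(2) b'(2) b(3) b'(3) aa(3)])
      fix z assume "z \<in> V" "a \<sim> z"
      then show "z = i \<or> z = a' \<or> t \<sim> z" using thin[OF * _ _ nt(1)] by metis
    qed
  next
    assume *: "nb ?W a' = {j, a}"
    show thesis
    proof (rule that[OF mem(2,1) ij(2)[symmetric] b'(1) b(1) b'(2) b(2) b'(3) b(3) sym[OF aa(3)]])
      fix z assume "z \<in> V" "a' \<sim> z"
      then show "z = j \<or> z = a \<or> t \<sim> z" using thin[OF * _ _ nt(2)] by metis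
    qed
  qed
qed

text \<open>The hypothesis is applied at \<open>(m, t)\<close>, at \<open>(i, a)\<close> and, in one
  case, at \<open>(p, c)\<close>. The last clause for \<open>a\<close> confines \<open>d\<close> and
  \<open>d'\<close> to \<open>a'\<close> and the neighbours of \<open>t\<close>, of which
  \<open>a\<close> has at most one. In the last case the same clause for \<open>c\<close> forces the
  two members of the third pair to share a vertex behind them.\<close>

lemma no_thin_pairs:
  assumes "y \<in> V" "J \<subseteq> nb V y" "J \<noteq> {}" "\<And>u. u \<in> J \<Longrightarrow> far V y u \<noteq> {}"
    and thin: "\<And>m t. m \<in> J \<Longrightarrow> t \<in> far V y m \<Longrightarrow> \<exists>i j a b a' b'. i \<in> J - {m} \<and> j \<in> J - {m} \<and>
      i \<noteq> j \<and> far V y i = {a, b} \<and> far V y j = {a', b'} \<and> a \<noteq> b \<and> a' \<noteq> b' \<and> t \<sim> b \<and> t \<sim> b' \<and>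
      a \<sim> a' \<and> (\<forall>z\<in>V. a \<sim> z \<longrightarrow> z = i \<or> z = a' \<or> t \<sim> z)"
  shows False
proof -
  have Jy: "y \<sim> u" if "u \<in> J" for u using assms(2) that by auto
  have distinct: "c \<noteq> d" if "c \<in> far V y u" "d \<in> far V y v" "u \<in> J" "v \<in> J" "u \<noteq> v" for c d u v
    using far_facts(5)[OF Jy Jy, of u v c V] that by blast
  have same: "\<not> c \<sim> d" if "c \<in> far V y u" "d \<in> far V y u" for c d u
    using no_common[of u c d] that by (auto simp: far_iff)
  have once: "c = d" if "c \<in> far V y u" "d \<in> far V y u" "e \<sim> c" "e \<sim> d" "e \<in> far V y v"
      "u \<in> J" "v \<in> J" "u \<noteq> v" for c d e u v
    using no4[of u c d e] that far_facts(3)[OF Jy Jy, of v u e V] by (auto simp: far_iff)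
  obtain m t where m: "m \<in> J" "t \<in> far V y m" using assms(3,4) by blast
  obtain i j a b a' b' where 1: "i \<in> J - {m}" "j \<in> J - {m}" "i \<noteq> j"
    "far V y i = {a, b}" "far V y j = {a', b'}" "a \<noteq> b" "a' \<noteq> b'" "t \<sim> b" "t \<sim> b'" "a \<sim> a'"
    "\<forall>z\<in>V. a \<sim> z \<longrightarrow> z = i \<or> z = a' \<or> t \<sim> z"
    using thin[OF m] by blast
  have a: "i \<in> J" "a \<in> far V y i" using 1 by auto
  have inV: "c \<in> V \<and> u \<sim> c" if "c \<in> far V y u" for c u using that by (auto simp: far_iff)
  have nfar: "c \<notin> J" if "c \<in> far V y u" "u \<in> J" for c u
    using no3[OF Jy[OF that(2)], of c] Jy[of c] that by (auto simp: far_iff)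
  obtain p q c d c' d' where 2: "p \<in> J - {i}" "q \<in> J - {i}" "p \<noteq> q"
    "far V y p = {c, d}" "far V y q = {c', d'}" "c \<noteq> d" "c' \<noteq> d'" "a \<sim> d" "a \<sim> d'" "c \<sim> c'"
    "\<forall>z\<in>V. c \<sim> z \<longrightarrow> z = p \<or> z = c' \<or> a \<sim> z"
    using thin[OF a] by blast
  have ta: "\<not> t \<sim> a" using once[of a i b t m] 1 m by auto
  have "a \<noteq> t" using distinct[of a i t m] 1 m by auto
  have dd: "d = a' \<or> t \<sim> d" "d' = a' \<or> t \<sim> d'" "d \<noteq> d'"
    using 1(11) 2 inV[of d p] inV[of d' q] nfar[of d p] nfar[of d' q] a distinct[of d p d' q] by auto
  have two: "z = z'" if "t \<sim> z" "t \<sim> z'" "a \<sim> z" "a \<sim> z'" for z z'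
    using no4[of t z z' a] that \<open>a \<noteq> t\<close> by blast
  consider (l) "d = a'" "t \<sim> d'" | (r) "d' = a'" "t \<sim> d"
    using dd two[of d d'] 2 by blast
  then show False
  proof cases
    case l
    then have "p = j" using distinct[of d p a' j] 1 2 by auto
    then have c: "c = b'" using 1 2 l by auto
    have "t = p \<or> t = c' \<or> a \<sim> t" using 2(11) 1(9) c inV[OF m(2)] sym by blast
    moreover have "t \<noteq> p" using nfar[OF m(2,1)] 2 by blast
    moreover have "t \<noteq> c'"
    proof
      assume "t = c'"
      then have "q = m" using distinct[of c' q t m] 2 m by auto
      then show False using same[of t m d'] m 2 l by auto
    qed
    ultimately show False using ta sym by blast
  next
    case r
    then have "q = j" using distinct[of d' q a' j] 1 2 by auto
    then have c': "c' = b'" using 1 2 r by auto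
    have "p \<in> J" "c \<in> far V y p" using 2 by auto
    from thin[OF this] obtain p2 q2 e f e' f' where 3: "p2 \<in> J - {p}" "q2 \<in> J - {p}" "p2 \<noteq> q2"
      "far V y p2 = {e, f}" "far V y q2 = {e', f'}" "c \<sim> f" "c \<sim> f'"
      by blast
    have key: "z = b'" if zf: "z \<in> {f, f'}" for z
    proof -
      obtain v where v: "v \<in> J" "z \<in> far V y v" "c \<sim> z" using zf 3 by auto
      have "z = p \<or> z = b' \<or> a \<sim> z" using 2(11) v inV c' by blast
      moreover have "z \<noteq> p" using nfar[OF v(2,1)] 2 by blast
      moreover have "\<not> a \<sim> z"
      proof
        assume az: "a \<sim> z"
        have "z \<noteq> i" using nfar[OF v(2,1)] 1 by blast
        then consider "z = a'" | "t \<sim> z" using 1(11) az inV[OF v(2)] by blast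
        then show False
        proof cases
          case 1
          then show False
            using once[of a' j b' c p] v 2 c' \<open>q = j\<close> \<open>far V y j = {a', b'}\<close> \<open>a' \<noteq> b'\<close> \<open>j \<in> J - {m}\<close> by auto
        next
          case 2
          then have "z = d" using two[of z d] az \<open>a \<sim> d\<close> r by blast
          then show False using same[of c p d] v \<open>far V y p = {c, d}\<close> by auto
        qed
      qed
      ultimately show ?thesis by blast
    qed
    have "f = f'" using key[of f] key[of f'] by simp
    then show False using distinct[of f p2 f' q2] 3 by auto
  qed
qed

text \<open>One of three exchanges for a blocked triple in which \<open>a\<close> is the only vertex
  behind \<open>m\<close>. With \<open>n1\<close> and \<open>p1\<close> on both sides,
  \<open>y\<close> alone replaces \<open>j\<close> and \<open>m\<close>: their other neighbours
  \<open>n2\<close> and \<open>a\<close> are covered by \<open>n1\<close> and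
  \<open>p1\<close>.\<close>

lemma triple_one_single:
  assumes "wc V" "y \<in> V" "i \<in> nb V y" "j \<in> nb V y" "m \<in> nb V y" "i \<noteq> j" "i \<noteq> m" "j \<noteq> m"
    and far: "far V y m = {a}" "far V y i = {n1, p1}" "far V y j = {n2}"
    and ne: "n1 \<noteq> p1" and adj: "a \<sim> p1" "n1 \<sim> n2" "\<not> a \<sim> n1"
  shows False
proof -
  have y: "y \<sim> i" "y \<sim> j" "y \<sim> m" using assms by auto
  have f: "a \<in> far V y m" "n1 \<in> far V y i" "p1 \<in> far V y i" "n2 \<in> far V y j" using far by auto
  have nbs: "nb V m = {y, a}" "nb V j = {y, n2}"
    using far y assms(2) sym by (auto simp: far_def)
  have e: "m \<sim> a" "i \<sim> n1" "i \<sim> p1" "j \<sim> n2" "a \<in> V" "n1 \<in> V" "p1 \<in> V"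
    using f by (auto simp: far_iff)
  have n: "\<not> y \<sim> n1" "\<not> y \<sim> p1" "\<not> n1 \<sim> p1" "\<not> j \<sim> m" "\<not> j \<sim> n1" "\<not> j \<sim> p1" "\<not> m \<sim> n1"
    "\<not> m \<sim> p1" "j \<noteq> n1" "j \<noteq> p1" "m \<noteq> n1" "m \<noteq> p1"
    using far_facts[OF y(1,2) assms(6) f(2)] far_facts[OF y(1,2) assms(6) f(3)]
      far_facts[OF y(1,3) assms(7) f(2)] far_facts[OF y(1,3) assms(7) f(3)] no_common e y by blast+
  show False
    by (rule exchange[OF assms(1), of "[j, m, n1, p1]" "[y, n1, p1]"])
      (use n nbs e y ne adj assms in \<open>auto simp: cl_iff comm\<close>)
qed

lemma triple_outer:
  assumes "wc V" "y \<in> V" "i \<in> nb V y" "j \<in> nb V y" "m \<in> nb V y" "i \<noteq> j" "i \<noteq> m" "j \<noteq> m"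
    and far: "far V y m = {a}" "far V y i = {n1, p1}" "far V y j = {n2, p2}"
    and ne: "n1 \<noteq> p1" "n2 \<noteq> p2" and adj: "a \<sim> p1" "a \<sim> p2" "n1 \<sim> n2"
    and z: "z \<in> V" "p1 \<sim> z" "z \<noteq> i" "z \<noteq> a"
  shows "n2 \<sim> z"
proof (rule ccontr)
  assume nz: "\<not> n2 \<sim> z"
  have y: "y \<sim> i" "y \<sim> j" "y \<sim> m" using assms by auto
  have f: "a \<in> far V y m" "n1 \<in> far V y i" "p1 \<in> far V y i" "n2 \<in> far V y j" "p2 \<in> far V y j"
    using far by auto
  have nbs: "nb V m = {y, a}" "nb V i = {y, n1, p1}"
    using far y assms(2) sym by (auto simp: far_def)
  have e: "m \<sim> a" "i \<sim> n1" "i \<sim> p1" "j \<sim> n2" "j \<sim> p2" "a \<in> V" "n1 \<in> V" "p1 \<in> V" "n2 \<in> V" "p2 \<in> V"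
    "p1 \<noteq> y"
    using f by (auto simp: far_iff)
  note ff = far_facts[OF y(2,1) assms(6)[symmetric] f(4)] far_facts[OF y(2,1) assms(6)[symmetric] f(5)]
    far_facts[OF y(2,3) assms(8) f(4)] far_facts[OF y(2,3) assms(8) f(5)]
  have n: "\<not> y \<sim> n2" "\<not> y \<sim> p2" "\<not> n2 \<sim> p2" "\<not> i \<sim> m" "\<not> i \<sim> n2" "\<not> i \<sim> p2" "\<not> m \<sim> n2"
    "\<not> m \<sim> p2" "i \<noteq> n2" "i \<noteq> p2" "m \<noteq> n2" "m \<noteq> p2"
    using ff no_common e y by blast+
  have "p1 \<noteq> p2" "p1 \<noteq> m" using ff f far_facts[OF y(1,3) assms(7) f(3)] by blast+
  then have zn: "\<not> z \<sim> p2" "\<not> z \<sim> y" "\<not> z \<sim> i" "\<not> z \<sim> m" "z \<noteq> m" "z \<noteq> p2"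
    using no_chord[of z p1 a p2] no_chord[of z p1 i y] no_common[of p1 z i] no_chord[of z p1 a m]
      far_facts(2)[OF y(1,3) assms(7) f(3)] no_common[of a p1 p2] z e adj sym y by blast+
  have "\<not> p1 \<sim> n2"
    using no4[of n2 n1 p1 i] e adj ne n sym by blast
  then have "z \<noteq> n2" using z by blast
  show False
    by (rule exchange[OF assms(1), of "[i, m, p2, n2, z]" "[y, p2, n2, z]"])
      (use n nbs e y ne adj zn z nz \<open>z \<noteq> n2\<close> assms(2-8) in \<open>auto simp: cl_iff comm\<close>)
qed

text \<open>With \<open>n1\<close> on both sides, \<open>y\<close> and \<open>a\<close> replace
  \<open>m\<close>, \<open>p1\<close> and \<open>p2\<close>. The assumption \<open>out\<close>,
  supplied by \<open>triple_outer\<close>, places the remaining neighbours of \<open>p2\<close> next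
  to \<open>n1\<close>.\<close>

lemma triple_thin:
  assumes "wc V" "y \<in> V" "i \<in> nb V y" "j \<in> nb V y" "m \<in> nb V y" "i \<noteq> j" "i \<noteq> m" "j \<noteq> m"
    and far: "far V y m = {a}" "far V y i = {n1, p1}" "far V y j = {n2, p2}"
    and ne: "n1 \<noteq> p1" "n2 \<noteq> p2" and adj: "a \<sim> p1" "a \<sim> p2" "n1 \<sim> n2" "\<not> a \<sim> n1"
    and out: "\<And>z. z \<in> V \<Longrightarrow> p2 \<sim> z \<Longrightarrow> z \<noteq> j \<Longrightarrow> z \<noteq> a \<Longrightarrow> n1 \<sim> z"
    and thin: "nb V p1 = {i, a}"
  shows False
proof -
  have y: "y \<sim> i" "y \<sim> j" "y \<sim> m" using assms by auto
  have f: "a \<in> far V y m" "n1 \<in> far V y i" "p1 \<in> far V y i" "n2 \<in> far V y j" "p2 \<in> far V y j"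
    using far by auto
  have nbs: "nb V m = {y, a}"
    using far y assms(2) sym by (auto simp: far_def)
  have e: "m \<sim> a" "i \<sim> n1" "i \<sim> p1" "j \<sim> n2" "j \<sim> p2" "a \<in> V" "n1 \<in> V" "p1 \<in> V" "p2 \<in> V" "a \<noteq> y"
    using f by (auto simp: far_iff)
  note ff = far_facts[OF y(1,3) assms(7) f(2)] far_facts[OF y(1,3) assms(7) f(3)]
    far_facts[OF y(2,3) assms(8) f(5)] far_facts[OF y(2,1) assms(6)[symmetric] f(5)]
    far_facts[OF y(1,2) assms(6) f(2)]
  have n: "\<not> m \<sim> p1" "\<not> m \<sim> p2" "\<not> m \<sim> n1" "\<not> y \<sim> a" "\<not> y \<sim> n1" "\<not> p1 \<sim> p2" "\<not> p1 \<sim> n1"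
    "m \<noteq> p1" "m \<noteq> p2" "m \<noteq> n1" "p1 \<noteq> p2" "n1 \<noteq> p2"
    using ff no_common[of i p1 n1] no_common[of a p1 p2] no3[of y m a] e y adj f by blast+
  have "\<not> n1 \<sim> p2"
    using no4[of n1 n2 p2 j] e adj ne ff by blast
  have out': "z \<in> cl {y, a, n1}" if "z \<in> V" "p2 \<sim> z" for z
    using out[OF that] y e adj by (auto simp: cl_iff)
  show False
    by (rule exchange[OF assms(1), of "[m, p1, p2, n1]" "[y, a, n1]"])
      (use n nbs e y ne adj thin \<open>\<not> n1 \<sim> p2\<close> assms(2-8) out' in \<open>auto simp: cl_iff comm\<close>)
qed

lemma third_nb:
  assumes "nb V c \<noteq> {p, q}" "p \<in> V" "q \<in> V" "c \<sim> p" "c \<sim> q"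
  obtains z where "z \<in> V" "c \<sim> z" "z \<noteq> p" "z \<noteq> q"
  using assms unfolding nb_def by blast

text \<open>Minimality provides \<open>n1\<close> and \<open>n2\<close> that are not adjacent to
  \<open>a\<close>. Since the triple is blocked they are adjacent, and behind \<open>i\<close> and
  behind \<open>j\<close> there is at most one more vertex, which is a neighbour of
  \<open>a\<close>. This gives the four cases.\<close>

lemma no_triple_single:
  assumes "wc V" "y \<in> V" "min_blocked V y J" "J = {m, i, j}" "i \<noteq> j" "i \<noteq> m" "j \<noteq> m"
    and far: "far V y m = {a}"
  shows False
proof -
  have mem: "i \<in> nb V y" "j \<in> nb V y" "m \<in> nb V y"
    using assms(3,4) by (auto simp: min_blocked_def blocked_def)
  then have y: "y \<sim> i" "y \<sim> j" "y \<sim> m" by auto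
  have pair: "\<exists>c\<in>far V y u. \<exists>c'\<in>far V y v. \<not> c \<sim> c'" if "{u, v} \<subset> J" "u \<noteq> v" for u v
  proof -
    have "\<not> blocked V y {u, v}" using assms(3) that(1) unfolding min_blocked_def by blast
    then show ?thesis using that mem assms(4) unfolding blocked_def transv_def by auto
  qed
  have "{m, i} \<subset> J" "{m, j} \<subset> J" "{i, j} \<subset> J" using assms(4-7) by auto
  note pairs = this
  obtain n1 where n1: "n1 \<in> far V y i" "\<not> a \<sim> n1" using pair[OF pairs(1)] far assms by auto
  obtain n2 where n2: "n2 \<in> far V y j" "\<not> a \<sim> n2" using pair[OF pairs(2)] far assms by auto
  have block: "c \<sim> c'" if "c \<in> far V y i" "c' \<in> far V y j" "\<not> a \<sim> c" "\<not> a \<sim> c'" for c c'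
  proof (rule ccontr)
    assume "\<not> c \<sim> c'"
    then have "transv V y J (\<lambda>w. if w = m then a else if w = i then c else c')"
      using that far assms(4-7) comm[of c a] comm[of c' a] comm[of c' c] by (auto simp: transv_def irr)
    then show False using assms(3) unfolding min_blocked_def blocked_def by blast
  qed
  have n12: "n1 \<sim> n2" using block n1 n2 by blast
  have af: "a \<in> far V y m" using far by simp
  have once: "c = c'" if "c \<in> far V y u" "c' \<in> far V y u" "e \<sim> c" "e \<sim> c'" "e \<noteq> u" for c c' e u
    using no4[of e c c' u] that by (auto simp: far_iff)
  have neq: "n1 \<noteq> j" "n2 \<noteq> i" "a \<noteq> i" "a \<noteq> j"
    using far_facts[OF y(1,2) assms(5) n1(1)] far_facts[OF y(2,1) assms(5)[symmetric] n2(1)]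
      far_facts[OF y(3,1) assms(6)[symmetric] af] far_facts[OF y(3,2) assms(7)[symmetric] af] by blast+
  have fi: "c = n1 \<or> a \<sim> c" if "c \<in> far V y i" for c
    using once[of c i n1 n2] block[OF that n2(1)] n1 n2 n12 sym neq that by blast
  have fj: "c = n2 \<or> a \<sim> c" if "c \<in> far V y j" for c
    using once[of c j n2 n1] block[OF n1(1) that] n1 n2 n12 neq that by blast
  have two: "X = {n} \<or> (\<exists>p. p \<noteq> n \<and> a \<sim> p \<and> X = {n, p})"
    if X: "n \<in> X" "\<not> a \<sim> n" "\<forall>c\<in>X. c = n \<or> a \<sim> c" "\<forall>c\<in>X. \<forall>d\<in>X. a \<sim> c \<longrightarrow> a \<sim> d \<longrightarrow> c = d" for X n
  proof (cases "\<exists>c\<in>X. a \<sim> c")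
    case True
    then obtain p where p: "p \<in> X" "a \<sim> p" by blast
    then have "c = n \<or> c = p" if "c \<in> X" for c using X(3,4) that by auto
    then have "X = {n, p}" using X(1) p(1) by auto
    then show ?thesis using p X(2) by auto
  next
    case False
    then have "c = n" if "c \<in> X" for c using X(3) that by auto
    then show ?thesis using X(1) by blast
  qed
  have fi': "far V y i = {n1} \<or> (\<exists>p1. p1 \<noteq> n1 \<and> a \<sim> p1 \<and> far V y i = {n1, p1})"
  proof (rule two)
    show "\<forall>c\<in>far V y i. \<forall>d\<in>far V y i. a \<sim> c \<longrightarrow> a \<sim> d \<longrightarrow> c = d"
      using once neq by blast
  qed (use n1 fi in blast)+
  have fj': "far V y j = {n2} \<or> (\<exists>p2. p2 \<noteq> n2 \<and> a \<sim> p2 \<and> far V y j = {n2, p2})"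
  proof (rule two)
    show "\<forall>c\<in>far V y j. \<forall>d\<in>far V y j. a \<sim> c \<longrightarrow> a \<sim> d \<longrightarrow> c = d"
      using once neq by blast
  qed (use n2 fj in blast)+
  consider (1) "far V y i = {n1}" "far V y j = {n2}"
    | (2) p1 where "p1 \<noteq> n1" "a \<sim> p1" "far V y i = {n1, p1}" "far V y j = {n2}"
    | (3) p2 where "p2 \<noteq> n2" "a \<sim> p2" "far V y i = {n1}" "far V y j = {n2, p2}"
    | (4) p1 p2 where "p1 \<noteq> n1" "a \<sim> p1" "far V y i = {n1, p1}" "p2 \<noteq> n2" "a \<sim> p2" "far V y j = {n2, p2}"
    using fi' fj' by blast
  then show False
  proof cases
    case 1
    then show False using pair[OF pairs(3)] assms(5) n12 by auto
  next
    case 2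
    then show False
      using triple_one_single[OF assms(1,2) mem assms(5-7) far, of n1 p1 n2] n1 n12 by blast
  next
    case 3
    then show False
      using triple_one_single[OF assms(1,2) mem(2,1,3) assms(5)[symmetric] assms(7,6) far, of n2 p2 n1]
        n2 n12 sym by blast
  next
    case (4 p1 p2)
    note outer = triple_outer[OF assms(1,2) mem assms(5-7) far 4(3,6) _ _ 4(2,5) n12]
    note outer' = triple_outer[OF assms(1,2) mem(2,1,3) assms(5)[symmetric] assms(7,6) far 4(6,3) _ _ 4(5,2) sym[OF n12]]
    \<comment> \<open>Otherwise further neighbours \<open>z1\<close> of \<open>p1\<close> and
      \<open>z2\<close> of \<open>p2\<close> exist. By \<open>triple_outer\<close> they also cover
      \<open>n2\<close> and \<open>n1\<close>, so \<open>y\<close> alone could replace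
      \<open>i\<close> and \<open>j\<close>.\<close>
    have "nb V p1 = {i, a} \<or> nb V p2 = {j, a}"
    proof (rule ccontr)
      assume neg: "\<not> ?thesis"
      have e: "i \<sim> n1" "i \<sim> p1" "j \<sim> n2" "j \<sim> p2" "m \<sim> a" "a \<in> V"
        using 4(3,6) far far_iff[of _ V y] by auto
      obtain z1 where z1: "z1 \<in> V" "p1 \<sim> z1" "z1 \<noteq> i" "z1 \<noteq> a"
        by (rule third_nb[of V p1 i a]) (use neg e 4(2) mem sym in auto)
      obtain z2 where z2: "z2 \<in> V" "p2 \<sim> z2" "z2 \<noteq> j" "z2 \<noteq> a"
        by (rule third_nb[of V p2 j a]) (use neg e 4(5) mem sym in auto)
      have zz: "n2 \<sim> z1" "n1 \<sim> z2"
        using outer[OF _ _ z1] outer'[OF _ _ z2] 4 by auto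
      have nbs: "nb V i = {y, n1, p1}" "nb V j = {y, n2, p2}"
        using 4(3,6) y mem assms(2) sym by (auto simp: far_def)
      have d: "z1 \<noteq> n1" "z2 \<noteq> n2" "p1 \<noteq> y" "p2 \<noteq> y" "z1 \<noteq> z2" "z1 \<noteq> j" "z2 \<noteq> i"
      proof -
        have p: "p1 \<in> far V y i" "p2 \<in> far V y j" using 4(3,6) by auto
        show "z1 \<noteq> n1" "z2 \<noteq> n2" using no_common[of i p1 n1] no_common[of j p2 n2] z1 z2 e by blast+
        show "p1 \<noteq> y" "p2 \<noteq> y" using p by (auto simp: far_iff)
        show "z1 \<noteq> z2" using no3[of n1 n2 z1] zz n12 by blast
        show "z1 \<noteq> j" "z2 \<noteq> i"
          using far_facts(2)[OF y(1,2) assms(5) p(1)] far_facts(2)[OF y(2,1) assms(5)[symmetric] p(2)]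
            z1(2) z2(2) sym by blast+
      qed
      have n: "\<not> z1 \<sim> z2" "\<not> a \<sim> z1" "\<not> a \<sim> z2" "\<not> y \<sim> z1" "\<not> y \<sim> z2" "\<not> y \<sim> a" "\<not> i \<sim> j"
        "\<not> i \<sim> a" "\<not> j \<sim> a" "\<not> i \<sim> z1" "\<not> i \<sim> z2" "\<not> j \<sim> z1" "\<not> j \<sim> z2"
        using no_chord[of z1 n2 n1 z2] no_common[of p1 a z1] no_common[of p2 a z2]
          no_chord[of y i p1 z1] no_chord[of y j p2 z2] no3[of y m a] no_common[of y i j]
          far_facts[OF y(3,1) assms(6)[symmetric] af] far_facts[OF y(3,2) assms(7)[symmetric] af]
          no_common[of p1 i z1] no_common[of n1 i z2] no_common[of n2 j z1] no_common[of p2 j z2]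
          zz n12 z1 z2 e d y 4 sym by blast+
      show False
        by (rule exchange[OF assms(1), of "[i, j, a, z1, z2]" "[y, a, z1, z2]"])
          (use n d nbs e y zz z1 z2 neq mem assms(2-8) n12 in \<open>auto simp: cl_iff comm\<close>)
    qed
    then show False
    proof
      assume "nb V p1 = {i, a}"
      then show False
        using triple_thin[OF assms(1,2) mem assms(5-7) far 4(3,6) _ _ 4(2,5) n12 n1(2)] outer' 4 by metis
    next
      assume "nb V p2 = {j, a}"
      then show False
        using triple_thin[OF assms(1,2) mem(2,1,3) assms(5)[symmetric] assms(7,6) far 4(6,3) _ _ 4(5,2) sym[OF n12] n2(2)]
          outer 4 by metis
    qed
  qed
qed

text \<open>Deleting a vertex behind a member makes the induction hypothesis available for the
  others. If some member has only one vertex behind it, \<open>J\<close> turns out to be a triple,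
  which \<open>no_triple_single\<close> excludes. If every member has at least two,
  \<open>thin_pair\<close> feeds \<open>no_thin_pairs\<close>.\<close>

lemma min_blocked_card_le_2:
  "wc V \<Longrightarrow> y \<in> V \<Longrightarrow> min_blocked V y J \<Longrightarrow> card J \<le> 2"
proof (induction "card J" arbitrary: V J rule: less_induct)
  case less
  note wcV = less.prems(1) and yV = less.prems(2) and mb = less.prems(3)
  have bl: "blocked V y J" and nbl: "\<And>J'. J' \<subset> J \<Longrightarrow> \<not> blocked V y J'"
    using mb by (auto simp: min_blocked_def)
  have Jnb: "J \<subseteq> nb V y" using bl by (auto simp: blocked_def)
  have finJ: "finite J"
    using Jnb wc_finite[OF wcV] by (auto simp: nb_def intro: finite_subset)
  show ?case
  proof (rule ccontr)
    assume "\<not> card J \<le> 2"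
    then have k: "3 \<le> card J" by simp
    have IH: "card J' \<le> 2" if "min_blocked (V - cl {t}) y J'" "J' \<subseteq> J - {m}" "m \<in> J" "t \<in> far V y m" for t m J'
    proof (rule less.hyps[OF _ _ _ that(1)])
      show "card J' < card J" using that(2,3) finJ by (metis Diff_iff insertI1 psubsetI psubset_card_mono subset_Diff_insert subset_iff)
      have m: "m \<in> nb V y" using Jnb that(3) by blast
      show "y \<in> V - cl {t}" using delete_far(1)[OF yV m that(4)] .
      show "wc (V - cl {t})"
        using wc_diff[OF wcV, of "{t}"] that(4) by (auto simp: indep_def irr far_iff)
    qed
    have ne: "far V y u \<noteq> {}" if "u \<in> J" for u
    proof
      assume "far V y u = {}"
      then have "blocked V y {u}" using Jnb that by (auto simp: blocked_def transv_def)
      moreover have "{u} \<subset> J" using that k by auto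
      ultimately show False using nbl by blast
    qed
    show False
    proof (cases "\<exists>m\<in>J. \<exists>a. far V y m = {a}")
      case True
      then obtain m a where m: "m \<in> J" "far V y m = {a}" by blast
      have a: "a \<in> far V y m" using m by simp
      have mnb: "m \<in> nb V y" using Jnb m(1) by blast
      note d = delete_far[OF yV mnb a]
      have "blocked (V - cl {a}) y (J - {m})" using blocked_delete[OF yV bl m(1) a] .
      then obtain J' where J': "J' \<subseteq> J - {m}" "min_blocked (V - cl {a}) y J'"
        using exists_min_blocked wc_finite[OF wcV] by (metis finite_Diff)
      have c2: "card J' \<le> 2" using IH[OF J'(2,1) m(1) a] .
      \<comment> \<open>A transversal must take the value \<open>a\<close> at \<open>m\<close>, so
        its other values avoid \<open>cl {a}\<close> and would form a transversal of
        \<open>J'\<close> after the deletion.\<close>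
      have blm: "blocked V y (insert m J')"
        unfolding blocked_def
      proof (intro conjI notI)
        show "insert m J' \<subseteq> nb V y" using J' Jnb m by blast
        assume "\<exists>\<tau>. transv V y (insert m J') \<tau>"
        then obtain \<tau> where \<tau>: "transv V y (insert m J') \<tau>" by blast
        have "\<tau> m = a" using \<tau> m(2) by (auto simp: transv_def)
        have "\<tau> u \<in> far (V - cl {a}) y u" if u: "u \<in> J'" for u
        proof -
          have "u \<in> nb V y - {m}" using u J' Jnb by blast
          then show ?thesis using d(3)[of u] \<tau> u \<open>\<tau> m = a\<close> by (auto simp: transv_def)
        qed
        then have "transv (V - cl {a}) y J' \<tau>" using \<tau> by (auto simp: transv_def)
        then show False using J'(2) by (auto simp: min_blocked_def blocked_def)
      qed
      have "insert m J' \<subseteq> J" using J'(1) m(1) by auto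
      then have JJ: "insert m J' = J" using nbl[of "insert m J'"] blm by auto
      have finJ': "finite J'" using finJ J' finite_subset by blast
      have "card J = Suc (card J')" using JJ finJ' J'(1) by (metis Diff_iff card_insert_disjoint insertI1 subsetD)
      then have "card J' = 2" using k c2 by linarith
      then obtain i j where ij: "J' = {i, j}" "i \<noteq> j" by (auto simp: card_2_iff)
      show False
        by (rule no_triple_single[OF wcV yV mb _ ij(2) _ _ m(2)]) (use ij JJ J' in auto)
    next
      case False
      have "J \<noteq> {}" using k by auto
      show False
      proof (rule no_thin_pairs[OF yV Jnb \<open>J \<noteq> {}\<close> ne])
        fix m t assume mt: "m \<in> J" "t \<in> far V y m"
        show "\<exists>i j a b a' b'. i \<in> J - {m} \<and> j \<in> J - {m} \<and>
          i \<noteq> j \<and> far V y i = {a, b} \<and> far V y j = {a', b'} \<and> a \<noteq> b \<and> a' \<noteq> b' \<and> t \<sim> b \<and> t \<sim> b' \<and>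
          a \<sim> a' \<and> (\<forall>z\<in>V. a \<sim> z \<longrightarrow> z = i \<or> z = a' \<or> t \<sim> z)"
        proof (rule thin_pair[OF wcV yV bl mt])
          show "\<And>u a. u \<in> J \<Longrightarrow> far V y u \<noteq> {a}" using False by blast
          show "\<And>u. u \<in> J \<Longrightarrow> far V y u \<noteq> {}" using ne .
          show "\<And>J'. min_blocked (V - cl {t}) y J' \<Longrightarrow> J' \<subseteq> J - {m} \<Longrightarrow> card J' \<le> 2"
            using IH mt by blast
        qed metis
      qed
    qed
  qed
qed

definition thin :: "'v set \<Rightarrow> 'v \<Rightarrow> 'v \<Rightarrow> 'v \<Rightarrow> bool" where
  "thin V p c q \<longleftrightarrow> nb V c = {p, q}"

text \<open>The five disjunctions, one for each edge, say that no edge joins two vertices of degree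
  at least three. The cycle is induced by girth five.\<close>

definition basic5 :: "'v set \<Rightarrow> 'v \<Rightarrow> 'v \<Rightarrow> 'v \<Rightarrow> 'v \<Rightarrow> 'v \<Rightarrow> bool" where
  "basic5 V a b c d e \<longleftrightarrow> {a, b, c, d, e} \<subseteq> V \<and> a \<sim> b \<and> b \<sim> c \<and> c \<sim> d \<and> d \<sim> e \<and> e \<sim> a \<and>
     (thin V e a b \<or> thin V a b c) \<and> (thin V a b c \<or> thin V b c d) \<and> (thin V b c d \<or> thin V c d e) \<and>
     (thin V c d e \<or> thin V d e a) \<and> (thin V d e a \<or> thin V e a b)"

lemma basic5_rotate: "basic5 V a b c d e \<Longrightarrow> basic5 V b c d e a"
  unfolding basic5_def by auto

lemma basic5_reflect: "basic5 V a b c d e \<Longrightarrow> basic5 V a e d c b"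
  unfolding basic5_def thin_def by (auto simp: insert_commute comm)

text \<open>Isolated vertices are not good; they appear as a separate alternative
  throughout.\<close>

definition good :: "'v set \<Rightarrow> 'v \<Rightarrow> bool" where
  "good V x \<longleftrightarrow> x \<in> V \<and> ((\<exists>u. nb V x = {u}) \<or> (\<exists>u\<in>V. nb V u = {x}) \<or>
     (\<exists>b c d e. basic5 V x b c d e))"

text \<open>An obstruction with one member is a leaf next to \<open>y\<close>. One with two members
  closes the 5-cycle of \<open>blocked_pair\<close>, in which \<open>u\<close>, \<open>v\<close> and
  one of \<open>a\<close>, \<open>b\<close> have degree two.\<close>

theorem blocked_imp_good:
  assumes "wc V" "y \<in> V" "blocked V y (nb V y)"
  shows "good V y"
proof -
  obtain J where J: "J \<subseteq> nb V y" "min_blocked V y J"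
    using exists_min_blocked[OF assms(3)] wc_finite[OF assms(1)] by blast
  have finJ: "finite J"
    using J(1) wc_finite[OF assms(1)] by (auto simp: nb_def intro: finite_subset)
  have c: "card J \<le> 2" using min_blocked_card_le_2[OF assms(1,2) J(2)] .
  have "J \<noteq> {}" using J(2) by (auto simp: min_blocked_def blocked_def transv_def)
  then have "card J \<noteq> 0" using finJ by simp
  then consider "card J = 1" | "card J = 2" using c by linarith
  then show ?thesis
  proof cases
    case 1
    then obtain u where u: "J = {u}" by (auto simp: card_1_singleton_iff)
    have "far V y u = {}"
    proof (rule ccontr)
      assume "far V y u \<noteq> {}"
      then obtain a where "a \<in> far V y u" by blast
      then have "transv V y J (\<lambda>_. a)" using u irr by (auto simp: transv_def)
      then show False using J(2) by (auto simp: min_blocked_def blocked_def)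
    qed
    then have "nb V u = {y}" "u \<in> V" using u J(1) assms(2) sym by (auto simp: far_def)
    then show ?thesis using assms(2) by (auto simp: good_def)
  next
    case 2
    then obtain u v where uv: "J = {u, v}" "u \<noteq> v" by (auto simp: card_2_iff)
    obtain a b where ab: "far V y u = {a}" "far V y v = {b}" "a \<sim> b"
      "nb V a = {u, b} \<or> nb V b = {v, a}"
      using blocked_pair[OF assms(1,2) _ uv(2)] J(2) uv(1) by metis
    have y: "u \<in> V" "v \<in> V" "y \<sim> u" "y \<sim> v" using J uv by auto
    have e: "u \<sim> a" "v \<sim> b" "a \<in> V" "b \<in> V" using ab far_iff[of _ V y] by auto
    have "nb V u = {y, a}" "nb V v = {y, b}"
      using ab y assms(2) sym by (auto simp: far_def)
    then have "basic5 V y u a b v"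
      using ab(3,4) e y assms(2) by (auto simp: basic5_def thin_def comm insert_commute)
    then show ?thesis using assms(2) by (auto simp: good_def)
  qed
qed

end

section \<open>Neighbours of good vertices are good\<close>

context girth5 begin

lemma c5_facts:
  assumes "a \<sim> b" "b \<sim> c" "c \<sim> d" "d \<sim> e" "e \<sim> a"
  shows "\<not> a \<sim> c" "\<not> a \<sim> d" "\<not> b \<sim> d" "\<not> b \<sim> e" "\<not> c \<sim> e" "distinct [a, b, c, d, e]"
proof -
  show n: "\<not> a \<sim> c" "\<not> a \<sim> d" "\<not> b \<sim> d" "\<not> b \<sim> e" "\<not> c \<sim> e"
    using no3 assms sym by blast+
  show "distinct [a, b, c, d, e]"
    using n assms irr sym by auto
qed

lemma basic5_adj:
  assumes "basic5 V a b c d e"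
  shows "a \<sim> b" "b \<sim> c" "c \<sim> d" "d \<sim> e" "e \<sim> a" "a \<in> V" "b \<in> V" "c \<in> V" "d \<in> V" "e \<in> V"
  using assms by (auto simp: basic5_def)

lemma basic5_good:
  assumes "basic5 V a b c d e" "x \<in> {a, b, c, d, e}"
  shows "good V x"
proof -
  note r = assms(1) basic5_rotate[OF assms(1)]
  note r2 = r(2)[THEN basic5_rotate] r(2)[THEN basic5_rotate, THEN basic5_rotate]
    r(2)[THEN basic5_rotate, THEN basic5_rotate, THEN basic5_rotate]
  show ?thesis using r r2 assms(2) basic5_adj[OF assms(1)] unfolding good_def by blast
qed

text \<open>The leaf raises the degree of \<open>s\<close> to at least three, hence \<open>b\<close>
  and \<open>e\<close> are thin. Then \<open>s\<close> and \<open>d\<close> dominate all that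
  \<open>l\<close>, \<open>b\<close> and \<open>d\<close> dominate.\<close>

lemma pendant_basic5_aux:
  assumes "wc V" "l \<in> V" "nb V l = {s}" "basic5 V s b c d e" "thin V c d e"
  shows False
proof -
  note a = basic5_adj[OF assms(4)]
  note f = c5_facts[OF a(1-5)]
  have l: "l \<sim> s" "\<And>z. z \<in> V \<Longrightarrow> l \<sim> z \<Longrightarrow> z = s" using assms(3) by (auto simp: set_eq_iff)
  have ln: "\<not> l \<sim> b" "\<not> l \<sim> c" "\<not> l \<sim> d" "\<not> l \<sim> e"
    using l(2)[OF a(7)] l(2)[OF a(8)] l(2)[OF a(9)] l(2)[OF a(10)] f(6) by auto
  have "l \<noteq> b" "l \<noteq> e" "l \<noteq> d"
    using l(2)[OF a(8)] l(2)[OF a(9)] l(2)[OF a(10)] a(2,4) sym[OF a(4)] f(6) by auto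
  then have "\<not> thin V e s b" "\<not> thin V b s e"
    using l(1) assms(2) sym by (auto simp: thin_def set_eq_iff)
  then have "nb V b = {s, c}" "nb V e = {d, s}" "nb V d = {c, e}"
    using assms(4,5) by (auto simp: basic5_def thin_def)
  then show False
    by (intro exchange[OF assms(1), of "[l, b, d]" "[s, d]"])
      (use ln a f assms(2,3) l(1) \<open>l \<noteq> b\<close> \<open>l \<noteq> d\<close> in \<open>auto simp: cl_iff comm\<close>)
qed

lemma pendant_basic5:
  assumes "wc V" "l \<in> V" "nb V l = {s}" "basic5 V s b c d e"
  shows False
proof -
  have "thin V c d e \<or> thin V b c d" using assms(4) by (auto simp: basic5_def)
  then show False
  proof
    assume "thin V b c d"
    then have "thin V d c b" by (auto simp: thin_def insert_commute)
    then show False using pendant_basic5_aux[OF assms(1-3) basic5_reflect[OF assms(4)]] by blast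
  qed (use pendant_basic5_aux[OF assms] in blast)
qed

text \<open>A switch at \<open>g\<close>: the stable set \<open>K\<close>, which contains
  \<open>g\<close>, may replace \<open>K'\<close> of the same size, so an exchange can use
  \<open>g\<close> as a dominating vertex at no cost. \<open>E\<close> lists further vertices wanted
  in \<open>K\<close>; the vertices of \<open>P\<close> absorb the difference.\<close>

definition gadget :: "'v set \<Rightarrow> 'v \<Rightarrow> 'v set \<Rightarrow> 'v set \<Rightarrow> 'v set \<Rightarrow> 'v set \<Rightarrow> bool" where
  "gadget V g P E K K' \<longleftrightarrow> K \<subseteq> V \<and> K' \<subseteq> V \<and> indep K \<and> indep K' \<and> card K' = card K \<and>
     insert g E \<subseteq> K \<and> K \<subseteq> insert g E \<union> P \<and> K' \<subseteq> E \<union> P \<and> V \<inter> cl K' \<subseteq> cl K"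

lemma exchange_gadget:
  assumes "wc V" "gadget V g P E K K'"
    and "distinct as" "length as = Suc (length bs)" "set as \<subseteq> V" "set bs \<subseteq> V"
    and "indepl as" "indepl bs" "set as \<inter> (E \<union> P) = {}"
    and "\<forall>a\<in>set as. \<forall>k\<in>E \<union> P. \<not> a \<sim> k" "\<forall>b\<in>set bs. \<forall>k\<in>insert g E \<union> P. \<not> b \<sim> k"
    and "\<forall>a\<in>set as. a \<in> set bs \<or> insert a (nb V a) \<subseteq> cl (insert g E \<union> set bs)"
  shows False
proof -
  have K: "K \<subseteq> V" "K' \<subseteq> V" "indep K" "indep K'" "card K' = card K" "insert g E \<subseteq> K"
    "K \<subseteq> insert g E \<union> P" "K' \<subseteq> E \<union> P" "V \<inter> cl K' \<subseteq> cl K"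
    using assms(2) by (auto simp: gadget_def)
  have fin: "finite K" "finite K'" using K(1,2) wc_finite[OF assms(1)] finite_subset by blast+
  have 1: "indep (K' \<union> set as)" unfolding indep_Un
    using K(4,8) assms(7,10) comm by (metis indepl_iff subsetD)
  have 2: "indep (K \<union> set bs)" unfolding indep_Un
    using K(3,7) assms(8,11) comm by (metis indepl_iff subsetD)
  have "cl (insert g E \<union> set bs) \<subseteq> cl (K \<union> set bs)"
    using K(6) unfolding cl_def by blast
  then have "\<forall>a\<in>set as. a \<in> set bs \<or> insert a (nb V a) \<subseteq> cl (K \<union> set bs)"
    using assms(12) by (meson order_trans)
  then have "V \<inter> cl (set as) \<subseteq> cl (K \<union> set bs)"
    by (fastforce simp: cl_iff)
  then have "V \<inter> cl (K' \<union> set as) \<subseteq> cl (K \<union> set bs)"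
    using K(9) by (auto simp: cl_Un)
  then have "card (K' \<union> set as) \<le> card (K \<union> set bs)"
    using wcD[OF assms(1) _ _ 1 2] K(1,2) assms(5,6) by blast
  also have "\<dots> \<le> card K + length bs"
    using card_Un_le[of K "set bs"] card_length[of bs] by linarith
  finally have "card (K' \<union> set as) \<le> card K + length bs" .
  moreover have "card (K' \<union> set as) = card K' + length as"
    using assms(3,9) K(8) fin by (subst card_Un_disjoint) (auto simp: distinct_card)
  ultimately show False using assms(4) K(5) by simp
qed

text \<open>Up to reflection this is how a 5-cycle that is basic after a deletion fails to be basic
  before it: \<open>g\<close> is a third neighbour of \<open>x\<close>, and \<open>b\<close> is not
  thin. With \<open>g\<close> free of cost, \<open>d\<close> replaces either \<open>c\<close> and
  \<open>e\<close>, or \<open>x\<close> and \<open>d\<close>; a further neighbour \<open>w\<close>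
  of \<open>b\<close> and, in the second case, \<open>z\<close> of \<open>e\<close> cover the
  rest.\<close>

lemma bad_neighbour_aux:
  assumes "wc V" "g \<in> V" "g \<sim> x"
    and P: "g \<notin> P" "\<And>z p. z \<in> V \<Longrightarrow> z \<notin> Q \<Longrightarrow> z \<notin> P \<Longrightarrow> z \<noteq> g \<Longrightarrow> p \<in> P \<Longrightarrow> \<not> z \<sim> p"
    and gad: "\<And>E. E \<subseteq> V \<Longrightarrow> indep E \<Longrightarrow> E \<inter> P = {} \<Longrightarrow> g \<notin> E \<Longrightarrow> \<forall>e\<in>E. \<not> g \<sim> e \<Longrightarrow> \<exists>K K'. gadget V g P E K K'"
    and c: "{x, b, c, d, e} \<subseteq> V" "x \<sim> b" "b \<sim> c" "c \<sim> d" "d \<sim> e" "e \<sim> x" "{x, b, c, d, e} \<inter> (Q \<union> P) = {}"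
    and nx: "nb V x = {g, e, b}" and nc: "nb V c = {b, d}" and nbb: "nb V b \<noteq> {x, c}" "b \<noteq> g" "c \<noteq> g" "d \<noteq> g" "e \<noteq> g"
  shows False
proof -
  note f = c5_facts[OF c(2-6)]
  have mem: "x \<in> V" "b \<in> V" "c \<in> V" "d \<in> V" "e \<in> V" using c(1) by auto
  have gn: "\<not> g \<sim> b" "\<not> g \<sim> e" "\<not> g \<sim> c" "\<not> g \<sim> d"
    using no_common[of x g b] no_common[of x g e] no_chord[of g x b c] no_chord[of g x e d]
      assms(3) c(2-6) f nbb sym by auto
  have Pn: "\<not> z \<sim> p" "\<not> p \<sim> z" if "z \<in> {x, b, c, d, e}" "p \<in> P" for z p
  proof -
    have "z \<noteq> g" using that nbb assms(3) irr by auto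
    then show "\<not> z \<sim> p" using P(2)[of z p] that c(1,7) by blast
    then show "\<not> p \<sim> z" using sym by blast
  qed
  have xg: "x \<noteq> g" using assms(3) irr by blast
  obtain w where w: "w \<in> V" "b \<sim> w" "w \<noteq> x" "w \<noteq> c"
    by (rule third_nb[OF nbb(1) mem(1,3) sym[OF c(2)] c(3)])
  have wP: "w \<notin> P" using Pn(1)[of b w] w by auto
  have "w \<noteq> g" using gn(1) sym[OF w(2)] by auto
  moreover have "\<not> g \<sim> w" using no_chord[OF assms(3) c(2) w(2)] nbb(2) w(3) by auto
  ultimately have wg: "w \<noteq> g" "\<not> g \<sim> w" .
  have wn: "\<not> x \<sim> w" "\<not> c \<sim> w" "\<not> e \<sim> w" "\<not> d \<sim> w" "w \<noteq> e" "w \<noteq> d" "w \<noteq> b"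
    using no_common[of b x w] no_common[of b c w] no_chord[of e x b w] no_chord[of d c b w] w c(2-6) f sym irr
    by auto
  have np: "\<forall>k\<in>P. \<not> x \<sim> k \<and> \<not> c \<sim> k \<and> \<not> e \<sim> k \<and> \<not> d \<sim> k \<and> \<not> k \<sim> x \<and> \<not> k \<sim> c \<and> \<not> k \<sim> e \<and> \<not> k \<sim> d"
    using Pn by auto
  show False
  proof (cases "\<forall>z\<in>V. e \<sim> z \<longrightarrow> z \<noteq> d \<longrightarrow> z \<noteq> x \<longrightarrow> w \<sim> z")
    case True
    have "\<exists>K K'. gadget V g P {w} K K'"
      by (rule gad) (use w wP wg irr in \<open>auto simp: indep_def\<close>)
    then obtain K K' where K: "gadget V g P {w} K K'" by blast
    have "insert e (nb V e) \<subseteq> cl (insert g {w} \<union> set [d])"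
      using True c(5) assms(3) by (auto simp: cl_iff)
    moreover have "insert c (nb V c) \<subseteq> cl (insert g {w} \<union> set [d])"
      using nc c(4) w(2) sym by (auto simp: cl_iff)
    ultimately show False
      by (intro exchange_gadget[OF assms(1) K, of "[c, e]" "[d]"])
        (use f wn w(3,4) mem c(7) np gn in \<open>auto simp: comm\<close>)
  next
    case False
    then obtain z where z: "z \<in> V" "e \<sim> z" "z \<noteq> d" "z \<noteq> x" "\<not> w \<sim> z" by blast
    have zP: "z \<notin> P" using Pn(1)[of e z] z by auto
    have "z \<noteq> g" using gn(2) sym[OF z(2)] by auto
    moreover have "\<not> g \<sim> z" using no_chord[OF assms(3) sym[OF c(6)] z(2)] nbb(5) z(4) by auto
    ultimately have zg: "z \<noteq> g" "\<not> g \<sim> z" .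
    have zn: "\<not> x \<sim> z" "\<not> d \<sim> z" using no_common[of e x z] no_common[of e d z] z c sym by blast+
    have "\<exists>K K'. gadget V g P {w, z} K K'"
      by (rule gad) (use w wP wg z zP zg irr sym in \<open>auto simp: indep_def\<close>)
    then obtain K K' where K: "gadget V g P {w, z} K K'" by blast
    have "insert x (nb V x) \<subseteq> cl (insert g {w, z} \<union> set [d])"
      using nx assms(3) w(2) z(2) sym by (auto simp: cl_iff)
    then show False
      by (intro exchange_gadget[OF assms(1) K, of "[x, d]" "[d]"])
        (use f wn zn w(3,4) mem c(7) np gn z in \<open>auto simp: comm\<close>)
  qed
qed

text \<open>Each way for \<open>x\<close> to be good or isolated after deleting
  \<open>cl {l}\<close> either persists in \<open>V\<close> or contradicts
  \<open>exchange_gadget\<close>. \<open>P\<close> carries the gadget at \<open>g\<close>. Apart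
  from \<open>g\<close>, only vertices of \<open>Q\<close> may be adjacent to \<open>P\<close> from
  outside or lose a neighbour other than \<open>g\<close> by the deletion.\<close>

lemma bad_neighbour:
  assumes "wc V" "g \<in> V" "x \<in> V" "g \<sim> x" "\<not> good V x" "l \<sim> g" "x \<in> V - cl {l}"
    and gW: "good (V - cl {l}) x \<or> nb (V - cl {l}) x = {}"
    and nbW: "\<And>z y. z \<in> V - cl {l} \<Longrightarrow> z \<notin> Q \<Longrightarrow> y \<in> V \<Longrightarrow> z \<sim> y \<Longrightarrow> y \<noteq> g \<Longrightarrow> y \<in> V - cl {l}"
    and xQ: "x \<notin> Q" "\<And>q. q \<in> Q \<Longrightarrow> \<not> x \<sim> q" and xP: "x \<notin> P" "g \<notin> P"
    and P: "\<And>z p. z \<in> V \<Longrightarrow> z \<notin> Q \<Longrightarrow> z \<notin> P \<Longrightarrow> z \<noteq> g \<Longrightarrow> p \<in> P \<Longrightarrow> \<not> z \<sim> p"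
    and DQ: "\<And>b c d e. basic5 (V - cl {l}) x b c d e \<Longrightarrow> {b, c, d, e} \<inter> (Q \<union> P) = {}"
    and gad: "\<And>E. E \<subseteq> V \<Longrightarrow> indep E \<Longrightarrow> E \<inter> P = {} \<Longrightarrow> g \<notin> E \<Longrightarrow> \<forall>e\<in>E. \<not> g \<sim> e \<Longrightarrow> \<exists>K K'. gadget V g P E K K'"
  shows False
proof -
  let ?W = "V - cl {l}"
  have gnW: "g \<notin> ?W" using assms(6) by (auto simp: cl_iff)
  have xg: "x \<noteq> g" using assms(4) irr by blast
  have nbx: "nb V x = insert g (nb ?W x)"
  proof (intro Set.set_eqI iffI)
    fix y assume y: "y \<in> nb V x"
    then have "y = g \<or> y \<in> ?W" using nbW[OF assms(7) xQ(1), of y] by auto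
    then show "y \<in> insert g (nb ?W x)" using y by auto
  qed (use assms(2,4) sym in auto)
  consider "nb ?W x = {}" | s where "nb ?W x = {s}" | u where "u \<in> ?W" "nb ?W u = {x}"
    | b c d e where "basic5 ?W x b c d e"
    using gW unfolding good_def by blast
  then show False
  proof cases
    case 1
    then show False using nbx assms(3,5) by (auto simp: good_def)
  next
    case (2 s)
    have s: "s \<in> ?W" "x \<sim> s" using 2 by (auto simp del: Diff_iff)
    have sQ: "s \<notin> Q" "s \<noteq> g" "s \<in> V" using xQ(2) s gnW by auto
    have sP: "s \<notin> P" using P[of x s] assms(3) xQ xP s xg by blast
    have "nb V s \<noteq> {x}" using assms(3,5) sQ by (auto simp: good_def)
    then obtain w where w: "w \<in> V" "s \<sim> w" "w \<noteq> x" using s assms(3) sym by (auto simp: set_eq_iff)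
    have wP: "w \<notin> P" using P[of s w] sQ sP w by blast
    have wg: "w \<noteq> g" "\<not> g \<sim> w" "\<not> x \<sim> w"
      using no_common[of x g s] no_chord[of g x s w] no_common[of s x w] assms(4) s w sQ sym by blast+
    have "\<exists>K K'. gadget V g P {w} K K'"
      by (rule gad) (use w wP wg irr in \<open>auto simp: indep_def\<close>)
    then obtain K K' where K: "gadget V g P {w} K K'" by blast
    have "insert x (nb V x) \<subseteq> cl (insert g {w} \<union> set [])"
      using nbx 2 assms(4) w sym by (auto simp: cl_iff)
    then show False
      by (intro exchange_gadget[OF assms(1) K, of "[x]" "[]"])
        (use w wg xP P[of x] assms(3) xQ xg in auto)
  next
    case (3 u)
    have "u \<sim> x" "u \<in> V" using 3 by auto
    then have "u \<notin> Q" "\<not> u \<sim> g" using xQ(2) no_common[of x u g] assms(4) sym by blast+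
    then have "nb V u = {x}"
      using nbW[OF 3(1)] 3(2) \<open>u \<sim> x\<close> assms(3) by (auto simp: set_eq_iff simp del: Diff_iff)
    then show False using \<open>u \<in> V\<close> assms(3,5) by (auto simp: good_def)
  next
    case (4 b c d e)
    note a = basic5_adj[OF 4]
    note f = c5_facts[OF a(1-5)]
    have Q: "{b, c, d, e} \<inter> (Q \<union> P) = {}" using DQ[OF 4] .
    have neg: "b \<noteq> g" "c \<noteq> g" "d \<noteq> g" "e \<noteq> g" using a gnW by blast+
    have V: "{x, b, c, d, e} \<subseteq> V" using a by auto
    have gn: "\<not> b \<sim> g" "\<not> e \<sim> g" "\<not> c \<sim> g" "\<not> d \<sim> g"
      using no_common[of x b g] no_common[of x e g] no_chord[of c b x g] no_chord[of d e x g]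
        assms(4) a(1-5) f neg sym by auto
    have nbV: "nb V z = nb ?W z" if "z \<in> {b, c, d, e}" for z
    proof -
      have "z \<in> ?W" "z \<notin> Q" "\<not> z \<sim> g" using that a(6-10) Q gn by auto
      then show ?thesis using nbW[of z] by (auto simp del: Diff_iff) (auto)
    qed
    have tb: "thin V x b c = thin ?W x b c" "thin V b c d = thin ?W b c d" "thin V c d e = thin ?W c d e"
      "thin V d e x = thin ?W d e x"
      using nbV by (auto simp: thin_def)
    have xt: "thin ?W e x b"
    proof (rule ccontr)
      assume n: "\<not> thin ?W e x b"
      then have "basic5 V x b c d e"
        using 4 tb V unfolding basic5_def by blast
      then show False using assms(3,5) by (auto simp: good_def)
    qed
    then have nx: "nb V x = {g, e, b}" using nbx by (auto simp: thin_def)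
    have "\<not> (thin V x b c \<and> thin V d e x)"
    proof
      assume "thin V x b c \<and> thin V d e x"
      then have "basic5 V x b c d e" using 4 tb V unfolding basic5_def by blast
      then show False using assms(3,5) by (auto simp: good_def)
    qed
    then consider "\<not> thin V x b c" | "\<not> thin V d e x" by blast
    then show False
    proof cases
      case 1
      then have t: "thin V b c d" using 4 tb unfolding basic5_def by blast
      show False
      proof (rule bad_neighbour_aux[OF assms(1,2,4) xP(2), of Q b c d e])
        show "\<And>z p. z \<in> V \<Longrightarrow> z \<notin> Q \<Longrightarrow> z \<notin> P \<Longrightarrow> z \<noteq> g \<Longrightarrow> p \<in> P \<Longrightarrow> \<not> z \<sim> p" by (rule P)
        show "\<And>E. E \<subseteq> V \<Longrightarrow> indep E \<Longrightarrow> E \<inter> P = {} \<Longrightarrow> g \<notin> E \<Longrightarrow> \<forall>e\<in>E. \<not> g \<sim> e \<Longrightarrow>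
          \<exists>K K'. gadget V g P E K K'" by (rule gad)
      qed (use 1 Q xQ(1) xP(1) V a(1-5) nx neg t in \<open>auto simp: thin_def insert_commute\<close>)
    next
      case 2
      then have t: "thin V c d e" using 4 tb unfolding basic5_def by blast
      show False
      proof (rule bad_neighbour_aux[OF assms(1,2,4) xP(2), of Q e d c b])
        show "\<And>z p. z \<in> V \<Longrightarrow> z \<notin> Q \<Longrightarrow> z \<notin> P \<Longrightarrow> z \<noteq> g \<Longrightarrow> p \<in> P \<Longrightarrow> \<not> z \<sim> p" by (rule P)
        show "\<And>E. E \<subseteq> V \<Longrightarrow> indep E \<Longrightarrow> E \<inter> P = {} \<Longrightarrow> g \<notin> E \<Longrightarrow> \<forall>e\<in>E. \<not> g \<sim> e \<Longrightarrow>
          \<exists>K K'. gadget V g P E K K'" by (rule gad)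
      qed (use 2 Q xQ(1) xP(1) V a(1-5)[THEN sym] nx neg t in \<open>auto simp: thin_def insert_commute\<close>)
    qed
  qed
qed

text \<open>The situation in the inductive step once special components are excluded after every
  deletion. \<open>S\<close> is nonempty because the claim for \<open>V\<close> itself is the
  goal.\<close>

definition hereditary :: "'v set \<Rightarrow> bool" where
  "hereditary V \<longleftrightarrow> (\<forall>S\<subseteq>V. S \<noteq> {} \<longrightarrow> indep S \<longrightarrow>
     (\<forall>z\<in>V - cl S. good (V - cl S) z \<or> nb (V - cl S) z = {}))"

lemma hereditaryD:
  "hereditary V \<Longrightarrow> l \<in> V \<Longrightarrow> z \<in> V - cl {l} \<Longrightarrow> good (V - cl {l}) z \<or> nb (V - cl {l}) z = {}"
  unfolding hereditary_def by (metis empty_subsetI indep_def insert_subset insert_not_empty irr singletonD)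

text \<open>The leaf provides the gadget: \<open>g\<close> dominates all that \<open>l\<close>
  dominates, so it can take its place.\<close>

lemma bad_next_to_stem:
  assumes "wc V" "hereditary V" "g \<in> V" "x \<in> V" "g \<sim> x" "\<not> good V x" "l \<in> V" "nb V l = {g}"
  shows False
proof -
  have l: "l \<sim> g" "\<And>z. z \<in> V \<Longrightarrow> l \<sim> z \<Longrightarrow> z = g" using assms(8) by (auto simp: set_eq_iff)
  have "x \<noteq> l" using assms(4,6,8) by (auto simp: good_def)
  then have xW: "x \<in> V - cl {l}" using assms(4,5) l irr by (auto simp: cl_iff)
  have lg: "l \<noteq> g" using l irr by blast
  show False
  proof (rule bad_neighbour[OF assms(1,3-6) l(1) xW hereditaryD[OF assms(2,7) xW], of "{}" "{l}"])
    fix z y assume "z \<in> V - cl {l}" "y \<in> V" "z \<sim> y" "y \<noteq> g"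
    then show "y \<in> V - cl {l}" using l sym by (auto simp: cl_iff)
  next
    fix z p assume "z \<in> V" "z \<noteq> g" "p \<in> {l}"
    then show "\<not> z \<sim> p" using l sym by blast
  next
    fix b c d e assume "basic5 (V - cl {l}) x b c d e"
    from basic5_adj[OF this] show "{b, c, d, e} \<inter> ({} \<union> {l}) = {}" by (auto simp: cl_iff)
  next
    fix E assume E: "E \<subseteq> V" "indep E" "E \<inter> {l} = {}" "g \<notin> E" "\<forall>e\<in>E. \<not> g \<sim> e"
    have fin: "finite E" using E(1) wc_finite[OF assms(1)] finite_subset by blast
    have lE: "\<forall>e\<in>E. \<not> l \<sim> e" using l(2) E(1,4) by blast
    have "gadget V g {l} E (insert g E) (insert l E)"
      unfolding gadget_def
    proof (intro conjI)
      show "indep (insert g E)" "indep (insert l E)"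
        using E(2,5) lE irr sym unfolding indep_def by blast+
      show "card (insert l E) = card (insert g E)" using fin E(3,4) by auto
      show "V \<inter> cl (insert l E) \<subseteq> cl (insert g E)"
        using l sym by (auto simp: cl_iff)
    qed (use E assms(3,7) in auto)
    then show "\<exists>K K'. gadget V g {l} E K K'" by blast
  qed (use \<open>x \<noteq> l\<close> lg in auto)
qed

text \<open>Here \<open>s\<close> is the vertex whose closed neighbourhood is deleted. Afterwards
  \<open>p\<close> is a leaf at \<open>q\<close>, so by \<open>pendant_basic5\<close> a basic
  5-cycle through \<open>x\<close> avoids \<open>q\<close> and with it the gadget on
  \<open>p\<close>, \<open>r\<close>, \<open>s\<close>.\<close>

lemma bad_next_to_basic5_aux:
  assumes "wc V" "hereditary V" "x \<in> V" "g \<sim> x" "\<not> good V x" "basic5 V g p q r s" "x \<notin> {g, p, q, r, s}"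
    and thin: "nb V p = {g, q}" "nb V s = {r, g}" "nb V r = {q, s}"
  shows False
proof -
  note a = basic5_adj[OF assms(6)]
  note f = c5_facts[OF a(1-5)]
  have P: "\<And>z. z \<in> V \<Longrightarrow> p \<sim> z \<Longrightarrow> z = g \<or> z = q" "\<And>z. z \<in> V \<Longrightarrow> r \<sim> z \<Longrightarrow> z = q \<or> z = s"
    "\<And>z. z \<in> V \<Longrightarrow> s \<sim> z \<Longrightarrow> z = g \<or> z = r"
    using thin by (auto simp: set_eq_iff)
  have xW: "x \<in> V - cl {s}" using assms(3,7) P(3) by (auto simp: cl_iff)
  have pW: "p \<in> V - cl {s}" "nb (V - cl {s}) p = {q}"
  proof -
    show "nb (V - cl {s}) p = {q}"
      using P(1) a(2,8) a(5) f(4,5,6) comm[of s q] comm[of s p] by (fastforce simp: cl_iff)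
    show "p \<in> V - cl {s}" using a(7) f(4,6) comm[of s p] by (auto simp: cl_iff)
  qed
  have wcW: "wc (V - cl {s})" using wc_diff[OF assms(1), of "{s}"] a(10) irr by (auto simp: indep_def)
  show False
  proof (rule bad_neighbour[OF assms(1) a(6) assms(3-5) a(5) xW hereditaryD[OF assms(2) a(10) xW], of "{q}" "{p, r, s}"])
    fix z y assume z: "z \<in> V - cl {s}" "z \<notin> {q}" "y \<in> V" "z \<sim> y" "y \<noteq> g"
    have "y \<noteq> s" using z(1,4) sym by (auto simp: cl_iff)
    moreover have "\<not> s \<sim> y"
    proof
      assume "s \<sim> y"
      then have "y = r" using P(3) z(3,5) by blast
      then have "z = s" using P(2)[of z] z sym by blast
      then show False using z(1) by (simp add: cl_iff)
    qed
    ultimately show "y \<in> V - cl {s}" using z(3) by (simp add: cl_iff)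
  next
    fix z p' assume "z \<in> V" "z \<notin> {q}" "z \<notin> {p, r, s}" "z \<noteq> g" "p' \<in> {p, r, s}"
    then show "\<not> z \<sim> p'" using P sym by blast
  next
    fix b c d e assume b5: "basic5 (V - cl {s}) x b c d e"
    note rot = basic5_rotate[OF b5] basic5_rotate[OF basic5_rotate[OF b5]]
      basic5_rotate[OF basic5_rotate[OF basic5_rotate[OF b5]]]
      basic5_rotate[OF basic5_rotate[OF basic5_rotate[OF basic5_rotate[OF b5]]]]
    have q: "q \<notin> {b, c, d, e}"
      using pendant_basic5[OF wcW pW] rot by blast
    note ab = basic5_adj[OF b5]
    have "r \<notin> {b, c, d, e}" "s \<notin> {b, c, d, e}"
      using ab(6-10) a(4) sym by (auto simp: cl_iff)
    moreover have "p \<notin> {b, c, d, e}"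
    proof
      assume "p \<in> {b, c, d, e}"
      then have "q \<in> {x, b, c, d, e}"
      proof -
        have "\<exists>u\<in>{x, b, c, d, e}. u \<in> V - cl {s} \<and> p \<sim> u"
          using \<open>p \<in> {b, c, d, e}\<close> ab by auto
        then show ?thesis using pW(2) by auto
      qed
      then show False using q assms(7) by auto
    qed
    ultimately show "{b, c, d, e} \<inter> ({q} \<union> {p, r, s}) = {}" using q by blast
  next
    fix E assume E: "E \<subseteq> V" "indep E" "E \<inter> {p, r, s} = {}" "g \<notin> E" "\<forall>e\<in>E. \<not> g \<sim> e"
    have fin: "finite E" using E(1) wc_finite[OF assms(1)] finite_subset by blast
    show "\<exists>K K'. gadget V g {p, r, s} E K K'"
    \<comment> \<open>If \<open>q\<close> belongs to \<open>E\<close>, then \<open>p\<close> and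
      \<open>r\<close> stand in for \<open>g\<close> and \<open>q\<close>. Otherwise
      \<open>r\<close> can be added on both sides, and \<open>p\<close> stands in for
      \<open>g\<close>.\<close>
    proof (cases "q \<in> E")
      case True
      have "gadget V g {p, r, s} E (insert g E) (insert p (insert r (E - {q})))"
        unfolding gadget_def
      proof (intro conjI)
        show "indep (insert g E)" using E(2,5) irr sym unfolding indep_def by blast
        have "\<not> p \<sim> e" "\<not> r \<sim> e" if "e \<in> E - {q}" for e
          using P(1,2)[of e] that E by auto
        then show "indep (insert p (insert r (E - {q})))"
          using E(2) f irr sym unfolding indep_def by blast
        have "card (E - {q}) + 1 = card E" using True fin by (metis card_Suc_Diff1 Suc_eq_plus1)
        then show "card (insert p (insert r (E - {q}))) = card (insert g E)"
          using fin E(3,4) f by auto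
        show "V \<inter> cl (insert p (insert r (E - {q}))) \<subseteq> cl (insert g E)"
        proof
          fix y assume y: "y \<in> V \<inter> cl (insert p (insert r (E - {q})))"
          then consider "y = p" | "y = r" | "y \<in> E" | e where "e \<in> E" "e \<sim> y" | "p \<sim> y" | "r \<sim> y"
            unfolding cl_def by blast
          then have "y \<in> insert g E \<or> g \<sim> y \<or> (\<exists>e\<in>E. e \<sim> y)"
          proof cases
            case 5
            then show ?thesis using P(1) y True by blast
          next
            case 6
            then show ?thesis using P(2) y True sym[OF a(5)] by blast
          qed (use a True in blast)+
          then show "y \<in> cl (insert g E)" unfolding cl_def by blast
        qed
      qed (use E True a in auto)
      then show ?thesis by blast
    next
      case False
      have rE: "\<not> r \<sim> e" "\<not> p \<sim> e" if "e \<in> E" for e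
        using P(1,2)[of e] that E False by auto
      have "gadget V g {p, r, s} E (insert g (insert r E)) (insert p (insert r E))"
        unfolding gadget_def
      proof (intro conjI)
        show "indep (insert g (insert r E))" "indep (insert p (insert r E))"
          using E(2,5) rE f irr sym unfolding indep_def by blast+
        show "card (insert p (insert r E)) = card (insert g (insert r E))"
          using fin E(3,4) f by auto
        show "V \<inter> cl (insert p (insert r E)) \<subseteq> cl (insert g (insert r E))"
        proof
          fix y assume y: "y \<in> V \<inter> cl (insert p (insert r E))"
          then consider "y = p" | "y = r" | "y \<in> E" | e where "e \<in> E" "e \<sim> y" | "p \<sim> y" | "r \<sim> y"
            unfolding cl_def by blast
          then have "y \<in> insert g (insert r E) \<or> g \<sim> y \<or> r \<sim> y \<or> (\<exists>e\<in>E. e \<sim> y)"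
          proof cases
            case 5
            then show ?thesis using P(1) y sym[OF a(3)] sym[OF a(2)] by blast
          qed (use a in blast)+
          then show "y \<in> cl (insert g (insert r E))" unfolding cl_def by blast
        qed
      qed (use E a in auto)
      then show ?thesis by blast
    qed
  next
    show "\<And>q'. q' \<in> {q} \<Longrightarrow> \<not> x \<sim> q'"
      using no_chord[of x g p q] assms(4,7) a f sym by auto
  qed (use assms(7) f in auto)
qed

theorem good_neighbour_good:
  assumes "wc V" "hereditary V" "g \<in> V" "x \<in> V" "g \<sim> x" "good V g"
  shows "good V x"
proof (rule ccontr)
  assume nx: "\<not> good V x"
  consider u where "nb V g = {u}" | l where "l \<in> V" "nb V l = {g}"
    | p q r s where "basic5 V g p q r s"
    using assms(6) unfolding good_def by blast
  then show False
  proof cases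
    case (1 u)
    then have "nb V g = {x}" using assms(4,5) by auto
    then show False using nx assms(3,4) by (auto simp: good_def)
  next
    case (2 l)
    then show False using bad_next_to_stem assms nx by blast
  next
    case (3 p q r s)
    note a = basic5_adj[OF 3]
    note f = c5_facts[OF a(1-5)]
    have x: "x \<notin> {g, p, q, r, s}" using basic5_good[OF 3] nx by blast
    then have "\<not> thin V s g p" using assms(4,5) by (auto simp: thin_def set_eq_iff)
    then have t: "nb V p = {g, q}" "nb V s = {r, g}" "thin V p q r \<or> thin V q r s"
      using 3 by (auto simp: basic5_def thin_def)
    from t(3) show False
    proof
      assume "thin V q r s"
      then show False
        using bad_next_to_basic5_aux[OF assms(1,2,4,5) nx 3 x t(1,2)] by (simp add: thin_def)
    next
      assume "thin V p q r"
      then show False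
        using bad_next_to_basic5_aux[OF assms(1,2,4,5) nx basic5_reflect[OF 3]] x t(1,2)
        by (simp add: thin_def insert_commute)
    qed
  qed
qed

end

section \<open>Bad vertices of hereditary graphs have degree two\<close>

context girth5 begin

lemma not_good_transv:
  assumes "wc V" "y \<in> V" "\<not> good V y"
  obtains \<tau> where "transv V y (nb V y) \<tau>"
proof -
  have "\<not> blocked V y (nb V y)" using blocked_imp_good assms by blast
  then show thesis using that by (auto simp: blocked_def)
qed

text \<open>A good vertex with three neighbours is next to a leaf, which has no vertex behind it, or
  lies on a basic 5-cycle with two thin neighbours, whose only vertices behind them are
  adjacent.\<close>

lemma good_no_transv:
  assumes "good W x" "card (nb W x) = 3" "transv W x (nb W x) \<tau>"
  shows False
proof -
  have ne: "nb W x \<noteq> {u}" "nb W x \<noteq> {p, q}" for u p q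
    using assms(2) by (auto simp: card_insert_if split: if_splits)
  have t: "\<tau> u \<in> far W x u" "\<not> \<tau> u \<sim> \<tau> v" if "u \<in> nb W x" "v \<in> nb W x" for u v
    using assms(3) that by (auto simp: transv_def)
  consider u where "u \<in> W" "nb W u = {x}" | b c d e where "basic5 W x b c d e"
    using assms(1) ne unfolding good_def by blast
  then show False
  proof cases
    case (1 u)
    then have "u \<in> nb W x" using sym by (auto simp: set_eq_iff)
    then have "\<tau> u \<in> far W x u" using t by blast
    then show False using 1 by (auto simp: far_def)
  next
    case (2 b c d e)
    note a = basic5_adj[OF 2]
    have "\<not> thin W e x b" using ne(2) by (simp add: thin_def)
    then have "thin W x b c" "thin W d e x" using 2 unfolding basic5_def by blast+
    then have "nb W b = {x, c}" "nb W e = {d, x}" by (simp_all add: thin_def)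
    then have "far W x b = {c}" "far W x e = {d}"
      using c5_facts(6)[OF a(1-5)] by (auto simp: far_def)
    then show False using t[of b e] t[of e e] a sym by auto
  qed
qed

text \<open>The values on \<open>J\<close> are adjacent to no other neighbour of \<open>y\<close>,
  so the degree of \<open>y\<close> can be lowered at will while the rest of the transversal
  survives.\<close>

lemma delete_transversal:
  assumes "y \<in> V" "transv V y (nb V y) \<tau>" "J \<subseteq> nb V y"
  shows "y \<in> V - cl (\<tau> ` J)" "nb (V - cl (\<tau> ` J)) y = nb V y - J" "indep (\<tau> ` J)" "\<tau> ` J \<subseteq> V"
    "\<And>u. u \<in> nb V y - J \<Longrightarrow> \<tau> u \<in> far (V - cl (\<tau> ` J)) y u"
proof -
  have t: "\<tau> u \<in> far V y u" "\<not> \<tau> u \<sim> \<tau> v" if "u \<in> nb V y" "v \<in> nb V y" for u v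
    using assms(2) that by (auto simp: transv_def)
  have ff: "\<not> y \<sim> \<tau> v" "\<not> u \<sim> \<tau> v" "\<tau> v \<noteq> u" "\<tau> v \<noteq> \<tau> u" "\<tau> v \<noteq> y" "v \<sim> \<tau> v" "\<tau> v \<in> V"
    if "v \<in> nb V y" "u \<in> nb V y" "u \<noteq> v" for u v
    using far_facts[of y v u "\<tau> v" V] t[of v v] t[of u u] that by (auto simp: far_iff)
  have ff1: "\<not> y \<sim> \<tau> v" "\<tau> v \<noteq> y" "v \<sim> \<tau> v" "\<tau> v \<in> V" if "v \<in> nb V y" for v
    using t[OF that that] no3[of y v "\<tau> v"] that by (auto simp: far_iff)
  show "indep (\<tau> ` J)" using t assms(3) unfolding indep_def by blast
  show "\<tau> ` J \<subseteq> V" using ff1 assms(3) by blast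
  show "y \<in> V - cl (\<tau> ` J)"
    using ff1 assms(1,3) sym unfolding cl_def by blast
  show "nb (V - cl (\<tau> ` J)) y = nb V y - J"
  proof (intro Set.set_eqI iffI)
    fix u assume "u \<in> nb (V - cl (\<tau> ` J)) y"
    then show "u \<in> nb V y - J" using ff1(3) assms(3) sym unfolding nb_def cl_def by blast
  next
    fix u assume u: "u \<in> nb V y - J"
    have "u \<notin> cl (\<tau> ` J)"
    proof
      assume "u \<in> cl (\<tau> ` J)"
      then obtain v where "v \<in> J" "\<tau> v = u \<or> \<tau> v \<sim> u" by (auto simp: cl_iff)
      moreover from this have "v \<in> nb V y" "u \<noteq> v" using u assms(3) by auto
      ultimately show False using ff(2,3)[of v u] u sym by blast
    qed
    then show "u \<in> nb (V - cl (\<tau> ` J)) y" using u by auto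
  qed
  fix u assume u: "u \<in> nb V y - J"
  have "\<tau> u \<notin> cl (\<tau> ` J)"
  proof
    assume "\<tau> u \<in> cl (\<tau> ` J)"
    then obtain v where "v \<in> J" "\<tau> v = \<tau> u \<or> \<tau> v \<sim> \<tau> u" by (auto simp: cl_iff)
    moreover from this have "v \<in> nb V y" "u \<noteq> v" using u assms(3) by auto
    ultimately show False using ff(4)[of v u] t(2)[of v u] u by blast
  qed
  then show "\<tau> u \<in> far (V - cl (\<tau> ` J)) y u" using t(1)[of u u] u by (auto simp: far_iff)
qed

lemma bad_degree_le_3:
  assumes "wc V" "hereditary V" "y \<in> V" "\<not> good V y"
  shows "card (nb V y) \<le> 3"
proof (rule ccontr)
  assume n: "\<not> card (nb V y) \<le> 3"
  obtain \<tau> where \<tau>: "transv V y (nb V y) \<tau>" using not_good_transv[OF assms(1,3,4)] .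
  have fin: "finite (nb V y)" using wc_finite[OF assms(1)] by (auto simp: nb_def)
  \<comment> \<open>Exactly three neighbours are to remain, the degree at which goodness excludes a
    transversal.\<close>
  obtain J where J: "J \<subseteq> nb V y" "card J = card (nb V y) - 3"
    by (metis diff_le_self obtain_subset_with_card_n)
  have Jne: "J \<noteq> {}" using J n by auto
  note d = delete_transversal[OF assms(3) \<tau> J(1)]
  let ?W = "V - cl (\<tau> ` J)"
  have "good ?W y \<or> nb ?W y = {}"
    using assms(2) d(1,3,4) Jne unfolding hereditary_def by blast
  moreover have c: "card (nb ?W y) = 3"
    using d(2) J n fin by (simp add: card_Diff_subset finite_subset)
  ultimately have "good ?W y" by auto
  moreover have "transv ?W y (nb ?W y) \<tau>"
    using d(2,5) \<tau> by (auto simp: transv_def)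
  ultimately show False using good_no_transv c by blast
qed

text \<open>Deleting the vertex behind \<open>k\<close> leaves \<open>x\<close> with two neighbours
  and good, hence on a basic 5-cycle \<open>x i p q j\<close>. The implications locate its thin
  vertices: if \<open>q\<close> differs from \<open>\<tau> j\<close>, then \<open>j\<close> keeps a
  third neighbour, so \<open>q\<close> is thin after the deletion.\<close>

lemma cubic_edge:
  assumes "wc V" "hereditary V" "x \<in> V" "nb V x = {i, j, k}" "i \<noteq> j" "i \<noteq> k" "j \<noteq> k"
    and \<tau>: "transv V x (nb V x) \<tau>"
  shows "\<exists>p q. p \<in> far V x i \<and> q \<in> far V x j \<and> p \<sim> q \<and> \<not> \<tau> k \<sim> p \<and> \<not> \<tau> k \<sim> q \<and>
    (q \<noteq> \<tau> j \<longrightarrow> (\<forall>z\<in>V. q \<sim> z \<longrightarrow> z = p \<or> z = j \<or> \<tau> k \<sim> z \<or> z = \<tau> k)) \<and>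
    (p \<noteq> \<tau> i \<longrightarrow> (\<forall>z\<in>V. p \<sim> z \<longrightarrow> z = q \<or> z = i \<or> \<tau> k \<sim> z \<or> z = \<tau> k))"
proof -
  have k: "{k} \<subseteq> nb V x" using assms(4) by simp
  note d = delete_transversal[OF assms(3) \<tau> k]
  let ?W = "V - cl {\<tau> k}"
  have nbW: "nb ?W x = {i, j}" using d(2) assms(4-7) by auto
  have tW: "\<tau> u \<in> far ?W x u" if "u \<in> {i, j}" for u
    using d(5)[of u] that assms(4-7) by auto
  have "good ?W x \<or> nb ?W x = {}"
    using assms(2) d(1,3,4) unfolding hereditary_def by simp
  then have "good ?W x" using nbW by auto
  moreover have "nb ?W x \<noteq> {u}" for u using nbW assms(5) by auto
  moreover have "nb ?W u \<noteq> {x}" if "u \<in> ?W" for u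
  proof
    assume u: "nb ?W u = {x}"
    then have "u \<in> nb ?W x" using sym that by (auto simp: set_eq_iff)
    then have "\<tau> u \<in> far ?W x u" using nbW tW by blast
    then show False using u by (auto simp: far_def)
  qed
  ultimately obtain b c e f where 1: "basic5 ?W x b c e f" unfolding good_def by blast
  note a1 = basic5_adj[OF 1]
  have "b \<in> nb ?W x" "f \<in> nb ?W x" using a1(1,5,7,10) sym by auto
  moreover have "b \<noteq> f" using c5_facts(6)[OF a1(1-5)] by auto
  ultimately have "b = i \<and> f = j \<or> b = j \<and> f = i" using nbW by auto
  then obtain p q where b: "basic5 ?W x i p q j"
    using 1 basic5_reflect[OF 1] by blast
  note a = basic5_adj[OF b]
  note f = c5_facts(6)[OF a(1-5)]
  have cW: "z = c \<or> z = c' \<or> \<tau> k \<sim> z \<or> z = \<tau> k" if "thin ?W c w c'" "z \<in> V" "w \<sim> z" for c w c' z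
    using that by (auto simp: thin_def set_eq_iff cl_iff)
  have tj: "\<tau> j \<in> nb ?W j" "\<tau> j \<noteq> x" "\<tau> i \<in> nb ?W i" "\<tau> i \<noteq> x"
    using tW[of j] tW[of i] by (simp_all add: far_def)
  show ?thesis
  proof (intro exI conjI impI)
    show "p \<in> far V x i" "q \<in> far V x j" "p \<sim> q" using a f sym by (auto simp: far_iff)
    show "\<not> \<tau> k \<sim> p" "\<not> \<tau> k \<sim> q" using a by (auto simp: cl_iff)
    assume "q \<noteq> \<tau> j"
    then have "\<not> thin ?W q j x" using tj(1,2) unfolding thin_def by (metis insertE singletonD)
    then have "thin ?W p q j" using b by (auto simp: basic5_def)
    then show "\<forall>z\<in>V. q \<sim> z \<longrightarrow> z = p \<or> z = j \<or> \<tau> k \<sim> z \<or> z = \<tau> k" using cW by blast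
  next
    assume "p \<noteq> \<tau> i"
    then have "\<not> thin ?W x i p" using tj(3,4) unfolding thin_def by (metis insertE singletonD)
    then have "thin ?W i p q" using b by (auto simp: basic5_def)
    then show "\<forall>z\<in>V. p \<sim> z \<longrightarrow> z = q \<or> z = i \<or> \<tau> k \<sim> z \<or> z = \<tau> k" using cW by blast
  qed
qed

lemma third_neighbour:
  assumes "card (nb V t) = 3" "{a, b} \<subseteq> nb V t" "a \<noteq> b"
  obtains e where "nb V t = {a, b, e}" "e \<noteq> a" "e \<noteq> b"
proof -
  have "card (nb V t - {a, b}) = 1" using assms by (simp add: card_Diff_subset)
  then obtain e where "nb V t - {a, b} = {e}" by (auto simp: card_1_singleton_iff)
  then show thesis using that[of e] assms(2) by blast
qed

lemma far_card:
  assumes "x \<in> V" "u \<in> nb V x" "finite V"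
  shows "card (nb V u) = Suc (card (far V x u))"
proof -
  have "x \<in> nb V u" using assms sym by auto
  moreover have "finite (nb V u)" using assms by (simp add: nb_def)
  ultimately show ?thesis unfolding far_def by (metis card_Suc_Diff1)
qed

text \<open>If only \<open>\<tau> i\<close> were behind \<open>i\<close>, the 5-cycles through
  \<open>i, j\<close> and through \<open>i, k\<close> would both use it. The one through
  \<open>j, k\<close> avoids its neighbours and would have to use the non-adjacent
  \<open>\<tau> j\<close> and \<open>\<tau> k\<close>.\<close>

lemma cubic_far:
  assumes "wc V" "hereditary V" "x \<in> V" "nb V x = {i, j, k}" "i \<noteq> j" "i \<noteq> k" "j \<noteq> k"
    and deg: "\<forall>z\<in>V. card (nb V z) \<le> 3" and \<tau>: "transv V x (nb V x) \<tau>"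
  obtains r where "far V x i = {\<tau> i, r}" "r \<noteq> \<tau> i"
proof -
  have fin: "finite V" using wc_finite[OF assms(1)] .
  have x: "u \<in> nb V x" "u \<in> V" if "u \<in> {i, j, k}" for u using that assms(4) by auto
  have c2: "card (far V x u) \<le> 2" if "u \<in> {i, j, k}" for u
    using far_card[OF assms(3) x(1)[OF that] fin] deg x(2)[OF that] by fastforce
  have finf: "finite (far V x u)" for u using fin by (auto simp: far_def nb_def)
  have t: "\<tau> u \<in> far V x u" "\<not> \<tau> u \<sim> \<tau> v" if "u \<in> {i, j, k}" "v \<in> {i, j, k}" for u v
    using \<tau> that assms(4) by (auto simp: transv_def)
  have two: "far V x u = {\<tau> u, q}" if "u \<in> {i, j, k}" "q \<in> far V x u" "q \<noteq> \<tau> u" for u q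
    by (rule card_seteq[symmetric, OF finf]) (use that t[of u u] c2[of u] in auto)
  have "\<exists>r\<in>far V x i. r \<noteq> \<tau> i"
  proof (rule ccontr)
    assume "\<not> ?thesis"
    then have one: "p = \<tau> i" if "p \<in> far V x i" for p using that by blast
    have nb': "nb V x = {i, k, j}" "nb V x = {j, k, i}" using assms(4) by auto
    obtain p q where pq: "p \<in> far V x i" "q \<in> far V x j" "p \<sim> q"
      using cubic_edge[OF assms(1-7) \<tau>] by metis
    obtain p' q' where pq': "p' \<in> far V x i" "q' \<in> far V x k" "p' \<sim> q'"
      using cubic_edge[OF assms(1-3) nb'(1) assms(6,5) assms(7)[symmetric] \<tau>] by metis
    obtain p2 q2 where pq2: "p2 \<in> far V x j" "q2 \<in> far V x k" "p2 \<sim> q2" "\<not> \<tau> i \<sim> p2" "\<not> \<tau> i \<sim> q2"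
      using cubic_edge[OF assms(1-3) nb'(2) assms(7) assms(5,6)[symmetric] \<tau>] by metis
    have "\<tau> i \<sim> q" "\<tau> i \<sim> q'" using one pq pq' by metis+
    then have "q \<noteq> \<tau> j" "q' \<noteq> \<tau> k" "p2 \<noteq> q" "q2 \<noteq> q'" using t pq2 by auto
    then have "p2 = \<tau> j" "q2 = \<tau> k"
      using two[of j q] two[of k q'] pq(2) pq'(2) pq2(1,2) by auto
    then show False using pq2(3) t by blast
  qed
  then show thesis using that two by blast
qed

lemma cubic_neighbours:
  assumes "wc V" "hereditary V" "\<forall>z\<in>V. \<not> good V z" "x \<in> V" "card (nb V x) = 3" "u \<in> nb V x"
  shows "card (nb V u) = 3"
proof -
  have "card (nb V x - {u}) = 2" using assms(5,6) by simp
  then obtain j k where "nb V x - {u} = {j, k}" "j \<noteq> k" by (meson card_2_iff)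
  then have jk: "nb V x = {u, j, k}" "u \<noteq> j" "u \<noteq> k" "j \<noteq> k" using assms(6) by blast+
  obtain \<tau> where \<tau>: "transv V x (nb V x) \<tau>" using not_good_transv assms(1,3,4) by blast
  have deg: "\<forall>z\<in>V. card (nb V z) \<le> 3" using bad_degree_le_3 assms(1-3) by blast
  obtain r where "far V x u = {\<tau> u, r}" "r \<noteq> \<tau> u"
    using cubic_far[OF assms(1,2,4) jk deg \<tau>] by blast
  then show ?thesis using far_card[OF assms(4,6) wc_finite[OF assms(1)]] by simp
qed

lemma cubic_pairs:
  assumes "wc V" "hereditary V" "\<forall>z\<in>V. \<not> good V z" "x \<in> V" "card (nb V x) = 3"
    "u \<in> nb V x" "v \<in> nb V x" "u \<noteq> v"
  shows "\<exists>p\<in>far V x u. \<exists>q\<in>far V x v. p \<sim> q"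
proof -
  obtain k where k: "nb V x = {u, v, k}" "u \<noteq> k" "v \<noteq> k"
    using third_neighbour[OF assms(5) _ assms(8)] assms(6,7) by (metis empty_subsetI insert_subset)
  obtain \<tau> where \<tau>: "transv V x (nb V x) \<tau>" using not_good_transv assms(1,3,4) by blast
  show ?thesis using cubic_edge[OF assms(1,2,4) k(1) assms(8) k(2,3) \<tau>] by metis
qed

text \<open>The \<open>t\<close>s come from a transversal, the \<open>r\<close>s are the remaining
  vertices behind \<open>v1\<close>, \<open>v2\<close>, \<open>v3\<close>, and the three 5-cycles
  through \<open>x\<close> are arranged cyclically. The last three clauses are the thinness
  statements of \<open>cubic_edge\<close>.\<close>

definition cubic_config where
  "cubic_config V x v1 v2 v3 t1 t2 t3 r1 r2 r3 \<longleftrightarrow> nb V x = {v1, v2, v3} \<and> distinct [v1, v2, v3] \<and>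
    nb V v1 = {x, t1, r1} \<and> nb V v2 = {x, t2, r2} \<and> nb V v3 = {x, t3, r3} \<and>
    distinct [x, t1, r1] \<and> distinct [x, t2, r2] \<and> distinct [x, t3, r3] \<and>
    t1 \<sim> r2 \<and> t2 \<sim> r3 \<and> t3 \<sim> r1 \<and> \<not> t1 \<sim> t2 \<and> \<not> t2 \<sim> t3 \<and> \<not> t3 \<sim> t1 \<and>
    \<not> r2 \<sim> t3 \<and> \<not> r3 \<sim> t1 \<and> \<not> r1 \<sim> t2 \<and>
    (\<forall>z\<in>V. r2 \<sim> z \<longrightarrow> z = t1 \<or> z = v2 \<or> t3 \<sim> z) \<and>
    (\<forall>z\<in>V. r3 \<sim> z \<longrightarrow> z = t2 \<or> z = v3 \<or> t1 \<sim> z) \<and>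
    (\<forall>z\<in>V. r1 \<sim> z \<longrightarrow> z = t3 \<or> z = v1 \<or> t2 \<sim> z)"

lemma cubic_structure:
  assumes "wc V" "hereditary V" "\<forall>z\<in>V. \<not> good V z" "x \<in> V" "card (nb V x) = 3"
  shows "\<exists>v1 v2 v3 t1 t2 t3 r1 r2 r3. cubic_config V x v1 v2 v3 t1 t2 t3 r1 r2 r3"
proof -
  obtain u1 u2 u3 where u: "nb V x = {u1, u2, u3}" "u1 \<noteq> u2" "u1 \<noteq> u3" "u2 \<noteq> u3"
    using assms(5) by (metis card_3_iff)
  have u': "nb V x = {u1, u3, u2}" "nb V x = {u2, u3, u1}" "nb V x = {u2, u1, u3}" "nb V x = {u3, u1, u2}"
    using u(1) by auto
  obtain \<tau> where \<tau>: "transv V x (nb V x) \<tau>" using not_good_transv assms(1,3,4) by blast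
  have deg: "\<forall>z\<in>V. card (nb V z) \<le> 3" using bad_degree_le_3 assms(1-3) by blast
  define t1 t2 t3 where t: "t1 = \<tau> u1" "t2 = \<tau> u2" "t3 = \<tau> u3"
  obtain r1 where r1: "far V x u1 = {t1, r1}" "r1 \<noteq> t1"
    using cubic_far[OF assms(1,2,4) u deg \<tau>] t by blast
  obtain r2 where r2: "far V x u2 = {t2, r2}" "r2 \<noteq> t2"
    using cubic_far[OF assms(1,2,4) u'(3) u(2)[symmetric] u(4,3) deg \<tau>] t by blast
  obtain r3 where r3: "far V x u3 = {t3, r3}" "r3 \<noteq> t3"
    using cubic_far[OF assms(1,2,4) u'(4) u(3,4)[symmetric] u(2) deg \<tau>] t by blast
  have tt: "\<not> t1 \<sim> t2" "\<not> t2 \<sim> t3" "\<not> t3 \<sim> t1" "\<not> t2 \<sim> t1" "\<not> t3 \<sim> t2" "\<not> t1 \<sim> t3"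
    using \<tau> u(1) t by (auto simp: transv_def)
  have y: "x \<sim> u1" "x \<sim> u2" "x \<sim> u3" "u1 \<in> V" "u2 \<in> V" "u3 \<in> V" using u(1) by (auto simp: set_eq_iff)
  have nbu: "nb V u1 = {x, t1, r1}" "nb V u2 = {x, t2, r2}" "nb V u3 = {x, t3, r3}"
    "x \<noteq> t1" "x \<noteq> r1" "x \<noteq> t2" "x \<noteq> r2" "x \<noteq> t3" "x \<noteq> r3"
    using r1(1) r2(1) r3(1) y assms(4) sym by (auto simp: far_def)
  define thn where "thn q p j k \<longleftrightarrow> (\<forall>z\<in>V. q \<sim> z \<longrightarrow> z = p \<or> z = j \<or> k \<sim> z)" for q p j k
  have step: "(ti \<sim> rj \<and> \<not> tk \<sim> rj \<and> thn rj ti j tk) \<or> (tj \<sim> ri \<and> \<not> tk \<sim> ri \<and> thn ri tj i tk) \<or>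
      (ri \<sim> rj \<and> \<not> tk \<sim> ri \<and> \<not> tk \<sim> rj)"
    if ijk: "nb V x = {i, j, k}" "i \<noteq> j" "i \<noteq> k" "j \<noteq> k" "far V x i = {ti, ri}" "far V x j = {tj, rj}"
      "ti = \<tau> i" "tj = \<tau> j" "tk = \<tau> k" "ri \<noteq> ti" "rj \<noteq> tj" "\<not> ti \<sim> tj" for i j k ti tj tk ri rj
  proof -
    obtain p q where pq: "p \<in> far V x i" "q \<in> far V x j" "p \<sim> q" "\<not> \<tau> k \<sim> p" "\<not> \<tau> k \<sim> q"
      "q \<noteq> \<tau> j \<longrightarrow> (\<forall>z\<in>V. q \<sim> z \<longrightarrow> z = p \<or> z = j \<or> \<tau> k \<sim> z \<or> z = \<tau> k)"
      "p \<noteq> \<tau> i \<longrightarrow> (\<forall>z\<in>V. p \<sim> z \<longrightarrow> z = q \<or> z = i \<or> \<tau> k \<sim> z \<or> z = \<tau> k)"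
      using cubic_edge[OF assms(1,2,4) ijk(1-4) \<tau>] by blast
    have "\<not> p \<sim> \<tau> k" "\<not> q \<sim> \<tau> k" using pq(4,5) sym by blast+
    then have th: "q \<noteq> \<tau> j \<Longrightarrow> thn q p j (\<tau> k)" "p \<noteq> \<tau> i \<Longrightarrow> thn p q i (\<tau> k)"
      using pq(6,7) unfolding thn_def by metis+
    have "p = ti \<or> p = ri" "q = tj \<or> q = rj" using pq(1,2) ijk(5,6) by auto
    then show ?thesis using pq(3-5) th ijk(7-12) sym by metis
  qed
  have s12: "(t1 \<sim> r2 \<and> \<not> t3 \<sim> r2 \<and> thn r2 t1 u2 t3) \<or> (t2 \<sim> r1 \<and> \<not> t3 \<sim> r1 \<and> thn r1 t2 u1 t3) \<or>
      (r1 \<sim> r2 \<and> \<not> t3 \<sim> r1 \<and> \<not> t3 \<sim> r2)"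
    using step[OF u r1(1) r2(1) t(1,2,3) r1(2) r2(2) tt(1)] .
  have s13: "(t1 \<sim> r3 \<and> \<not> t2 \<sim> r3 \<and> thn r3 t1 u3 t2) \<or> (t3 \<sim> r1 \<and> \<not> t2 \<sim> r1 \<and> thn r1 t3 u1 t2) \<or>
      (r1 \<sim> r3 \<and> \<not> t2 \<sim> r1 \<and> \<not> t2 \<sim> r3)"
    using step[OF u'(1) u(3,2) u(4)[symmetric] r1(1) r3(1) t(1,3,2) r1(2) r3(2) tt(6)] .
  have s23: "(t2 \<sim> r3 \<and> \<not> t1 \<sim> r3 \<and> thn r3 t2 u3 t1) \<or> (t3 \<sim> r2 \<and> \<not> t1 \<sim> r2 \<and> thn r2 t3 u2 t1) \<or>
      (r2 \<sim> r3 \<and> \<not> t1 \<sim> r2 \<and> \<not> t1 \<sim> r3)"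
    using step[OF u'(2) u(4) u(2,3)[symmetric] r2(1) r3(1) t(2,3,1) r2(2) r3(2) tt(2)] .
  have tri: "\<not> (r1 \<sim> r2 \<and> r2 \<sim> r3 \<and> r1 \<sim> r3)" using no3 by blast
  \<comment> \<open>Each pair of neighbours of \<open>x\<close> offers a
    \<open>t\<close>-\<open>r\<close> edge in one of two directions or an
    \<open>r\<close>-\<open>r\<close> edge. The non-adjacencies and the absence of triangles leave
    only the two cyclic arrangements.\<close>
  have "(t1 \<sim> r2 \<and> t2 \<sim> r3 \<and> t3 \<sim> r1 \<and> \<not> t3 \<sim> r2 \<and> \<not> t1 \<sim> r3 \<and> \<not> t2 \<sim> r1 \<and>
      thn r2 t1 u2 t3 \<and> thn r3 t2 u3 t1 \<and> thn r1 t3 u1 t2) \<or>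
    (t1 \<sim> r3 \<and> t3 \<sim> r2 \<and> t2 \<sim> r1 \<and> \<not> t2 \<sim> r3 \<and> \<not> t1 \<sim> r2 \<and> \<not> t3 \<sim> r1 \<and>
      thn r3 t1 u3 t2 \<and> thn r2 t3 u2 t1 \<and> thn r1 t2 u1 t3)"
    using s12 s13 s23 tri by argo
  then show ?thesis
  proof
    assume a: "t1 \<sim> r2 \<and> t2 \<sim> r3 \<and> t3 \<sim> r1 \<and> \<not> t3 \<sim> r2 \<and> \<not> t1 \<sim> r3 \<and> \<not> t2 \<sim> r1 \<and>
      thn r2 t1 u2 t3 \<and> thn r3 t2 u3 t1 \<and> thn r1 t3 u1 t2"
    have "cubic_config V x u1 u2 u3 t1 t2 t3 r1 r2 r3"
      unfolding cubic_config_def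
      using a u nbu tt r1(2) r2(2) r3(2) comm[of r2 t3] comm[of r3 t1] comm[of r1 t2]
      by (simp add: thn_def)
    then show ?thesis by blast
  next
    assume a: "t1 \<sim> r3 \<and> t3 \<sim> r2 \<and> t2 \<sim> r1 \<and> \<not> t2 \<sim> r3 \<and> \<not> t1 \<sim> r2 \<and> \<not> t3 \<sim> r1 \<and>
      thn r3 t1 u3 t2 \<and> thn r2 t3 u2 t1 \<and> thn r1 t2 u1 t3"
    have "cubic_config V x u1 u3 u2 t1 t3 t2 r1 r3 r2"
      unfolding cubic_config_def
      using a u' u(2-4) nbu tt r1(2) r2(2) r3(2) comm[of r3 t2] comm[of r2 t1] comm[of r1 t3]
      by (simp add: thn_def)
    then show ?thesis by blast
  qed
qed

text \<open>By \<open>cubic_pairs\<close> at \<open>v1\<close> some vertex behind \<open>t1\<close>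
  is adjacent to one behind \<open>r1\<close>; all candidates but \<open>e1\<close> and
  \<open>e2\<close> are excluded.\<close>

lemma cubic_chord:
  assumes "wc V" "hereditary V" "\<forall>z\<in>V. \<not> good V z" "v1 \<in> V" "nb V v1 = {x, t1, r1}" "distinct [x, t1, r1]"
    and t1: "nb V t1 = {v1, r2, e1}" "e1 \<noteq> v1" and r1: "nb V r1 = {v1, t3, e2}" "e2 \<noteq> v1"
    and t3: "nb V t3 = {v3, r1, e3}" and r2: "nb V r2 = {t1, v2, e3}"
    and n: "t1 \<noteq> e2" "v2 \<noteq> e2" "v3 \<noteq> e1" "\<not> r2 \<sim> t3" "e2 \<noteq> r2" "e1 \<noteq> t3" "e2 \<noteq> e3" "e1 \<noteq> e3"
  shows "e1 \<sim> e2"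
proof -
  have "card (nb V v1) = 3" using assms(5,6) by simp
  then obtain p q where pq: "p \<in> far V v1 t1" "q \<in> far V v1 r1" "p \<sim> q"
    using cubic_pairs[OF assms(1-4), of t1 r1] assms(5,6) by auto
  then have "p \<in> {r2, e1}" "q \<in> {t3, e2}" using t1 r1 by (auto simp: far_def)
  moreover have "\<not> r2 \<sim> e2"
  proof
    assume "r2 \<sim> e2"
    then have "e2 \<in> nb V r2" using r1 by (auto simp: set_eq_iff)
    then show False using r2 n by auto
  qed
  moreover have "\<not> e1 \<sim> t3"
  proof
    assume "e1 \<sim> t3"
    then have "e1 \<in> nb V t3" using t1 sym by (auto simp: set_eq_iff)
    then have "e1 = r1" using t3 n by auto
    then have "t1 \<sim> r1" using t1 by (auto simp: set_eq_iff)
    moreover have "v1 \<sim> t1" "v1 \<sim> r1" using assms(5) by (auto simp: set_eq_iff)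
    ultimately show False using no_common by blast
  qed
  ultimately show ?thesis using pq(3) n(4) by auto
qed

text \<open>All neighbours of cubic vertices are cubic. The thinness clauses place the third
  neighbour of each \<open>r\<close> next to a \<open>t\<close>, so only three new vertices
  \<open>e1\<close>, \<open>e2\<close>, \<open>e3\<close> arise, and \<open>cubic_chord\<close> at
  the three neighbours of \<open>x\<close> makes them a triangle.\<close>

lemma no_cubic:
  assumes "wc V" "hereditary V" "\<forall>z\<in>V. \<not> good V z" "x \<in> V" "card (nb V x) = 3"
  shows False
proof -
  obtain v1 v2 v3 t1 t2 t3 r1 r2 r3 where cc: "cubic_config V x v1 v2 v3 t1 t2 t3 r1 r2 r3"
    using cubic_structure[OF assms] by blast
  note c = cc[unfolded cubic_config_def]
  have v: "v1 \<in> nb V x" "v2 \<in> nb V x" "v3 \<in> nb V x" "v1 \<in> V" "v2 \<in> V" "v3 \<in> V" "x \<sim> v1" "x \<sim> v2" "x \<sim> v3"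
    using c by (auto simp: set_eq_iff)
  have n: "t1 \<in> nb V v1" "r1 \<in> nb V v1" "t2 \<in> nb V v2" "r2 \<in> nb V v2" "t3 \<in> nb V v3" "r3 \<in> nb V v3" using c by auto
  then have vt: "v1 \<sim> t1" "v1 \<sim> r1" "v2 \<sim> t2" "v2 \<sim> r2" "v3 \<sim> t3" "v3 \<sim> r3"
    and V: "t1 \<in> V" "r1 \<in> V" "t2 \<in> V" "r2 \<in> V" "t3 \<in> V" "r3 \<in> V" by auto
  have d: "card (nb V v1) = 3" "card (nb V v2) = 3" "card (nb V v3) = 3" using c by simp_all
  have dt: "card (nb V t1) = 3" "card (nb V r1) = 3" "card (nb V t2) = 3" "card (nb V r2) = 3"
    "card (nb V t3) = 3" "card (nb V r3) = 3"
    using cubic_neighbours[OF assms(1-3)] d v n by blast+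
  have far: "t1 \<in> far V x v1" "r1 \<in> far V x v1" "t2 \<in> far V x v2" "r2 \<in> far V x v2" "t3 \<in> far V x v3" "r3 \<in> far V x v3"
    using c n by (auto simp: far_def)
  have ne: "v1 \<noteq> v2" "v1 \<noteq> v3" "v2 \<noteq> v3" using c by auto
  note f12 = far_facts[OF v(7,8) ne(1) far(1)] far_facts[OF v(7,8) ne(1) far(2)]
  note f13 = far_facts[OF v(7,9) ne(2) far(1)] far_facts[OF v(7,9) ne(2) far(2)]
  note f21 = far_facts[OF v(8,7) ne(1)[symmetric] far(3)] far_facts[OF v(8,7) ne(1)[symmetric] far(4)]
  note f23 = far_facts[OF v(8,9) ne(3) far(3)] far_facts[OF v(8,9) ne(3) far(4)]
  note f31 = far_facts[OF v(9,7) ne(2)[symmetric] far(5)] far_facts[OF v(9,7) ne(2)[symmetric] far(6)]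
  note f32 = far_facts[OF v(9,8) ne(3)[symmetric] far(5)] far_facts[OF v(9,8) ne(3)[symmetric] far(6)]
  have cyc: "t1 \<sim> r2" "t2 \<sim> r3" "t3 \<sim> r1" using c by auto
  obtain e1 where e1: "nb V t1 = {v1, r2, e1}" "e1 \<noteq> v1" "e1 \<noteq> r2"
    by (rule third_neighbour[OF dt(1), of v1 r2]) (use V v(4) sym[OF vt(1)] cyc(1) f21(8) in auto)
  obtain e2 where e2: "nb V t2 = {v2, r3, e2}" "e2 \<noteq> v2" "e2 \<noteq> r3"
    by (rule third_neighbour[OF dt(3), of v2 r3]) (use V v(5) sym[OF vt(3)] cyc(2) f32(8) in auto)
  obtain e3 where e3: "nb V t3 = {v3, r1, e3}" "e3 \<noteq> v3" "e3 \<noteq> r1"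
    by (rule third_neighbour[OF dt(5), of v3 r1]) (use V v(6) sym[OF vt(5)] cyc(3) f13(8) in auto)
  have e: "t1 \<sim> e1" "t2 \<sim> e2" "t3 \<sim> e3" "e1 \<in> V" "e2 \<in> V" "e3 \<in> V" using e1 e2 e3 by (auto simp: set_eq_iff)
  have rr: "\<not> r2 \<sim> r1" "\<not> r3 \<sim> r2" "\<not> r1 \<sim> r3"
  proof -
    have "t1 \<noteq> r1" "t2 \<noteq> r2" "t3 \<noteq> r3" using c by auto
    then show "\<not> r2 \<sim> r1" "\<not> r3 \<sim> r2" "\<not> r1 \<sim> r3"
      using no4[OF sym[OF cyc(1)] _ vt(1,2) f21(8)] no4[OF sym[OF cyc(2)] _ vt(3,4) f32(8)]
        no4[OF sym[OF cyc(3)] _ vt(5,6) f13(8)] by blast+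
  qed
  obtain z2 where z2: "nb V r2 = {t1, v2, z2}" "z2 \<noteq> t1" "z2 \<noteq> v2"
    by (rule third_neighbour[OF dt(4), of t1 v2]) (use V v(5) sym[OF vt(4)] sym[OF cyc(1)] f12(3) in auto)
  obtain z3 where z3: "nb V r3 = {t2, v3, z3}" "z3 \<noteq> t2" "z3 \<noteq> v3"
    by (rule third_neighbour[OF dt(6), of t2 v3]) (use V v(6) sym[OF vt(6)] sym[OF cyc(2)] f23(3) in auto)
  obtain z1 where z1: "nb V r1 = {t3, v1, z1}" "z1 \<noteq> t3" "z1 \<noteq> v1"
    by (rule third_neighbour[OF dt(2), of t3 v1]) (use V v(4) sym[OF vt(2)] sym[OF cyc(3)] f31(3) in auto)
  have z: "r1 \<sim> z1" "r2 \<sim> z2" "r3 \<sim> z3" "z1 \<in> V" "z2 \<in> V" "z3 \<in> V" using z1 z2 z3 by (auto simp: set_eq_iff)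
  have "t3 \<sim> z2" "t1 \<sim> z3" "t2 \<sim> z1" using c z z1 z2 z3 by blast+
  then have "z2 \<in> nb V t3" "z3 \<in> nb V t1" "z1 \<in> nb V t2" using z by auto
  moreover have "z2 \<noteq> v3" "z3 \<noteq> v1" "z1 \<noteq> v2" using z f23 f31 f12 sym by blast+
  moreover have "z2 \<noteq> r1" "z3 \<noteq> r2" "z1 \<noteq> r3" using z rr by blast+
  ultimately have ze: "z2 = e3" "z3 = e1" "z1 = e2" using e1(1) e2(1) e3(1) by auto
  have dist: "e2 \<noteq> e3" "e3 \<noteq> e1" "e1 \<noteq> e2"
    using no3[of t3 r1 e2] no3[of t1 r2 e3] no3[of t2 r3 e1] cyc z ze e by auto
  have nbr: "nb V r1 = {v1, t3, e2}" "nb V r2 = {v2, t1, e3}" "nb V r3 = {v3, t2, e1}"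
    "nb V r2 = {t1, v2, e3}" "nb V r3 = {t2, v3, e1}" "nb V r1 = {t3, v1, e2}"
    using z1(1) z2(1) z3(1) ze by auto
  have xe: "e1 \<noteq> v2" "e1 \<noteq> v3" "e2 \<noteq> v1" "e2 \<noteq> v3" "e3 \<noteq> v1" "e3 \<noteq> v2"
    using e(1-3) f12(2) f13(2) f21(2) f23(2) f31(2) f32(2) sym by blast+
  have te: "t1 \<noteq> e2" "t2 \<noteq> e3" "t3 \<noteq> e1" "e2 \<noteq> r2" "e3 \<noteq> r3" "e1 \<noteq> r1"
  proof -
    have nt: "\<not> t1 \<sim> t2" "\<not> t2 \<sim> t3" "\<not> t3 \<sim> t1" using c by auto
    show "t1 \<noteq> e2" "t2 \<noteq> e3" "t3 \<noteq> e1" using e(1-3) nt sym by blast+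
    show "e2 \<noteq> r2" "e3 \<noteq> r3" "e1 \<noteq> r1" using z(1-3) ze rr sym by blast+
  qed
  have cn: "nb V v1 = {x, t1, r1}" "nb V v2 = {x, t2, r2}" "nb V v3 = {x, t3, r3}"
    "distinct [x, t1, r1]" "distinct [x, t2, r2]" "distinct [x, t3, r3]"
    "\<not> r2 \<sim> t3" "\<not> r3 \<sim> t1" "\<not> r1 \<sim> t2" "t1 \<noteq> e2" "e1 \<noteq> e3" "e2 \<noteq> e1" "e3 \<noteq> e2"
    "v2 \<noteq> e1" "v3 \<noteq> e1" "v1 \<noteq> e2" "v3 \<noteq> e2" "v1 \<noteq> e3" "v2 \<noteq> e3"
    using c te dist xe by simp_all
  have "e1 \<sim> e2"
    by (rule cubic_chord[OF assms(1-3) v(4) _ _ e1(1,2) nbr(1) _ e3(1) nbr(4)]) (use cn xe te dist e1(2) e2(2) e3(2) in auto)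
  moreover have "e2 \<sim> e3"
    by (rule cubic_chord[OF assms(1-3) v(5) _ _ e2(1,2) nbr(2) _ e1(1) nbr(5)]) (use cn xe te dist e1(2) e2(2) e3(2) in auto)
  moreover have "e3 \<sim> e1"
    by (rule cubic_chord[OF assms(1-3) v(6) _ _ e3(1,2) nbr(3) _ e2(1) nbr(6)]) (use cn xe te dist e1(2) e2(2) e3(2) in auto)
  ultimately show False using no3 sym by blast
qed

definition seven_cycle :: "'v set \<Rightarrow> 'v list \<Rightarrow> bool" where
  "seven_cycle V vs \<longleftrightarrow> (\<exists>x u1 a1 s1 s2 a2 u2. vs = [x, u1, a1, s1, s2, a2, u2] \<and> distinct vs \<and> set vs \<subseteq> V \<and>
     nb V x = {u2, u1} \<and> nb V u1 = {x, a1} \<and> nb V a1 = {u1, s1} \<and> nb V s1 = {a1, s2} \<and>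
     nb V s2 = {s1, a2} \<and> nb V a2 = {s2, u2} \<and> nb V u2 = {a2, x})"

text \<open>The cycle is followed from \<open>x\<close> in both directions. Closing at length five
  gives a basic 5-cycle; length six and non-adjacent ends \<open>s1\<close>, \<open>s2\<close> are
  refuted because \<open>x\<close> could replace \<open>u1\<close> and \<open>u2\<close>.\<close>

lemma two_regular:
  assumes "wc V" "\<forall>z\<in>V. \<not> good V z" "\<forall>z\<in>V. card (nb V z) = 2" "x \<in> V"
  obtains vs where "seven_cycle V vs"
proof -
  have other: "\<exists>w. nb V z = {y, w} \<and> w \<noteq> y \<and> w \<in> V \<and> z \<sim> w" if zy: "z \<in> V" "y \<in> V" "z \<sim> y" for z y
  proof -
    have "card (nb V z) = 2" "y \<in> nb V z" using assms(3) zy by auto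
    then obtain w where "nb V z = {y, w}" "w \<noteq> y" by (metis card_2_iff insertE insert_commute singletonD)
    then show ?thesis by (auto simp: set_eq_iff)
  qed
  obtain u1 u2 where x: "nb V x = {u1, u2}" "u1 \<noteq> u2" using assms(3,4) by (meson card_2_iff)
  then have u: "x \<sim> u1" "x \<sim> u2" "u1 \<in> V" "u2 \<in> V" by (auto simp: set_eq_iff)
  obtain a1 where a1: "nb V u1 = {x, a1}" "a1 \<noteq> x" "a1 \<in> V" "u1 \<sim> a1"
    using other[OF u(3) assms(4) sym[OF u(1)]] by blast
  obtain a2 where a2: "nb V u2 = {x, a2}" "a2 \<noteq> x" "a2 \<in> V" "u2 \<sim> a2"
    using other[OF u(4) assms(4) sym[OF u(2)]] by blast
  have f1: "a1 \<in> far V x u1" and f2: "a2 \<in> far V x u2" using a1 a2 by (auto simp: far_iff)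
  note ff = far_facts[OF u(1,2) x(2) f1] far_facts[OF u(2,1) x(2)[symmetric] f2]
  have na: "a1 \<noteq> a2" using ff f2 by blast
  obtain s1 where s1: "nb V a1 = {u1, s1}" "s1 \<noteq> u1" "s1 \<in> V" "a1 \<sim> s1"
    using other[OF a1(3) u(3) sym[OF a1(4)]] by blast
  obtain s2 where s2: "nb V a2 = {u2, s2}" "s2 \<noteq> u2" "s2 \<in> V" "a2 \<sim> s2"
    using other[OF a2(3) u(4) sym[OF a2(4)]] by blast
  have naa: "\<not> a1 \<sim> a2"
  proof
    assume a: "a1 \<sim> a2"
    then have "s1 = a2" "s2 = a1" using s1(1) s2(1) a1(3) a2(3) ff sym by (metis insertE nb_iff singletonD)+
    then have "basic5 V x u1 a1 a2 u2"
      using x a1 a2 s1 s2 u assms(4) a sym by (auto simp: basic5_def thin_def insert_commute)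
    then show False using assms(2,4) by (auto simp: good_def)
  qed
  have xs: "x \<noteq> s1" "x \<noteq> s2" "\<not> x \<sim> s1" "\<not> x \<sim> s2"
    using ff(1,6) sym[OF s1(4)] sym[OF s2(4)] no_chord[OF u(1) a1(4) s1(4) a1(2)[symmetric] s1(2)[symmetric]]
      no_chord[OF u(2) a2(4) s2(4) a2(2)[symmetric] s2(2)[symmetric]] by auto
  have us: "\<not> u1 \<sim> s1" "\<not> u2 \<sim> s2" "\<not> u1 \<sim> u2"
    using no_common[of a1 u1 s1] no_common[of a2 u2 s2] no_common[of x u1 u2] a1 a2 s1 s2 u sym by blast+
  have us2: "\<not> u1 \<sim> s2" "\<not> u2 \<sim> s1" "u1 \<noteq> s2" "u2 \<noteq> s1"
    using a1(1) a2(1) s1(3,4) s2(3,4) xs naa ff sym by (metis insertE nb_iff singletonD)+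
  have ss: "s1 \<noteq> s2"
  proof
    assume "s1 = s2"
    then show False
      by (intro exchange[OF assms(1), of "[s1, u1, u2]" "[s1, x]"])
        (use x u a1 a2 s1 s2 us us2 xs assms(4) in \<open>auto simp: cl_iff comm\<close>)
  qed
  have adj: "s1 \<sim> s2"
  proof (rule ccontr)
    assume "\<not> s1 \<sim> s2"
    then show False
      by (intro exchange[OF assms(1), of "[s1, s2, u1, u2]" "[s1, s2, x]"])
        (use x u a1 a2 s1 s2 us us2 xs ss assms(4) in \<open>auto simp: cl_iff comm\<close>)
  qed
  have "a1 \<noteq> s2" "a2 \<noteq> s1" using naa s1(4) s2(4) sym by auto
  have "nb V s1 = {a1, s2}" "nb V s2 = {s1, a2}"
  proof -
    obtain w where w: "nb V s1 = {a1, w}" using other[OF s1(3) a1(3) sym[OF s1(4)]] by blast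
    obtain w' where w': "nb V s2 = {a2, w'}" using other[OF s2(3) a2(3) sym[OF s2(4)]] by blast
    have "s2 \<in> nb V s1" "s1 \<in> nb V s2" using adj sym s1 s2 by auto
    then show "nb V s1 = {a1, s2}" "nb V s2 = {s1, a2}"
      using w w' \<open>a1 \<noteq> s2\<close> \<open>a2 \<noteq> s1\<close> by auto
  qed
  moreover have "distinct [x, u1, a1, s1, s2, a2, u2]"
    using x u a1 a2 s1 s2 ss na ff us2 xs irr \<open>a1 \<noteq> s2\<close> \<open>a2 \<noteq> s1\<close> by auto
  ultimately have "seven_cycle V [x, u1, a1, s1, s2, a2, u2]"
    unfolding seven_cycle_def using x u a1 a2 s1 s2 assms(4) by (simp add: insert_commute)
  then show thesis using that by blast
qed

text \<open>The bad vertices form a closed set by \<open>good_neighbour_good\<close>, so with one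
  bad vertex all are bad. The third assumption expresses connectedness.\<close>

theorem hereditary_bad_seven_cycle:
  assumes "wc V" "hereditary V" "\<And>X. closed V X \<Longrightarrow> X \<noteq> {} \<Longrightarrow> X = V"
    and "x \<in> V" "\<not> good V x" "nb V x \<noteq> {}"
  obtains vs where "seven_cycle V vs"
proof -
  have "closed V {z \<in> V. \<not> good V z}"
    using good_neighbour_good[OF assms(1,2)] sym unfolding closed_def by blast
  then have all: "\<forall>z\<in>V. \<not> good V z" using assms(3)[of "{z \<in> V. \<not> good V z}"] assms(4,5) by blast
  have fin: "finite (nb V z)" for z using wc_finite[OF assms(1)] by (auto simp: nb_def)
  have "card (nb V z) = 2" if z: "z \<in> V" for z
  proof -
    have "nb V z \<noteq> {}"
    proof
      assume "nb V z = {}"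
      then have "closed V {z}" using z by (auto simp: closed_def)
      then have "V = {z}" using assms(3) by blast
      then show False using \<open>nb V z = {}\<close> assms(4,6) by auto
    qed
    then have "card (nb V z) \<noteq> 0" using fin by simp
    moreover have "card (nb V z) \<noteq> 1" using all z by (auto simp: good_def card_1_singleton_iff)
    moreover have "card (nb V z) \<noteq> 3" using no_cubic[OF assms(1,2) all z] by blast
    moreover have "card (nb V z) \<le> 3" using bad_degree_le_3[OF assms(1,2) z] all z by blast
    ultimately show ?thesis by linarith
  qed
  then show thesis using two_regular[OF assms(1) all _ assms(4)] that by blast
qed

end

section \<open>Sporadic components\<close>

text \<open>For the finite checks, a graph on a list of vertices is given by the rows of its reflexive adjacency
  matrix, and a set of vertices by a Boolean list.\<close>

fun bdisj :: "bool list \<Rightarrow> bool list \<Rightarrow> bool" where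
  "bdisj (a # as) (b # bs) = (if a then if b then False else bdisj as bs else bdisj as bs)"
| "bdisj _ _ = True"

fun bsub :: "bool list \<Rightarrow> bool list \<Rightarrow> bool" where
  "bsub (a # as) (b # bs) = (if a then if b then bsub as bs else False else bsub as bs)"
| "bsub _ _ = True"

fun band :: "bool list \<Rightarrow> bool list \<Rightarrow> bool list" where
  "band (a # as) (b # bs) = (a \<and> b) # band as bs"
| "band _ _ = []"

fun bor :: "bool list \<Rightarrow> bool list \<Rightarrow> bool list" where
  "bor (a # as) (b # bs) = (a \<or> b) # bor as bs"
| "bor _ _ = []"

fun bcount :: "bool list \<Rightarrow> nat" where
  "bcount [] = 0"
| "bcount (a # as) = (if a then Suc (bcount as) else bcount as)"

fun bnull :: "bool list \<Rightarrow> bool" where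
  "bnull [] = True"
| "bnull (a # as) = (if a then False else bnull as)"

lemma bdisj_map: "bdisj (map f xs) (map g xs) \<longleftrightarrow> (\<forall>x\<in>set xs. \<not> (f x \<and> g x))"
  by (induction xs) auto

lemma bsub_map: "bsub (map f xs) (map g xs) \<longleftrightarrow> (\<forall>x\<in>set xs. f x \<longrightarrow> g x)"
  by (induction xs) auto

lemma band_map: "band (map f xs) (map g xs) = map (\<lambda>x. f x \<and> g x) xs"
  by (induction xs) auto

lemma bor_map: "bor (map f xs) (map g xs) = map (\<lambda>x. f x \<or> g x) xs"
  by (induction xs) auto

lemma bnull_map: "bnull (map f xs) \<longleftrightarrow> (\<forall>x\<in>set xs. \<not> f x)"
  by (induction xs) auto

lemma bcount_map: "distinct xs \<Longrightarrow> bcount (map f xs) = card {x \<in> set xs. f x}"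
proof (induction xs)
  case (Cons a xs)
  have "{x \<in> set (a # xs). f x} = (if f a then insert a {x \<in> set xs. f x} else {x \<in> set xs. f x})"
    by auto
  then show ?case using Cons by auto
qed simp

lemma mask_as_map:
  assumes "distinct vs" "length T = length vs"
  obtains p where "T = map p vs"
proof
  show "T = map (\<lambda>v. T ! (THE i. i < length vs \<and> vs ! i = v)) vs"
  proof (rule nth_equalityI)
    fix i assume "i < length T"
    then have i: "i < length vs" using assms by simp
    have "(THE j. j < length vs \<and> vs ! j = vs ! i) = i"
      using i assms(1) by (intro the_equality) (auto simp: nth_eq_iff_index_eq)
    then show "T ! i = map (\<lambda>v. T ! (THE i. i < length vs \<and> vs ! i = v)) vs ! i" using i by simp
  qed (use assms in simp)
qed

text \<open>A strictly upper triangular conflict matrix: in girth five, two vertices whose closed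
  neighbourhoods meet have no common neighbour outside the graph. Row tails suffice because
  \<open>gen\<close> decides positions from the back.\<close>

fun near_tri :: "bool list list \<Rightarrow> bool list list" where
  "near_tri [] = []"
| "near_tri (r # rs) = map (\<lambda>s. \<not> bdisj r s) rs # near_tri rs"

fun gen :: "bool list list \<Rightarrow> bool list list" where
  "gen [] = [[]]"
| "gen (r # rs) = (let R = gen rs in map ((#) False) R @ map ((#) True) (filter (bdisj r) R))"

function fams :: "('a \<Rightarrow> 'a \<Rightarrow> bool) \<Rightarrow> 'a list \<Rightarrow> 'a list list" where
  "fams c [] = [[]]"
| "fams c (y # ys) = fams c ys @ map ((#) y) (fams c (filter (c y) ys))"
  by pat_completeness auto
termination by (relation "measure (length \<circ> snd)") (auto simp: le_imp_less_Suc)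

lemma fams_complete:
  "S \<subseteq> set ys \<Longrightarrow> (\<And>x y. x \<in> S \<Longrightarrow> y \<in> S \<Longrightarrow> x \<noteq> y \<Longrightarrow> c x y) \<Longrightarrow>
    \<exists>l\<in>set (fams c ys). set l = S \<and> distinct l"
proof (induction c ys arbitrary: S rule: fams.induct)
  case (2 c y ys)
  show ?case
  proof (cases "y \<in> S")
    case True
    have "S - {y} \<subseteq> set (filter (c y) ys)" using 2(3,4) True by auto
    then obtain l where "l \<in> set (fams c (filter (c y) ys))" "set l = S - {y}" "distinct l"
      using 2(2)[of "S - {y}"] 2(4) by auto
    then show ?thesis using True by (intro bexI[of _ "y # l"]) auto
  next
    case False
    then show ?thesis using 2(1)[of S] 2(3,4) by auto
  qed
qed auto

definition und :: "bool list list \<Rightarrow> bool list \<Rightarrow> bool list" where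
  "und C T = map (\<lambda>r. bdisj r T) C"

text \<open>Stability read off from closed neighbourhoods: a chosen vertex sees exactly one chosen
  vertex, namely itself.\<close>

fun stab_aux :: "bool list list \<Rightarrow> bool list \<Rightarrow> bool list \<Rightarrow> bool" where
  "stab_aux (r # C) (t # ts) T = (if t then bcount (band r T) = 1 \<and> stab_aux C ts T else stab_aux C ts T)"
| "stab_aux _ _ T = True"

definition stab :: "bool list list \<Rightarrow> bool list \<Rightarrow> bool" where
  "stab C T \<longleftrightarrow> length T = length C \<and> stab_aux C T T"

text \<open>Unlike \<^const>\<open>list_all\<close> and \<^const>\<open>list_ex\<close>, these stop at the first decisive element when they are
  evaluated by rewriting.\<close>

fun every :: "('a \<Rightarrow> bool) \<Rightarrow> 'a list \<Rightarrow> bool" where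
  "every P [] = True"
| "every P (x # xs) = (if P x then every P xs else False)"

fun some :: "('a \<Rightarrow> bool) \<Rightarrow> 'a list \<Rightarrow> bool" where
  "some P [] = False"
| "some P (x # xs) = (if P x then True else some P xs)"

lemma every_iff: "every P xs \<longleftrightarrow> (\<forall>x\<in>set xs. P x)"
  by (induction xs) auto

lemma some_iff: "some P xs \<longleftrightarrow> (\<exists>x\<in>set xs. P x)"
  by (induction xs) auto

text \<open>Necessary for two neighbours of the centre. A common vertex would close a 4-cycle. A set
  of \<open>ms\<close> missing both would, enlarged by all neighbours of the centre that it misses,
  be larger than when enlarged by the centre.\<close>

definition compat :: "bool list list \<Rightarrow> bool list \<Rightarrow> bool list \<Rightarrow> bool" where
  "compat ms y y' \<longleftrightarrow> (if bdisj y y' then every (\<lambda>M. if bdisj M y then \<not> bdisj M y' else True) ms else False)"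

text \<open>\<open>T\<close> with the missed neighbours of the centre is then a maximal stable set
  of the enlarged graph whose size is not \<open>Suc a\<close>, the size of a set of
  \<open>ms\<close> with the centre.\<close>

definition viol :: "nat \<Rightarrow> bool list list \<Rightarrow> bool list list \<Rightarrow> bool list \<Rightarrow> bool" where
  "viol a C fam T \<longleftrightarrow> (let U = filter (bdisj T) fam in
     if U = [] then False else if bcount T + length U = Suc a then False
     else bsub (und C T) (foldr bor U (map (\<lambda>_. False) T)))"

fun unit_mask :: "nat \<Rightarrow> nat \<Rightarrow> bool list" where
  "unit_mask 0 j = []"
| "unit_mask (Suc k) j = (j = 0) # unit_mask k (j - 1)"

text \<open>The vertices are ordered as old graph, centre, neighbours of the centre; the latter are
  pairwise non-adjacent.\<close>

definition extend :: "bool list list \<Rightarrow> bool list list \<Rightarrow> bool list list" where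
  "extend C fam = map (\<lambda>i. C ! i @ False # map (\<lambda>y. y ! i) fam) [0..<length C] @
     (map (\<lambda>_. False) C @ True # map (\<lambda>_. True) fam) #
     map (\<lambda>j. fam ! j @ True # map (\<lambda>i. i = j) [0..<length fam]) [0..<length fam]"

definition permute :: "nat list \<Rightarrow> 'a list list \<Rightarrow> 'a list list" where
  "permute \<pi> L = map (\<lambda>i. map (\<lambda>j. L ! i ! j) \<pi>) \<pi>"

definition solves :: "bool list list \<Rightarrow> bool list list list \<Rightarrow> bool list list \<Rightarrow> bool list list \<times> nat list \<Rightarrow> bool" where
  "solves C Ts fam s \<longleftrightarrow> (if fst s = fam then (let \<pi> = snd s; N = length C + Suc (length fam) in
     length \<pi> = N \<and> distinct \<pi> \<and> every (\<lambda>i. i < N) \<pi> \<and> some (\<lambda>T. permute \<pi> (extend C fam) = T) Ts) else False)"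

text \<open>A star with centre \<open>t\<close> is attached to the graph \<open>C\<close> by choosing the family \<open>fam\<close> of neighbourhoods in \<open>C\<close> of
  the neighbours of \<open>t\<close>; girth five forces each of them into \<open>gen (near_tri C)\<close>. Either some stable set in \<open>ts\<close>
  shows that the result is not well-covered, or \<open>sols\<close> contains an isomorphism onto a member of \<open>Ts\<close>.\<close>

definition certificate :: "bool list list \<Rightarrow> nat \<Rightarrow> bool list list \<Rightarrow> bool list list \<Rightarrow>
    (bool list list \<times> nat list) list \<Rightarrow> bool list list list \<Rightarrow> bool" where
  "certificate C a ms ts sols Ts \<longleftrightarrow> (let Y = filter (\<lambda>y. \<not> bnull y) (gen (near_tri C)) in
     ms \<noteq> [] \<and> every (\<lambda>M. stab C M \<and> bnull (und C M) \<and> bcount M = a) ms \<and> every (stab C) ts \<and>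
     every (\<lambda>y. some (\<lambda>M. bdisj M y) ms \<and>
       some (\<lambda>T. if bdisj T y then if bnull (und C T) then False else bsub (und C T) y else False) ts) Y \<and>
     every (\<lambda>fam. case fam of _ # _ # _ \<Rightarrow> if some (viol a C fam) ts then True else some (solves C Ts fam) sols | _ \<Rightarrow> True)
       (fams (compat ms) Y))"

definition mask :: "nat \<Rightarrow> nat list \<Rightarrow> bool list" where
  "mask n is = map (\<lambda>i. i \<in> set is) [0..<n]"

definition edge_matrix :: "nat \<Rightarrow> (nat \<times> nat) list \<Rightarrow> bool list list" where
  "edge_matrix n es = map (\<lambda>i. map (\<lambda>j. i = j \<or> (i, j) \<in> set es \<or> (j, i) \<in> set es) [0..<n]) [0..<n]"

definition C7_matrix :: "bool list list" where
  "C7_matrix = edge_matrix 7 [(0, 1), (1, 2), (2, 3), (3, 4), (4, 5), (5, 6), (6, 0)]"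

text \<open>The vertices 0 to 9 are \<open>va 1\<close>, \<open>va 2\<close>, \<open>vb 1\<close>,
  \<open>vb 2\<close>, \<open>vc 1\<close>, \<open>vc 2\<close>, \<open>vd 1\<close>,
  \<open>vd 2\<close>, \<open>vg 1\<close>, \<open>vg 2\<close>; in particular 6 and 7 are the
  exceptional \<open>vd 1\<close> and \<open>vd 2\<close>.\<close>

definition P10_matrix :: "bool list list" where
  "P10_matrix = edge_matrix 10 [(0, 2), (2, 7), (7, 6), (6, 3), (3, 1), (0, 8), (8, 6), (8, 4), (4, 5), (5, 9), (9, 1), (7, 9)]"

definition P13_matrix :: "bool list list" where
  "P13_matrix = edge_matrix 13 [(0, 1), (0, 4), (1, 5), (4, 8), (5, 8), (8, 9), (9, 6), (9, 7), (2, 6), (3, 7), (2, 3), (4, 10), (6, 10), (5, 11), (7, 11), (10, 12), (11, 12)]"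

definition Q13_matrix :: "bool list list" where
  "Q13_matrix = edge_matrix 13 [(0, 1), (0, 6), (1, 7), (6, 10), (7, 10), (10, 12), (12, 11), (11, 8), (11, 9), (6, 8), (7, 9), (8, 2), (9, 3), (3, 4), (4, 6), (2, 5), (5, 7), (4, 5)]"

definition P14_matrix :: "bool list list" where
  "P14_matrix = edge_matrix 14 [(0, 1), (1, 2), (2, 3), (3, 4), (4, 5), (5, 6), (6, 0), (0, 7), (1, 8), (2, 9), (3, 10), (4, 11), (5, 12), (6, 13), (7, 9), (8, 10), (9, 11), (10, 12), (11, 13), (12, 7), (13, 8)]"

definition sporadic :: "bool list list list" where
  "sporadic = [C7_matrix, P10_matrix, Q13_matrix, P13_matrix, P14_matrix]"

text \<open>All listed permutations have ten entries: the stars that survive turn the 7-cycle into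
  P10.\<close>

lemma C7_certificate: "certificate C7_matrix 3
  (map (mask 7) [[2,4,6], [1,3,5], [0,2,5], [1,4,6], [1,3,6], [0,3,5], [0,2,4]])
  (map (mask 7) [[3,6], [2,5], [1,4], [0,4], [1,5], [2,6], [0,3]])
  [(map (mask 7) [[1,4], [0]], [3,9,2,7,5,6,8,1,4,0]), (map (mask 7) [[1], [0,4]], [5,8,6,7,3,2,9,0,4,1]), (map (mask 7) [[2,5], [1]], [4,9,3,7,6,0,8,2,5,1]), (map (mask 7) [[2], [1,5]], [6,8,0,7,4,3,9,1,5,2]), (map (mask 7) [[3,6], [0]], [4,9,5,7,2,1,8,6,3,0]), (map (mask 7) [[3,6], [2]], [5,9,4,7,0,1,8,3,6,2]), (map (mask 7) [[3], [0,4]], [6,8,5,7,1,2,9,4,0,3]), (map (mask 7) [[3], [2,6]], [0,8,1,7,5,4,9,2,6,3]), (map (mask 7) [[4], [0,3]], [1,8,2,7,6,5,9,3,0,4]), (map (mask 7) [[4], [1,5]], [0,8,6,7,2,3,9,5,1,4]), (map (mask 7) [[5], [1,4]], [2,8,3,7,0,6,9,4,1,5]), (map (mask 7) [[5], [2,6]], [1,8,0,7,3,4,9,6,2,5]), (map (mask 7) [[6], [0,3]], [2,8,1,7,4,5,9,0,3,6]), (map (mask 7) [[6], [2,5]], [3,8,4,7,1,0,9,5,2,6])] sporadic"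
  by code_simp

text \<open>The permutation with fourteen entries leads to P14. Those with thirteen lead to P13 or
  Q13, according as the enlarged graph has 17 or 18 edges.\<close>

lemma P10_certificate: "certificate P10_matrix 4
  (map (mask 10) [[0,1,5,6], [2,4,6,9], [3,5,7,8], [0,1,4,7], [2,3,8,9], [1,5,7,8], [0,4,6,9], [1,2,4,6], [0,3,5,7], [1,2,5,8], [0,3,4,9]])
  (map (mask 10) [[8,9], [1,7,8], [0,6,9], [1,4,7], [2,3,5], [3,8,9], [3,7,8], [2,6,9], [2,5,6], [1,2,8], [0,3,9], [2,8,9], [2,3,4], [1,2,4], [0,5,6], [0,3,5]])
  [(map (mask 10) [[2,5], [0]], [1,3,10,12,9,6,11,0,7,2,5,8,4]), (map (mask 10) [[3,4], [1]], [0,2,10,12,8,7,11,1,6,3,4,9,5]), (map (mask 10) [[3,4], [2,5], [0,1]], [2,7,6,3,11,10,12,0,9,8,1,4,13,5]), (map (mask 10) [[4,7], [1,8]], [0,2,10,5,4,11,8,7,12,9,6,1,3]), (map (mask 10) [[5,6], [0,9]], [1,3,10,4,5,11,9,6,12,8,7,0,2]), (map (mask 10) [[6], [0,3,5]], [10,11,4,2,0,8,12,6,5,7,3,9,1]), (map (mask 10) [[7], [1,2,4]], [10,11,5,3,1,9,12,7,4,6,2,8,0]), (map (mask 10) [[8,9], [0,1]], [4,5,2,3,6,7,8,9,0,1,11,12,10])] sporadic"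
  by code_simp

text \<open>Here and for Q13 and P14 the list of solutions is empty: no star with at least two rays
  survives, so growth ends.\<close>

lemma P13_certificate: "certificate P13_matrix 5
  (map (mask 13) [[3,4,5,9,12], [1,2,7,8,10], [0,3,6,8,11], [1,2,4,9,11], [0,6,7,8,12], [0,2,5,7,10], [1,3,9,10,11], [4,5,6,7,12], [0,3,5,9,10], [1,3,4,6,11], [0,2,9,10,11], [1,6,7,8,12], [2,4,5,9,12], [1,3,6,8,12], [0,2,7,8,12], [1,3,4,9,12], [0,2,5,9,12], [1,2,8,10,11], [0,3,8,10,11], [3,4,5,6,12], [2,4,5,7,12], [1,4,6,7,12], [0,5,6,7,12], [1,3,8,10,11], [1,2,7,8,12], [0,3,6,8,12], [0,2,8,10,11]])
  (map (mask 13) [[4,5,6,7], [5,7,10], [4,6,11], [1,3,9,10], [0,2,9,11], [3,5,10], [1,7,10], [3,4,6,11], [1,4,6,11], [3,5,9,10], [1,7,8,10], [1,2,9,12], [1,2,4,7], [0,3,8,12], [0,3,5,6], [0,2,9,12], [0,2,8,12], [1,2,7,10], [1,2,4,11]])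
  [] sporadic"
  by code_simp

lemma Q13_certificate: "certificate Q13_matrix 5
  (map (mask 13) [[1,4,8,9,10], [0,5,8,9,10], [2,3,6,7,12], [1,3,5,6,11], [0,2,4,7,11], [1,5,6,9,12], [0,4,7,8,12], [1,2,4,10,11], [0,3,5,10,11], [2,3,6,7,11], [1,3,5,8,10], [0,2,4,9,10], [1,5,8,9,10], [1,4,8,9,12], [0,5,8,9,12], [0,4,8,9,10], [1,2,6,9,12], [0,3,7,8,12]])
  (map (mask 13) [[6,7,11], [5,6,9], [5,6,9,12], [4,7,8,12], [4,7,8], [3,6,7,11], [2,6,7,11], [1,2,9,10], [0,3,8,10], [1,5,9,10], [0,4,8,10], [5,10,11], [4,10,11], [1,5,6,9], [3,7,8,12], [3,6,7,12], [2,6,9,12], [2,6,7,12], [1,2,4,11], [1,2,3,12], [1,2,3,10], [0,4,7,8], [0,2,3,12]])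
  [] sporadic"
  by code_simp

lemma P14_certificate: "certificate P14_matrix 5
  (map (mask 14) [[2,4,6,7,8], [1,3,6,11,12], [0,5,9,10,13], [3,5,7,8,11], [0,2,4,12,13], [1,4,6,9,10], [3,6,8,9,12], [0,2,5,10,11], [1,4,7,10,13], [1,3,5,9,13], [2,6,8,11,12], [0,4,8,9,12], [2,6,7,10,11], [0,3,5,8,9], [2,5,7,8,11], [1,3,5,7,13], [3,6,7,8,11], [2,4,7,10,13], [1,6,7,10,11], [1,4,9,12,13], [0,3,8,11,12], [4,6,8,9,12], [2,5,7,10,13], [1,5,9,10,13], [1,5,7,10,11], [0,4,9,10,13], [0,3,9,12,13], [0,2,8,11,12]])
  (map (mask 14) [[3,6,8,9], [2,5,7,13], [1,5,10,11], [2,6,11,12], [4,6,9,10], [4,6,7,8], [3,5,8,9], [2,4,7,8], [1,6,11,12], [1,4,12,13], [0,2,12,13], [4,7,8], [3,6,7,8], [1,5,9,10], [1,3,7,13]])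
  [] sporadic"
  by code_simp

section \<open>Attaching stars to special components\<close>

context girth5 begin

definition cmat :: "'v list \<Rightarrow> bool list list" where
  "cmat vs = map (\<lambda>x. map (\<lambda>y. x = y \<or> x \<sim> y) vs) vs"

definition special :: "'v set \<Rightarrow> bool" where
  "special X \<longleftrightarrow> (\<exists>vs. distinct vs \<and> set vs = X \<and> cmat vs \<in> set sporadic)"

text \<open>Two neighbours of \<open>z\<close> with meeting closed neighbourhoods in
  \<open>ws\<close> would lie with \<open>z\<close> on a cycle of length three or four.\<close>

lemma gen_complete:
  assumes "z \<notin> set ws"
  shows "set vs \<subseteq> set ws \<Longrightarrow> distinct vs \<Longrightarrow>
    map (\<lambda>v. v \<sim> z) vs \<in> set (gen (near_tri (map (\<lambda>x. map (\<lambda>y. x = y \<or> x \<sim> y) ws) vs)))"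
proof (induction vs)
  case (Cons x vs)
  have IH: "map (\<lambda>v. v \<sim> z) vs \<in> set (gen (near_tri (map (\<lambda>x. map (\<lambda>y. x = y \<or> x \<sim> y) ws) vs)))"
    using Cons by simp
  have "bdisj (map (\<lambda>s. \<not> bdisj (map (\<lambda>y. x = y \<or> x \<sim> y) ws) s) (map (\<lambda>x. map (\<lambda>y. x = y \<or> x \<sim> y) ws) vs))
      (map (\<lambda>v. v \<sim> z) vs)" if xz: "x \<sim> z"
  proof -
    have "\<not> (\<exists>y\<in>set ws. (x = y \<or> x \<sim> y) \<and> (v = y \<or> v \<sim> y))" if v: "v \<in> set vs" "v \<sim> z" for v
    proof
      assume "\<exists>y\<in>set ws. (x = y \<or> x \<sim> y) \<and> (v = y \<or> v \<sim> y)"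
      then obtain y where y: "y \<in> set ws" "x = y \<or> x \<sim> y" "v = y \<or> v \<sim> y" by blast
      have "x \<noteq> v" using v Cons.prems(2) by auto
      moreover have "\<not> x \<sim> v" "\<not> v \<sim> x" using no_common[of z x v] xz v sym by blast+
      ultimately have "x \<sim> y" "v \<sim> y" using y by blast+
      then have "y = z" using no4[of x y z v] xz v \<open>x \<noteq> v\<close> by blast
      then show False using y(1) assms by blast
    qed
    then show ?thesis by (simp add: comp_def bdisj_map) blast
  qed
  then show ?case using IH by (auto simp: Let_def)
qed simp

lemma und_cmat: "und (cmat vs) (map p vs) = map (\<lambda>x. \<forall>y\<in>set vs. p y \<longrightarrow> x \<noteq> y \<and> \<not> x \<sim> y) vs"
  unfolding und_def cmat_def by (auto simp: bdisj_map)

lemma stab_aux_map: "distinct vs \<Longrightarrow> stab_aux (map (\<lambda>x. map (f x) vs) us) (map p us) (map p vs) \<longleftrightarrow>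
    (\<forall>x\<in>set us. p x \<longrightarrow> card {y \<in> set vs. f x y \<and> p y} = 1)"
  by (induction us) (auto simp: band_map bcount_map)

lemma stab_cmat:
  assumes "distinct vs" "stab (cmat vs) T"
  obtains p where "T = map p vs" "indep {v \<in> set vs. p v}"
proof -
  have "length T = length vs" using assms(2) by (simp add: stab_def cmat_def)
  then obtain p where p: "T = map p vs" using mask_as_map assms(1) by blast
  have c: "\<forall>x\<in>set vs. p x \<longrightarrow> card {y \<in> set vs. (x = y \<or> x \<sim> y) \<and> p y} = 1"
    using assms unfolding stab_def cmat_def p by (simp add: stab_aux_map)
  have "indep {v \<in> set vs. p v}"
    unfolding indep_def
  proof (intro ballI notI)
    fix x y assume xy: "x \<in> {v \<in> set vs. p v}" "y \<in> {v \<in> set vs. p v}" "x \<sim> y"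
    let ?S = "{y \<in> set vs. (x = y \<or> x \<sim> y) \<and> p y}"
    have "card ?S = 1" using c xy(1) by blast
    then obtain w where "?S = {w}" by (auto simp: card_1_singleton_iff)
    moreover have "x \<in> ?S" "y \<in> ?S" using xy by auto
    ultimately have "x = y" by (metis singletonD)
    then show False using xy irr by blast
  qed
  then show thesis using that p by blast
qed

lemma maximal_indep:
  assumes "finite Z"
  obtains S where "S \<subseteq> Z" "indep S" "Z \<subseteq> cl S"
proof -
  let ?F = "{S. S \<subseteq> Z \<and> indep S}"
  have "finite ?F" using assms by simp
  moreover have "{} \<in> ?F" by (simp add: indep_def)
  then have "?F \<noteq> {}" by blast
  ultimately have "\<exists>S\<in>?F. \<forall>S'\<in>?F. S \<subseteq> S' \<longrightarrow> S = S'" by (rule finite_has_maximal)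
  then obtain S where S: "S \<in> ?F" "\<And>S'. S' \<in> ?F \<Longrightarrow> S \<subseteq> S' \<Longrightarrow> S = S'" by meson
  have "z \<in> cl S" if z: "z \<in> Z" for z
  proof (rule ccontr)
    assume n: "z \<notin> cl S"
    then have "indep (insert z S)" using S(1) irr sym unfolding indep_def cl_def by blast
    then have "S = insert z S" using S(1) z by (intro S(2)) auto
    then show False using n by (auto simp: cl_def)
  qed
  then show thesis using that S(1) by blast
qed

text \<open>The centre \<open>t\<close> with the set given by \<open>pM\<close>, and the set given
  by \<open>p\<close> with the rays it misses, are both stable and dominate \<open>W\<close>; hence
  their sizes agree.\<close>

lemma attach_count:
  assumes "wc W" "distinct vs" "W = set vs \<union> insert t U" "t \<notin> set vs" "\<forall>v\<in>set vs. \<not> t \<sim> v"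
    and U: "\<forall>z\<in>U. t \<sim> z" "U \<inter> set vs = {}"
    and M: "indep {v \<in> set vs. pM v}" "\<forall>v\<in>set vs. \<exists>w\<in>set vs. pM w \<and> (v = w \<or> v \<sim> w)"
    and T: "indep {v \<in> set vs. p v}" "Us = {z \<in> U. \<forall>v\<in>set vs. p v \<longrightarrow> \<not> v \<sim> z}" "Us \<noteq> {}"
      "\<forall>v\<in>set vs. (\<exists>w\<in>set vs. p w \<and> (v = w \<or> v \<sim> w)) \<or> (\<exists>z\<in>Us. v \<sim> z)"
  shows "card {v \<in> set vs. p v} + card Us = Suc (card {v \<in> set vs. pM v})"
proof -
  let ?A = "{v \<in> set vs. p v}" and ?B = "{v \<in> set vs. pM v}"
  have fin: "finite U" using wc_finite[OF assms(1)] assms(3) by simp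
  have i1: "indep (?A \<union> Us)" unfolding indep_Un
  proof (intro conjI ballI)
    have "\<not> z \<sim> z'" if "z \<in> U" "z' \<in> U" for z z'
      using no_common[of t z z'] that U(1) by blast
    then show "indep Us" using T(2) by (auto simp: indep_def)
  qed (use T(1,2) in auto)
  have i2: "indep (insert t ?B)" using M(1) assms(5) irr sym unfolding indep_def by blast
  have d1: "W \<subseteq> cl (?A \<union> Us)"
  proof
    fix w assume "w \<in> W"
    then consider "w \<in> set vs" | "w = t" | "w \<in> U" using assms(3) by blast
    then show "w \<in> cl (?A \<union> Us)"
    proof cases
      case 1
      then show ?thesis using T(4) sym unfolding cl_def by blast
    next
      case 2
      obtain z where "z \<in> Us" using T(3) by blast
      then show ?thesis using 2 U(1) T(2) sym unfolding cl_def by blast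
    next
      case 3
      then show ?thesis using T(2) unfolding cl_def by blast
    qed
  qed
  have d2: "W \<subseteq> cl (insert t ?B)"
    using assms(3) M(2) U(1) sym unfolding cl_def by blast
  have s: "?A \<union> Us \<subseteq> W" "insert t ?B \<subseteq> W" using assms(3) T(2) by auto
  have "card (?A \<union> Us) \<le> card (insert t ?B)" "card (insert t ?B) \<le> card (?A \<union> Us)"
    using wcD[OF assms(1) s i1 i2] wcD[OF assms(1) s(2,1) i2 i1] d1 d2 by blast+
  moreover have "card (?A \<union> Us) = card ?A + card Us"
    using fin T(2) U(2) by (intro card_Un_disjoint) auto
  moreover have "card (insert t ?B) = Suc (card ?B)" using assms(4) by simp
  ultimately show ?thesis by simp
qed

lemma foldr_bor: "foldr bor (map (\<lambda>z. map (\<lambda>v. v \<sim> z) vs) l) (map (\<lambda>_. False) vs) =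
    map (\<lambda>v. \<exists>z\<in>set l. v \<sim> z) vs"
  by (induction l) (auto simp: bor_map)

lemma cmat_nth: "i < length L \<Longrightarrow> j < length L \<Longrightarrow> cmat L ! i ! j = (L ! i = L ! j \<or> L ! i \<sim> L ! j)"
  by (simp add: cmat_def)

lemma cmat_permute:
  assumes "\<forall>i\<in>set \<pi>. i < length L"
  shows "cmat (map ((!) L) \<pi>) = permute \<pi> (cmat L)"
  unfolding permute_def cmat_def[of "map ((!) L) \<pi>"] using assms by (auto simp: cmat_nth)

lemma cmat_extend:
  assumes "distinct (vs @ t # us)" "\<forall>v\<in>set vs. \<not> t \<sim> v" "\<forall>z\<in>set us. t \<sim> z"
  shows "cmat (vs @ t # us) = extend (cmat vs) (map (\<lambda>z. map (\<lambda>v. v \<sim> z) vs) us)"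
proof -
  have uu: "\<not> us ! i \<sim> us ! j" if "i < length us" "j < length us" for i j
    using no_common[of t "us ! i" "us ! j"] assms(3) that by simp
  have idx: "map f xs = map (\<lambda>i. f (xs ! i)) [0..<length xs]" for f :: "'v \<Rightarrow> 'b" and xs
    by (rule nth_equalityI) auto
  have r1: "map (\<lambda>x. map (\<lambda>y. x = y \<or> x \<sim> y) (vs @ t # us)) vs =
      map (\<lambda>i. cmat vs ! i @ False # map (\<lambda>y. y ! i) (map (\<lambda>z. map (\<lambda>v. v \<sim> z) vs) us)) [0..<length (cmat vs)]"
    using assms by (subst idx) (auto simp: cmat_def comm[of _ t])
  have r2: "map (\<lambda>y. t = y \<or> t \<sim> y) (vs @ t # us) =
      map (\<lambda>_. False) (cmat vs) @ True # map (\<lambda>_. True) (map (\<lambda>z. map (\<lambda>v. v \<sim> z) vs) us)"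
    using assms by (auto simp: cmat_def)
  have r3: "map (\<lambda>x. map (\<lambda>y. x = y \<or> x \<sim> y) (vs @ t # us)) us =
      map (\<lambda>j. map (\<lambda>z. map (\<lambda>v. v \<sim> z) vs) us ! j @ True # map (\<lambda>i. i = j) [0..<length us]) [0..<length us]"
  proof (subst idx, rule map_cong[OF refl])
    fix j assume "j \<in> set [0..<length us]"
    then have j: "j < length us" by simp
    have mu: "map (\<lambda>y. us ! j = y \<or> us ! j \<sim> y) us = map (\<lambda>i. i = j) [0..<length us]"
      using j uu assms(1) by (subst idx) (auto simp: nth_eq_iff_index_eq)
    then show "map (\<lambda>y. us ! j = y \<or> us ! j \<sim> y) (vs @ t # us) =
      map (\<lambda>z. map (\<lambda>v. v \<sim> z) vs) us ! j @ True # map (\<lambda>i. i = j) [0..<length us]"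
    proof -
      have "us ! j \<in> set us" using j by simp
      then have n: "us ! j \<notin> set vs" "us ! j \<sim> t" using assms sym by auto
      then have "map (\<lambda>y. us ! j = y \<or> us ! j \<sim> y) vs = map (\<lambda>v. v \<sim> us ! j) vs"
        by (intro map_cong[OF refl]) (metis comm)
      then show ?thesis using mu n j by simp
    qed
  qed
  show ?thesis
    unfolding extend_def using r1 r2 r3 by (simp add: cmat_def)
qed

text \<open>A ray \<open>z\<close> is encoded by its trace \<open>mk z\<close> on the core. Traces
  are nonempty and pairwise disjoint, so the encoding is injective and the family of traces is among
  those that the certificate examines. By \<open>attach_count\<close> no set of \<open>ts\<close>
  violates it, so a listed permutation identifies \<open>W\<close>.\<close>

lemma attach_special:
  assumes "wc W" "distinct vs" "W = set vs \<union> insert t U" "t \<notin> set vs" "\<forall>v\<in>set vs. \<not> t \<sim> v"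
    and U: "\<forall>z\<in>U. t \<sim> z" "U \<inter> set vs = {}" "2 \<le> card U" "\<forall>z\<in>U. \<exists>v\<in>set vs. v \<sim> z"
    and cert: "certificate (cmat vs) a ms ts sols sporadic"
  shows "special W"
proof -
  define mk where "mk z = map (\<lambda>v. v \<sim> z) vs" for z
  define Y where "Y = filter (\<lambda>y. \<not> bnull y) (gen (near_tri (cmat vs)))"
  note ce = cert[unfolded certificate_def Let_def, folded Y_def]
  have ms: "ms \<noteq> []" "\<And>M. M \<in> set ms \<Longrightarrow> stab (cmat vs) M" "\<And>M. M \<in> set ms \<Longrightarrow> bnull (und (cmat vs) M)"
    "\<And>M. M \<in> set ms \<Longrightarrow> bcount M = a" and ts: "\<And>T. T \<in> set ts \<Longrightarrow> stab (cmat vs) T"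
    using ce by (auto simp: every_iff)
  have fin: "finite U" using wc_finite[OF assms(1)] assms(3) by simp
  have tU: "t \<notin> U" using U(1) irr by blast
  obtain M0 where M0: "M0 \<in> set ms" using ms(1) by (metis list.set_intros(1) neq_Nil_conv)
  obtain pM where pM: "M0 = map pM vs" "indep {v \<in> set vs. pM v}"
    using stab_cmat[OF assms(2) ms(2)[OF M0]] .
  have domM: "\<forall>v\<in>set vs. \<exists>w\<in>set vs. p w \<and> (v = w \<or> v \<sim> w)" if "bnull (und (cmat vs) (map p vs))" for p
    using that by (auto simp: und_cmat bnull_map)
  have cM: "card {v \<in> set vs. pM v} = a"
    using ms(4)[OF M0] pM(1) assms(2) by (simp add: bcount_map)
  note count = attach_count[OF assms(1-5) U(1,2) pM(2) domM, unfolded cM]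
  have dM: "bnull (und (cmat vs) (map pM vs))" using ms(3)[OF M0] pM(1) by simp
  have mkY: "mk z \<in> set Y" if "z \<in> U" for z
  proof -
    have "z \<notin> set vs" using that U(2) by blast
    then have "mk z \<in> set (gen (near_tri (cmat vs)))"
      unfolding mk_def cmat_def using gen_complete[of z vs vs] assms(2) by simp
    moreover have "\<not> bnull (mk z)" using U(4) that by (auto simp: mk_def bnull_map)
    ultimately show ?thesis by (simp add: Y_def)
  qed
  have inj: "v \<noteq> v' \<or> z = z'" if "z \<in> U" "z' \<in> U" "v \<in> set vs" "v \<sim> z" "v' \<sim> z'" for v v' z z'
  proof -
    have "t \<noteq> v" using that assms(4) by blast
    then show ?thesis using no4[of t z z' v] that U(1) by blast
  qed
  have compat: "compat ms (mk z) (mk z')" if z: "z \<in> U" "z' \<in> U" "z \<noteq> z'" for z z'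
  proof -
    have "bdisj (mk z) (mk z')" using inj z by (auto simp: mk_def bdisj_map)
    moreover have "\<not> (bdisj M (mk z) \<and> bdisj M (mk z'))" if M: "M \<in> set ms" for M
    proof
      assume b: "bdisj M (mk z) \<and> bdisj M (mk z')"
      obtain p where p: "M = map p vs" "indep {v \<in> set vs. p v}" using stab_cmat[OF assms(2) ms(2)[OF M]] .
      define Us where "Us = {z \<in> U. \<forall>v\<in>set vs. p v \<longrightarrow> \<not> v \<sim> z}"
      have zz: "{z, z'} \<subseteq> Us" using b z by (auto simp: Us_def p(1) mk_def bdisj_map)
      have "card {v \<in> set vs. p v} + card Us = Suc a"
      proof (rule count[OF dM p(2) Us_def])
        show "Us \<noteq> {}" using zz by auto
        show "\<forall>v\<in>set vs. (\<exists>w\<in>set vs. p w \<and> (v = w \<or> v \<sim> w)) \<or> (\<exists>z\<in>Us. v \<sim> z)"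
          using domM[of p] ms(3)[OF M] p(1) by blast
      qed
      moreover have "card {v \<in> set vs. p v} = a" using ms(4)[OF M] p(1) assms(2) by (simp add: bcount_map)
      moreover have "finite Us" using fin by (simp add: Us_def)
      then have "2 \<le> card Us" using card_mono[OF _ zz] z(3) by simp
      ultimately show False by simp
    qed
    ultimately show ?thesis by (auto simp: compat_def every_iff)
  qed
  have mkinj: "inj_on mk U"
  proof (rule inj_onI)
    fix z z' assume z: "z \<in> U" "z' \<in> U" "mk z = mk z'"
    obtain v where v: "v \<in> set vs" "v \<sim> z" using U(4) z(1) by blast
    then have "v \<sim> z'" using z(3) by (auto simp: mk_def)
    then show "z = z'" using inj z v by blast
  qed
  obtain fam where fam: "fam \<in> set (fams (compat ms) Y)" "set fam = mk ` U" "distinct fam"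
    using fams_complete[of "mk ` U" Y "compat ms"] mkY compat by blast
  define us where "us = map (inv_into U mk) fam"
  have us: "map mk us = fam" "set us = U" "distinct us"
  proof -
    show "map mk us = fam" unfolding us_def map_map
      by (rule map_idI) (use fam(2) in \<open>auto simp: f_inv_into_f\<close>)
    show "set us = U" unfolding us_def using fam(2) mkinj by (auto simp: inv_into_f_f image_iff)
    show "distinct us" unfolding us_def
      using fam(2,3) by (auto simp: distinct_map intro: inj_on_inv_into)
  qed
  have famU: "fam = map (\<lambda>z. map (\<lambda>v. v \<sim> z) vs) us" unfolding us(1)[symmetric] by (simp add: mk_def)
  have nviol: "\<not> viol a (cmat vs) fam T" if T: "T \<in> set ts" for T
  proof
    assume v: "viol a (cmat vs) fam T"
    obtain p where p: "T = map p vs" "indep {v \<in> set vs. p v}" using stab_cmat[OF assms(2) ts[OF T]] .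
    define Us where "Us = {z \<in> U. \<forall>v\<in>set vs. p v \<longrightarrow> \<not> v \<sim> z}"
    define l where "l = filter (\<lambda>z. bdisj T (mk z)) us"
    have l: "set l = Us" "distinct l" "length l = card Us"
    proof -
      show "set l = Us" using us(2) by (auto simp: l_def Us_def p(1) mk_def bdisj_map)
      show "distinct l" using us(3) by (simp add: l_def)
      then show "length l = card Us" using \<open>set l = Us\<close> distinct_card by metis
    qed
    have fl: "filter (bdisj T) fam = map (\<lambda>z. map (\<lambda>v. v \<sim> z) vs) l"
      unfolding us(1)[symmetric] l_def mk_def by (simp add: filter_map comp_def)
    have lT: "map (\<lambda>_. False) T = map (\<lambda>_. False) vs" by (simp add: p(1))
    have v': "l \<noteq> []" "bcount T + length l \<noteq> Suc a"
      "bsub (und (cmat vs) T) (map (\<lambda>v. \<exists>z\<in>set l. v \<sim> z) vs)"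
      using v unfolding viol_def fl lT foldr_bor Let_def by (auto split: if_splits)
    have "card {v \<in> set vs. p v} + card Us = Suc a"
    proof (rule count[OF dM p(2) Us_def])
      show "Us \<noteq> {}" using v'(1) l(1) by auto
      show "\<forall>v\<in>set vs. (\<exists>w\<in>set vs. p w \<and> (v = w \<or> v \<sim> w)) \<or> (\<exists>z\<in>Us. v \<sim> z)"
        using v'(3) unfolding p(1) und_cmat bsub_map l(1) by blast
    qed
    then show False using v'(2) l(3) p(1) assms(2) by (simp add: bcount_map)
  qed
  have "length fam = card U" using us fam distinct_card by (metis length_map)
  then obtain f1 f2 fr where "fam = f1 # f2 # fr" using U(3)
    by (metis One_nat_def Suc_1 length_0_conv length_Suc_conv list.exhaust not_less_eq_eq le_zero_eq nat_le_linear)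
  then have "some (viol a (cmat vs) fam) ts \<or> some (solves (cmat vs) sporadic fam) sols"
    using ce fam(1) unfolding every_iff by (metis (no_types, lifting) list.simps(5))
  then obtain s where s: "solves (cmat vs) sporadic fam s"
    using nviol by (auto simp: some_iff)
  define \<pi> where "\<pi> = snd s"
  define L where "L = vs @ t # us"
  have L: "distinct L" "length L = length (cmat vs) + Suc (length fam)" "set L = W"
    using us assms(2,3,4) U(2) tU by (auto simp: L_def cmat_def famU)
  have pi: "length \<pi> = length L" "distinct \<pi>" "\<forall>i\<in>set \<pi>. i < length L" "permute \<pi> (extend (cmat vs) fam) \<in> set sporadic"
    using s L(2) unfolding solves_def Let_def \<pi>_def by (auto simp: every_iff some_iff split: if_splits)
  have "set \<pi> = {..<length L}"
    by (rule card_subset_eq) (use pi in \<open>auto simp: distinct_card\<close>)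
  then have "set (map ((!) L) \<pi>) = (!) L ` {..<length L}" by simp
  also have "\<dots> = W" unfolding L(3)[symmetric] by (auto simp: set_conv_nth)
  finally have "set (map ((!) L) \<pi>) = W" .
  moreover have "distinct (map ((!) L) \<pi>)"
    using pi(2,3) L(1) by (auto simp: distinct_map inj_on_def nth_eq_iff_index_eq)
  moreover have "cmat (map ((!) L) \<pi>) \<in> set sporadic"
    using cmat_permute[OF pi(3)] cmat_extend[of vs t us] L(1) assms(5) U(1) us(2) pi(4)
    by (simp add: L_def famU)
  ultimately show ?thesis unfolding special_def by blast
qed

lemma cmat_certificate:
  assumes "cmat vs \<in> set sporadic"
  obtains a ms ts sols where "certificate (cmat vs) a ms ts sols sporadic"
proof -
  have "cmat vs = C7_matrix \<or> cmat vs = P10_matrix \<or> cmat vs = P13_matrix \<or> cmat vs = Q13_matrix \<or> cmat vs = P14_matrix"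
    using assms by (auto simp: sporadic_def)
  then show thesis
    using that C7_certificate P10_certificate P13_certificate Q13_certificate P14_certificate by metis
qed

text \<open>If \<open>X\<close> is no longer closed when \<open>t\<close> returns, some neighbour
  \<open>u\<close> of \<open>t\<close> touches \<open>X\<close>. Deleting a stable set that
  dominates everything outside \<open>X\<close>, \<open>cl {t}\<close> and \<open>cl {u}\<close>
  leaves \<open>X\<close> with a star centred at \<open>t\<close>.\<close>

lemma special_extends:
  assumes "wc V" "t \<in> V" "closed (V - cl {t}) X" "special X" "\<not> closed V X"
  shows "\<exists>S\<subseteq>V. indep S \<and> special (V - cl S) \<and> card X < card (V - cl S)"
proof -
  obtain vs where vs: "distinct vs" "set vs = X" "cmat vs \<in> set sporadic"
    using assms(4) by (auto simp: special_def)
  obtain a ms ts sols where cert: "certificate (cmat vs) a ms ts sols sporadic"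
    using cmat_certificate[OF vs(3)] .
  define Y where "Y = filter (\<lambda>y. \<not> bnull y) (gen (near_tri (cmat vs)))"
  note ce = cert[unfolded certificate_def Let_def, folded Y_def]
  have XV: "X \<subseteq> V" "X \<inter> cl {t} = {}" using assms(3) by (auto simp: closed_def)
  have Xcl: "y \<in> X" if "x \<in> X" "y \<in> V" "y \<notin> cl {t}" "x \<sim> y \<or> y \<sim> x" for x y
    using assms(3) that sym unfolding closed_def by blast
  obtain x0 u where xu: "x0 \<in> X" "u \<in> V" "x0 \<sim> u" "u \<notin> X"
    using assms(5) XV(1) unfolding closed_def by blast
  have tX: "t \<notin> X" "\<not> t \<sim> x" if "x \<in> X" for x using XV(2) that by (auto simp: cl_iff)
  have tu: "t \<sim> u"
  proof -
    have "u \<in> cl {t}" using Xcl[OF xu(1,2)] xu by blast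
    then show ?thesis using tX(2)[OF xu(1)] xu(3) sym by (auto simp: cl_iff)
  qed
  define Z where "Z = V - X - cl {t} - cl {u}"
  have "finite Z" using wc_finite[OF assms(1)] by (simp add: Z_def)
  then obtain S where S: "S \<subseteq> Z" "indep S" "Z \<subseteq> cl S" using maximal_indep by blast
  have SV: "S \<subseteq> V" using S(1) by (auto simp: Z_def)
  define W where "W = V - cl S"
  have wcW: "wc W" using wc_diff[OF assms(1) SV S(2)] by (simp add: W_def)
  have XW: "X \<subseteq> W"
  proof
    fix x assume x: "x \<in> X"
    have "x \<notin> cl S"
    proof
      assume "x \<in> cl S"
      then obtain s where s: "s \<in> S" "s = x \<or> s \<sim> x" by (auto simp: cl_iff)
      then have "s \<in> V" "s \<notin> X" "s \<notin> cl {t}" using S(1) by (auto simp: Z_def)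
      then show False using Xcl[OF x, of s] s x by blast
    qed
    then show "x \<in> W" using x XV(1) by (auto simp: W_def)
  qed
  have tuW: "t \<in> W" "u \<in> W"
    using S(1) assms(2) xu(2) sym unfolding W_def Z_def cl_def by blast+
  define R where "R = {r \<in> W. u \<sim> r \<and> r \<noteq> t \<and> r \<notin> X}"
  define U' where "U' = {z \<in> W. t \<sim> z \<and> z \<noteq> u}"
  have Wsplit: "w \<in> X \<or> w = t \<or> w = u \<or> w \<in> R \<or> w \<in> U'" if "w \<in> W" for w
    using that S(3) unfolding W_def Z_def R_def U'_def cl_def by blast
  have U'X: "z \<notin> X" "z \<noteq> t" "\<not> u \<sim> z" if "z \<in> U'" for z
    using that tX irr no_common[OF tu] unfolding U'_def by blast+
  have RR: "\<not> t \<sim> r" "r \<notin> cl {t}" if "r \<in> R" for r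
    using that no3[OF tu, of r] unfolding R_def cl_def by blast+
  have nR: "w = u" if "r \<in> R" "w \<in> W" "r \<sim> w" for r w
  proof -
    have r: "u \<sim> r" "r \<noteq> t" "r \<notin> X" "r \<in> V" using that(1) by (auto simp: R_def W_def)
    have "w \<notin> X" using Xcl[of w r] r RR[OF that(1)] that(3) by blast
    moreover have "w \<noteq> t" using RR[OF that(1)] that(3) sym by blast
    moreover have "w \<notin> R" using no_common[OF r(1)] that(3) by (auto simp: R_def)
    moreover have "w \<notin> U'"
    proof
      assume "w \<in> U'"
      then have "t \<sim> w" "u \<noteq> w" by (auto simp: U'_def)
      then show False using no_chord[OF sym[OF r(1)] sym[OF tu]] r(2) that(3) by blast
    qed
    ultimately show ?thesis using Wsplit[OF that(2)] by blast
  qed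
  have nU: "w = t \<or> w \<in> X" if "z \<in> U'" "w \<in> W" "z \<sim> w" for z w
  proof -
    have z: "t \<sim> z" "z \<noteq> u" using that(1) by (auto simp: U'_def)
    have "w \<noteq> u" using U'X(3)[OF that(1)] that(3) sym by blast
    moreover have "w \<notin> R" using nR[of w z] that z sym by (auto simp: U'_def)
    moreover have "w \<notin> U'" using no_common[OF z(1)] that(3) by (auto simp: U'_def)
    ultimately show ?thesis using Wsplit[OF that(2)] by blast
  qed
  define yu where "yu = map (\<lambda>v. v \<sim> u) vs"
  have "yu \<in> set (gen (near_tri (cmat vs)))"
    unfolding yu_def cmat_def using gen_complete[of u vs vs] vs(1,2) xu(4) by simp
  moreover have "\<not> bnull yu" using xu(1,3) vs(2) by (auto simp: yu_def bnull_map)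
  ultimately have yuY: "yu \<in> set Y" by (simp add: Y_def)
  then have "some (\<lambda>M. bdisj M yu) ms"
    "some (\<lambda>T. if bdisj T yu then if bnull (und (cmat vs) T) then False else bsub (und (cmat vs) T) yu else False) ts"
    using ce by (auto simp: every_iff)
  then obtain M T where MT: "M \<in> set ms" "bdisj M yu" "T \<in> set ts" "bdisj T yu" "\<not> bnull (und (cmat vs) T)"
      "bsub (und (cmat vs) T) yu"
    by (auto simp: some_iff split: if_splits)
  have sM: "stab (cmat vs) M" "bnull (und (cmat vs) M)" "stab (cmat vs) T"
    using ce MT by (auto simp: every_iff)
  obtain pM where pM: "M = map pM vs" "indep {v \<in> X. pM v}" using stab_cmat[OF vs(1) sM(1)] vs(2) by blast
  obtain pT where pT: "T = map pT vs" "indep {v \<in> X. pT v}" using stab_cmat[OF vs(1) sM(3)] vs(2) by blast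
  have M: "\<forall>v\<in>X. pM v \<longrightarrow> \<not> v \<sim> u" "\<forall>v\<in>X. \<exists>w\<in>X. pM w \<and> (v = w \<or> v \<sim> w)"
    using MT(2) sM(2) vs(2) unfolding pM(1) yu_def bdisj_map und_cmat bnull_map by blast+
  have T: "\<forall>v\<in>X. pT v \<longrightarrow> \<not> v \<sim> u" "\<exists>v\<in>X. \<forall>w\<in>X. pT w \<longrightarrow> v \<noteq> w \<and> \<not> v \<sim> w"
    "\<forall>v\<in>X. (\<forall>w\<in>X. pT w \<longrightarrow> v \<noteq> w \<and> \<not> v \<sim> w) \<longrightarrow> v \<sim> u"
    using MT(4-6) vs(2) unfolding pT(1) yu_def bdisj_map und_cmat bnull_map bsub_map by blast+
  let ?AM = "{v \<in> X. pM v}" and ?AT = "{v \<in> X. pT v}"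
  have wcM: "wc (W - cl ?AM)" and wcT: "wc (W - cl ?AT)"
    using wc_diff[OF wcW] pM(2) pT(2) XW by (metis (no_types, lifting) Collect_mem_eq Collect_mono_iff subsetD)+
  have tucl: "t \<in> W - cl ?AM" "u \<in> W - cl ?AM" "t \<in> W - cl ?AT" "u \<in> W - cl ?AT"
    using tuW tX xu(4) M(1) T(1) sym unfolding cl_def by blast+
  \<comment> \<open>The certificate supplies a stable set of the core whose undominated vertices
    exist and are all next to \<open>u\<close>. After its deletion \<open>y0\<close> is a leaf at
    \<open>u\<close>.\<close>
  obtain y0 where y0: "y0 \<in> X" "\<forall>w\<in>X. pT w \<longrightarrow> y0 \<noteq> w \<and> \<not> y0 \<sim> w" using T(2) by blast
  have y0u: "y0 \<sim> u" using T(3) y0 by blast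
  have y0W: "y0 \<in> W - cl ?AT" using y0 XW sym unfolding cl_def by blast
  have RT: "r \<in> W - cl A" if "r \<in> R" "A \<subseteq> X" for r A
  proof -
    have "r \<in> W" "r \<notin> X" "u \<noteq> r" using that(1) irr by (auto simp: R_def)
    moreover have "\<not> a \<sim> r" if "a \<in> A" for a
      using nR[OF \<open>r \<in> R\<close>, of a] that \<open>A \<subseteq> X\<close> XW xu(4) sym by blast
    ultimately show ?thesis using that(2) by (auto simp: cl_iff)
  qed
  have XT: "w \<sim> u" if "w \<in> X" "w \<in> W - cl ?AT" for w
    using T(3) that sym unfolding cl_def by blast
  have nb_y0: "nb (W - cl ?AT) y0 = {u}"
  proof -
    have "w = u" if w: "w \<in> W - cl ?AT" "y0 \<sim> w" for w
    proof (rule ccontr)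
      assume wu: "w \<noteq> u"
      have "w \<noteq> t" using tX(2)[OF y0(1)] w(2) sym by blast
      moreover have "w \<notin> X" using XT[of w] w no_common[of u y0 w] y0u sym by blast
      moreover have "w \<notin> R" using nR[of w y0] w(2) y0 XW xu(4) sym by blast
      moreover have "w \<notin> U'"
      proof
        assume "w \<in> U'"
        then have "t \<sim> w" by (simp add: U'_def)
        moreover have "t \<noteq> y0" using tX y0(1) by blast
        ultimately show False using no4[of t w u y0] tu w(2) y0u wu by blast
      qed
      ultimately show False using Wsplit[of w] w(1) wu by blast
    qed
    then show ?thesis using tucl(4) y0u unfolding nb_def by blast
  qed
  \<comment> \<open>A vertex of \<open>R\<close> would be a second leaf at \<open>u\<close>, and the
    stem could replace both leaves.\<close>
  have Rempty: "R = {}"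
  proof (rule ccontr)
    assume "R \<noteq> {}"
    then obtain r where r: "r \<in> R" by blast
    have rW: "r \<in> W - cl ?AT" by (rule RT[OF r]) auto
    have "w = u" if "w \<in> W - cl ?AT" "r \<sim> w" for w using nR[OF r _ that(2)] that(1) by blast
    moreover have "r \<sim> u" using r sym by (simp add: R_def)
    ultimately have "nb (W - cl ?AT) r = {u}" using tucl(4) unfolding nb_def by blast
    moreover have "r \<noteq> y0" "u \<sim> r" using r y0(1) by (auto simp: R_def)
    moreover have "\<not> r \<sim> y0" using nR[OF r, of y0] y0(1) XW xu(4) by blast
    ultimately show False
      using exchange[OF wcT, of "[r, y0]" "[u]"] rW y0W tucl(4) nb_y0 sym[OF y0u]
      by (simp add: cl_iff del: Diff_iff)
  qed
  \<comment> \<open>Deleting a dominating stable set of the core that misses \<open>u\<close> makes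
    \<open>u\<close> a leaf at \<open>t\<close>; a ray without neighbour in \<open>X\<close> would
    be another one.\<close>
  have hit: "\<exists>v\<in>X. v \<sim> z" if z: "z \<in> U'" for z
  proof (rule ccontr)
    assume n: "\<not> (\<exists>v\<in>X. v \<sim> z)"
    have zW: "z \<in> W - cl ?AM" using z n U'X(1)[OF z] by (auto simp: U'_def cl_iff)
    have nbz: "nb (W - cl ?AM) z = {t}"
    proof -
      have "w = t" if "w \<in> W" "z \<sim> w" for w using nU[OF z that] n that(2) sym by blast
      moreover have "z \<sim> t" using z sym by (auto simp: U'_def)
      ultimately show ?thesis using tucl(1) unfolding nb_def by blast
    qed
    have nbu: "nb (W - cl ?AM) u = {t}"
    proof -
      have "w = t" if w: "w \<in> W - cl ?AM" "u \<sim> w" for w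
      proof -
        have "w \<notin> X" using M(2) w sym unfolding cl_def by blast
        then show ?thesis using Wsplit[of w] w Rempty irr U'X(3) by blast
      qed
      then show ?thesis using tucl(1) sym[OF tu] unfolding nb_def by blast
    qed
    have "z \<noteq> u" "t \<sim> z" using z by (simp_all add: U'_def)
    then show False
      using exchange[OF wcM, of "[u, z]" "[t]"] zW tucl(1,2) nbz nbu U'X(3)[OF z] tu
      by (simp add: cl_iff del: Diff_iff)
  qed
  \<comment> \<open>If \<open>u\<close> were the only ray, \<open>t\<close> itself would be a second
    leaf at \<open>u\<close> besides \<open>y0\<close>.\<close>
  have "U' \<noteq> {}"
  proof
    assume e: "U' = {}"
    have nbt: "nb (W - cl ?AT) t = {u}"
    proof -
      have "w = u" if w: "w \<in> W - cl ?AT" "t \<sim> w" for w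
        using w e by (auto simp: U'_def)
      then show ?thesis using tucl(4) tu unfolding nb_def by blast
    qed
    have "y0 \<noteq> t" "\<not> t \<sim> y0" using tX y0(1) by blast+
    then show False
      using exchange[OF wcT, of "[t, y0]" "[u]"] y0W tucl(3,4) nb_y0 nbt sym[OF y0u] sym[OF tu]
      by (simp add: cl_iff del: Diff_iff)
  qed
  define U where "U = insert u U'"
  have finU: "finite U'" using wc_finite[OF wcW] by (simp add: U'_def)
  have uU': "u \<notin> U'" by (simp add: U'_def)
  have WU: "W = set vs \<union> insert t U"
    using Wsplit Rempty XW tuW vs(2) by (auto simp: U_def U'_def)
  have "special W"
  proof (rule attach_special[OF wcW vs(1) WU _ _ _ _ _ _ cert])
    show "t \<notin> set vs" "\<forall>v\<in>set vs. \<not> t \<sim> v" using tX vs(2) xu(1) by blast+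
    show "\<forall>z\<in>U. t \<sim> z" using tu by (auto simp: U_def U'_def)
    show "U \<inter> set vs = {}" using xu(4) U'X(1) vs(2) by (auto simp: U_def)
    show "\<forall>z\<in>U. \<exists>v\<in>set vs. v \<sim> z" using xu(1,3) hit vs(2) by (auto simp: U_def)
    show "2 \<le> card U" using finU uU' \<open>U' \<noteq> {}\<close> by (simp add: U_def Suc_le_eq card_gt_0_iff)
  qed
  moreover have "card X < card W"
    by (rule psubset_card_mono) (use wc_finite[OF wcW] XW tuW tX xu(1) in blast)+
  ultimately show ?thesis using SV S(2) unfolding W_def by blast
qed

lemma special_nonempty: "special X \<Longrightarrow> X \<noteq> {}"
  by (auto simp: special_def cmat_def sporadic_def C7_matrix_def P10_matrix_def P13_matrix_def
      Q13_matrix_def P14_matrix_def edge_matrix_def)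

lemma C7_matrix_rows: "C7_matrix =
    [[True, True, False, False, False, False, True],
     [True, True, True, False, False, False, False],
     [False, True, True, True, False, False, False],
     [False, False, True, True, True, False, False],
     [False, False, False, True, True, True, False],
     [False, False, False, False, True, True, True],
     [True, False, False, False, False, True, True]]"
  by code_simp

lemma seven_cycle_special:
  assumes "seven_cycle V vs"
  shows "closed V (set vs)" "special (set vs)"
proof -
  obtain x u1 a1 s1 s2 a2 u2 where vs: "vs = [x, u1, a1, s1, s2, a2, u2]" "distinct vs" "set vs \<subseteq> V"
     and n: "nb V x = {u2, u1}" "nb V u1 = {x, a1}" "nb V a1 = {u1, s1}" "nb V s1 = {a1, s2}"
     "nb V s2 = {s1, a2}" "nb V a2 = {s2, u2}" "nb V u2 = {a2, x}"
    using assms unfolding seven_cycle_def by blast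
  have a: "v \<sim> w \<longleftrightarrow> w \<in> nb V v" if "w \<in> set vs" for v w using that vs(3) by auto
  have "cmat vs = map (\<lambda>v. map (\<lambda>w. v = w \<or> w \<in> nb V v) vs) vs"
    unfolding cmat_def by (intro map_cong refl) (simp add: a del: nb_iff)
  also have "\<dots> = C7_matrix"
    using vs(2) unfolding C7_matrix_rows vs(1) by (simp del: nb_iff add: n) (auto simp del: nb_iff)
  finally show "special (set vs)" using vs(2) unfolding special_def by (auto simp: sporadic_def)
  have "w \<in> set vs" if "v \<in> set vs" "w \<in> nb V v" for v w
    using that unfolding vs(1) by (auto simp del: nb_iff simp add: n)
  then show "closed V (set vs)" using vs(3) unfolding closed_def by auto
qed

lemma closed_nb: "closed V K \<Longrightarrow> z \<in> K \<Longrightarrow> nb K z = nb V z"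
  unfolding closed_def by auto

lemma closed_good:
  assumes "closed V K" "good K x"
  shows "good V x"
proof -
  have n: "\<And>z. z \<in> K \<Longrightarrow> nb K z = nb V z" using closed_nb[OF assms(1)] .
  have KV: "K \<subseteq> V" using assms(1) by (simp add: closed_def)
  have "basic5 V x b c d e" if "basic5 K x b c d e" for b c d e
  proof -
    note a = basic5_adj[OF that]
    have "{x, b, c, d, e} \<subseteq> V" using a(6-10) KV by blast
    then show ?thesis
      using that by (simp add: basic5_def thin_def n[OF a(6), symmetric] n[OF a(7), symmetric]
        n[OF a(8), symmetric] n[OF a(9), symmetric] n[OF a(10), symmetric] del: nb_iff)
  qed
  then show ?thesis using assms(2) n KV unfolding good_def by blast
qed

lemma closed_trans: "closed V K \<Longrightarrow> closed K X \<Longrightarrow> closed V X"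
  unfolding closed_def by blast

text \<open>Among all stable sets with a special closed set in the rest, choose the special set as
  large and then the stable set as small as possible. If the latter is nonempty, putting one of its
  vertices back contradicts either minimality or, by \<open>special_extends\<close>,
  maximality.\<close>

lemma special_closed_extends:
  assumes "wc V" "S \<subseteq> V" "indep S" "closed (V - cl S) X" "special X"
  shows "\<exists>Y. closed V Y \<and> special Y"
proof -
  define P where "P S X \<longleftrightarrow> S \<subseteq> V \<and> indep S \<and> closed (V - cl S) X \<and> special X" for S X
  have finV: "finite V" using wc_finite[OF assms(1)] .
  have bound: "card X \<le> card V" if "P S X" for S X
    using that finV unfolding P_def closed_def by (meson Diff_subset card_mono order_trans)
  define Q where "Q n \<longleftrightarrow> (\<exists>S X. P S X \<and> card X = n)" for n
  have q: "Q (card X)" using assms unfolding Q_def P_def by auto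
  have "{n. Q n} \<subseteq> {..card V}" using bound by (auto simp: Q_def)
  then have fin: "finite {n. Q n}" by (rule finite_subset) simp
  have "Max {n. Q n} \<in> {n. Q n}"
  proof (rule Max_in[OF fin])
    show "{n. Q n} \<noteq> {}" using q by blast
  qed
  then obtain m where m: "Q m" "\<And>n. Q n \<Longrightarrow> n \<le> m" using Max_ge[OF fin] by simp
  define R where "R n \<longleftrightarrow> (\<exists>S X. P S X \<and> card X = m \<and> card S = n)" for n
  have "\<exists>n. R n" using m(1) by (auto simp: Q_def R_def)
  then have "R (LEAST n. R n)" by (rule LeastI_ex)
  then obtain T Y where TY: "P T Y" "card Y = m" "card T = (LEAST n. R n)" by (auto simp: R_def)
  have least: "card T \<le> card T'" if "P T' Y'" "card Y' = m" for T' Y'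
    unfolding TY(3) by (rule Least_le) (use that in \<open>auto simp: R_def\<close>)
  show ?thesis
  proof (cases "T = {}")
    case True
    then have "V - cl T = V" by (simp add: cl_def)
    then show ?thesis using TY(1) by (auto simp: P_def)
  next
    case False
    then obtain t where t: "t \<in> T" by blast
    define T0 where "T0 = T - {t}"
    have T: "T \<subseteq> V" "indep T" "closed (V - cl T) Y" "special Y" using TY(1) by (auto simp: P_def)
    have T0: "T0 \<subseteq> V" "indep T0" using T by (auto simp: T0_def indep_def)
    have Tt: "T = T0 \<union> {t}" using t by (auto simp: T0_def)
    define V0 where "V0 = V - cl T0"
    have V0t: "V0 - cl {t} = V - cl T" unfolding V0_def Tt cl_Un by blast
    have "t \<in> V0" using T(1,2) t sym unfolding V0_def T0_def cl_def indep_def by blast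
    have wc0: "wc V0" using wc_diff[OF assms(1) T0] by (simp add: V0_def)
    show ?thesis
    proof (cases "closed V0 Y")
      case True
      then have "P T0 Y" using T0 T(4) by (auto simp: P_def V0_def)
      then have "card T \<le> card T0" using least TY(2) by blast
      moreover have "card T0 < card T"
        using t T(1) finV unfolding T0_def by (meson card_Diff1_less finite_subset)
      ultimately show ?thesis by simp
    next
      case False
      then obtain S' where S': "S' \<subseteq> V0" "indep S'" "special (V0 - cl S')" "card Y < card (V0 - cl S')"
        using special_extends[OF wc0 \<open>t \<in> V0\<close> _ T(4)] T(3) V0t by metis
      have e: "V - cl (T0 \<union> S') = V0 - cl S'" by (auto simp: V0_def cl_Un)
      have "indep (T0 \<union> S')" unfolding indep_Un
        using T0(2) S'(1,2) unfolding V0_def cl_def by blast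
      then have "P (T0 \<union> S') (V0 - cl S')"
        using T0(1) S'(1,3) e by (auto simp: P_def V0_def closed_def)
      then have "card (V0 - cl S') \<le> m" using m(2) by (auto simp: Q_def)
      then show ?thesis using S'(4) TY(2) by simp
    qed
  qed
qed

text \<open>Components are handled by induction, so \<open>V\<close> may be taken connected. If no
  closed set is special, none becomes so after a deletion, by \<open>special_closed_extends\<close>;
  then \<open>V\<close> is hereditary, and the resulting 7-cycle is itself special and
  closed.\<close>

theorem well_covered_classification:
  "wc V \<Longrightarrow> x \<in> V \<Longrightarrow> good V x \<or> nb V x = {} \<or> (\<exists>X. x \<in> X \<and> closed V X \<and> special X)"
proof (induction "card V" arbitrary: V x rule: less_induct)
  case less
  note wcV = less.prems(1) and xV = less.prems(2)
  have finV: "finite V" using wc_finite[OF wcV] .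
  let ?r = "{(a, b). a \<in> V \<and> b \<in> V \<and> a \<sim> b}"
  define K where "K = {z. (x, z) \<in> ?r\<^sup>*}"
  have xK: "x \<in> K" by (simp add: K_def)
  have KV: "K \<subseteq> V"
  proof
    fix z assume "z \<in> K"
    then have "(x, z) \<in> ?r\<^sup>*" by (simp add: K_def)
    then show "z \<in> V" by (induction rule: rtrancl_induct) (use xV in auto)
  qed
  have clK: "closed V K"
    unfolding closed_def using KV by (auto simp: K_def intro: rtrancl_into_rtrancl)
  show ?case
  proof (cases "K = V")
    case False
    then have "card K < card V" using KV finV by (simp add: psubset_card_mono psubset_eq)
    then have "good K x \<or> nb K x = {} \<or> (\<exists>X. x \<in> X \<and> closed K X \<and> special X)"
      by (rule less.hyps[OF _ wc_closed[OF wcV clK] xK])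
    then consider "good K x" | "nb K x = {}" | X where "x \<in> X" "closed K X" "special X" by blast
    then show ?thesis
    proof cases
      case 1
      then show ?thesis using closed_good[OF clK] by simp
    next
      case 2
      then show ?thesis using closed_nb[OF clK xK] by simp
    next
      case (3 X)
      then have "closed V X" using closed_trans[OF clK, of X] by simp
      then show ?thesis using 3(1,3) by metis
    qed
  next
    case True
    have conn: "X = V" if X: "closed V X" "X \<noteq> {}" for X
    proof -
      obtain z where z: "z \<in> X" using X(2) by blast
      then have "(x, z) \<in> ?r\<^sup>*" using X(1) True by (auto simp: K_def closed_def)
      then have "x \<in> X" using z
      proof (induction rule: rtrancl_induct)
        case (step y z)
        then have "y \<in> V" "z \<sim> y" using sym by auto
        then show ?case using step X(1) by (simp add: closed_def)
      qed simp
      have "w \<in> X" if "(x, w) \<in> ?r\<^sup>*" for w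
        using that by (induction rule: rtrancl_induct) (use \<open>x \<in> X\<close> X(1) in \<open>auto simp: closed_def\<close>)
      then show ?thesis using True X(1) by (auto simp: K_def closed_def)
    qed
    show ?thesis
    proof (rule ccontr)
      assume n0: "\<not> ?thesis"
      then have n: "\<not> good V x" "nb V x \<noteq> {}" "\<And>X. x \<in> X \<Longrightarrow> closed V X \<Longrightarrow> \<not> special X"
        by simp_all
      have nsp: "\<not> (closed V Y \<and> special Y)" for Y
      proof
        assume Y: "closed V Y \<and> special Y"
        then have "Y = V" using conn[of Y] special_nonempty[of Y] by simp
        then show False using n(3)[of Y] Y xV by simp
      qed
      have her: "hereditary V"
        unfolding hereditary_def
      proof (intro allI impI ballI)
        fix S z assume S: "S \<subseteq> V" "S \<noteq> {}" "indep S" and z: "z \<in> V - cl S"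
        have "S \<subseteq> cl S" by (auto simp: cl_def)
        then have "V - cl S \<subset> V" using S(1,2) by blast
        then have "card (V - cl S) < card V" using finV by (rule psubset_card_mono[rotated])
        then have "good (V - cl S) z \<or> nb (V - cl S) z = {} \<or>
            (\<exists>X. z \<in> X \<and> closed (V - cl S) X \<and> special X)"
          by (rule less.hyps[OF _ wc_diff[OF wcV S(1,3)] z])
        moreover have "\<not> (closed (V - cl S) X \<and> special X)" for X
          using special_closed_extends[OF wcV S(1,3), of X] nsp by metis
        ultimately show "good (V - cl S) z \<or> nb (V - cl S) z = {}" by metis
      qed
      obtain vs where "seven_cycle V vs"
        using hereditary_bad_seven_cycle[OF wcV her conn xV n(1,2)] by metis
      then show False using seven_cycle_special[of V vs] nsp[of "set vs"] by simp
    qed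
  qed
qed

end

section \<open>Evaluating maximal stable sets and out-neighbourhoods on fixed graphs\<close>

fun adj_tri :: "nat \<Rightarrow> bool list list \<Rightarrow> bool list list" where
  "adj_tri k [] = []"
| "adj_tri k (r # rs) = drop (Suc k) r # adj_tri (Suc k) rs"

text \<open>\<open>gen\<close> applied to the adjacencies beyond the diagonal lists the stable sets;
  the maximal ones leave no vertex undominated.\<close>

definition equicardinal :: "bool list list \<Rightarrow> nat \<Rightarrow> bool" where
  "equicardinal C a \<longleftrightarrow> every (\<lambda>T. if bnull (und C T) then bcount T = a else True) (gen (adj_tri 0 C))"

fun submasks :: "bool list \<Rightarrow> bool list list" where
  "submasks [] = [[]]"
| "submasks (b # bs) = (let R = submasks bs in
     if b then map ((#) False) R @ map ((#) True) R else map ((#) False) R)"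

text \<open>A stable set \<open>S\<close> refutes the set \<open>os\<close> of out-neighbours of a vertex \<open>y\<close> with adjacency row \<open>r\<close> if \<open>S\<close> contains a
  neighbour of \<open>y\<close> but misses \<open>os\<close>, and some \<open>z\<close> in \<open>os\<close> is the only undominated vertex of its closed
  neighbourhood: no stable set containing \<open>S\<close> and missing \<open>os\<close> is then maximal.\<close>

fun detects :: "bool list list \<Rightarrow> bool list \<Rightarrow> bool list \<Rightarrow> bool" where
  "detects (r # C) (z # os) u =
     (if z then if bcount (band r u) = 1 then True else detects C os u else detects C os u)"
| "detects _ _ u = False"

definition refutes :: "bool list list \<Rightarrow> bool list \<Rightarrow> bool list \<Rightarrow> bool list \<Rightarrow> bool" where
  "refutes C r os S \<longleftrightarrow> (if bdisj os S then if bdisj r S then False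
     else let u = und C S in detects C (band os u) u else False)"

fun without :: "bool list \<Rightarrow> nat \<Rightarrow> bool list" where
  "without (b # bs) 0 = False # bs"
| "without (b # bs) (Suc n) = b # without bs n"
| "without [] n = []"

text \<open>The candidates \<open>os\<close> are possible out-neighbourhoods of a non-sink of weight
  greater than one: nonempty, and not the full neighbourhood, since such a vertex is no source.
  \<open>ex\<close> lists the candidates exempt from refutation.\<close>

definition sinks_only :: "bool list list \<Rightarrow> bool list list \<Rightarrow> (nat \<times> bool list) list \<Rightarrow> bool" where
  "sinks_only C ss ex \<longleftrightarrow> every (stab C) ss \<and> every (\<lambda>y. let r = without (C ! y) y in
     every (\<lambda>os. if bnull os then True else if os = r then True
       else if some (\<lambda>S. if S ! y then False else refutes C r os S) ss then True
       else some (\<lambda>p. p = (y, os)) ex) (submasks r)) [0..<length C]"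

lemma submasks_complete: "(\<And>x. x \<in> set xs \<Longrightarrow> f x \<Longrightarrow> g x) \<Longrightarrow> map f xs \<in> set (submasks (map g xs))"
  by (induction xs) (auto simp: Let_def)

lemma without_map: "distinct xs \<Longrightarrow> i < length xs \<Longrightarrow> without (map f xs) i = map (\<lambda>x. f x \<and> x \<noteq> xs ! i) xs"
proof (induction xs arbitrary: i)
  case (Cons a xs)
  show ?case
  proof (cases i)
    case 0
    then show ?thesis using Cons.prems by (auto simp: map_eq_conv)
  next
    case (Suc j)
    then show ?thesis using Cons by auto
  qed
qed simp

lemma detects_map: "detects (map (\<lambda>x. map (f x) vs) us) (map p us) (map u vs) \<Longrightarrow> distinct vs \<Longrightarrow>
    \<exists>z\<in>set us. p z \<and> card {v \<in> set vs. f z v \<and> u v} = 1"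
  by (induction us) (auto simp: band_map bcount_map split: if_splits)

section \<open>Uniqueness of the pendant edge or basic 5-cycle through a vertex\<close>

context girth5 begin

lemma pendant_unique:
  assumes "wc V" "l \<in> V" "l' \<in> V" "nb V l = {s}" "nb V l' = {s'}" "{l, s} \<inter> {l', s'} \<noteq> {}"
  shows "{l, s} = {l', s'}"
proof -
  have e: "l \<sim> s" "l' \<sim> s'" "s \<in> V" "s' \<in> V" using assms(4,5) by (auto simp: set_eq_iff)
  consider "l = l'" | "l = s'" | "s = l'" | "s = s'" "l \<noteq> l'" using assms(6) by blast
  then show ?thesis
  proof cases
    case 1
    then show ?thesis using assms(4,5) by auto
  next
    case 2
    then have "l' \<in> nb V l" using sym[OF e(2)] assms(3) by simp
    then have "l' = s" using assms(4) by simp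
    then show ?thesis using 2 by (simp add: insert_commute)
  next
    case 3
    then have "l \<in> nb V l'" using sym[OF e(1)] assms(2) by simp
    then have "l = s'" using assms(5) by simp
    then show ?thesis using 3 by (simp add: insert_commute)
  next
    case 4
    have "\<not> l \<sim> l'"
    proof
      assume "l \<sim> l'"
      then have "l' \<in> nb V l" using assms(3) by simp
      then have "l' = s" using assms(4) by simp
      then show False using e 4 irr by blast
    qed
    then show ?thesis
      using exchange[OF assms(1), of "[l, l']" "[s]"] assms(2-5) e 4 sym by (simp add: cl_iff)
  qed
qed

text \<open>The vertex \<open>x\<close> has degree at least three, so its neighbours on both cycles
  are thin and \<open>d = d'\<close>. Then \<open>x\<close> and \<open>d\<close> replace
  \<open>e\<close>, \<open>b\<close> and \<open>b'\<close>.\<close>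

lemma basic5_unique_aux:
  assumes "wc V" "basic5 V x b c d e" "basic5 V x b' c' d' e'" "b \<notin> {b', e'}" "e = e'"
  shows False
proof -
  note a = basic5_adj[OF assms(2)] and a' = basic5_adj[OF assms(3)]
  note f = c5_facts[OF a(1-5)] and f' = c5_facts[OF a'(1-5)]
  have "b' \<noteq> e" "b' \<noteq> b" using f' assms(4,5) by auto
  have "b' \<in> nb V x" "b \<in> nb V x" "e \<in> nb V x" using a a' sym by auto
  then have "\<not> thin V e x b" "\<not> thin V e' x b'"
    using assms(4,5) \<open>b' \<noteq> e\<close> \<open>b' \<noteq> b\<close> unfolding thin_def by blast+
  then have t: "nb V b = {x, c}" "nb V e = {d, x}" "nb V b' = {x, c'}" "nb V e = {d', x}"
    using assms(2,3,5) by (auto simp: basic5_def thin_def)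
  then have dd: "d = d'" using f f' by (auto simp: doubleton_eq_iff)
  have bb: "\<not> b \<sim> b'" "\<not> b \<sim> e" "\<not> b' \<sim> e"
    using no_common a(1,5) a'(1) sym by blast+
  show False
    by (rule exchange[OF assms(1), of "[e, b, b']" "[x, d]"])
      (use t dd a a' f f' bb \<open>b' \<noteq> e\<close> \<open>b' \<noteq> b\<close> in \<open>auto simp: cl_iff comm\<close>)
qed

text \<open>With \<open>d\<close> and \<open>d'\<close> on both sides, \<open>x\<close> replaces
  \<open>b\<close> and \<open>b'\<close>, which are thin because \<open>x\<close> has degree at
  least four; \<open>d\<close> and \<open>d'\<close> cover their other neighbours \<open>c\<close>
  and \<open>c'\<close>.\<close>

lemma basic5_disjoint_aux:
  assumes "wc V" "basic5 V x b c d e" "basic5 V x b' c' d' e'" "{b, e} \<inter> {b', e'} = {}"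
    "thin V c d e" "thin V c' d' e'"
  shows False
proof -
  note a = basic5_adj[OF assms(2)] and a' = basic5_adj[OF assms(3)]
  note f = c5_facts[OF a(1-5)] and f' = c5_facts[OF a'(1-5)]
  have "{b, e, b', e'} \<subseteq> nb V x" using a a' sym by auto
  then have "\<not> thin V e x b" "\<not> thin V e' x b'"
    using assms(4) unfolding thin_def by (metis Int_iff empty_iff insertCI insertE singletonD subsetD)+
  note nt = this
  have t: "nb V b = {x, c}" "nb V e = {d, x}" "nb V b' = {x, c'}" "nb V e' = {d', x}"
    "nb V d = {c, e}" "nb V d' = {c', e'}"
  proof -
    have "thin V x b c" "thin V d e x" "thin V x b' c'" "thin V d' e' x"
      using assms(2,3) nt unfolding basic5_def by blast+
    then show "nb V b = {x, c}" "nb V e = {d, x}" "nb V b' = {x, c'}" "nb V e' = {d', x}"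
      "nb V d = {c, e}" "nb V d' = {c', e'}"
      using assms(5,6) by (simp_all add: thin_def)
  qed
  have E: "u = v \<or> u = w" if "nb V z = {v, w}" "u \<in> V" "z \<sim> u" for z u v w
      using nb_iff[of u V z] unfolding that(1) using that(2,3) by simp
  have ne: "d \<noteq> d'" "d \<noteq> b'" "d' \<noteq> b"
  proof -
    show "d \<noteq> d'"
    proof
      assume "d = d'"
      then have "e \<in> nb V d'" using a(4,10) by simp
      then have "e \<in> {c', e'}" unfolding t(6) .
      then have "e = c'" using assms(4) by auto
      then have "x \<sim> c'" using a(5) sym by blast
      then show False using f'(1) by blast
    qed
    show "d \<noteq> b'" using f(2) a'(1) by blast
    show "d' \<noteq> b" using f'(2) a(1) by blast
  qed
  have "\<not> b \<sim> b'" using no_common a(1) a'(1) by blast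
  moreover have "\<not> d \<sim> d'"
  proof
    assume "d \<sim> d'"
    then have "d' = c \<or> d' = e" using E[OF t(5)] a'(9) by blast
    moreover have "d' \<noteq> e" using f'(2) a(5) sym by blast
    ultimately have "c = d'" by blast
    then have "b = c' \<or> b = e'" using E[OF t(6), of b] a(2,7) sym by blast
    then show False using f'(1) a(1) assms(4) by blast
  qed
  moreover have "\<not> d \<sim> b'"
  proof
    assume "d \<sim> b'"
    then have "b' = c \<or> b' = e" using E[OF t(5)] a'(7) by blast
    then show False using f(1) a'(1) assms(4) by blast
  qed
  moreover have "\<not> b \<sim> d'"
  proof
    assume "b \<sim> d'"
    then have "b = c' \<or> b = e'" using E[OF t(6)] a(7) sym by blast
    then show False using f'(1) a(1) assms(4) by blast
  qed
  ultimately have n: "\<not> b \<sim> b'" "\<not> d \<sim> d'" "\<not> d \<sim> b'" "\<not> b \<sim> d'" by blast+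
  have bb: "b \<noteq> b'" using assms(4) by blast
  show False
    by (rule exchange[OF assms(1), of "[b, d, b', d']" "[x, d, d']"])
      (use t a a' f f' n ne bb in \<open>auto simp: cl_iff comm\<close>)
qed

text \<open>Reflections reduce the cases of one or no shared neighbour of \<open>x\<close> to the
  two lemmas above. If both are shared and the opposite edges differ, then \<open>x\<close>,
  \<open>c\<close> and \<open>d'\<close> are thin and are replaced by \<open>b\<close> and
  \<open>e\<close>.\<close>

lemma basic5_unique:
  assumes "wc V" "basic5 V x b c d e" "basic5 V x b' c' d' e'"
  shows "{x, b, c, d, e} = {x, b', c', d', e'}"
proof (rule ccontr)
  assume n: "\<not> ?thesis"
  note r = basic5_reflect[OF assms(2)] and r' = basic5_reflect[OF assms(3)]
  have same: "{x, b, c, d, e} = {x, b', c', d', e'}" if "b = b'" "e = e'"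
    "basic5 V x b c d e" "basic5 V x b' c' d' e'" for b c d e b' c' d' e'
  proof -
    note a = basic5_adj[OF that(3)] and a' = basic5_adj[OF that(4)]
    note f = c5_facts[OF a(1-5)] and f' = c5_facts[OF a'(1-5)]
    have t: "thin V b c d \<or> thin V c d e" "thin V x b c \<or> thin V b c d" "thin V c d e \<or> thin V d e x"
      "thin V x b c \<or> thin V e x b" "thin V d e x \<or> thin V e x b"
      using that(3) unfolding basic5_def by blast+
    have E: "u = v \<or> u = w" if "nb V z = {v, w}" "u \<in> V" "z \<sim> u" for z u v w
      using nb_iff[of u V z] unfolding that(1) using that(2,3) by simp
    have cc: "c = c'" if tb: "thin V x b c"
      using E[OF tb[unfolded thin_def], of c'] a'(2,8) f'(6) \<open>b = b'\<close> by auto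
    have dd: "d = d'" if te: "thin V d e x"
      using E[OF te[unfolded thin_def], of d'] sym[OF a'(4)] a'(9) f'(6) \<open>e = e'\<close> by auto
    have cd: "d = d'" if "c = c'"
      using no4[of c d d' e] a(3,4) a'(3,4) f(6) sym that \<open>e = e'\<close> by auto
    have dc: "c = c'" if "d = d'"
      using no4[of b c c' d] a(2,3) a'(2,3) f(6) sym that \<open>b = b'\<close> by auto
    have "c = c' \<and> d = d'"
    proof (cases "thin V x b c \<or> thin V d e x")
      case True
      then show ?thesis using cc dd cd dc by blast
    next
      case False
      then have th: "thin V e x b" "thin V b c d" "thin V c d e" using t by blast+
      show ?thesis
      proof (rule ccontr)
        assume "\<not> ?thesis"
        then have ne: "c \<noteq> c'" "d \<noteq> d'" using cd dc by blast+
        have "\<not> thin V c' d' e' \<Longrightarrow> thin V d' e' x"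
          using that(4) unfolding basic5_def by blast
        moreover have "\<not> thin V d' e' x"
        proof
          assume te: "thin V d' e' x"
          have "d = d' \<or> d = x"
            by (rule E[OF te[unfolded thin_def]]) (use sym[OF a(4)] a(9) \<open>e = e'\<close> in simp_all)
          then show False using ne f(6) by auto
        qed
        ultimately have th': "thin V c' d' e'" by blast
        have n: "nb V x = {e, b}" "nb V c = {b, d}" "nb V d' = {c', e'}" using th th' by (simp_all add: thin_def)
        have "\<not> c \<sim> d'"
        proof
          assume "c \<sim> d'"
          then have "d' = b \<or> d' = d" using E[OF n(2)] a'(9) by blast
          then show False using ne f'(6) \<open>b = b'\<close> by auto
        qed
        moreover have "c \<noteq> d'" using f(1) f'(2) a(2) a'(2) f'(3) \<open>b = b'\<close> by blast
        ultimately show False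
          using exchange[OF assms(1), of "[x, c, d']" "[b, e]"] n a a' f f'(2,6) \<open>b = b'\<close> \<open>e = e'\<close> sym[OF a'(4)] sym[OF a(4)]
            sym[OF a(1)] by (simp add: cl_iff)
      qed
    qed
    then show ?thesis using that(1,2) by simp
  qed
  have t: "thin V b c d \<or> thin V c d e" "thin V b' c' d' \<or> thin V c' d' e'"
    using assms(2,3) by (auto simp: basic5_def)
  have flip: "thin V d c b" if "thin V b c d" for b c d using that by (simp add: thin_def insert_commute)
  show False
  proof (cases "{b, e} \<inter> {b', e'} = {}")
    case True
    then show False
      using t basic5_disjoint_aux[OF assms] basic5_disjoint_aux[OF assms(1) r assms(3)]
        basic5_disjoint_aux[OF assms(1,2) r'] basic5_disjoint_aux[OF assms(1) r r'] flip
      by (metis insert_commute)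
  next
    case False
    then consider "b = b'" "e = e'" | "b = e'" "e = b'" | "b \<noteq> b'" "e = e'" | "b \<noteq> e'" "e = b'"
      | "b = b'" "e \<noteq> e'" | "b = e'" "e \<noteq> b'"
      by blast
    then show False
    proof cases
      case 1
      then show False using same[OF _ _ assms(2,3)] n by blast
    next
      case 2
      then show False using same[OF _ _ assms(2) r'] n by auto
    next
      case 3
      then show False using basic5_unique_aux[OF assms] c5_facts(6) basic5_adj[OF assms(2)] by auto
    next
      case 4
      then show False using basic5_unique_aux[OF assms(1,2) r'] c5_facts(6) basic5_adj[OF assms(2)] by auto
    next
      case 5
      then show False using basic5_unique_aux[OF assms(1) r r'] c5_facts(6) basic5_adj[OF assms(2)] by auto
    next
      case 6
      then show False using basic5_unique_aux[OF assms(1) r assms(3)] c5_facts(6) basic5_adj[OF assms(2)] by auto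
    qed
  qed
qed

section \<open>Maximal stable sets and soundness of the checks\<close>

definition max_indep :: "'v set \<Rightarrow> 'v set \<Rightarrow> bool" where
  "max_indep V S \<longleftrightarrow> S \<subseteq> V \<and> indep S \<and> V \<subseteq> cl S"

lemma max_indep_extends:
  assumes "finite V" "S0 \<subseteq> V" "indep S0"
  obtains S where "S0 \<subseteq> S" "max_indep V S"
proof -
  obtain S where S: "S \<subseteq> V - cl S0" "indep S" "V - cl S0 \<subseteq> cl S"
    using maximal_indep[of "V - cl S0"] assms(1) by blast
  have "indep (S0 \<union> S)" unfolding indep_Un using assms(3) S(1,2) by (auto simp: cl_iff)
  moreover have "V \<subseteq> cl (S0 \<union> S)" using S(3) by (auto simp: cl_Un)
  ultimately show thesis using that[of "S0 \<union> S"] assms(2) S(1) by (auto simp: max_indep_def)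
qed

text \<open>Complete \<open>B\<close> to a maximal stable set by some \<open>S\<close> outside
  \<open>cl B\<close>. Since \<open>cl B\<close> contains \<open>cl A\<close> within
  \<open>V\<close>, the same \<open>S\<close> can be added to \<open>A\<close>, and maximal sets of
  equal size give the inequality.\<close>

lemma wcI:
  assumes fin: "finite V" and eq: "\<And>S T. max_indep V S \<Longrightarrow> max_indep V T \<Longrightarrow> card S = card T"
  shows "wc V"
  unfolding wc_def
proof (intro conjI allI impI)
  show "finite V" by (rule fin)
  fix A B assume *: "A \<subseteq> V" "B \<subseteq> V" "indep A" "indep B" "V \<inter> cl A \<subseteq> cl B"
  obtain S where S: "S \<subseteq> V - cl B" "indep S" "V - cl B \<subseteq> cl S"
    using maximal_indep[of "V - cl B"] fin by blast
  have iB: "indep (B \<union> S)" unfolding indep_Un using *(4) S(1,2) by (auto simp: cl_iff)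
  have "S \<inter> cl A = {}" using S(1) *(5) by blast
  then have iA: "indep (A \<union> S)" unfolding indep_Un cl_def using *(3) S(2) by blast
  have mB: "max_indep V (B \<union> S)" using iB *(2) S by (auto simp: max_indep_def cl_Un)
  obtain T where T: "A \<union> S \<subseteq> T" "max_indep V T"
    using max_indep_extends[OF fin _ iA] *(1) S(1) by blast
  have finT: "finite T" "finite A" "finite B" "finite S"
    using T(2) *(1,2) S(1) fin finite_subset unfolding max_indep_def by blast+
  have "A \<inter> S = {}" "B \<inter> S = {}" using S(1) *(5,1) by (auto simp: cl_iff)
  then have "card A + card S = card (A \<union> S)" "card B + card S = card (B \<union> S)"
    using finT by (simp_all add: card_Un_disjoint)
  moreover have "card (A \<union> S) \<le> card T" using T(1) finT(1) by (rule card_mono[rotated])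
  moreover have "card T = card (B \<union> S)" using eq T(2) mB by blast
  ultimately show "card A \<le> card B" by linarith
qed

lemma gen_indep:
  assumes "indep A"
  shows "pre @ us = vs \<Longrightarrow> distinct vs \<Longrightarrow>
    map (\<lambda>v. v \<in> A) us \<in> set (gen (adj_tri (length pre) (map (\<lambda>x. map (\<lambda>y. x = y \<or> x \<sim> y) vs) us)))"
proof (induction us arbitrary: pre)
  case (Cons x us)
  have IH: "map (\<lambda>v. v \<in> A) us \<in> set (gen (adj_tri (Suc (length pre)) (map (\<lambda>x. map (\<lambda>y. x = y \<or> x \<sim> y) vs) us)))"
    using Cons.IH[of "pre @ [x]"] Cons.prems by simp
  have d: "drop (Suc (length pre)) (map (\<lambda>y. x = y \<or> x \<sim> y) vs) = map (\<lambda>y. x = y \<or> x \<sim> y) us"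
    unfolding Cons.prems(1)[symmetric] by simp
  have "bdisj (map (\<lambda>y. x = y \<or> x \<sim> y) us) (map (\<lambda>v. v \<in> A) us)" if "x \<in> A"
    using that assms Cons.prems unfolding bdisj_map indep_def by auto
  then show ?case using IH d by (auto simp: Let_def)
qed simp

lemma equicardinal_sound:
  assumes "distinct vs" "equicardinal (cmat vs) a" "max_indep (set vs) S"
  shows "card S = a"
proof -
  have S: "S \<subseteq> set vs" "indep S" "set vs \<subseteq> cl S" using assms(3) by (auto simp: max_indep_def)
  have "map (\<lambda>v. v \<in> S) vs \<in> set (gen (adj_tri 0 (cmat vs)))"
    unfolding cmat_def using gen_indep[OF S(2), of "[]" vs vs] assms(1) by simp
  moreover have "bnull (und (cmat vs) (map (\<lambda>v. v \<in> S) vs))"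
    unfolding und_cmat bnull_map using S(1,3) sym unfolding cl_def by blast
  ultimately have "bcount (map (\<lambda>v. v \<in> S) vs) = a"
    using assms(2) unfolding equicardinal_def every_iff by fastforce
  moreover have "{v \<in> set vs. v \<in> S} = S" using S(1) by blast
  ultimately show ?thesis using assms(1) by (simp add: bcount_map)
qed

lemma sinks_only_sound:
  assumes "distinct vs" "sinks_only (cmat vs) ss ex" "i < length vs" "O' \<subseteq> nb (set vs) (vs ! i)"
    "O' \<noteq> {}" "O' \<noteq> nb (set vs) (vs ! i)" "(i, map (\<lambda>v. v \<in> O') vs) \<notin> set ex"
  obtains S z where "S \<subseteq> set vs" "indep S" "vs ! i \<notin> S" "O' \<inter> S = {}" "nb (set vs) (vs ! i) \<inter> S \<noteq> {}"
    "z \<in> O'" "z \<notin> cl S" "nb (set vs) z \<subseteq> cl S"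
proof -
  let ?y = "vs ! i"
  have yv: "?y \<in> set vs" using assms(3) by simp
  define r where "r = without (cmat vs ! i) i"
  have r: "r = map (\<lambda>v. ?y \<sim> v) vs"
    unfolding r_def cmat_def using assms(1,3) irr by (auto simp: without_map)
  let ?os = "map (\<lambda>v. v \<in> O') vs"
  have Ov: "O' \<subseteq> set vs" using assms(4) by auto
  have "?os \<in> set (submasks r)" unfolding r by (rule submasks_complete) (use assms(4) in auto)
  moreover have "\<not> bnull ?os" using assms(5) Ov by (auto simp: bnull_map)
  moreover have "?os \<noteq> r" using assms(4,6) unfolding r by (auto simp: map_eq_conv nb_def)
  moreover have "\<not> some (\<lambda>p. p = (i, ?os)) ex" using assms(7) by (auto simp: some_iff)
  moreover have "i \<in> set [0..<length (cmat vs)]" using assms(3) by (simp add: cmat_def)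
  ultimately have os: "?os \<in> set (submasks r)" "\<not> bnull ?os" "?os \<noteq> r" "\<not> some (\<lambda>p. p = (i, ?os)) ex"
    and i: "i \<in> set [0..<length (cmat vs)]"
    by blast+
  have "every (\<lambda>y. let r = without (cmat vs ! y) y in
     every (\<lambda>os. if bnull os then True else if os = r then True
       else if some (\<lambda>S. if S ! y then False else refutes (cmat vs) r os S) ss then True
       else some (\<lambda>p. p = (y, os)) ex) (submasks r)) [0..<length (cmat vs)]"
    using assms(2) by (simp only: sinks_only_def)
  from bspec[OF this[unfolded every_iff[of _ "[0..<length (cmat vs)]"]] i]
  have "every (\<lambda>os. if bnull os then True else if os = r then True
       else if some (\<lambda>S. if S ! i then False else refutes (cmat vs) r os S) ss then True
       else some (\<lambda>p. p = (i, os)) ex) (submasks r)"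
    by (simp only: Let_def r_def)
  note F = bspec[OF this[unfolded every_iff] os(1)]
  have "some (\<lambda>S. if S ! i then False else refutes (cmat vs) r ?os S) ss"
  proof (rule ccontr)
    assume n: "\<not> ?thesis"
    from F show False by (simp only: n os if_False)
  qed
  then obtain S where S: "S \<in> set ss" "\<not> S ! i" "refutes (cmat vs) r ?os S"
    by (auto simp: some_iff split: if_splits)
  have "stab (cmat vs) S" using assms(2) S(1) by (auto simp: sinks_only_def every_iff)
  then obtain p where p: "S = map p vs" "indep {v \<in> set vs. p v}" using stab_cmat[OF assms(1)] by blast
  let ?S = "{v \<in> set vs. p v}"
  have rf: "bdisj ?os S" "\<not> bdisj r S" "detects (cmat vs) (band ?os (und (cmat vs) S)) (und (cmat vs) S)"
    using S(3) unfolding refutes_def Let_def by (auto split: if_splits)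
  let ?u = "\<lambda>x. \<forall>y\<in>set vs. p y \<longrightarrow> x \<noteq> y \<and> \<not> x \<sim> y"
  have "detects (map (\<lambda>x. map (\<lambda>y. x = y \<or> x \<sim> y) vs) vs) (map (\<lambda>x. x \<in> O' \<and> ?u x) vs) (map ?u vs)"
    by (rule rf(3)[unfolded p(1) und_cmat band_map, unfolded cmat_def])
  from detects_map[OF this assms(1)]
  obtain z where z: "z \<in> set vs" "z \<in> O'" "?u z" "card {v \<in> set vs. (z = v \<or> z \<sim> v) \<and> ?u v} = 1"
    by blast
  obtain w where "{v \<in> set vs. (z = v \<or> z \<sim> v) \<and> ?u v} = {w}" using z(4) by (auto simp: card_1_singleton_iff)
  moreover from this have "z \<in> {w}" using z(1,3) by blast
  ultimately have only: "{v \<in> set vs. (z = v \<or> z \<sim> v) \<and> ?u v} = {z}" by simp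
  have dom: "v \<in> cl ?S" if "v \<in> set vs" "\<not> ?u v" for v
    using that sym unfolding cl_def by blast
  show thesis
  proof (rule that[of ?S z])
    show "indep ?S" by (rule p(2))
    show "?y \<notin> ?S" using S(2) p(1) assms(3) by simp
    show "O' \<inter> ?S = {}" using rf(1) unfolding p(1) bdisj_map by blast
    show "nb (set vs) ?y \<inter> ?S \<noteq> {}" using rf(2) unfolding p(1) r bdisj_map nb_def by blast
    show "z \<notin> cl ?S" using z(3) sym unfolding cl_def by blast
    show "nb (set vs) z \<subseteq> cl ?S"
    proof
      fix v assume v: "v \<in> nb (set vs) z"
      then have "v \<noteq> z" using irr by auto
      then have "\<not> ?u v" using only v by (auto simp del: nb_iff simp: nb_def)
      then show "v \<in> cl ?S" using dom v by simp
    qed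
  qed (use z in auto)
qed

end

section \<open>Strong vertex covers\<close>

definition dadj :: "'v wograph \<Rightarrow> 'v \<Rightarrow> 'v \<Rightarrow> bool" where
  "dadj D x y \<longleftrightarrow> (x, y) \<in> arcs D \<or> (y, x) \<in> arcs D"

text \<open>\<open>L1\<close> is the part \<open>L\<^sub>1(C)\<close> of the usual partition \<open>L\<^sub>1, L\<^sub>2, L\<^sub>3\<close> of a vertex cover; a vertex of a cover
  lies in \<open>L\<^sub>3(C)\<close> if all its neighbours belong to the cover.\<close>

definition L1 :: "'v wograph \<Rightarrow> 'v set \<Rightarrow> 'v set" where
  "L1 D C = {x \<in> C. \<exists>y. (x, y) \<in> arcs D \<and> y \<notin> C}"

definition strong_cover :: "'v wograph \<Rightarrow> 'v set \<Rightarrow> bool" where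
  "strong_cover D C \<longleftrightarrow> C \<subseteq> verts D \<and> (\<forall>x y. (x, y) \<in> arcs D \<longrightarrow> x \<in> C \<or> y \<in> C) \<and>
     (\<forall>x\<in>C. (\<forall>y. dadj D x y \<longrightarrow> y \<in> C) \<longrightarrow> (\<exists>y\<in>C - L1 D C. (y, x) \<in> arcs D \<and> 1 < weight D y))"

definition equal_covers :: "'v wograph \<Rightarrow> bool" where
  "equal_covers D \<longleftrightarrow> (\<forall>C C'. strong_cover D C \<longrightarrow> strong_cover D C' \<longrightarrow> card C = card C')"

lemma underlying_edge: "{x, y} \<in> snd (underlying D) \<longleftrightarrow> dadj D x y"
  by (auto simp: underlying_def dadj_def doubleton_eq_iff)

lemma cycle_edges_image: "cycle_edges c = (\<lambda>i. {c ! i, c ! (Suc i mod length c)}) ` {..<length c}"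
  unfolding cycle_edges_def by blast

lemma cycle_edges_3: "cycle_edges [a, b, c] = {{a, b}, {b, c}, {c, a}}"
  unfolding cycle_edges_image by (simp add: lessThan_Suc insert_commute)

lemma cycle_edges_4: "cycle_edges [a, b, c, d] = {{a, b}, {b, c}, {c, d}, {d, a}}"
  unfolding cycle_edges_image by (simp add: lessThan_Suc insert_commute)

lemma cycle_edges_5: "cycle_edges [a, b, c, d, e] = {{a, b}, {b, c}, {c, d}, {d, e}, {e, a}}"
  unfolding cycle_edges_image by (simp add: lessThan_Suc insert_commute)

locale girth5_wograph =
  fixes D :: "'v wograph"
  assumes wog: "weighted_oriented_graph D"
    and sources: "\<And>x. source D x \<Longrightarrow> weight D x = 1"
    and girth: "girth_at_least 5 (underlying D)"
begin

abbreviation V where "V \<equiv> verts D"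

lemma finite_V: "finite V" and arcs_V: "(x, y) \<in> arcs D \<Longrightarrow> x \<in> V \<and> y \<in> V"
  and asym: "(x, y) \<in> arcs D \<Longrightarrow> (y, x) \<notin> arcs D" and weight_pos: "x \<in> V \<Longrightarrow> 1 \<le> weight D x"
  using wog by (auto simp: weighted_oriented_graph_def)

lemma dadj_V: "dadj D x y \<Longrightarrow> x \<in> V \<and> y \<in> V"
  using arcs_V by (auto simp: dadj_def)

sublocale girth5 "dadj D"
proof
  have irr: "x \<noteq> y" if "dadj D x y" for x y using that asym by (auto simp: dadj_def)
  show sym: "dadj D y x" if "dadj D x y" for x y using that by (auto simp: dadj_def)
  show "\<not> dadj D x z" if "dadj D x y" "dadj D y z" for x y z
  proof
    assume "dadj D x z"
    then have "is_cycle (underlying D) [x, y, z]"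
      using that irr sym by (auto simp: is_cycle_def cycle_edges_3 underlying_edge)
    then show False using girth by (auto simp: girth_at_least_def)
  qed
  show "a = b" if "dadj D x a" "dadj D x b" "dadj D y a" "dadj D y b" "x \<noteq> y" for x a b y
  proof (rule ccontr)
    assume "a \<noteq> b"
    then have "is_cycle (underlying D) [x, a, y, b]"
      using that irr sym by (auto simp: is_cycle_def cycle_edges_4 underlying_edge)
    then show False using girth by (auto simp: girth_at_least_def)
  qed
qed

lemma graph_nbrs_nb: "graph_nbrs (underlying D) x = nb V x"
  using dadj_V by (auto simp: graph_nbrs_def underlying_edge)

lemma fst_induced: "X \<subseteq> V \<Longrightarrow> fst (graph_induced (underlying D) X) = X"
  by (auto simp: graph_induced_def underlying_def)

text \<open>Two neighbours of a simplicial vertex would form a triangle with it.\<close>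

lemma simplicial_iff: "simplicial (underlying D) v \<longleftrightarrow> v \<in> V \<and> (nb V v = {} \<or> (\<exists>u. nb V v = {u}))"
proof
  assume s: "simplicial (underlying D) v"
  then have v: "v \<in> V" by (simp add: simplicial_def underlying_def)
  have "u = w" if u: "u \<in> nb V v" "w \<in> nb V v" for u w
  proof (rule ccontr)
    assume "u \<noteq> w"
    moreover have "u \<in> V \<inter> insert v (nb V v)" "w \<in> V \<inter> insert v (nb V v)" using u by auto
    ultimately have "{u, w} \<in> snd (graph_induced (underlying D) (insert v (nb V v)))"
      using s unfolding simplicial_def complete_graph_def graph_nbrs_nb
      by (auto simp: graph_induced_def underlying_def)
    then have "dadj D u w" by (auto simp: graph_induced_def underlying_edge)
    then show False using no_common[of v u w] u by simp
  qed
  then show "v \<in> V \<and> (nb V v = {} \<or> (\<exists>u. nb V v = {u}))" using v by blast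
next
  assume v: "v \<in> V \<and> (nb V v = {} \<or> (\<exists>u. nb V v = {u}))"
  have "{x, y} \<in> snd (underlying D)" if "x \<in> insert v (nb V v)" "y \<in> insert v (nb V v)" "x \<noteq> y" for x y
    using that v unfolding underlying_edge by (metis empty_iff insertE nb_iff sym singletonD)
  then show "simplicial (underlying D) v"
    using v unfolding simplicial_def complete_graph_def graph_nbrs_nb
    by (auto simp: graph_induced_def underlying_def simp del: nb_iff)
qed

lemma nb_V: "nb V v \<subseteq> V"
  by auto

lemma simplexes_iff: "H \<in> simplexes (underlying D) \<longleftrightarrow>
    (\<exists>v\<in>V. (nb V v = {} \<or> (\<exists>u. nb V v = {u})) \<and> H = graph_induced (underlying D) (insert v (nb V v)))"
  unfolding simplexes_def simplicial_iff graph_nbrs_nb by blast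

lemma thin_card: "thin V p c q \<Longrightarrow> card (nb V c) < 3"
  unfolding thin_def by (metis card_2_iff card.insert_remove card_insert_le_m1 card_insert_if finite.emptyI
      finite_insert le_imp_less_Suc numeral_2_eq_2 numeral_3_eq_3 card_1_singleton_iff lessI less_SucI One_nat_def insert_absorb2)

lemma card_thin:
  assumes "card (nb V c) < 3" "c \<in> V" "p \<noteq> q" "dadj D c p" "dadj D c q"
  shows "thin V p c q"
proof -
  have "{p, q} \<subseteq> nb V c" using assms dadj_V by auto
  moreover have "card (nb V c) \<le> card {p, q}" using assms(1,3) by simp
  moreover have "finite (nb V c)" using finite_V by (simp add: nb_def)
  ultimately have "{p, q} = nb V c" by (intro card_seteq) auto
  then show ?thesis by (simp add: thin_def)
qed

lemma basic5_edge_thin: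
  assumes "basic5 V a b c d e" "{x, y} \<in> {{a, b}, {b, c}, {c, d}, {d, e}, {e, a}}"
  shows "card (nb V x) < 3 \<or> card (nb V y) < 3"
proof -
  have "card (nb V a) < 3 \<or> card (nb V b) < 3" "card (nb V b) < 3 \<or> card (nb V c) < 3"
    "card (nb V c) < 3 \<or> card (nb V d) < 3" "card (nb V d) < 3 \<or> card (nb V e) < 3"
    "card (nb V e) < 3 \<or> card (nb V a) < 3"
    using assms(1) thin_card unfolding basic5_def by blast+
  then show ?thesis using assms(2) by (auto simp: doubleton_eq_iff simp del: nb_iff)
qed

lemma induced_5_edges:
  assumes "dadj D a b" "dadj D b c" "dadj D c d" "dadj D d e" "dadj D e a"
  shows "snd (graph_induced (underlying D) {a, b, c, d, e}) = cycle_edges [a, b, c, d, e]"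
proof -
  note f = c5_facts[OF assms]
  have "{x, y} \<in> cycle_edges [a, b, c, d, e]" if "dadj D x y" "{x, y} \<subseteq> {a, b, c, d, e}" for x y
  proof -
    have n: "\<not> dadj D c a" "\<not> dadj D d a" "\<not> dadj D d b" "\<not> dadj D e b" "\<not> dadj D e c"
      using f(1-5) sym by blast+
    have "x = a \<or> x = b \<or> x = c \<or> x = d \<or> x = e" "y = a \<or> y = b \<or> y = c \<or> y = d \<or> y = e"
      using that(2) by auto
    then show ?thesis
      using that(1) f(1-5) n irr unfolding cycle_edges_5 by (elim disjE) (simp_all add: insert_commute)
  qed
  moreover have "\<exists>x y. E = {x, y} \<and> dadj D x y" if "E \<in> snd (underlying D)" for E
    using that by (auto simp: underlying_def dadj_def)
  ultimately have "E \<in> cycle_edges [a, b, c, d, e]"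
    if "E \<in> snd (graph_induced (underlying D) {a, b, c, d, e})" for E
    using that unfolding graph_induced_def snd_conv mem_Collect_eq by metis
  moreover have "cycle_edges [a, b, c, d, e] \<subseteq> snd (graph_induced (underlying D) {a, b, c, d, e})"
    using assms unfolding cycle_edges_5 graph_induced_def by (simp add: underlying_edge)
  ultimately show ?thesis by blast
qed

lemma is_cycle_5:
  "is_cycle (underlying D) [a, b, c, d, e] \<longleftrightarrow> dadj D a b \<and> dadj D b c \<and> dadj D c d \<and> dadj D d e \<and> dadj D e a"
  using c5_facts(6)[of a b c d e] by (auto simp: is_cycle_def cycle_edges_5 underlying_edge)

lemma basic_5_cycles_iff: "H \<in> basic_5_cycles (underlying D) \<longleftrightarrow>
    (\<exists>a b c d e. basic5 V a b c d e \<and> H = graph_induced (underlying D) {a, b, c, d, e})"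
proof
  assume H: "H \<in> basic_5_cycles (underlying D)"
  then obtain l where l: "is_cycle (underlying D) l" "length l = 5" "H = graph_induced (underlying D) (set l)"
    by (auto simp: basic_5_cycles_def induced_5_cycles_def)
  then obtain a b c d e where ls: "l = [a, b, c, d, e]"
    by (auto simp: length_Suc_conv eval_nat_numeral)
  have adj: "dadj D a b" "dadj D b c" "dadj D c d" "dadj D d e" "dadj D e a"
    using l(1) unfolding ls is_cycle_5 by auto
  note f = c5_facts[OF adj]
  have V: "a \<in> V" "b \<in> V" "c \<in> V" "d \<in> V" "e \<in> V" using adj dadj_V by blast+
  have deg: "card (nb V x) < 3 \<or> card (nb V y) < 3" if "{x, y} \<in> cycle_edges [a, b, c, d, e]" for x y
  proof -
    have "{x, y} \<in> snd H" using that induced_5_edges[OF adj] l(3) ls by simp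
    then have "\<not> (3 \<le> graph_deg (underlying D) x \<and> 3 \<le> graph_deg (underlying D) y)"
      using H by (auto simp: basic_5_cycles_def)
    then show ?thesis by (auto simp: graph_deg_def graph_nbrs_nb)
  qed
  have th: "card (nb V a) < 3 \<Longrightarrow> thin V e a b" "card (nb V b) < 3 \<Longrightarrow> thin V a b c"
    "card (nb V c) < 3 \<Longrightarrow> thin V b c d" "card (nb V d) < 3 \<Longrightarrow> thin V c d e" "card (nb V e) < 3 \<Longrightarrow> thin V d e a"
    using card_thin V adj sym f(6) by auto
  have "basic5 V a b c d e"
    unfolding basic5_def using V adj deg[of a b] deg[of b c] deg[of c d] deg[of d e] deg[of e a] th
    by (auto simp: cycle_edges_5)
  moreover have "H = graph_induced (underlying D) {a, b, c, d, e}" using l(3) ls by simp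
  ultimately show "\<exists>a b c d e. basic5 V a b c d e \<and> H = graph_induced (underlying D) {a, b, c, d, e}"
    by blast
next
  assume "\<exists>a b c d e. basic5 V a b c d e \<and> H = graph_induced (underlying D) {a, b, c, d, e}"
  then obtain a b c d e where b: "basic5 V a b c d e" and H: "H = graph_induced (underlying D) {a, b, c, d, e}"
    by blast
  note adj = basic5_adj(1-5)[OF b]
  have "is_cycle (underlying D) [a, b, c, d, e]" using adj by (simp add: is_cycle_5)
  then have "H \<in> induced_5_cycles (underlying D)"
    unfolding induced_5_cycles_def using H induced_5_edges[OF adj]
    by (intro CollectI exI[of _ "[a, b, c, d, e]"]) simp
  moreover have "\<not> (3 \<le> graph_deg (underlying D) x \<and> 3 \<le> graph_deg (underlying D) y)" if "{x, y} \<in> snd H" for x y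
  proof -
    have "{x, y} \<in> {{a, b}, {b, c}, {c, d}, {d, e}, {e, a}}"
      using that H induced_5_edges[OF adj] by (simp add: cycle_edges_5)
    then have "card (nb V x) < 3 \<or> card (nb V y) < 3" by (rule basic5_edge_thin[OF b])
    then show ?thesis by (auto simp: graph_deg_def graph_nbrs_nb)
  qed
  ultimately show "H \<in> basic_5_cycles (underlying D)" by (auto simp: basic_5_cycles_def)
qed

text \<open>The vertex sets of the members of \<open>simplexes\<close> and
  \<open>basic_5_cycles\<close> in girth five (see \<open>blocks\<close>).\<close>

definition block :: "'v set \<Rightarrow> bool" where
  "block B \<longleftrightarrow> (\<exists>v\<in>V. nb V v = {} \<and> B = {v}) \<or> (\<exists>v\<in>V. \<exists>u. nb V v = {u} \<and> B = {v, u}) \<or>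
     (\<exists>a b c d e. basic5 V a b c d e \<and> B = {a, b, c, d, e})"

lemma block_subset: "block B \<Longrightarrow> B \<subseteq> V"
  unfolding block_def basic5_def using nb_V by blast

lemma blocks: "H \<in> simplexes (underlying D) \<union> basic_5_cycles (underlying D) \<longleftrightarrow>
    (\<exists>B. block B \<and> H = graph_induced (underlying D) B)"
  unfolding Un_iff simplexes_iff basic_5_cycles_iff block_def by (auto simp del: nb_iff) (metis)+

lemma block_cover: "(\<exists>B. block B \<and> x \<in> B) \<longleftrightarrow> x \<in> V \<and> (good V x \<or> nb V x = {})"
proof
  assume "\<exists>B. block B \<and> x \<in> B"
  then obtain B where B: "block B" "x \<in> B" by blast
  have "x \<in> V" using B block_subset by blast
  from B(1) consider v where "v \<in> V" "nb V v = {}" "B = {v}" | v u where "v \<in> V" "nb V v = {u}" "B = {v, u}"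
    | a b c d e where "basic5 V a b c d e" "B = {a, b, c, d, e}" unfolding block_def by blast
  then show "x \<in> V \<and> (good V x \<or> nb V x = {})"
  proof cases
    case 2
    then show ?thesis using B(2) \<open>x \<in> V\<close> by (auto simp: good_def)
  next
    case 3
    then show ?thesis using B(2) basic5_good \<open>x \<in> V\<close> by blast
  qed (use B(2) in auto)
next
  assume x: "x \<in> V \<and> (good V x \<or> nb V x = {})"
  then consider "nb V x = {}" | u where "nb V x = {u}" | u where "u \<in> V" "nb V u = {x}"
    | b c d e where "basic5 V x b c d e" unfolding good_def by blast
  then show "\<exists>B. block B \<and> x \<in> B"
  proof cases
    case 1
    then have "block {x}" using x by (auto simp: block_def)
    then show ?thesis by blast
  next
    case (2 u)
    then have "block {x, u}" using x by (auto simp: block_def)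
    then show ?thesis by blast
  next
    case (3 u)
    then have "block {u, x}" by (auto simp: block_def)
    then show ?thesis by blast
  next
    case (4 b c d e)
    then have "block {x, b, c, d, e}" unfolding block_def by blast
    then show ?thesis by blast
  qed
qed

lemma block_unique:
  assumes "wc V" "block B" "block B'" "x \<in> B" "x \<in> B'"
  shows "B = B'"
proof -
  have rot: "\<exists>b c d e. basic5 V z b c d e \<and> B = {z, b, c, d, e}"
    if "basic5 V a b c d e" "B = {a, b, c, d, e}" "z \<in> B" for z a b c d e B
  proof -
    note r = basic5_rotate[OF that(1)]
    note r2 = basic5_rotate[OF r] and r3 = basic5_rotate[OF basic5_rotate[OF r]]
      and r4 = basic5_rotate[OF basic5_rotate[OF basic5_rotate[OF r]]]
    have "B = {b, c, d, e, a}" "B = {c, d, e, a, b}" "B = {d, e, a, b, c}" "B = {e, a, b, c, d}"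
      using that(2) by auto
    then show ?thesis using that r r2 r3 r4 by blast
  qed
  have cases: "(nb V x = {} \<and> B = {x}) \<or> (\<exists>v\<in>V. \<exists>u. nb V v = {u} \<and> B = {v, u}) \<or>
     (\<exists>b c d e. basic5 V x b c d e \<and> B = {x, b, c, d, e})" if "block B" "x \<in> B" for B
    using that(1) unfolding block_def using that(2) rot by blast
  have iso: False if "nb V x = {}" "dadj D x y" for y
  proof -
    have "y \<in> nb V x" using that(2) dadj_V by simp
    then show False using that(1) by blast
  qed
  have pend: False if "v \<in> V" "nb V v = {u}" "x \<in> {v, u}" "basic5 V x b c d e" for v u b c d e
  proof (cases "x = u")
    case True
    then show ?thesis using pendant_basic5[OF assms(1) that(1)] that(2,4) by blast
  next
    case False
    note a = basic5_adj[OF that(4)]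
    have "b \<in> nb V v" "e \<in> nb V v" using a that(3) False sym by auto
    then have "b = e" unfolding that(2) by simp
    then show ?thesis using c5_facts(6)[OF a(1-5)] by simp
  qed
  have leaf: "x \<noteq> y" if "v \<in> V" "nb V v = {u}" "x \<in> {v, u}" "nb V x = {}" for v u y
    using that sym by (auto simp: set_eq_iff)
  show ?thesis
    using cases[OF assms(2,4)] cases[OF assms(3,5)]
  proof (elim disjE)
    assume "\<exists>v\<in>V. \<exists>u. nb V v = {u} \<and> B = {v, u}" "\<exists>v\<in>V. \<exists>u. nb V v = {u} \<and> B' = {v, u}"
    then obtain l s l' s' where "l \<in> V" "l' \<in> V" "nb V l = {s}" "nb V l' = {s'}" "B = {l, s}" "B' = {l', s'}"
      by blast
    then show ?thesis using pendant_unique[OF assms(1), of l l' s s'] assms(4,5) by blast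
  next
    assume "\<exists>b c d e. basic5 V x b c d e \<and> B = {x, b, c, d, e}" "\<exists>b c d e. basic5 V x b c d e \<and> B' = {x, b, c, d, e}"
    then show ?thesis using basic5_unique[OF assms(1)] by blast
  next
    assume "\<exists>v\<in>V. \<exists>u. nb V v = {u} \<and> B = {v, u}" "\<exists>b c d e. basic5 V x b c d e \<and> B' = {x, b, c, d, e}"
    then show ?thesis using pend assms(4) by blast
  next
    assume "\<exists>b c d e. basic5 V x b c d e \<and> B = {x, b, c, d, e}" "\<exists>v\<in>V. \<exists>u. nb V v = {u} \<and> B' = {v, u}"
    then show ?thesis using pend assms(5) by blast
  next
    assume "nb V x = {} \<and> B = {x}" "\<exists>b c d e. basic5 V x b c d e \<and> B' = {x, b, c, d, e}"
    then show ?thesis using iso basic5_adj(1) by blast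
  next
    assume "\<exists>b c d e. basic5 V x b c d e \<and> B = {x, b, c, d, e}" "nb V x = {} \<and> B' = {x}"
    then show ?thesis using iso basic5_adj(1) by blast
  next
    assume "nb V x = {} \<and> B = {x}" "\<exists>v\<in>V. \<exists>u. nb V v = {u} \<and> B' = {v, u}"
    then show ?thesis using leaf assms(5) by blast
  next
    assume "\<exists>v\<in>V. \<exists>u. nb V v = {u} \<and> B = {v, u}" "nb V x = {} \<and> B' = {x}"
    then show ?thesis using leaf assms(4) by blast
  qed auto
qed

definition partitioned :: bool where
  "partitioned \<longleftrightarrow> (\<forall>x\<in>V. \<exists>!H. H \<in> simplexes (underlying D) \<union> basic_5_cycles (underlying D) \<and> x \<in> fst H)"

lemma partitioned_iff: "partitioned \<longleftrightarrow> (\<forall>x\<in>V. \<exists>!B. block B \<and> x \<in> B)"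
proof -
  have inj: "B = B'" if "block B" "block B'" "graph_induced (underlying D) B = graph_induced (underlying D) B'" for B B'
    using that fst_induced[OF block_subset] by metis
  have "(\<exists>!H. H \<in> simplexes (underlying D) \<union> basic_5_cycles (underlying D) \<and> x \<in> fst H) \<longleftrightarrow>
      (\<exists>!B. block B \<and> x \<in> B)" for x
    unfolding blocks using inj fst_induced[OF block_subset] by (smt (verit, best))
  then show ?thesis by (simp add: partitioned_def)
qed

lemma good_imp_partitioned:
  assumes "wc V" "\<forall>x\<in>V. good V x \<or> nb V x = {}"
  shows partitioned
  unfolding partitioned_iff using block_cover block_unique[OF assms(1)] assms(2) by blast

section \<open>Strong covers in terms of their stable complements\<close>

lemma strong_cover_facts:
  assumes "strong_cover D C"
  shows "C \<subseteq> V" "indep (V - C)" "\<And>x. x \<in> C \<Longrightarrow> nb V x \<subseteq> C \<Longrightarrow>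
    \<exists>y. (y, x) \<in> arcs D \<and> y \<in> Vplus D \<and> y \<in> C \<and> out_nbrs D y \<subseteq> C"
proof -
  show CV: "C \<subseteq> V" using assms by (simp add: strong_cover_def)
  show "indep (V - C)" using assms unfolding strong_cover_def indep_def dadj_def by blast
  fix x assume x: "x \<in> C" "nb V x \<subseteq> C"
  then have "\<forall>y. dadj D x y \<longrightarrow> y \<in> C" using dadj_V by auto
  then obtain y where y: "y \<in> C - L1 D C" "(y, x) \<in> arcs D" "1 < weight D y"
    using assms x(1) unfolding strong_cover_def by blast
  then show "\<exists>y. (y, x) \<in> arcs D \<and> y \<in> Vplus D \<and> y \<in> C \<and> out_nbrs D y \<subseteq> C"
    using CV by (auto simp: L1_def Vplus_def out_nbrs_def)
qed

lemma strong_coverI: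
  assumes "S \<subseteq> V" "indep S"
    and "\<And>x. x \<in> V \<Longrightarrow> x \<notin> S \<Longrightarrow> x \<notin> cl S \<Longrightarrow> \<exists>y. (y, x) \<in> arcs D \<and> y \<in> Vplus D \<and> y \<notin> S \<and> out_nbrs D y \<inter> S = {}"
  shows "strong_cover D (V - S)"
  unfolding strong_cover_def
proof (intro conjI allI impI ballI)
  fix x y assume a: "(x, y) \<in> arcs D"
  then show "x \<in> V - S \<or> y \<in> V - S" using assms(2) arcs_V[OF a] unfolding indep_def dadj_def by blast
next
  fix x assume x: "x \<in> V - S" "\<forall>y. dadj D x y \<longrightarrow> y \<in> V - S"
  then have "x \<notin> cl S" using sym by (auto simp: cl_iff)
  then obtain y where y: "(y, x) \<in> arcs D" "y \<in> Vplus D" "y \<notin> S" "out_nbrs D y \<inter> S = {}"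
    using assms(3) x(1) by blast
  then show "\<exists>y\<in>V - S - L1 D (V - S). (y, x) \<in> arcs D \<and> 1 < weight D y"
    using arcs_V by (intro bexI[of _ y]) (auto simp: Vplus_def L1_def out_nbrs_def)
qed auto

lemma max_indep_strong: "max_indep V S \<Longrightarrow> strong_cover D (V - S)"
  by (rule strong_coverI) (auto simp: max_indep_def)

lemma equal_covers_max_indep:
  assumes "equal_covers D" "max_indep V S" "max_indep V T"
  shows "card S = card T"
proof -
  have "card (V - S) = card (V - T)" using assms max_indep_strong by (auto simp: equal_covers_def)
  moreover have "S \<subseteq> V" "T \<subseteq> V" using assms by (auto simp: max_indep_def)
  moreover have "card S \<le> card V" "card T \<le> card V" using calculation finite_V card_mono by blast+
  ultimately show ?thesis using finite_V by (simp add: card_Diff_subset finite_subset)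
qed

lemma equal_covers_wc: "equal_covers D \<Longrightarrow> wc V"
  using wcI[OF finite_V] equal_covers_max_indep by blast

text \<open>A maximal stable extension of \<open>S\<close> also has a strong complement, of the same
  size, and therefore adds nothing.\<close>

lemma strong_max_indep:
  assumes "equal_covers D" "S \<subseteq> V" "indep S" "strong_cover D (V - S)"
  shows "max_indep V S"
proof -
  obtain T where T: "S \<subseteq> T" "max_indep V T" using max_indep_extends[OF finite_V assms(2,3)] .
  have TV: "T \<subseteq> V" using T(2) by (simp add: max_indep_def)
  have "card (V - S) = card (V - T)"
    using assms(1,4) max_indep_strong[OF T(2)] unfolding equal_covers_def by blast
  moreover have "V - T \<subseteq> V - S" using T(1) by blast
  ultimately have "V - T = V - S" using finite_V by (metis card_subset_eq finite_Diff)
  then have "S = T" using assms(2) TV by blast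
  then show ?thesis using T(2) by simp
qed

text \<open>The members of \<open>P\<close> witness that \<open>V - S\<close> is a strong cover.\<close>

lemma witness_max_indep:
  assumes "equal_covers D" "P \<subseteq> Vplus D" "S0 \<subseteq> V" "indep S0"
    and disj: "S0 \<inter> P = {}" "\<And>p. p \<in> P \<Longrightarrow> out_nbrs D p \<inter> S0 = {}"
    and wit: "\<And>p. p \<in> P \<Longrightarrow> \<exists>z\<in>S0 \<union> P. (z, p) \<in> arcs D"
  obtains S where "S0 \<subseteq> S" "max_indep V S" "S \<inter> P = {}" "\<And>p. p \<in> P \<Longrightarrow> out_nbrs D p \<inter> S = {}"
proof -
  define Z where "Z = V - P - (\<Union>p\<in>P. out_nbrs D p)"
  have "finite Z" using finite_V by (simp add: Z_def)
  moreover have "S0 \<subseteq> Z" using assms(3) disj by (auto simp: Z_def)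
  ultimately obtain S where S: "S0 \<subseteq> S" "max_indep Z S" using max_indep_extends assms(4) by blast
  have SZ: "S \<subseteq> Z" "indep S" "Z \<subseteq> cl S" using S(2) by (auto simp: max_indep_def)
  have out: "out_nbrs D p \<inter> S = {}" if "p \<in> P" for p using SZ(1) that by (auto simp: Z_def)
  have SP: "S \<inter> P = {}" using SZ(1) by (auto simp: Z_def)
  have "strong_cover D (V - S)"
  proof (rule strong_coverI)
    show "S \<subseteq> V" using SZ(1) by (auto simp: Z_def)
    fix x assume x: "x \<in> V" "x \<notin> S" "x \<notin> cl S"
    then have "x \<notin> Z" using SZ(3) by blast
    then consider "x \<in> P" | p where "p \<in> P" "x \<in> out_nbrs D p" using x(1) by (auto simp: Z_def)
    then have "\<exists>p\<in>P. (p, x) \<in> arcs D"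
    proof cases
      case 1
      then obtain z where z: "z \<in> S0 \<union> P" "(z, x) \<in> arcs D" using wit by blast
      have "z \<notin> S0"
      proof
        assume "z \<in> S0"
        then have "x \<in> cl S" using S(1) z(2) by (auto simp: cl_iff dadj_def)
        then show False using x(3) by blast
      qed
      then show ?thesis using z by blast
    next
      case 2
      then show ?thesis by (auto simp: out_nbrs_def)
    qed
    then show "\<exists>y. (y, x) \<in> arcs D \<and> y \<in> Vplus D \<and> y \<notin> S \<and> out_nbrs D y \<inter> S = {}"
      using assms(2) out SP by blast
  qed (rule SZ(2))
  then have "max_indep V S" using strong_max_indep[OF assms(1) _ SZ(2)] SZ(1) by (auto simp: Z_def)
  then show thesis using that S(1) SP out by blast
qed

section \<open>Local conditions forced by strong covers of equal size\<close>

lemma Vplus_in: "y \<in> Vplus D \<Longrightarrow> \<exists>z. (z, y) \<in> arcs D"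
  using sources[of y] by (auto simp: Vplus_def source_def in_nbrs_def)

text \<open>With \<open>s\<close> as witness, a stable set containing an in-neighbour of
  \<open>s\<close> and missing \<open>s\<close> and its out-neighbours can be chosen maximal. But it
  leaves \<open>l\<close> undominated.\<close>

lemma no_heavy_stem:
  assumes "equal_covers D" "l \<in> V" "nb V l = {s}" "(s, l) \<in> arcs D" "s \<in> Vplus D"
  shows False
proof -
  obtain z where z: "(z, s) \<in> arcs D" using Vplus_in[OF assms(5)] by blast
  have zV: "z \<in> V" "z \<noteq> s" "(s, z) \<notin> arcs D" using arcs_V[OF z] asym z by auto
  obtain S where S: "{z} \<subseteq> S" "max_indep V S" "S \<inter> {s} = {}" "\<And>p. p \<in> {s} \<Longrightarrow> out_nbrs D p \<inter> S = {}"
    by (rule witness_max_indep[OF assms(1), of "{s}" "{z}"])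
      (use assms(5) zV z irr in \<open>auto simp: indep_def out_nbrs_def\<close>)
  have "l \<notin> S" using S(4)[of s] assms(4) by (auto simp: out_nbrs_def)
  moreover have "l \<in> cl S" using S(2) assms(2) by (auto simp: max_indep_def)
  ultimately obtain x where "x \<in> S" "dadj D x l" by (auto simp: cl_iff)
  then have "x \<in> nb V l" using sym dadj_V by auto
  then show False using assms(3) S(3) \<open>x \<in> S\<close> by auto
qed

text \<open>One of \<open>c\<close> and \<open>d\<close> is thin, and its whole closed neighbourhood
  is missed by \<open>S\<close>.\<close>

lemma basic5_max_indep:
  assumes "basic5 V a b c d e" "max_indep V S" "b \<notin> S" "c \<notin> S" "d \<notin> S" "e \<notin> S"
  shows False
proof -
  have "thin V b c d \<or> thin V c d e" using assms(1) by (auto simp: basic5_def)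
  then obtain x where x: "x \<in> {c, d}" "nb V x \<subseteq> {b, c, d, e}" by (auto simp: thin_def)
  have "x \<in> V" using x(1) basic5_adj[OF assms(1)] by auto
  then have "x \<in> cl S" using assms(2) by (auto simp: max_indep_def)
  then obtain y where "y \<in> S" "dadj D y x" using x(1) assms(4,5) by (auto simp: cl_iff)
  then have "y \<in> nb V x" using sym dadj_V by auto
  then show False using x(2) assms(3-6) \<open>y \<in> S\<close> by blast
qed

lemma in_max_indep: "max_indep V S \<Longrightarrow> x \<in> S \<Longrightarrow> dadj D x y \<or> dadj D y x \<Longrightarrow> y \<notin> S"
  unfolding max_indep_def indep_def by blast

text \<open>A maximal stable set cannot miss \<open>a'\<close>, \<open>a\<close> and
  \<open>b\<close> together (\<open>three\<close>). If \<open>a\<close> pointed to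
  \<open>a'\<close>, the witness set \<open>{a}\<close> would produce such a set; if
  \<open>a'\<close> were heavy, \<open>{a', a}\<close> would.\<close>

lemma star_1:
  assumes "equal_covers D" "basic5 V a' a b b' c" "(a, b) \<in> arcs D" "a \<in> Vplus D"
  shows "(a', a) \<in> arcs D" "weight D a' = 1"
proof -
  note adj = basic5_adj[OF assms(2)]
  note f = c5_facts[OF adj(1-5)]
  note r1 = basic5_rotate[OF assms(2)]
  note r2 = basic5_rotate[OF r1] note r3 = basic5_rotate[OF r2] note r4 = basic5_rotate[OF r3]
  have three: False if "max_indep V S" "a' \<notin> S" "a \<notin> S" "b \<notin> S" for S
  proof (cases "b' \<in> S")
    case True
    then have "c \<notin> S" using in_max_indep[OF that(1)] adj(4) by blast
    then show False using basic5_max_indep[OF r3 that(1)] that by blast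
  next
    case False
    then show False using basic5_max_indep[OF r4 that(1)] that by blast
  qed
  obtain z where z: "(z, a) \<in> arcs D" using Vplus_in[OF assms(4)] by blast
  have zV: "z \<in> V" "z \<noteq> a" "(a, z) \<notin> arcs D" using arcs_V[OF z] asym z by auto
  show a'a: "(a', a) \<in> arcs D"
  proof (rule ccontr)
    assume "(a', a) \<notin> arcs D"
    then have aa: "(a, a') \<in> arcs D" using adj(1) by (auto simp: dadj_def)
    obtain S where S: "{z} \<subseteq> S" "max_indep V S" "S \<inter> {a} = {}" "\<And>p. p \<in> {a} \<Longrightarrow> out_nbrs D p \<inter> S = {}"
      by (rule witness_max_indep[OF assms(1), of "{a}" "{z}"])
        (use assms(4) zV z irr in \<open>auto simp: indep_def out_nbrs_def\<close>)
    then show False using three[OF S(2)] S(3) S(4)[of a] aa assms(3) by (auto simp: out_nbrs_def)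
  qed
  show "weight D a' = 1"
  proof (rule ccontr)
    assume "weight D a' \<noteq> 1"
    then have a'p: "a' \<in> Vplus D" using weight_pos[OF adj(6)] adj(6) by (simp add: Vplus_def)
    obtain p where p: "(p, a') \<in> arcs D" using Vplus_in[OF a'p] by blast
    have pV: "p \<in> V" "p \<noteq> a'" "(a', p) \<notin> arcs D" "p \<noteq> a" using arcs_V[OF p] asym p a'a by auto
    have "\<not> dadj D a p" using no_common[of a' a p] adj(1) p by (auto simp: dadj_def)
    then have "(a, p) \<notin> arcs D" by (auto simp: dadj_def)
    then obtain S where S: "{p} \<subseteq> S" "max_indep V S" "S \<inter> {a', a} = {}" "\<And>q. q \<in> {a', a} \<Longrightarrow> out_nbrs D q \<inter> S = {}"
      by (rule_tac witness_max_indep[OF assms(1), of "{a', a}" "{p}"])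
        (use assms(4) a'p pV p a'a irr in \<open>auto simp: indep_def out_nbrs_def\<close>)
    then show False using three[OF S(2)] S(3) S(4)[of a] assms(3) by (auto simp: out_nbrs_def)
  qed
qed

text \<open>Stronger than the inclusions to be proved: \<open>a'\<close> is the only in-neighbour of
  \<open>a\<close>. If \<open>z\<close> is not adjacent to \<open>c\<close>, both fit into a maximal
  stable set that misses \<open>a'\<close>, \<open>a\<close>, \<open>b\<close>, \<open>b'\<close>;
  if it is, it closes a 4-cycle unless it equals \<open>a'\<close>.\<close>

lemma star_2:
  assumes "equal_covers D" "basic5 V a' a b b' c" "(a, b) \<in> arcs D" "a \<in> Vplus D" "(z, a) \<in> arcs D"
  shows "z = a'"
proof -
  note adj = basic5_adj[OF assms(2)]
  note f = c5_facts[OF adj(1-5)]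
  note r1 = basic5_rotate[OF assms(2)]
  note r2 = basic5_rotate[OF r1] note r3 = basic5_rotate[OF r2] note r4 = basic5_rotate[OF r3]
  have zV: "z \<in> V" "z \<noteq> a" "(a, z) \<notin> arcs D" using arcs_V[OF assms(5)] asym assms(5) by auto
  have "dadj D z c"
  proof (rule ccontr)
    assume n: "\<not> dadj D z c"
    have "\<not> dadj D a c" using f(4) .
    then have "(a, c) \<notin> arcs D" "\<not> dadj D c z" using n sym by (auto simp: dadj_def)
    then obtain S where S: "{z, c} \<subseteq> S" "max_indep V S" "S \<inter> {a} = {}" "\<And>p. p \<in> {a} \<Longrightarrow> out_nbrs D p \<inter> S = {}"
      by (rule_tac witness_max_indep[OF assms(1), of "{a}" "{z, c}"])
        (use assms(4,5) zV adj f n irr in \<open>auto simp: indep_def out_nbrs_def\<close>)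
    have "b \<notin> S" using S(4)[of a] assms(3) by (auto simp: out_nbrs_def)
    moreover have "a' \<notin> S" "b' \<notin> S" using in_max_indep[OF S(2), of c] S(1) adj(4,5) by auto
    ultimately show False using basic5_max_indep[OF r4 S(2)] S(3) by auto
  qed
  then show ?thesis using no4[of a z a' c] assms(5) adj(1,5) f(6) sym by (auto simp: dadj_def)
qed

text \<open>Otherwise \<open>z\<close> and \<open>a'\<close> fit into one maximal stable set with
  witness \<open>a\<close>; it misses \<open>a\<close>, \<open>b\<close>, \<open>b'\<close> and
  \<open>c\<close>.\<close>

lemma star_3:
  assumes "equal_covers D" "basic5 V a' a b b' c" "(a, b) \<in> arcs D" "a \<in> Vplus D" "dadj D z b'"
  shows "dadj D z a' \<or> (a, z) \<in> arcs D"
proof (rule ccontr)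
  assume "\<not> ?thesis"
  then have n: "\<not> dadj D z a'" "\<not> dadj D a' z" "(a, z) \<notin> arcs D" using sym by auto
  note adj = basic5_adj[OF assms(2)]
  note f = c5_facts[OF adj(1-5)]
  have a'a: "(a', a) \<in> arcs D" using star_1[OF assms(1-4)] by blast
  then have "(a, a') \<notin> arcs D" using asym by blast
  have "z \<in> V" "z \<noteq> a" using dadj_V[OF assms(5)] f(3) assms(5) by auto
  then obtain S where S: "{z, a'} \<subseteq> S" "max_indep V S" "S \<inter> {a} = {}" "\<And>p. p \<in> {a} \<Longrightarrow> out_nbrs D p \<inter> S = {}"
    by (rule_tac witness_max_indep[OF assms(1), of "{a}" "{z, a'}"])
      (use assms(4) n adj f a'a \<open>(a, a') \<notin> arcs D\<close> irr in \<open>auto simp: indep_def out_nbrs_def\<close>)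
  have "b \<notin> S" using S(4)[of a] assms(3) by (auto simp: out_nbrs_def)
  moreover have "c \<notin> S" using in_max_indep[OF S(2), of a'] S(1) adj(5) by auto
  moreover have "b' \<notin> S" using in_max_indep[OF S(2), of z] S(1) assms(5) by auto
  ultimately show False using basic5_max_indep[OF assms(2) S(2)] S(3) by auto
qed

text \<open>Girth five and the preceding conditions force \<open>z = c\<close>. If \<open>a'\<close>
  pointed to \<open>c\<close>, both \<open>a\<close> and \<open>c\<close> would be witnesses for a
  set containing \<open>a'\<close>, and this set would miss the rest of the cycle.\<close>

lemma star_4:
  assumes "equal_covers D" "basic5 V a' a b b' c" "(a, b) \<in> arcs D" "a \<in> Vplus D" "(z, b') \<in> arcs D" "z \<in> Vplus D"
  shows "(z, a') \<in> arcs D"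
proof -
  note adj = basic5_adj[OF assms(2)]
  note f = c5_facts[OF adj(1-5)]
  note s1 = star_1[OF assms(1-4)]
  have zb: "dadj D z b'" using assms(5) by (auto simp: dadj_def)
  have "z \<noteq> b"
  proof
    assume "z = b"
    then have "weight D a = 1" using star_1(2)[OF assms(1) basic5_rotate[OF assms(2)]] assms(5,6) by blast
    then show False using assms(4) by (simp add: Vplus_def)
  qed
  moreover have "z = b" if "dadj D a z"
    using no4[of a z b b'] that zb adj f(6) sym by auto
  ultimately have za: "dadj D z a'" using star_3[OF assms(1-4) zb] by (auto simp: dadj_def)
  have zc: "z = c" using no4[of a' z c b'] za zb adj f(6) sym by auto
  show ?thesis
  proof (rule ccontr)
    assume "\<not> ?thesis"
    then have ac: "(a', c) \<in> arcs D" using za zc by (auto simp: dadj_def)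
    then have "(c, a') \<notin> arcs D" "(a, a') \<notin> arcs D" using asym s1(1) by blast+
    then obtain S where S: "{a'} \<subseteq> S" "max_indep V S" "S \<inter> {a, c} = {}" "\<And>p. p \<in> {a, c} \<Longrightarrow> out_nbrs D p \<inter> S = {}"
      by (rule_tac witness_max_indep[OF assms(1), of "{a, c}" "{a'}"])
        (use assms(4,6) zc adj f ac s1 irr in \<open>auto simp: indep_def out_nbrs_def\<close>)
    have "b \<notin> S" "b' \<notin> S" using S(4)[of a] S(4)[of c] assms(3,5) zc by (auto simp: out_nbrs_def)
    then show False using basic5_max_indep[OF assms(2) S(2)] S(3) by auto
  qed
qed

text \<open>The star property quantifies over all ways of writing the cycle. A 5-cycle on the same
  vertices has the same edges, so the thinness conditions transfer.\<close>

lemma basic5_cyclic: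
  assumes "basic5 V p q r s t" "is_cycle (underlying D) [a', a, b, b', c]" "{a', a, b, b', c} \<subseteq> {p, q, r, s, t}"
  shows "basic5 V a' a b b' c"
proof -
  have adj: "dadj D a' a" "dadj D a b" "dadj D b b'" "dadj D b' c" "dadj D c a'"
    using assms(2) unfolding is_cycle_5 by auto
  note f = c5_facts[OF adj]
  have "card {a', a, b, b', c} = 5" using f(6) by simp
  moreover have "card {p, q, r, s, t} = 5" using c5_facts(6)[OF basic5_adj(1-5)[OF assms(1)]] by simp
  ultimately have eq: "{a', a, b, b', c} = {p, q, r, s, t}"
    using assms(3) by (intro card_subset_eq) auto
  have V: "a' \<in> V" "a \<in> V" "b \<in> V" "b' \<in> V" "c \<in> V" using adj dadj_V by blast+
  have "snd (graph_induced (underlying D) {p, q, r, s, t}) = cycle_edges [p, q, r, s, t]"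
    using induced_5_edges basic5_adj(1-5)[OF assms(1)] by blast
  then have ce: "cycle_edges [a', a, b, b', c] = cycle_edges [p, q, r, s, t]"
    using induced_5_edges[OF adj] eq by simp
  have deg: "card (nb V x) < 3 \<or> card (nb V y) < 3" if "{x, y} \<in> cycle_edges [p, q, r, s, t]" for x y
    by (rule basic5_edge_thin[OF assms(1) that[unfolded cycle_edges_5]])
  have th: "card (nb V a') < 3 \<Longrightarrow> thin V c a' a" "card (nb V a) < 3 \<Longrightarrow> thin V a' a b"
    "card (nb V b) < 3 \<Longrightarrow> thin V a b b'" "card (nb V b') < 3 \<Longrightarrow> thin V b b' c" "card (nb V c) < 3 \<Longrightarrow> thin V b' c a'"
    using card_thin V adj sym f(6) by auto
  have m: "{a', a} \<in> cycle_edges [p, q, r, s, t]" "{a, b} \<in> cycle_edges [p, q, r, s, t]"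
    "{b, b'} \<in> cycle_edges [p, q, r, s, t]" "{b', c} \<in> cycle_edges [p, q, r, s, t]"
    "{c, a'} \<in> cycle_edges [p, q, r, s, t]"
    using cycle_edges_5[of a' a b b' c] unfolding ce by simp_all
  show ?thesis
    unfolding basic5_def using V adj th deg[OF m(1)] deg[OF m(2)] deg[OF m(3)] deg[OF m(4)] deg[OF m(5)] by blast
qed

end

section \<open>Counting strong covers on blocks; condition (c)\<close>

context girth5_wograph begin

lemma nbrs_iff: "z \<in> nbrs D x \<longleftrightarrow> dadj D x z"
  by (auto simp: nbrs_def out_nbrs_def in_nbrs_def dadj_def)

lemma equal_covers_star_property:
  assumes "equal_covers D" "C \<in> basic_5_cycles (underlying D)"
  shows "star_property D C"
proof -
  obtain p q r s t where b5: "basic5 V p q r s t" and C: "C = graph_induced (underlying D) {p, q, r, s, t}"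
    using assms(2) basic_5_cycles_iff by blast
  show ?thesis
    unfolding star_property_def
  proof (intro allI impI, elim conjE)
    fix a' a b b' c
    assume cyc: "is_cycle C [a', a, b, b', c]" and ab: "(a, b) \<in> arcs D" "a \<in> Vplus D"
    have "cycle_edges [a', a, b, b', c] \<subseteq> snd (underlying D)" "\<forall>e\<in>cycle_edges [a', a, b, b', c]. e \<subseteq> {p, q, r, s, t}"
      using cyc unfolding C is_cycle_def graph_induced_def by auto
    moreover have "distinct [a', a, b, b', c]" using cyc unfolding is_cycle_def by blast
    ultimately have "is_cycle (underlying D) [a', a, b, b', c]" "{a', a, b, b', c} \<subseteq> {p, q, r, s, t}"
      unfolding is_cycle_def cycle_edges_5 by simp_all
    from basic5_cyclic[OF b5 this] have B: "basic5 V a' a b b' c" .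
    note adj = basic5_adj[OF B]
    note s1 = star_1[OF assms(1) B ab]
    have "in_nbrs D a \<subseteq> {a'}" using star_2[OF assms(1) B ab] by (auto simp: in_nbrs_def)
    moreover have "a' \<in> nbrs D c" using adj(5) by (simp add: nbrs_iff)
    moreover have "a' \<notin> Vplus D" using s1(2) by (simp add: Vplus_def)
    moreover have "nbrs D b' \<subseteq> nbrs D a' \<union> out_nbrs D a"
      using star_3[OF assms(1) B ab] sym unfolding Un_iff nbrs_iff subset_iff out_nbrs_def mem_Collect_eq by blast
    moreover have "in_nbrs D b' \<inter> Vplus D \<subseteq> in_nbrs D a'"
      using star_4[OF assms(1) B ab] by (auto simp: in_nbrs_def)
    ultimately show "((a', a) \<in> arcs D \<and> weight D a' = 1) \<and>
        (in_nbrs D a \<subseteq> nbrs D c \<and> in_nbrs D a \<inter> Vplus D \<subseteq> in_nbrs D c) \<and>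
        (nbrs D b' \<subseteq> nbrs D a' \<union> out_nbrs D a \<and> in_nbrs D b' \<inter> Vplus D \<subseteq> in_nbrs D a')"
      using s1 by blast
  qed
qed

lemma star_property_use:
  assumes "\<forall>C\<in>basic_5_cycles (underlying D). star_property D C" "basic5 V a' a b b' c" "(a, b) \<in> arcs D" "a \<in> Vplus D"
  shows "(a', a) \<in> arcs D" "weight D a' = 1" "(z, a) \<in> arcs D \<Longrightarrow> dadj D c z"
    "(z, a) \<in> arcs D \<Longrightarrow> z \<in> Vplus D \<Longrightarrow> (z, c) \<in> arcs D"
    "dadj D b' z \<Longrightarrow> dadj D a' z \<or> (a, z) \<in> arcs D"
    "(z, b') \<in> arcs D \<Longrightarrow> z \<in> Vplus D \<Longrightarrow> (z, a') \<in> arcs D"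
proof -
  define C where "C = graph_induced (underlying D) {a', a, b, b', c}"
  note adj = basic5_adj[OF assms(2)]
  have "C \<in> basic_5_cycles (underlying D)" using basic_5_cycles_iff assms(2) C_def by blast
  then have sp: "star_property D C" using assms(1) by blast
  have "snd C = cycle_edges [a', a, b, b', c]" unfolding C_def by (rule induced_5_edges[OF adj(1-5)])
  then have "is_cycle C [a', a, b, b', c]" using c5_facts(6)[OF adj(1-5)] by (simp add: is_cycle_def)
  then have "((a', a) \<in> arcs D \<and> weight D a' = 1) \<and>
        (in_nbrs D a \<subseteq> nbrs D c \<and> in_nbrs D a \<inter> Vplus D \<subseteq> in_nbrs D c) \<and>
        (nbrs D b' \<subseteq> nbrs D a' \<union> out_nbrs D a \<and> in_nbrs D b' \<inter> Vplus D \<subseteq> in_nbrs D a')"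
    using sp assms(3,4) unfolding star_property_def by blast
  then show "(a', a) \<in> arcs D" "weight D a' = 1" "(z, a) \<in> arcs D \<Longrightarrow> dadj D c z"
    "(z, a) \<in> arcs D \<Longrightarrow> z \<in> Vplus D \<Longrightarrow> (z, c) \<in> arcs D"
    "dadj D b' z \<Longrightarrow> dadj D a' z \<or> (a, z) \<in> arcs D"
    "(z, b') \<in> arcs D \<Longrightarrow> z \<in> Vplus D \<Longrightarrow> (z, a') \<in> arcs D"
    unfolding in_nbrs_def out_nbrs_def subset_iff Int_iff Un_iff nbrs_iff mem_Collect_eq by blast+
qed

lemma strong_cover_thin:
  assumes "strong_cover D C" "thin V p x q" "x \<in> C" "p \<in> C" "q \<in> C"
  obtains y where "y = p \<or> y = q" "(y, x) \<in> arcs D" "y \<in> Vplus D" "out_nbrs D y \<subseteq> C"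
proof -
  have nx: "nb V x = {p, q}" using assms(2) by (simp add: thin_def)
  then obtain y where y: "(y, x) \<in> arcs D" "y \<in> Vplus D" "out_nbrs D y \<subseteq> C"
    using strong_cover_facts(3)[OF assms(1,3), unfolded nx] assms(4,5) by blast
  have "y \<in> nb V x" using y(1) arcs_V by (auto simp: dadj_def)
  then show thesis using that y nx by blast
qed

text \<open>The thin \<open>c\<close> needs a heavy witness, \<open>b\<close> or \<open>d\<close>.
  The star property for its arc shows that all neighbours of \<open>d\<close> are covered, so
  \<open>d\<close> needs a witness as well, and every candidate points to the uncovered
  \<open>a\<close>.\<close>

lemma star_two_a:
  assumes st: "\<forall>C\<in>basic_5_cycles (underlying D). star_property D C" and C: "strong_cover D C"
    and B: "basic5 V a b c d e" and in_C: "a \<in> V" "a \<notin> C" "b \<in> C" "c \<in> C" "d \<in> C" and th: "thin V b c d"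
  shows False
proof -
  note adj = basic5_adj[OF B]
  note sf = strong_cover_facts[OF C]
  have aC: "z \<in> C" if "dadj D a z" for z
    using sf(2) that in_C(1,2) dadj_V[OF that] unfolding indep_def by blast
  obtain y where y: "y = b \<or> y = d" "(y, c) \<in> arcs D" "y \<in> Vplus D" "out_nbrs D y \<subseteq> C"
    by (rule strong_cover_thin[OF C th in_C(4,3,5)])
  have key: False if "\<And>z. dadj D d z \<Longrightarrow> z \<in> C" "\<And>z. (z, d) \<in> arcs D \<Longrightarrow> z \<in> Vplus D \<Longrightarrow> (z, a) \<in> arcs D"
  proof -
    have "nb V d \<subseteq> C" using that(1) by auto
    then obtain w where "(w, d) \<in> arcs D" "w \<in> Vplus D" "out_nbrs D w \<subseteq> C"
      using sf(3)[OF in_C(5)] by blast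
    then show False using that(2) in_C(2) by (auto simp: out_nbrs_def)
  qed
  from y(1) show False
  proof
    assume yb: "y = b"
    note s = star_property_use[OF st B y(2,3)[unfolded yb]]
    show False
    proof (rule key)
      fix z assume "dadj D d z"
      then show "z \<in> C" using s(5) aC y(4) yb by (auto simp: out_nbrs_def)
    qed (rule s(6))
  next
    assume yd: "y = d"
    have "basic5 V e d c b a" using basic5_reflect[OF B] basic5_rotate by blast
    note s = star_property_use[OF st this y(2,3)[unfolded yd]]
    show False
    proof (rule key)
      fix z assume "dadj D d z"
      then show "z \<in> C" using s(3) aC y(4) yd by (auto simp: dadj_def out_nbrs_def)
    qed (rule s(4))
  qed
qed

text \<open>If the whole cycle is covered, its thin vertices need heavy witnesses on the cycle.
  Tracing these from the heavy arc between \<open>a\<close> and \<open>b\<close> ends at a vertex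
  that the star property makes light, or at an arc of the wrong direction.\<close>

lemma star_two_b:
  assumes st: "\<forall>C\<in>basic_5_cycles (underlying D). star_property D C" and C: "strong_cover D C"
    and B: "basic5 V a' a b b' c" and in_C: "{a', a, b, b', c} \<subseteq> C" and y: "(a, b) \<in> arcs D" "a \<in> Vplus D"
  shows False
proof -
  have in_C': "a' \<in> C" "a \<in> C" "b \<in> C" "b' \<in> C" "c \<in> C" using in_C by auto
  note s = star_property_use[OF st B y]
  note r = basic5_rotate[OF B]
  have r4: "basic5 V b' c a' a b" using basic5_rotate[OF basic5_rotate[OF r]] .
  have wt: "x \<notin> Vplus D" if "weight D x = 1" for x using that by (simp add: Vplus_def)
  consider "\<not> thin V c a' a" | "thin V c a' a" "thin V b b' c" | "thin V c a' a" "\<not> thin V b b' c" by blast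
  then show False
  proof cases
    case 1
    then have "thin V a' a b" using B by (auto simp: basic5_def)
    from strong_cover_thin[OF C this in_C'(2,1,3)] obtain w where "w = a' \<or> w = b" "(w, a) \<in> arcs D" "w \<in> Vplus D"
      by blast
    then show False using wt s(2) asym y(1) by blast
  next
    case 2
    from strong_cover_thin[OF C 2(1) in_C'(1,5,2)] have c: "(c, a') \<in> arcs D" "c \<in> Vplus D"
      using asym s(1) by blast+
    note s' = star_property_use[OF st r4 c]
    from strong_cover_thin[OF C 2(2) in_C'(4,3,5)] have b: "(b, b') \<in> arcs D" "b \<in> Vplus D"
      using asym s'(1) by blast+
    show False using star_property_use(2)[OF st r b] wt y(2) by blast
  next
    case 3
    from strong_cover_thin[OF C 3(1) in_C'(1,5,2)] have c: "(c, a') \<in> arcs D" "c \<in> Vplus D"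
      using asym s(1) by blast+
    note s' = star_property_use[OF st r4 c]
    have "thin V b' c a'" using 3(2) B by (auto simp: basic5_def)
    from strong_cover_thin[OF C this in_C'(5,4,1)] show False using wt s'(2) asym c(1) by blast
  qed
qed

text \<open>A vertex cover contains at least three vertices of a 5-cycle; four and five are excluded
  by \<open>star_two_a\<close> and \<open>star_two_b\<close>.\<close>

lemma star_card_3:
  assumes st: "\<forall>C\<in>basic_5_cycles (underlying D). star_property D C" and C: "strong_cover D C"
    and B: "basic5 V a b c d e"
  shows "card (C \<inter> {a, b, c, d, e}) = 3"
proof -
  have one: False if B: "basic5 V a b c d e" and n: "a \<notin> C" "b \<in> C" "c \<in> C" "d \<in> C" "e \<in> C" for a b c d e
  proof -
    have aV: "a \<in> V" using B by (simp add: basic5_def)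
    have R: "basic5 V a e d c b" using basic5_reflect[OF B] basic5_rotate by blast
    have "thin V b c d \<or> thin V e d c" using B by (auto simp: basic5_def thin_def insert_commute)
    then show False using star_two_a[OF st C B aV] star_two_a[OF st C R aV] n by blast
  qed
  have zero: False if i: "{a, b, c, d, e} \<subseteq> C"
  proof -
    have z: False if B: "basic5 V a b c d e" and i: "{a, b, c, d, e} \<subseteq> C" and th: "thin V b c d" for a b c d e
    proof -
      have i': "c \<in> C" "b \<in> C" "d \<in> C" "{e, d, c, b, a} \<subseteq> C" using i by auto
      have R: "basic5 V e d c b a" using basic5_reflect[OF B] basic5_rotate by blast
      obtain y where "y = b \<or> y = d" "(y, c) \<in> arcs D" "y \<in> Vplus D"
        using strong_cover_thin[OF C th i'(1-3)] .
      then show False using star_two_b[OF st C B i] star_two_b[OF st C R i'(4)] by blast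
    qed
    have "thin V b c d \<or> thin V c d e" using B by (simp add: basic5_def)
    moreover have "{b, c, d, e, a} \<subseteq> C" using i by auto
    ultimately show False using z[OF B i] z[OF basic5_rotate[OF B]] by blast
  qed
  note r1 = basic5_rotate[OF B]
  note r2 = basic5_rotate[OF r1] note r3 = basic5_rotate[OF r2] note r4 = basic5_rotate[OF r3]
  note adj = basic5_adj[OF B]
  have cov: "x \<in> C \<or> y \<in> C" if "dadj D x y" for x y
    using strong_cover_facts(2)[OF C] that dadj_V[OF that] unfolding indep_def by blast
  note cs = cov[OF adj(1)] cov[OF adj(2)] cov[OF adj(3)] cov[OF adj(4)] cov[OF adj(5)]
  have f: "distinct [a, b, c, d, e]" using c5_facts(6)[OF adj(1-5)] .
  show ?thesis
    using cs zero one[OF B] one[OF r1] one[OF r2] one[OF r3] one[OF r4] f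
    by (cases "a \<in> C"; cases "b \<in> C"; cases "c \<in> C"; cases "d \<in> C"; cases "e \<in> C") (simp_all add: Int_insert_right)
qed

text \<open>Blocks have one, two or five vertices, so the value is 0, 1 or 3 and depends on the
  block alone.\<close>

lemma block_card:
  assumes st: "\<forall>C\<in>basic_5_cycles (underlying D). star_property D C"
    and c2: "\<And>l s. l \<in> V \<Longrightarrow> nb V l = {s} \<Longrightarrow> (s, l) \<in> arcs D \<Longrightarrow> s \<notin> Vplus D"
    and C: "strong_cover D C" and "block B"
  shows "card (C \<inter> B) = (if card B = 5 then 3 else card B - 1)"
proof -
  note sf = strong_cover_facts[OF C]
  consider (1) v where "v \<in> V" "nb V v = {}" "B = {v}" | (2) v u where "v \<in> V" "nb V v = {u}" "B = {v, u}"
    | (5) a b c d e where "basic5 V a b c d e" "B = {a, b, c, d, e}" using assms(4) unfolding block_def by blast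
  then show ?thesis
  proof cases
    case 1
    have "v \<notin> C"
    proof
      assume "v \<in> C"
      then obtain y where "(y, v) \<in> arcs D" using sf(3)[of v] 1(2) by blast
      then have "y \<in> nb V v" using arcs_V by (auto simp: dadj_def)
      then show False using 1(2) by blast
    qed
    then show ?thesis using 1(3) by simp
  next
    case 2
    have "u \<in> nb V v" using 2(2) by blast
    then have vu: "dadj D v u" "u \<in> V" by auto
    then have "v \<in> C \<or> u \<in> C" using sf(2) 2(1) unfolding indep_def by blast
    moreover have "\<not> (v \<in> C \<and> u \<in> C)"
    proof
      assume "v \<in> C \<and> u \<in> C"
      then obtain y where y: "(y, v) \<in> arcs D" "y \<in> Vplus D" using sf(3)[of v, unfolded 2(2)] by blast
      then have "y \<in> nb V v" using arcs_V by (auto simp: dadj_def)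
      then have "y = u" using 2(2) by blast
      then show False using c2[OF 2(1,2)] y by blast
    qed
    moreover have "v \<noteq> u" using vu irr by blast
    ultimately show ?thesis using 2(3) by (auto simp: Int_insert_right)
  next
    case 5
    have "card B = 5" using c5_facts(6)[OF basic5_adj(1-5)[OF 5(1)]] 5(2) by simp
    then show ?thesis using star_card_3[OF st C 5(1)] 5(2) by simp
  qed
qed

lemma partitioned_equal_covers:
  assumes partitioned and st: "\<forall>C\<in>basic_5_cycles (underlying D). star_property D C"
    and c2: "\<And>l s. l \<in> V \<Longrightarrow> nb V l = {s} \<Longrightarrow> (s, l) \<in> arcs D \<Longrightarrow> s \<notin> Vplus D"
  shows "equal_covers D"
proof -
  let ?F = "{B. block B}"
  have uni: "\<forall>x\<in>V. \<exists>!B. block B \<and> x \<in> B" using assms(1) partitioned_iff by blast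
  have fin: "finite ?F" using finite_subset[OF _ finite_Pow_iff[THEN iffD2, OF finite_V]] block_subset by blast
  have "card C = (\<Sum>B\<in>?F. if card B = 5 then 3 else card B - 1)" if C: "strong_cover D C" for C
  proof -
    have CV: "C \<subseteq> V" using strong_cover_facts(1)[OF C] .
    have ex: "\<exists>B. block B \<and> x \<in> B" if "x \<in> C" for x using uni CV that by blast
    have disj: "(C \<inter> B) \<inter> (C \<inter> B') = {}" if "block B" "block B'" "B \<noteq> B'" for B B'
      using uni block_subset[OF that(1)] that by blast
    have "C = (\<Union>B\<in>?F. C \<inter> B)" using ex by blast
    moreover have "card (\<Union>B\<in>?F. C \<inter> B) = (\<Sum>B\<in>?F. card (C \<inter> B))"
    proof (rule card_UN_disjoint[OF fin])
      show "\<forall>B\<in>?F. finite (C \<inter> B)" using finite_subset[OF CV finite_V] by simp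
    qed (use disj in simp)
    ultimately show ?thesis using block_card[OF st c2 C] by simp
  qed
  then show ?thesis unfolding equal_covers_def by simp
qed

text \<open>The forest is the single arc from \<open>s\<close> to \<open>l\<close>, a tree with
  parent \<open>s\<close>. An in-neighbour \<open>z\<close> of \<open>s\<close> serves as the
  outside vertex and forms \<open>W\<^sub>1\<close>.\<close>

lemma heavy_stem_generates:
  assumes "l \<in> V" "nb V l = {s}" "(s, l) \<in> arcs D" "s \<in> Vplus D"
  obtains K H where "K \<in> wo_simplexes D" "generating_star_semi_forest D K H"
proof -
  define K where "K = wo_induced D {l, s}"
  define H where "H = D\<lparr>verts := {s, l}, arcs := {(s, l)}\<rparr>"
  have H[simp]: "verts H = {s, l}" "arcs H = {(s, l)}" "weight H = weight D" by (simp_all add: H_def)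
  have sl: "s \<in> V" "s \<noteq> l" "(l, s) \<notin> arcs D" using arcs_V[OF assms(3)] asym assms(3) by auto
  obtain z where z: "(z, s) \<in> arcs D" using Vplus_in[OF assms(4)] by blast
  have zV: "z \<in> V" "z \<noteq> s" "z \<noteq> l" "(s, z) \<notin> arcs D" "(z, z) \<notin> arcs D"
    using arcs_V[OF z] asym z sl by auto
  have lz: "(l, z) \<notin> arcs D"
  proof
    assume "(l, z) \<in> arcs D"
    then have "z \<in> nb V l" using zV(1) by (simp add: dadj_def)
    then show False using assms(2) zV(2) by blast
  qed
  have G: "graph_induced (underlying D) {l, s} \<in> simplexes (underlying D)"
    using assms(1,2) simplexes_iff by metis
  then have KS: "K \<in> wo_simplexes D"
    unfolding wo_simplexes_def K_def using fst_induced[of "{l, s}"] assms(1) sl(1) G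
    by (intro CollectI exI[of _ "graph_induced (underlying D) {l, s}"]) simp
  have nbH: "nbrs H s = {l}" "nbrs H l = {s}"
    using sl(2) by (auto simp: nbrs_def out_nbrs_def in_nbrs_def)
  have sub: "wo_subgraph H D" using assms(1,3) sl(1) by (simp add: wo_subgraph_def)
  have nocycle: False if "is_cycle (underlying H) c" for c
  proof -
    have c: "3 \<le> length c" "distinct c" "cycle_edges c \<subseteq> {{s, l}}"
      using that by (auto simp: is_cycle_def underlying_def)
    then have "{c ! 0, c ! (Suc 0 mod length c)} \<in> cycle_edges c" "{c ! 1, c ! (Suc 1 mod length c)} \<in> cycle_edges c"
      unfolding cycle_edges_image by auto
    then have "{c ! 0, c ! 1} = {c ! 1, c ! 2}" using c by (auto simp: numeral_2_eq_2)
    moreover obtain x y z cs where "c = x # y # z # cs"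
      using c(1) by (auto simp: numeral_3_eq_3 Suc_le_length_iff)
    then have "c ! 0 \<noteq> c ! 1" "c ! 0 \<noteq> c ! 2" using c(2) by auto
    ultimately show False by (auto simp: doubleton_eq_iff)
  qed
  have "oriented_path H [s, l]" using sl(2) by (simp add: oriented_path_def)
  then have reach: "reaches H s l" unfolding reaches_def by (intro exI[of _ "[s, l]"]) simp
  have ROT: "ROT D H s"
    unfolding ROT_def using sub nocycle reach assms(4) nbH sl(2) by (auto simp: deg_def Vplus_def)
  have "star_semi_forest D H"
    unfolding star_semi_forest_def
    by (intro conjI[OF sub] exI[of _ 1] exI[of _ 0] exI[of _ "\<lambda>_. H"] exI[of _ "\<lambda>_. s"] exI[of _ "\<lambda>_. z"]
        exI[of _ "{z}"] exI[of _ "{}"])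
      (use ROT zV z lz in \<open>auto simp: stable_set_def nbrs_iff dadj_def out_nbrs_def disjoint_family_on_def Let_def\<close>)
  then have "generating_star_semi_forest D K H"
    using assms(1) sl(1) by (auto simp: generating_star_semi_forest_def K_def wo_induced_def)
  then show thesis using that KS by blast
qed

text \<open>A simplex has at most two vertices, too few for a cycle. The parent of the tree
  containing \<open>l\<close> has a neighbour outside the simplex, so it is the stem. Reaching
  \<open>l\<close> forces the arc, and a parent with a further vertex in its tree is heavy.\<close>

lemma generates_heavy_stem:
  assumes "K \<in> wo_simplexes D" "generating_star_semi_forest D K H"
  obtains l s where "l \<in> V" "nb V l = {s}" "(s, l) \<in> arcs D" "s \<in> Vplus D"
proof -
  obtain l where l: "l \<in> V" "nb V l = {} \<or> (\<exists>u. nb V l = {u})" and K: "verts K = insert l (nb V l)"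
  proof -
    obtain v where v: "v \<in> V" "nb V v = {} \<or> (\<exists>u. nb V v = {u})"
      "K = wo_induced D (fst (graph_induced (underlying D) (insert v (nb V v))))"
      using assms(1) unfolding wo_simplexes_def mem_Collect_eq simplexes_iff by blast
    have sub: "insert v (nb V v) \<subseteq> V" using v(1) by auto
    then have "verts K = insert v (nb V v)" using v(3) fst_induced[OF sub] by (auto simp: wo_induced_def)
    then show thesis using that v by blast
  qed
  have VH: "verts H = insert l (nb V l)" using assms(2) K by (simp add: generating_star_semi_forest_def)
  have c2: "card (verts H) \<le> 2" using l(2) VH by (auto simp: card_insert_if simp del: nb_iff)
  obtain r s' :: nat and T v B w where
    R: "\<forall>i<r. ROT D (T i) (v i)" and U: "\<forall>j<s'. unicycle_subgraph D (B j)"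
    and uni: "verts H = (\<Union>i<r. verts (T i)) \<union> (\<Union>j<s'. verts (B j))"
    and w: "\<forall>i<r. w i \<in> verts D - verts H \<and> w i \<in> nbrs D (v i)"
    using assms(2) unfolding generating_star_semi_forest_def star_semi_forest_def
    by (elim conjE exE) (rule that; assumption)
  have "s' = 0"
  proof (rule ccontr)
    assume "s' \<noteq> 0"
    then obtain c where c: "is_cycle (underlying (B 0)) c" "oriented_cycle (B 0) c"
      using U unfolding unicycle_subgraph_def by blast
    have "set c \<subseteq> verts H" using c(2) uni \<open>s' \<noteq> 0\<close> by (auto simp: oriented_cycle_def oriented_path_def)
    moreover have "card (set c) = length c" "3 \<le> length c" using c(1) by (auto simp: is_cycle_def distinct_card)
    moreover have "finite (verts H)" using VH finite_V by (simp add: nb_def)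
    ultimately have "3 \<le> card (verts H)" using card_mono by (metis order_trans)
    then show False using c2 by simp
  qed
  then obtain i where i: "i < r" "l \<in> verts (T i)" using uni VH by auto
  have Ti: "verts (T i) \<subseteq> insert l (nb V l)" using uni VH i(1) by blast
  have Ri: "ROT D (T i) (v i)" and wi: "w i \<in> V" "w i \<notin> insert l (nb V l)" "dadj D (v i) (w i)"
    using R w i(1) VH nbrs_iff by blast+
  have vT: "v i \<in> insert l (nb V l)" using Ri Ti by (auto simp: ROT_def simp del: nb_iff)
  moreover have "v i \<noteq> l" using wi by auto
  ultimately obtain s where s: "nb V l = {s}" "v i = s" using l(2) by blast
  have sl: "s \<noteq> l" using s \<open>v i \<noteq> l\<close> by blast
  have Ts: "verts (T i) \<subseteq> {s, l}" using Ti s(1) by blast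
  have rest: "arcs (T i) \<subseteq> arcs D" "\<forall>x\<in>verts (T i). weight (T i) x = weight D x" "s \<in> verts (T i)"
    "reaches (T i) s l" "weight (T i) s \<noteq> 1"
  proof -
    have *: "wo_subgraph (T i) D" "s \<in> verts (T i)" "\<forall>x\<in>verts (T i) - {s}. reaches (T i) s x"
      "\<forall>x\<in>verts (T i). weight (T i) x = 1 \<longrightarrow>
        (deg (T i) x = 1 \<and> x \<noteq> s) \<or> (verts (T i) = {s} \<and> x = s)"
      using Ri unfolding ROT_def s(2) by blast+
    show "arcs (T i) \<subseteq> arcs D" "\<forall>x\<in>verts (T i). weight (T i) x = weight D x"
      using *(1) unfolding wo_subgraph_def by blast+
    show "s \<in> verts (T i)" "reaches (T i) s l" using *(2,3) i(2) sl by auto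
    show "weight (T i) s \<noteq> 1" using *(2,4) i(2) sl by auto
  qed
  then obtain p where p: "oriented_path (T i) p" "hd p = s" "last p = l" unfolding reaches_def by blast
  have pp: "p \<noteq> []" "distinct p" "set p \<subseteq> {s, l}" "\<And>i'. Suc i' < length p \<Longrightarrow> (p ! i', p ! Suc i') \<in> arcs (T i)"
    using p(1) Ts unfolding oriented_path_def by blast+
  have "length p = card (set p)" using pp(2) by (simp add: distinct_card)
  also have "\<dots> \<le> card {s, l}" using pp(3) by (intro card_mono) auto
  finally have "length p \<le> 2" using sl by simp
  moreover have "length p \<noteq> 1"
  proof
    assume "length p = 1"
    then obtain x where "p = [x]" by (auto simp: length_Suc_conv)
    then show False using p(2,3) sl by simp
  qed
  moreover have "length p \<noteq> 0" using pp(1) by simp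
  ultimately have "length p = 2" by linarith
  then have "p ! 0 = s" "p ! 1 = l" using p(2,3) pp(1) by (simp_all add: hd_conv_nth last_conv_nth)
  then have "(s, l) \<in> arcs D" using pp(4)[of 0] \<open>length p = 2\<close> rest(1) by auto
  moreover have "s \<in> Vplus D"
    using rest(2,3,5) weight_pos arcs_V[OF calculation] by (fastforce simp: Vplus_def)
  ultimately show thesis using that l(1) s(1) by blast
qed

lemma no_generating_iff: "(\<forall>K\<in>wo_simplexes D. \<nexists>H. generating_star_semi_forest D K H) \<longleftrightarrow>
    (\<forall>l\<in>V. \<forall>s. nb V l = {s} \<longrightarrow> (s, l) \<in> arcs D \<longrightarrow> s \<notin> Vplus D)"
  using heavy_stem_generates generates_heavy_stem by metis

lemma condition_c_iff: "equal_covers D \<and> (\<forall>x\<in>V. good V x \<or> nb V x = {}) \<longleftrightarrow>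
    partitioned \<and> (\<forall>K\<in>wo_simplexes D. \<nexists>H. generating_star_semi_forest D K H) \<and>
    (\<forall>C\<in>basic_5_cycles (underlying D). star_property D C)"
proof
  assume a: "equal_covers D \<and> (\<forall>x\<in>V. good V x \<or> nb V x = {})"
  then show "partitioned \<and> (\<forall>K\<in>wo_simplexes D. \<nexists>H. generating_star_semi_forest D K H) \<and>
    (\<forall>C\<in>basic_5_cycles (underlying D). star_property D C)"
    using good_imp_partitioned equal_covers_wc equal_covers_star_property no_heavy_stem unfolding no_generating_iff by metis
next
  assume c: "partitioned \<and> (\<forall>K\<in>wo_simplexes D. \<nexists>H. generating_star_semi_forest D K H) \<and>
    (\<forall>C\<in>basic_5_cycles (underlying D). star_property D C)"
  then have "equal_covers D" using partitioned_equal_covers unfolding no_generating_iff by metis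
  moreover have "good V x \<or> nb V x = {}" if "x \<in> V" for x
    using c that block_cover[of x] unfolding partitioned_iff by metis
  ultimately show "equal_covers D \<and> (\<forall>x\<in>V. good V x \<or> nb V x = {})" by blast
qed

end

section \<open>The sporadic graphs and the classification\<close>

lemma C7_equicardinal: "equicardinal C7_matrix 3"
  by code_simp

lemma C7_sinks_only: "sinks_only C7_matrix
  (map (mask 7) [[3,6], [2,6], [2,5], [1,5], [1,4], [0,4], [0,3]]) []"
  by code_simp

lemma P10_equicardinal: "equicardinal P10_matrix 4"
  by code_simp

text \<open>The exempt candidates are the out-neighbourhoods allowed in (b): \<open>vg 1\<close>,
  \<open>vb 2\<close> for \<open>vd 1\<close> and \<open>vg 2\<close>, \<open>vb 1\<close> for
  \<open>vd 2\<close>.\<close>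

lemma P10_sinks_only: "sinks_only P10_matrix
  (map (mask 10) [[8,9], [1,2,4], [0,3,5], [7,8], [6,9], [2,3,5], [2,3,4], [5,6], [4,7], [1,8], [0,9]]) [(6, mask 10 [8,3]), (7, mask 10 [9,2])]"
  by code_simp

lemma P13_equicardinal: "equicardinal P13_matrix 5"
  by code_simp

lemma P13_sinks_only: "sinks_only P13_matrix
  (map (mask 13) [[3,5,10], [0,6,11], [3,8,12], [2,8,11], [1,9,10], [0,9,12], [6,7], [2,8,12], [2,4,11], [1,9,12], [1,7,10], [4,5], [3,8,10], [0,9,11]]) []"
  by code_simp

lemma Q13_equicardinal: "equicardinal Q13_matrix 5"
  by code_simp

lemma Q13_sinks_only: "sinks_only Q13_matrix
  (map (mask 13) [[1,4,11], [6,9], [4,8,10], [2,9,10], [1,2,3,12], [0,5,11], [0,2,3,12], [7,8], [6,7], [5,9,10], [3,8,10], [2,3,10], [1,4,12]]) []"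
  by code_simp

lemma P14_equicardinal: "equicardinal P14_matrix 5"
  by code_simp

lemma P14_sinks_only: "sinks_only P14_matrix
  (map (mask 14) [[6,9,10], [4,7,8], [5,8,9], [3,7,13], [2,11,12], [1,12,13], [1,10,11], [2,5,13], [0,4,10], [3,6,9], [3,6,7], [1,11,12], [2,6,10], [1,5,9], [0,11,12], [0,4,8]]) []"
  by code_simp

text \<open>The complements of strong covers in which a heavy \<open>y\<close> outside
  \<open>T\<close> has out-neighbours \<open>os\<close> and remaining neighbour \<open>z\<close>.
  Only \<open>os\<close> may be undominated, so \<open>y\<close> must be dominated, which only
  \<open>z\<close> can do.\<close>

definition almost_maximal :: "bool list list \<Rightarrow> nat \<Rightarrow> nat \<Rightarrow> nat list \<Rightarrow> bool list \<Rightarrow> bool" where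
  "almost_maximal C y z os T \<longleftrightarrow> (if T ! y then False else if T ! z
     then if every (\<lambda>i. \<not> T ! i) os then bsub (und C T) (mask (length C) os) else False else False)"

lemma P10_almost_maximal:
  "every (\<lambda>T. (if almost_maximal P10_matrix 6 7 [8, 3] T then bcount T = 4 else True) \<and>
     (if almost_maximal P10_matrix 7 6 [9, 2] T then bcount T = 4 else True)) (gen (adj_tri 0 P10_matrix))"
  by code_simp

context girth5_wograph begin

lemma out_nbrs_nb: "out_nbrs D y \<subseteq> nb V y"
  using arcs_V by (auto simp: out_nbrs_def dadj_def)

lemma max_indep_cover:
  assumes "strong_cover D C" "\<And>x. x \<in> C \<Longrightarrow> nb V x \<subseteq> C \<Longrightarrow> False"
  shows "max_indep V (V - C)"
  unfolding max_indep_def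
proof (intro conjI subsetI)
  fix x assume x: "x \<in> V"
  show "x \<in> cl (V - C)"
  proof (cases "x \<in> C")
    case True
    then obtain y where "y \<in> nb V x" "y \<notin> C" using assms(2) by blast
    then have "y \<in> V - C" "dadj D y x" using sym by auto
    then show ?thesis unfolding cl_iff by blast
  qed (use x in \<open>auto simp: cl_iff\<close>)
qed (use strong_cover_facts(2)[OF assms(1)] in auto)

lemma equal_coversI:
  assumes "\<And>C. strong_cover D C \<Longrightarrow> card (V - C) = a"
  shows "equal_covers D"
proof -
  have "card C = card V - a" if "strong_cover D C" for C
    using card_Diff_subset[of C V] assms[OF that] strong_cover_facts(1)[OF that] finite_V
    by (metis Diff_Diff_Int card_Diff_subset finite_subset Diff_subset finite_Diff inf.absorb2)
  then show ?thesis by (simp add: equal_covers_def)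
qed

text \<open>A sink is no witness, so every vertex of a strong cover has a neighbour outside it, and
  the complement is a maximal stable set.\<close>

lemma sinks_equal_covers:
  assumes "distinct vs" "set vs = V" "equicardinal (cmat vs) a" "\<forall>x\<in>Vplus D. sink D x"
  shows "equal_covers D"
proof (rule equal_coversI)
  fix C assume C: "strong_cover D C"
  have "max_indep V (V - C)"
  proof (rule max_indep_cover[OF C])
    fix x assume "x \<in> C" "nb V x \<subseteq> C"
    then obtain y where "(y, x) \<in> arcs D" "y \<in> Vplus D" using strong_cover_facts(3)[OF C] by blast
    then show False using assms(4) by (auto simp: sink_def out_nbrs_def)
  qed
  then show "card (V - C) = a" using equicardinal_sound[OF assms(1,3)] assms(2) by simp
qed

lemma equal_covers_nonsink:
  assumes "equal_covers D" "distinct vs" "set vs = V" "sinks_only (cmat vs) ss ex"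
    and y: "i < length vs" "vs ! i \<in> Vplus D" "\<not> sink D (vs ! i)"
  shows "(i, map (\<lambda>v. v \<in> out_nbrs D (vs ! i)) vs) \<in> set ex"
proof (rule ccontr)
  assume n: "\<not> ?thesis"
  let ?y = "vs ! i"
  have yV: "?y \<in> V" using y(2) by (simp add: Vplus_def)
  have ne: "out_nbrs D ?y \<noteq> {}" using y(3) yV by (simp add: sink_def)
  obtain p where p: "(p, ?y) \<in> arcs D" using Vplus_in[OF y(2)] by blast
  have "p \<in> nb V ?y" "p \<notin> out_nbrs D ?y" using arcs_V[OF p] asym[OF p] p by (auto simp: dadj_def out_nbrs_def)
  then have "out_nbrs D ?y \<noteq> nb V ?y" by blast
  then obtain S z where S: "S \<subseteq> V" "indep S" "?y \<notin> S" "out_nbrs D ?y \<inter> S = {}" "nb V ?y \<inter> S \<noteq> {}"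
    "z \<in> out_nbrs D ?y" "z \<notin> cl S" "nb V z \<subseteq> cl S"
    using sinks_only_sound[OF assms(2,4) y(1) _ ne _ n] out_nbrs_nb unfolding assms(3) by metis
  obtain x where x: "x \<in> S" "x \<in> nb V ?y" using S(5) by blast
  then have "(x, ?y) \<in> arcs D" using S(4) by (auto simp: dadj_def out_nbrs_def)
  then obtain S' where S': "S \<subseteq> S'" "max_indep V S'" "\<And>p. p \<in> {?y} \<Longrightarrow> out_nbrs D p \<inter> S' = {}"
    by (rule_tac witness_max_indep[OF assms(1) _ S(1,2), of "{?y}"]) (use y(2) S(3,4) x(1) in blast)+
  have zV: "z \<in> V" using S(6) out_nbrs_nb[of ?y] nb_V[of ?y] by blast
  then have "z \<in> cl S'" "z \<notin> S'" using S'(2) S'(3)[of ?y] S(6) unfolding max_indep_def by blast+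
  then obtain s where s: "s \<in> S'" "dadj D s z" unfolding cl_iff by blast
  then have "s \<in> nb V z" using dadj_V[OF s(2)] sym by simp
  then have "s \<in> cl S" using S(8) by blast
  moreover have "s \<notin> S" using S(7) s(2) by (auto simp: cl_iff)
  ultimately obtain q where "q \<in> S" "dadj D q s" unfolding cl_iff by blast
  then show False using S'(1,2) s(1) unfolding max_indep_def indep_def by blast
qed

lemma mask_eq:
  assumes "length vs = n" "X \<subseteq> set vs" "map (\<lambda>v. v \<in> X) vs = mask n is" "\<forall>j\<in>set is. j < n"
  shows "X = (!) vs ` set is"
proof -
  have e: "vs ! j \<in> X \<longleftrightarrow> j \<in> set is" if "j < n" for j
    using arg_cong[OF assms(3), of "\<lambda>l. l ! j"] that assms(1) by (simp add: mask_def)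
  show ?thesis
  proof (intro Set.set_eqI iffI)
    fix x assume "x \<in> X"
    moreover then obtain j where "j < n" "x = vs ! j" using assms(1,2) by (metis in_set_conv_nth subsetD)
    ultimately show "x \<in> (!) vs ` set is" using e by blast
  qed (use e assms(4) in auto)
qed

lemma almost_maximal_case:
  assumes vs: "distinct vs" "set vs = V" "length vs = 10" and yz: "y < 10" "z < 10" "set os \<subseteq> {..<10}"
    and cert: "every (\<lambda>T. if almost_maximal (cmat vs) y z os T then bcount T = 4 else True) (gen (adj_tri 0 (cmat vs)))"
    and C: "strong_cover D C" and mem: "vs ! y \<in> C" "vs ! z \<notin> C" "(!) vs ` set os \<subseteq> C"
    and und: "\<And>x. x \<in> C \<Longrightarrow> nb V x \<subseteq> C \<Longrightarrow> x \<in> (!) vs ` set os"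
  shows "card (V - C) = 4"
proof -
  let ?p = "\<lambda>v. v \<in> V - C"
  have ind: "indep (V - C)" using strong_cover_facts(2)[OF C] .
  have "map ?p vs \<in> set (gen (adj_tri 0 (cmat vs)))"
    unfolding cmat_def using gen_indep[OF ind, of "[]" vs vs] vs(1) by simp
  moreover have "almost_maximal (cmat vs) y z os (map ?p vs)"
  proof -
    have "\<not> map ?p vs ! y" "map ?p vs ! z" using mem(1,2) yz vs nth_mem by auto
    moreover have "every (\<lambda>i. \<not> map ?p vs ! i) os" unfolding every_iff
    proof
      fix i assume i: "i \<in> set os"
      then have "vs ! i \<in> C" "i < length vs" using mem(3) yz(3) vs(3) by auto
      then show "\<not> map ?p vs ! i" by simp
    qed
    moreover have "bsub (und (cmat vs) (map ?p vs)) (mask (length (cmat vs)) os)"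
    proof -
      have m: "mask (length (cmat vs)) os = map (\<lambda>v. v \<in> (!) vs ` set os) vs"
      proof (rule nth_equalityI)
        fix j assume "j < length (mask (length (cmat vs)) os)"
        then have j: "j < 10" by (simp add: mask_def cmat_def vs(3))
        have "vs ! j \<in> (!) vs ` set os \<longleftrightarrow> j \<in> set os"
          using j yz(3) vs(1,3) nth_eq_iff_index_eq[OF vs(1)] by fastforce
        then show "mask (length (cmat vs)) os ! j = map (\<lambda>v. v \<in> (!) vs ` set os) vs ! j"
          using j by (simp add: mask_def cmat_def vs(3))
      qed (simp add: mask_def cmat_def)
      show ?thesis unfolding m und_cmat bsub_map
      proof (intro ballI impI)
        fix x assume x: "x \<in> set vs" "\<forall>w\<in>set vs. w \<in> V - C \<longrightarrow> x \<noteq> w \<and> \<not> dadj D x w"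
        then have "x \<in> C" "nb V x \<subseteq> C" using vs(2) by auto
        then show "x \<in> (!) vs ` set os" using und by blast
      qed
    qed
    ultimately show ?thesis unfolding almost_maximal_def by simp
  qed
  ultimately have "bcount (map ?p vs) = 4" using cert unfolding every_iff by metis
  then have "card {v \<in> set vs. ?p v} = 4" using vs(1) by (simp add: bcount_map)
  moreover have "{v \<in> set vs. ?p v} = V - C" using vs(2) by blast
  ultimately show ?thesis by simp
qed

text \<open>The vertices 6 and 7 are adjacent, and neither exceptional out-neighbourhood contains
  the other vertex, so at most one of them is exceptional. All witnesses of a strong cover then
  coincide, and its complement is maximal or almost maximal.\<close>

lemma P10_equal_covers_iff:
  assumes vs: "distinct vs" "set vs = V" "cmat vs = P10_matrix"
  shows "equal_covers D \<longleftrightarrow> (\<forall>y\<in>Vplus D. \<not> sink D y \<longrightarrow>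
    (y = vs ! 6 \<and> out_nbrs D y = {vs ! 8, vs ! 3}) \<or> (y = vs ! 7 \<and> out_nbrs D y = {vs ! 9, vs ! 2}))"
    (is "_ \<longleftrightarrow> ?R")
proof
  have len: "length vs = 10" using arg_cong[OF vs(3), of length] by (simp add: cmat_def P10_matrix_def edge_matrix_def)
  {
    assume ec: "equal_covers D"
    show ?R
    proof (intro ballI impI)
      fix y assume y: "y \<in> Vplus D" "\<not> sink D y"
      then have "y \<in> set vs" using vs(2) by (simp add: Vplus_def)
      then obtain i where i: "i < length vs" "y = vs ! i" by (metis in_set_conv_nth)
      have "(i, map (\<lambda>v. v \<in> out_nbrs D y) vs) \<in> set [(6, mask 10 [8,3]), (7, mask 10 [9,2])]"
        using equal_covers_nonsink[OF ec vs(1,2) P10_sinks_only[folded vs(3)] i(1)] y i(2) by blast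
      then have "(i = 6 \<and> map (\<lambda>v. v \<in> out_nbrs D y) vs = mask 10 [8,3]) \<or>
          (i = 7 \<and> map (\<lambda>v. v \<in> out_nbrs D y) vs = mask 10 [9,2])" by (simp del: map_eq_conv)
      moreover have "out_nbrs D y \<subseteq> set vs" using out_nbrs_nb[of y] nb_V[of y] vs(2) by blast
      ultimately show "(y = vs ! 6 \<and> out_nbrs D y = {vs ! 8, vs ! 3}) \<or> (y = vs ! 7 \<and> out_nbrs D y = {vs ! 9, vs ! 2})"
        using mask_eq[OF len, of "out_nbrs D y" "[8,3]"] mask_eq[OF len, of "out_nbrs D y" "[9,2]"] i(2) by auto
    qed
  }
  assume R: ?R
  have adj: "dadj D (vs ! i) (vs ! j)" if "i < 10" "j < 10" "i \<noteq> j" "P10_matrix ! i ! j" for i j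
    using cmat_nth[of i vs j] that len vs(1,3) by (simp add: nth_eq_iff_index_eq)
  have adj67: "dadj D (vs ! 6) (vs ! 7)"
    by (rule adj) (simp_all add: P10_matrix_def edge_matrix_def)
  have nbi: "nb V (vs ! i) \<subseteq> (!) vs ` {j. j < 10 \<and> j \<noteq> i \<and> P10_matrix ! i ! j}" if "i < 10" for i
  proof
    fix x assume x: "x \<in> nb V (vs ! i)"
    then have "x \<in> set vs" using vs(2) by simp
    then obtain j where j: "j < 10" "x = vs ! j" using len by (metis in_set_conv_nth)
    have "dadj D (vs ! i) (vs ! j)" using x j(2) by simp
    then have "P10_matrix ! i ! j" "j \<noteq> i" using cmat_nth[of i vs j] j(1) that len vs(3) irr by auto
    then show "x \<in> (!) vs ` {j. j < 10 \<and> j \<noteq> i \<and> P10_matrix ! i ! j}" using j by blast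
  qed
  have "{j. j < 10 \<and> j \<noteq> 6 \<and> P10_matrix ! 6 ! j} \<subseteq> {7, 8, 3}" "{j. j < 10 \<and> j \<noteq> 7 \<and> P10_matrix ! 7 ! j} \<subseteq> {6, 9, 2}"
    by (auto simp: P10_matrix_def edge_matrix_def)
  then have nb67: "nb V (vs ! 6) \<subseteq> insert (vs ! 7) ((!) vs ` set [8, 3])" "nb V (vs ! 7) \<subseteq> insert (vs ! 6) ((!) vs ` set [9, 2])"
    using nbi[of 6] nbi[of 7] by auto
  have dist: "vs ! 6 \<noteq> vs ! 7" "vs ! 7 \<notin> {vs ! 8, vs ! 3}" "vs ! 6 \<notin> {vs ! 9, vs ! 2}"
    using vs(1) len by (simp_all add: nth_eq_iff_index_eq)
  note am = P10_almost_maximal[folded vs(3), unfolded every_iff]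
  show "equal_covers D"
  proof (rule equal_coversI)
    fix C assume C: "strong_cover D C"
    note sf = strong_cover_facts[OF C]
    have wit: "(\<exists>y\<in>C. out_nbrs D y \<subseteq> C \<and> x \<in> out_nbrs D y \<and> y \<in> Vplus D \<and>
        ((y = vs ! 6 \<and> out_nbrs D y = {vs ! 8, vs ! 3}) \<or> (y = vs ! 7 \<and> out_nbrs D y = {vs ! 9, vs ! 2})))"
      if x: "x \<in> C" "nb V x \<subseteq> C" for x
    proof -
      obtain y where y: "(y, x) \<in> arcs D" "y \<in> Vplus D" "y \<in> C" "out_nbrs D y \<subseteq> C" using sf(3)[OF x] by blast
      moreover have "x \<in> out_nbrs D y" using y(1) by (simp add: out_nbrs_def)
      moreover have "\<not> sink D y" using calculation(5) by (auto simp: sink_def)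
      ultimately show ?thesis using R by blast
    qed
    have count: "card (V - C) = 4"
      if yz: "y < 10" "z < 10" "set os \<subseteq> {..<10}" and nb: "nb V (vs ! y) \<subseteq> insert (vs ! z) ((!) vs ` set os)"
        and cert: "every (\<lambda>T. if almost_maximal (cmat vs) y z os T then bcount T = 4 else True) (gen (adj_tri 0 (cmat vs)))"
        and y: "vs ! y \<in> C" "out_nbrs D (vs ! y) = (!) vs ` set os" "out_nbrs D (vs ! y) \<subseteq> C"
        and out: "\<And>x. x \<in> C \<Longrightarrow> nb V x \<subseteq> C \<Longrightarrow> x \<in> out_nbrs D (vs ! y)"
      for y z os
    proof (rule almost_maximal_case[OF vs(1,2) len yz cert C y(1)])
      show "vs ! z \<notin> C"
      proof
        assume z: "vs ! z \<in> C"
        have "nb V (vs ! y) \<subseteq> C" using nb y(3) z unfolding y(2) by blast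
        then have "vs ! y \<in> out_nbrs D (vs ! y)" by (rule out[OF y(1)])
        then show False using asym by (auto simp: out_nbrs_def)
      qed
      show "(!) vs ` set os \<subseteq> C" using y(2,3) by simp
      show "x \<in> (!) vs ` set os" if "x \<in> C" "nb V x \<subseteq> C" for x using out[OF that] y(2) by simp
    qed
    have conflict: False if "out_nbrs D (vs ! 6) = {vs ! 8, vs ! 3}" "out_nbrs D (vs ! 7) = {vs ! 9, vs ! 2}"
      using adj67 that dist(2,3) unfolding dadj_def out_nbrs_def by blast
    show "card (V - C) = 4"
    proof (cases "max_indep V (V - C)")
      case True
      then show ?thesis using equicardinal_sound[OF vs(1) P10_equicardinal[folded vs(3)]] vs(2) by simp
    next
      case False
      then obtain x where "x \<in> C" "nb V x \<subseteq> C" using max_indep_cover[OF C] by blast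
      from wit[OF this] obtain y where y: "y \<in> C" "out_nbrs D y \<subseteq> C"
        "(y = vs ! 6 \<and> out_nbrs D y = {vs ! 8, vs ! 3}) \<or> (y = vs ! 7 \<and> out_nbrs D y = {vs ! 9, vs ! 2})" by blast
      from y(3) show ?thesis
      proof
        assume e: "y = vs ! 6 \<and> out_nbrs D y = {vs ! 8, vs ! 3}"
        show ?thesis
        proof (rule count[of 6 7 "[8, 3]"])
          show "every (\<lambda>T. if almost_maximal (cmat vs) 6 7 [8, 3] T then bcount T = 4 else True) (gen (adj_tri 0 (cmat vs)))"
            using am unfolding every_iff by blast
          show "x \<in> out_nbrs D (vs ! 6)" if "x \<in> C" "nb V x \<subseteq> C" for x
            using wit[OF that] conflict e by blast
        qed (use e y nb67 dist(1) in \<open>simp_all del: nb_iff\<close>)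
      next
        assume e: "y = vs ! 7 \<and> out_nbrs D y = {vs ! 9, vs ! 2}"
        show ?thesis
        proof (rule count[of 7 6 "[9, 2]"])
          show "every (\<lambda>T. if almost_maximal (cmat vs) 7 6 [9, 2] T then bcount T = 4 else True) (gen (adj_tri 0 (cmat vs)))"
            using am unfolding every_iff by blast
          show "x \<in> out_nbrs D (vs ! 7)" if "x \<in> C" "nb V x \<subseteq> C" for x
            using wit[OF that] conflict e by blast
        qed (use e y nb67 dist(1) in \<open>simp_all del: nb_iff\<close>)
      qed
    qed
  qed
qed

end

section \<open>From labelled graphs to adjacency matrices\<close>

definition label_matrix :: "'a sgraph \<Rightarrow> 'a list \<Rightarrow> bool list list" where
  "label_matrix G L = map (\<lambda>x. map (\<lambda>y. x = y \<or> {x, y} \<in> snd G) L) L"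

text \<open>Membership of two-element sets becomes membership of pairs in a list, which can be
  evaluated.\<close>

lemma label_matrix_code:
  assumes "snd G = (\<lambda>(x, y). {x, y}) ` set E"
  shows "label_matrix G L = map (\<lambda>x. map (\<lambda>y. x = y \<or> (x, y) \<in> set E \<or> (y, x) \<in> set E) L) L"
proof -
  have "{x, y} \<in> snd G \<longleftrightarrow> (x, y) \<in> set E \<or> (y, x) \<in> set E" for x y
    unfolding assms by (auto simp: doubleton_eq_iff image_iff)
  then show ?thesis by (simp add: label_matrix_def)
qed

lemma no_loop:
  assumes "snd G = (\<lambda>(x, y). {x, y}) ` set E" "list_all (\<lambda>(x, y). x \<noteq> y) E"
  shows "{x} \<notin> snd G"
  using assms(2) unfolding assms(1) list_all_iff by force

lemma C7_edges: "snd C\<^sub>7 = (\<lambda>(x, y). {x, y}) ` set (map (\<lambda>i. (i, Suc i mod 7)) [0..<7])"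
  by (auto simp: C\<^sub>7_def image_iff)

lemma C7_label_matrix: "label_matrix C\<^sub>7 [0..<7] = C7_matrix"
  unfolding label_matrix_code[OF C7_edges] by code_simp

lemma P10_label_matrix:
  "label_matrix P\<^sub>1\<^sub>0 [va 1, va 2, vb 1, vb 2, vc 1, vc 2, vd 1, vd 2, vg 1, vg 2] = P10_matrix"
proof -
  have e: "snd P\<^sub>1\<^sub>0 = (\<lambda>(x, y). {x, y}) ` set [(va 1, vb 1), (vb 1, vd 2), (vd 2, vd 1), (vd 1, vb 2), (vb 2, va 2),
      (va 1, vg 1), (vg 1, vd 1), (vg 1, vc 1), (vc 1, vc 2), (vc 2, vg 2), (vg 2, va 2), (vd 2, vg 2)]"
    by (simp add: P\<^sub>1\<^sub>0_def)
  show ?thesis unfolding label_matrix_code[OF e] by code_simp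
qed

lemma P13_label_matrix: "label_matrix P\<^sub>1\<^sub>3
  [va 1, va 2, va 3, va 4, vb 1, vb 2, vb 3, vb 4, vc 1, vc 2, vd 1, vd 2, vv] = P13_matrix"
proof -
  have e: "snd P\<^sub>1\<^sub>3 = (\<lambda>(x, y). {x, y}) ` set [(va 1, va 2), (va 1, vb 1), (va 2, vb 2), (vb 1, vc 1), (vb 2, vc 1),
      (vc 1, vc 2), (vc 2, vb 3), (vc 2, vb 4), (va 3, vb 3), (va 4, vb 4), (va 3, va 4), (vb 1, vd 1),
      (vb 3, vd 1), (vb 2, vd 2), (vb 4, vd 2), (vd 1, vv), (vd 2, vv)]"
    by (simp add: P\<^sub>1\<^sub>3_def)
  show ?thesis unfolding label_matrix_code[OF e] by code_simp
qed

lemma Q13_label_matrix: "label_matrix Q\<^sub>1\<^sub>3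
  [va 1, va 2, vb 1, vb 2, vc 1, vc 2, vd 1, vd 2, vg 1, vg 2, vh, vh', vv] = Q13_matrix"
proof -
  have e: "snd Q\<^sub>1\<^sub>3 = (\<lambda>(x, y). {x, y}) ` set [(va 1, va 2), (va 1, vd 1), (va 2, vd 2), (vd 1, vh), (vd 2, vh),
      (vh, vv), (vv, vh'), (vh', vg 1), (vh', vg 2), (vd 1, vg 1), (vd 2, vg 2), (vg 1, vb 1), (vg 2, vb 2),
      (vb 2, vc 1), (vc 1, vd 1), (vb 1, vc 2), (vc 2, vd 2), (vc 1, vc 2)]"
    by (simp add: Q\<^sub>1\<^sub>3_def)
  show ?thesis unfolding label_matrix_code[OF e] by code_simp
qed

lemma P14_edges: "snd P\<^sub>1\<^sub>4 = (\<lambda>(x, y). {x, y}) ` set (map (\<lambda>i. (va i, va (i mod 7 + 1))) [1..<8] @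
      map (\<lambda>i. (va i, vb i)) [1..<8] @ map (\<lambda>i. (vb i, vb ((i + 1) mod 7 + 1))) [1..<8])"
proof -
  have "{1..7} = set [1..<8]" by auto
  then show ?thesis
    unfolding P\<^sub>1\<^sub>4_def snd_conv set_append image_Un set_map image_image Setcompr_eq_image split_conv
    by (simp add: Un_assoc)
qed

lemma P14_label_matrix: "label_matrix P\<^sub>1\<^sub>4 (map va [1..<8] @ map vb [1..<8]) = P14_matrix"
  unfolding label_matrix_code[OF P14_edges] by code_simp

context girth5_wograph begin

lemma graph_iso_cmat:
  assumes "graph_iso G (underlying D) \<phi>" "distinct L" "set L = fst G"
  shows "distinct (map \<phi> L)" "set (map \<phi> L) = V" "cmat (map \<phi> L) = label_matrix G L"
proof -
  have b: "bij_betw \<phi> (set L) V" and e: "\<And>x y. x \<in> set L \<Longrightarrow> y \<in> set L \<Longrightarrow> {x, y} \<in> snd G \<longleftrightarrow> dadj D (\<phi> x) (\<phi> y)"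
    using assms(1) unfolding graph_iso_def assms(3) underlying_edge by (auto simp: underlying_def)
  show "distinct (map \<phi> L)" using b assms(2) by (simp add: distinct_map bij_betw_def)
  show "set (map \<phi> L) = V" using b by (simp add: bij_betw_def)
  have "\<phi> x = \<phi> y \<longleftrightarrow> x = y" if "x \<in> set L" "y \<in> set L" for x y
    using b that by (auto simp: bij_betw_def inj_on_def)
  then show "cmat (map \<phi> L) = label_matrix G L"
    unfolding cmat_def label_matrix_def map_map using e by (auto intro!: map_cong)
qed

lemma cmat_graph_iso:
  assumes "distinct L" "set L = fst G" "\<And>x. {x} \<notin> snd G"
    and "distinct vs" "set vs = V" "cmat vs = label_matrix G L"
  obtains \<phi> where "graph_iso G (underlying D) \<phi>" "map \<phi> L = vs"
proof -
  have len: "length vs = length L" using arg_cong[OF assms(6), of length] by (simp add: cmat_def label_matrix_def)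
  define \<phi> where "\<phi> x = the (map_of (zip L vs) x)" for x
  have \<phi>: "\<phi> (L ! i) = vs ! i" if "i < length L" for i
    using that len assms(1) by (simp add: \<phi>_def map_of_zip_nth)
  have m: "map \<phi> L = vs" by (rule nth_equalityI) (use len \<phi> in auto)
  have inj: "inj_on \<phi> (set L)" using assms(4) unfolding m[symmetric] by (simp add: distinct_map)
  have im: "\<phi> ` set L = V" using assms(5) unfolding m[symmetric] by simp
  have "{x, y} \<in> snd G \<longleftrightarrow> dadj D (\<phi> x) (\<phi> y)" if xy: "x \<in> set L" "y \<in> set L" for x y
  proof (cases "x = y")
    case True
    then show ?thesis using assms(3) irr by simp
  next
    case False
    obtain i j where ij: "i < length L" "x = L ! i" "j < length L" "y = L ! j" using xy by (metis in_set_conv_nth)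
    have "label_matrix G L ! i ! j \<longleftrightarrow> {x, y} \<in> snd G" using ij False by (simp add: label_matrix_def)
    moreover have "cmat vs ! i ! j \<longleftrightarrow> dadj D (\<phi> x) (\<phi> y)"
      using ij \<phi> cmat_nth[of i vs j] len False assms(1,4) by (auto simp: nth_eq_iff_index_eq)
    ultimately show ?thesis using assms(6) by simp
  qed
  then have "graph_iso G (underlying D) \<phi>"
    using inj im unfolding graph_iso_def assms(2)[symmetric] underlying_edge
    by (simp add: bij_betw_def underlying_def)
  then show thesis using that m by blast
qed

lemma isomorphic_cmat_iff:
  assumes "distinct L" "set L = fst G" "\<And>x. {x} \<notin> snd G" "label_matrix G L = M"
  shows "isomorphic G (underlying D) \<longleftrightarrow> (\<exists>vs. distinct vs \<and> set vs = V \<and> cmat vs = M)"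
  unfolding isomorphic_def using graph_iso_cmat[OF _ assms(1,2)] cmat_graph_iso[OF assms(1-3)] assms(4) by metis

lemma C7_iff: "isomorphic C\<^sub>7 (underlying D) \<longleftrightarrow> (\<exists>vs. distinct vs \<and> set vs = V \<and> cmat vs = C7_matrix)"
proof (rule isomorphic_cmat_iff[OF _ _ no_loop[OF C7_edges] C7_label_matrix])
  show "list_all (\<lambda>(x, y). x \<noteq> y) (map (\<lambda>i. (i, Suc i mod 7)) [0..<7])" by code_simp
qed (auto simp: C\<^sub>7_def)

lemma P13_iff: "isomorphic P\<^sub>1\<^sub>3 (underlying D) \<longleftrightarrow> (\<exists>vs. distinct vs \<and> set vs = V \<and> cmat vs = P13_matrix)"
  by (rule isomorphic_cmat_iff[OF _ _ _ P13_label_matrix]) (auto simp: P\<^sub>1\<^sub>3_def)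

lemma Q13_iff: "isomorphic Q\<^sub>1\<^sub>3 (underlying D) \<longleftrightarrow> (\<exists>vs. distinct vs \<and> set vs = V \<and> cmat vs = Q13_matrix)"
  by (rule isomorphic_cmat_iff[OF _ _ _ Q13_label_matrix]) (auto simp: Q\<^sub>1\<^sub>3_def)

lemma P14_iff: "isomorphic P\<^sub>1\<^sub>4 (underlying D) \<longleftrightarrow> (\<exists>vs. distinct vs \<and> set vs = V \<and> cmat vs = P14_matrix)"
proof (rule isomorphic_cmat_iff[OF _ _ no_loop[OF P14_edges] P14_label_matrix])
  show "distinct (map va [1..<8] @ map vb [1..<8])" by code_simp
  have "{1..7} = set [1..<8]" by auto
  then show "set (map va [1..<8] @ map vb [1..<8]) = fst P\<^sub>1\<^sub>4" by (simp add: P\<^sub>1\<^sub>4_def)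
  show "list_all (\<lambda>(x, y). x \<noteq> y) (map (\<lambda>i. (va i, va (i mod 7 + 1))) [1..<8] @
      map (\<lambda>i. (va i, vb i)) [1..<8] @ map (\<lambda>i. (vb i, vb ((i + 1) mod 7 + 1))) [1..<8])" by code_simp
qed

lemma P10_iff:
  "(\<exists>\<phi>. graph_iso P\<^sub>1\<^sub>0 (underlying D) \<phi> \<and> (\<forall>y\<in>Vplus D. \<not> sink D y \<longrightarrow>
      (y = \<phi> (vd 1) \<and> out_nbrs D y = {\<phi> (vg 1), \<phi> (vb 2)}) \<or>
      (y = \<phi> (vd 2) \<and> out_nbrs D y = {\<phi> (vg 2), \<phi> (vb 1)}))) \<longleftrightarrow>
    (\<exists>vs. distinct vs \<and> set vs = V \<and> cmat vs = P10_matrix \<and> equal_covers D)" (is "?l \<longleftrightarrow> ?r")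
proof -
  let ?L = "[va 1, va 2, vb 1, vb 2, vc 1, vc 2, vd 1, vd 2, vg 1, vg 2]"
  have L: "distinct ?L" "set ?L = fst P\<^sub>1\<^sub>0" "\<And>x. {x} \<notin> snd P\<^sub>1\<^sub>0" by (auto simp: P\<^sub>1\<^sub>0_def)
  have n: "\<phi> (vd 1) = map \<phi> ?L ! 6" "\<phi> (vd 2) = map \<phi> ?L ! 7" "\<phi> (vg 1) = map \<phi> ?L ! 8"
    "\<phi> (vg 2) = map \<phi> ?L ! 9" "\<phi> (vb 2) = map \<phi> ?L ! 3" "\<phi> (vb 1) = map \<phi> ?L ! 2" for \<phi> :: "label \<Rightarrow> 'a"
    by simp_all
  have eq: "equal_covers D \<longleftrightarrow> (\<forall>y\<in>Vplus D. \<not> sink D y \<longrightarrow>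
      (y = \<phi> (vd 1) \<and> out_nbrs D y = {\<phi> (vg 1), \<phi> (vb 2)}) \<or>
      (y = \<phi> (vd 2) \<and> out_nbrs D y = {\<phi> (vg 2), \<phi> (vb 1)}))"
    if "distinct (map \<phi> ?L)" "set (map \<phi> ?L) = V" "cmat (map \<phi> ?L) = P10_matrix" for \<phi>
    using P10_equal_covers_iff[OF that] by simp
  show ?thesis
  proof
    assume ?l
    then obtain \<phi> where \<phi>: "graph_iso P\<^sub>1\<^sub>0 (underlying D) \<phi>" "\<forall>y\<in>Vplus D. \<not> sink D y \<longrightarrow>
      (y = \<phi> (vd 1) \<and> out_nbrs D y = {\<phi> (vg 1), \<phi> (vb 2)}) \<or>
      (y = \<phi> (vd 2) \<and> out_nbrs D y = {\<phi> (vg 2), \<phi> (vb 1)})" by blast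
    note c = graph_iso_cmat[OF \<phi>(1) L(1,2), unfolded P10_label_matrix]
    show ?r using c eq[OF c] \<phi>(2) by blast
  next
    assume ?r
    then obtain vs where vs: "distinct vs" "set vs = V" "cmat vs = P10_matrix" "equal_covers D" by blast
    from cmat_graph_iso[OF L vs(1,2) vs(3)[folded P10_label_matrix]]
    obtain \<phi> where \<phi>: "graph_iso P\<^sub>1\<^sub>0 (underlying D) \<phi>" "map \<phi> ?L = vs" .
    show ?l using \<phi>(1) eq[of \<phi>] vs unfolding \<phi>(2) by blast
  qed
qed

lemma K1_iff: "isomorphic K\<^sub>1 (underlying D) \<longleftrightarrow> (\<exists>x. V = {x})"
proof
  assume "isomorphic K\<^sub>1 (underlying D)"
  then obtain \<phi> where "bij_betw \<phi> {0::nat} V"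
    by (auto simp: isomorphic_def graph_iso_def K\<^sub>1_def underlying_def)
  then have "V = {\<phi> 0}" by (auto simp: bij_betw_def)
  then show "\<exists>x. V = {x}" by blast
next
  assume "\<exists>x. V = {x}"
  then obtain x where x: "V = {x}" by blast
  have "graph_iso K\<^sub>1 (underlying D) (\<lambda>_. x)"
    unfolding graph_iso_def underlying_edge using irr x by (simp add: K\<^sub>1_def underlying_def bij_betw_def)
  then show "isomorphic K\<^sub>1 (underlying D)" by (auto simp: isomorphic_def)
qed

lemma connected_closed:
  assumes "connected_graph (underlying D)" "closed V X" "x \<in> X"
  shows "X = V"
proof
  show "X \<subseteq> V" using assms(2) by (simp add: closed_def)
  show "V \<subseteq> X"
  proof
    fix y assume y: "y \<in> V"
    have "x \<in> V" using assms(2,3) by (auto simp: closed_def)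
    then have "(x, y) \<in> {(u, v). {u, v} \<in> snd (underlying D)}\<^sup>*"
      using assms(1) y by (auto simp: connected_graph_def underlying_def)
    then show "y \<in> X"
    proof (induction rule: rtrancl_induct)
      case (step u v)
      then have "dadj D u v" by (simp add: underlying_edge)
      then show ?case using step(3) assms(2) dadj_V unfolding closed_def by blast
    qed (rule assms(3))
  qed
qed

lemma equal_covers_sinks:
  assumes "equal_covers D" "distinct vs" "set vs = V" "sinks_only (cmat vs) ss []"
  shows "\<forall>x\<in>Vplus D. sink D x"
proof (rule ballI, rule ccontr)
  fix x assume x: "x \<in> Vplus D" "\<not> sink D x"
  then have "x \<in> set vs" using assms(3) by (simp add: Vplus_def)
  then obtain i where "i < length vs" "x = vs ! i" by (metis in_set_conv_nth)
  then show False using equal_covers_nonsink[OF assms(1-4)] x by auto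
qed

theorem equal_covers_iff:
  assumes "connected_graph (underlying D)"
  shows "equal_covers D \<longleftrightarrow>
      ((isomorphic K\<^sub>1 (underlying D) \<or> isomorphic C\<^sub>7 (underlying D) \<or>
        isomorphic Q\<^sub>1\<^sub>3 (underlying D) \<or> isomorphic P\<^sub>1\<^sub>3 (underlying D) \<or>
        isomorphic P\<^sub>1\<^sub>4 (underlying D)) \<and>
       (\<forall>x\<in>Vplus D. sink D x))
    \<or> (\<exists>\<phi>. graph_iso P\<^sub>1\<^sub>0 (underlying D) \<phi> \<and>
         (\<forall>y\<in>Vplus D. \<not> sink D y \<longrightarrow>
            (y = \<phi> (vd 1) \<and> out_nbrs D y = {\<phi> (vg 1), \<phi> (vb 2)}) \<or>
            (y = \<phi> (vd 2) \<and> out_nbrs D y = {\<phi> (vg 2), \<phi> (vb 1)})))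
    \<or> ((\<forall>x\<in>verts D. \<exists>!H. H \<in> simplexes (underlying D) \<union> basic_5_cycles (underlying D) \<and>
           x \<in> fst H) \<and>
       (\<forall>K\<in>wo_simplexes D. \<nexists>H. generating_star_semi_forest D K H) \<and>
       (\<forall>C\<in>basic_5_cycles (underlying D). star_property D C))"
  unfolding P10_iff K1_iff C7_iff Q13_iff P13_iff P14_iff partitioned_def[symmetric] condition_c_iff[symmetric]
proof
  assume ec: "equal_covers D"
  show "(((\<exists>x. V = {x}) \<or> (\<exists>vs. distinct vs \<and> set vs = V \<and> cmat vs = C7_matrix) \<or>
      (\<exists>vs. distinct vs \<and> set vs = V \<and> cmat vs = Q13_matrix) \<or>
      (\<exists>vs. distinct vs \<and> set vs = V \<and> cmat vs = P13_matrix) \<or>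
      (\<exists>vs. distinct vs \<and> set vs = V \<and> cmat vs = P14_matrix)) \<and> (\<forall>x\<in>Vplus D. sink D x)) \<or>
    (\<exists>vs. distinct vs \<and> set vs = V \<and> cmat vs = P10_matrix \<and> equal_covers D) \<or>
    (equal_covers D \<and> (\<forall>x\<in>V. good V x \<or> nb V x = {}))"
  proof (cases "\<forall>x\<in>V. good V x \<or> nb V x = {}")
    case False
    then obtain x where x: "x \<in> V" "\<not> good V x" "nb V x \<noteq> {}" by blast
    then obtain X where X: "x \<in> X" "closed V X" "special X"
      using well_covered_classification[OF equal_covers_wc[OF ec] x(1)] by blast
    then have "special V" using connected_closed[OF assms X(2,1)] by simp
    then obtain vs where vs: "distinct vs" "set vs = V" "cmat vs \<in> set sporadic" by (auto simp: special_def)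
    note s = equal_covers_sinks[OF ec vs(1,2)]
    have "cmat vs = C7_matrix \<or> cmat vs = P10_matrix \<or> cmat vs = P13_matrix \<or> cmat vs = Q13_matrix \<or> cmat vs = P14_matrix"
      using vs(3) by (auto simp: sporadic_def)
    then show ?thesis
      using s vs(1,2) ec C7_sinks_only P13_sinks_only Q13_sinks_only P14_sinks_only by (elim disjE) metis+
  qed (use ec in blast)
next
  assume a: "(((\<exists>x. V = {x}) \<or> (\<exists>vs. distinct vs \<and> set vs = V \<and> cmat vs = C7_matrix) \<or>
      (\<exists>vs. distinct vs \<and> set vs = V \<and> cmat vs = Q13_matrix) \<or>
      (\<exists>vs. distinct vs \<and> set vs = V \<and> cmat vs = P13_matrix) \<or>
      (\<exists>vs. distinct vs \<and> set vs = V \<and> cmat vs = P14_matrix)) \<and> (\<forall>x\<in>Vplus D. sink D x)) \<or>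
    (\<exists>vs. distinct vs \<and> set vs = V \<and> cmat vs = P10_matrix \<and> equal_covers D) \<or>
    (equal_covers D \<and> (\<forall>x\<in>V. good V x \<or> nb V x = {}))"
  have K1: "equal_covers D" if "V = {x}" for x
  proof -
    have "C = {}" if C: "strong_cover D C" for C
    proof (rule ccontr)
      assume "C \<noteq> {}"
      then have "x \<in> C" "nb V x \<subseteq> C" using strong_cover_facts(1)[OF C] \<open>V = {x}\<close> by auto
      then obtain y where "(y, x) \<in> arcs D" using strong_cover_facts(3)[OF C] by blast
      then show False using arcs_V asym \<open>V = {x}\<close> by (metis singletonD)
    qed
    then show ?thesis unfolding equal_covers_def by metis
  qed
  have "equal_covers D"
    if "distinct vs" "set vs = V" "cmat vs = M" "\<forall>x\<in>Vplus D. sink D x" "equicardinal M n" for vs M n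
    using sinks_equal_covers that by metis
  note m = this[OF _ _ _ _ C7_equicardinal] this[OF _ _ _ _ P13_equicardinal] this[OF _ _ _ _ Q13_equicardinal]
    this[OF _ _ _ _ P14_equicardinal]
  show "equal_covers D" using a K1 m by blast
qed

end

section \<open>Associated primes of the edge ideal and their heights\<close>

type_synonym ('v, 'k) mpoly = "('v \<Rightarrow>\<^sub>0 nat) \<Rightarrow>\<^sub>0 'k"

abbreviation keys where "keys \<equiv> Poly_Mapping.keys"
abbreviation lookup where "lookup \<equiv> Poly_Mapping.lookup"
abbreviation single where "single \<equiv> Poly_Mapping.single"

definition mons :: "'v set \<Rightarrow> ('v \<Rightarrow>\<^sub>0 nat) set" where
  "mons V = {m. keys m \<subseteq> V}"

definition meets :: "'v set \<Rightarrow> ('v \<Rightarrow>\<^sub>0 nat) set" where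
  "meets C = {m. keys m \<inter> C \<noteq> {}}"

lemma keys_plus_nat: "keys (a + b) = keys a \<union> keys (b :: 'v \<Rightarrow>\<^sub>0 nat)"
  by (auto simp: in_keys_iff lookup_add)

lemma mons_add: "a + b \<in> mons V \<longleftrightarrow> a \<in> mons V \<and> b \<in> mons V"
  by (auto simp: mons_def keys_plus_nat)

lemma meets_add: "a + b \<in> meets C \<longleftrightarrow> a \<in> meets C \<or> b \<in> meets C"
  by (auto simp: meets_def keys_plus_nat)

lemma poly_expand: "(p :: ('v, 'k::field) mpoly) = (\<Sum>m\<in>keys p. single m (lookup p m))"
proof (rule poly_mapping_eqI)
  fix k
  have "lookup (\<Sum>m\<in>keys p. single m (lookup p m)) k = (\<Sum>m\<in>keys p. if m = k then lookup p m else 0)"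
    by (simp add: lookup_sum lookup_single when_def)
  also have "\<dots> = lookup p k" by (auto simp: in_keys_iff)
  finally show "lookup p k = lookup (\<Sum>m\<in>keys p. single m (lookup p m)) k" by simp
qed

text \<open>The coefficient at \<open>a + b\<close> is a single product of nonzero field
  elements.\<close>

lemma lookup_mult_unique:
  fixes f g :: "('v, 'k::field) mpoly"
  assumes "a \<in> keys f" "b \<in> keys g" "\<And>a' b'. a' \<in> keys f \<Longrightarrow> b' \<in> keys g \<Longrightarrow> a' + b' = a + b \<Longrightarrow> a' = a \<and> b' = b"
  shows "a + b \<in> keys (f * g)"
proof -
  have "f * g = (\<Sum>a'\<in>keys f. \<Sum>b'\<in>keys g. single (a' + b') (lookup f a' * lookup g b'))"
    by (subst poly_expand[of f], subst poly_expand[of g]) (simp add: sum_product mult_single)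
  then have "lookup (f * g) (a + b) = (\<Sum>a'\<in>keys f. \<Sum>b'\<in>keys g. if a' + b' = a + b then lookup f a' * lookup g b' else 0)"
    by (simp add: lookup_sum lookup_single when_def)
  also have "\<dots> = (\<Sum>a'\<in>keys f. \<Sum>b'\<in>keys g. if a' = a \<and> b' = b then lookup f a' * lookup g b' else 0)"
    using assms(3) by (intro sum.cong refl) auto
  also have "\<dots> = (\<Sum>a'\<in>keys f. if a' = a then (\<Sum>b'\<in>keys g. if b' = b then lookup f a' * lookup g b' else 0) else 0)"
    by (intro sum.cong refl) auto
  also have "\<dots> = lookup f a * lookup g b" using assms(1,2) by simp
  finally show ?thesis using assms(1,2) by (simp add: in_keys_iff)
qed

text \<open>The exponent monoid has unique products: compare the exponents of one variable after the other and
  keep only the elements where they are maximal.\<close>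

lemma unique_product_aux:
  assumes "finite X" "finite A" "finite B" "A \<noteq> {}" "B \<noteq> {}"
    and "\<And>a a' y. a \<in> A \<Longrightarrow> a' \<in> A \<Longrightarrow> y \<notin> X \<Longrightarrow> lookup a y = lookup a' y"
    and "\<And>b b' y. b \<in> B \<Longrightarrow> b' \<in> B \<Longrightarrow> y \<notin> X \<Longrightarrow> lookup b y = lookup b' y"
  shows "\<exists>a\<in>A. \<exists>b\<in>B. \<forall>a'\<in>A. \<forall>b'\<in>B. a' + b' = a + b \<longrightarrow> a' = a \<and> b' = (b :: 'v \<Rightarrow>\<^sub>0 nat)"
  using assms
proof (induction X arbitrary: A B rule: finite_induct)
  case empty
  then obtain a b where ab: "a \<in> A" "b \<in> B" by blast
  have "a' = a" if "a' \<in> A" for a' using empty(5)[OF that ab(1)] by (intro poly_mapping_eqI) simp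
  moreover have "b' = b" if "b' \<in> B" for b' using empty(6)[OF that ab(2)] by (intro poly_mapping_eqI) simp
  ultimately show ?case using ab by blast
next
  case (insert x X)
  define top where "top S = {a \<in> S. lookup a x = Max ((\<lambda>a. lookup a x) ` S)}" for S :: "('v \<Rightarrow>\<^sub>0 nat) set"
  have top: "finite (top S)" "top S \<noteq> {}" "top S \<subseteq> S" "\<And>s t. s \<in> S \<Longrightarrow> t \<in> top S \<Longrightarrow> lookup s x \<le> lookup t x"
    "\<And>s t. s \<in> S \<Longrightarrow> t \<in> top S \<Longrightarrow> lookup s x = lookup t x \<Longrightarrow> s \<in> top S"
    "\<And>s t. s \<in> top S \<Longrightarrow> t \<in> top S \<Longrightarrow> lookup s x = lookup t x"
    if "finite S" "S \<noteq> {}" for S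
  proof -
    have "Max ((\<lambda>a. lookup a x) ` S) \<in> (\<lambda>a. lookup a x) ` S" using that by (intro Max_in) auto
    then show "top S \<noteq> {}" by (auto simp: top_def)
    show "lookup s x \<le> lookup t x" if "s \<in> S" "t \<in> top S" for s t
      using that \<open>finite S\<close> by (simp add: top_def)
  qed (use that in \<open>auto simp: top_def\<close>)
  note tA = top[OF insert.prems(1,3)] and tB = top[OF insert.prems(2,4)]
  have "\<exists>a\<in>top A. \<exists>b\<in>top B. \<forall>a'\<in>top A. \<forall>b'\<in>top B. a' + b' = a + b \<longrightarrow> a' = a \<and> b' = b"
  proof (rule insert.IH[OF tA(1) tB(1) tA(2) tB(2)])
    show "lookup a y = lookup a' y" if "a \<in> top A" "a' \<in> top A" "y \<notin> X" for a a' y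
      using that insert.prems(5)[of a a' y] tA(3) tA(6)[of a a'] by (cases "y = x") auto
    show "lookup a y = lookup a' y" if "a \<in> top B" "a' \<in> top B" "y \<notin> X" for a a' y
      using that insert.prems(6)[of a a' y] tB(3) tB(6)[of a a'] by (cases "y = x") auto
  qed
  then obtain a b where ab: "a \<in> top A" "b \<in> top B"
    "\<And>a' b'. a' \<in> top A \<Longrightarrow> b' \<in> top B \<Longrightarrow> a' + b' = a + b \<Longrightarrow> a' = a \<and> b' = b" by blast
  have "a' = a \<and> b' = b" if "a' \<in> A" "b' \<in> B" "a' + b' = a + b" for a' b'
  proof -
    have "lookup a' x + lookup b' x = lookup a x + lookup b x" using that(3) by (metis lookup_add)
    moreover have "lookup a' x \<le> lookup a x" "lookup b' x \<le> lookup b x"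
      using tA(4)[OF that(1) ab(1)] tB(4)[OF that(2) ab(2)] .
    ultimately have "lookup a' x = lookup a x" "lookup b' x = lookup b x" by linarith+
    then show ?thesis using tA(5)[OF that(1) ab(1)] tB(5)[OF that(2) ab(2)] ab(3) that(3) by blast
  qed
  then show ?case using ab(1,2) tA(3) tB(3) by blast
qed

lemma unique_product:
  assumes "finite A" "finite B" "A \<noteq> {}" "B \<noteq> {}"
  obtains a b where "a \<in> A" "b \<in> B" "\<And>a' b'. a' \<in> A \<Longrightarrow> b' \<in> B \<Longrightarrow> a' + b' = a + b \<Longrightarrow> a' = a \<and> b' = (b :: 'v \<Rightarrow>\<^sub>0 nat)"
proof -
  let ?X = "\<Union> (keys ` (A \<union> B))"
  have z: "lookup m y = 0" if "m \<in> A \<union> B" "y \<notin> ?X" for m y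
    using that by (auto simp: in_keys_iff)
  have "\<exists>a\<in>A. \<exists>b\<in>B. \<forall>a'\<in>A. \<forall>b'\<in>B. a' + b' = a + b \<longrightarrow> a' = a \<and> b' = b"
  proof (rule unique_product_aux[OF _ assms])
    show "finite ?X" using assms by auto
    show "lookup a y = lookup a' y" if "a \<in> A" "a' \<in> A" "y \<notin> ?X" for a a' y using z[of a y] z[of a' y] that by simp
    show "lookup a y = lookup a' y" if "a \<in> B" "a' \<in> B" "y \<notin> ?X" for a a' y using z[of a y] z[of a' y] that by simp
  qed
  then show thesis using that by blast
qed

definition polys :: "'v set \<Rightarrow> ('v, 'k::field) mpoly set" where
  "polys V = {p. keys p \<subseteq> mons V}"

text \<open>A monomial ideal given by all exponents it contains rather than by generators, so that
  membership only inspects the support.\<close>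

definition mideal :: "'v set \<Rightarrow> ('v \<Rightarrow>\<^sub>0 nat) set \<Rightarrow> ('v, 'k::field) mpoly set" where
  "mideal V U = {p. keys p \<subseteq> mons V \<inter> U}"

lemma polynomial_ring_simps [simp]:
  "carrier (polynomial_ring V) = (polys V :: ('v, 'k::field) mpoly set)"
  "p \<otimes>\<^bsub>polynomial_ring V\<^esub> q = p * q" "p \<oplus>\<^bsub>polynomial_ring V\<^esub> q = p + q"
  "\<one>\<^bsub>polynomial_ring V\<^esub> = 1" "\<zero>\<^bsub>polynomial_ring V\<^esub> = 0"
  by (auto simp: polynomial_ring_def polys_def mons_def)

lemma polys_closed:
  "p \<in> polys V \<Longrightarrow> q \<in> polys V \<Longrightarrow> p + q \<in> polys V" "p \<in> polys V \<Longrightarrow> q \<in> polys V \<Longrightarrow> p * q \<in> polys V"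
  "0 \<in> polys V" "1 \<in> polys V" "p \<in> polys V \<Longrightarrow> - p \<in> polys V" "single m c \<in> polys V \<longleftrightarrow> c = 0 \<or> m \<in> mons V"
proof -
  show "p \<in> polys V \<Longrightarrow> q \<in> polys V \<Longrightarrow> p + q \<in> polys V"
    using keys_add[of p q] by (auto simp: polys_def)
  show "p \<in> polys V \<Longrightarrow> q \<in> polys V \<Longrightarrow> p * q \<in> polys V"
    using keys_mult[of p q] mons_add[of _ _ V] unfolding polys_def by blast
qed (auto simp: polys_def mons_def)

lemma cring_polynomial_ring: "cring (polynomial_ring V :: (('v, 'k::field) mpoly) ring)"
proof (rule cringI)
  show "abelian_group (polynomial_ring V :: (('v, 'k) mpoly) ring)"
  proof (rule abelian_groupI; simp add: polys_closed add.assoc add.commute)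
    show "\<And>x :: ('v, 'k) mpoly. x \<in> polys V \<Longrightarrow> \<exists>y\<in>polys V. x + y = 0"
      using polys_closed(5) by (metis add.right_inverse)
  qed
  show "Group.comm_monoid (polynomial_ring V :: (('v, 'k) mpoly) ring)"
    by (rule comm_monoidI; simp add: polys_closed mult.assoc mult.commute)
qed (simp add: distrib_right)

lemma minus_polynomial_ring: "p \<in> polys V \<Longrightarrow> \<ominus>\<^bsub>polynomial_ring V\<^esub> p = - (p :: ('v, 'k::field) mpoly)"
proof -
  assume p: "p \<in> polys V"
  interpret cring "polynomial_ring V :: (('v, 'k) mpoly) ring" by (rule cring_polynomial_ring)
  show ?thesis by (rule minus_equality) (use p polys_closed(5) in auto)
qed

lemma ideal_mideal:
  assumes "\<And>a m. a \<in> mons V \<Longrightarrow> m \<in> U \<Longrightarrow> a + m \<in> U"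
  shows "ideal (mideal V U :: ('v, 'k::field) mpoly set) (polynomial_ring V)"
proof -
  interpret cring "polynomial_ring V :: (('v, 'k) mpoly) ring" by (rule cring_polynomial_ring)
  have sub: "mideal V U \<subseteq> (polys V :: ('v, 'k) mpoly set)" by (auto simp: mideal_def polys_def)
  have mul: "x * a \<in> mideal V U" if "x \<in> polys V" "a \<in> mideal V U" for x a :: "('v, 'k) mpoly"
  proof -
    have "keys (x * a) \<subseteq> {b + m | b m. b \<in> keys x \<and> m \<in> keys a}" by (rule keys_mult)
    also have "\<dots> \<subseteq> mons V \<inter> U" using that assms mons_add[of _ _ V] unfolding mideal_def polys_def by blast
    finally show ?thesis by (simp add: mideal_def)
  qed
  have mul': "a * x \<in> mideal V U" if "x \<in> polys V" "a \<in> mideal V U" for x a :: "('v, 'k) mpoly"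
    using mul[OF that] by (simp add: mult.commute)
  show ?thesis
  proof (rule idealI[OF ring_axioms])
    show "subgroup (mideal V U) (add_monoid (polynomial_ring V :: (('v, 'k) mpoly) ring))"
    proof (rule add.subgroupI)
      show "mideal V U \<subseteq> carrier (polynomial_ring V :: (('v, 'k) mpoly) ring)" using sub by simp
      have "0 \<in> (mideal V U :: ('v, 'k) mpoly set)" by (simp add: mideal_def)
      then show "mideal V U \<noteq> ({} :: ('v, 'k) mpoly set)" by blast
      show "\<ominus>\<^bsub>polynomial_ring V\<^esub> a \<in> mideal V U" if "a \<in> mideal V U" for a :: "('v, 'k) mpoly"
      proof -
        have "a \<in> polys V" using that sub by blast
        then show ?thesis using that by (simp add: minus_polynomial_ring mideal_def)
      qed
      show "a \<oplus>\<^bsub>polynomial_ring V\<^esub> b \<in> mideal V U" if "a \<in> mideal V U" "b \<in> mideal V U" for a b :: "('v, 'k) mpoly"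
        using that keys_add[of a b] by (auto simp: mideal_def)
    qed
  qed (use mul mul' in auto)
qed

lemma prime_facts:
  assumes "primeideal (P :: ('v, 'k::field) mpoly set) (polynomial_ring V)"
  shows "P \<subseteq> polys V" "0 \<in> P" "a \<in> P \<Longrightarrow> b \<in> P \<Longrightarrow> a + b \<in> P" "a \<in> P \<Longrightarrow> - a \<in> P"
    "p \<in> polys V \<Longrightarrow> q \<in> P \<Longrightarrow> p * q \<in> P" "1 \<notin> P"
    "p * q \<in> P \<Longrightarrow> p \<in> polys V \<Longrightarrow> q \<in> polys V \<Longrightarrow> p \<in> P \<or> q \<in> P"
proof -
  note id = primeideal.axioms(1)[OF assms]
  note sg = ideal.axioms(1)[OF id]
  show sub: "P \<subseteq> polys V" using additive_subgroup.a_subset[OF sg] by simp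
  show "0 \<in> P" using additive_subgroup.zero_closed[OF sg] by simp
  show "a \<in> P \<Longrightarrow> b \<in> P \<Longrightarrow> a + b \<in> P" using additive_subgroup.a_closed[OF sg, of a b] by simp
  show "- a \<in> P" if "a \<in> P"
  proof -
    interpret cring "polynomial_ring V :: (('v, 'k) mpoly) ring" by (rule cring_polynomial_ring)
    from additive_subgroup.a_inv_closed[OF sg that] show ?thesis
      using minus_polynomial_ring that sub by (metis subsetD)
  qed
  show "p \<in> polys V \<Longrightarrow> q \<in> P \<Longrightarrow> p * q \<in> P" using ideal.I_l_closed[OF id, of q p] by simp
  show "1 \<notin> P" using ideal.one_imp_carrier[OF id] primeideal.I_notcarr[OF assms] by auto
  show "p * q \<in> P \<Longrightarrow> p \<in> polys V \<Longrightarrow> q \<in> polys V \<Longrightarrow> p \<in> P \<or> q \<in> P"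
    using primeideal.I_prime[OF assms, of p q] by simp
qed

definition variable_ideal :: "'v set \<Rightarrow> 'v set \<Rightarrow> ('v, 'k::field) mpoly set" where
  "variable_ideal V C = mideal V (meets C)"

text \<open>The terms of \<open>f\<close> and of \<open>g\<close> that avoid \<open>C\<close> have a
  unique product. It avoids \<open>C\<close> and does not cancel, because a sum of exponents avoids
  \<open>C\<close> only if both summands do.\<close>

lemma primeideal_variable_ideal: "primeideal (variable_ideal V C :: ('v, 'k::field) mpoly set) (polynomial_ring V)"
proof (rule primeidealI)
  show "ideal (variable_ideal V C :: ('v, 'k) mpoly set) (polynomial_ring V)"
    unfolding variable_ideal_def by (rule ideal_mideal) (simp add: meets_add)
  show "cring (polynomial_ring V :: (('v, 'k) mpoly) ring)" by (rule cring_polynomial_ring)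
  have "(1 :: ('v, 'k) mpoly) \<notin> variable_ideal V C" by (simp add: variable_ideal_def mideal_def meets_def)
  then show "carrier (polynomial_ring V) \<noteq> (variable_ideal V C :: ('v, 'k) mpoly set)" using polys_closed(4) by auto
  fix f g :: "('v, 'k) mpoly"
  assume fg: "f \<in> carrier (polynomial_ring V)" "g \<in> carrier (polynomial_ring V)" "f \<otimes>\<^bsub>polynomial_ring V\<^esub> g \<in> variable_ideal V C"
  show "f \<in> variable_ideal V C \<or> g \<in> variable_ideal V C"
  proof (rule ccontr)
    assume n: "\<not> ?thesis"
    define A where "A = {a \<in> keys f. a \<notin> meets C}"
    define B where "B = {a \<in> keys g. a \<notin> meets C}"
    have "A \<noteq> {}" "B \<noteq> {}" using n fg(1,2) by (auto simp: A_def B_def variable_ideal_def mideal_def polys_def)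
    moreover have "finite A" "finite B" by (auto simp: A_def B_def)
    ultimately obtain a b where ab: "a \<in> A" "b \<in> B"
      "\<And>a' b'. a' \<in> A \<Longrightarrow> b' \<in> B \<Longrightarrow> a' + b' = a + b \<Longrightarrow> a' = a \<and> b' = b" using unique_product by metis
    have nm: "a + b \<notin> meets C" using ab(1,2) by (simp add: A_def B_def meets_add)
    have "a + b \<in> keys (f * g)"
    proof (rule lookup_mult_unique)
      fix a' b' assume k: "a' \<in> keys f" "b' \<in> keys g" "a' + b' = a + b"
      then have "a' \<notin> meets C" "b' \<notin> meets C" using nm meets_add[of a' b' C] by auto
      then show "a' = a \<and> b' = b" using ab(3) k by (auto simp: A_def B_def)
    qed (use ab in \<open>auto simp: A_def B_def\<close>)
    then show False using fg(3) nm by (auto simp: variable_ideal_def mideal_def)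
  qed
qed

definition edge_mons :: "'v wograph \<Rightarrow> ('v \<Rightarrow>\<^sub>0 nat) set" where
  "edge_mons D = {m. \<exists>(x, y)\<in>arcs D. 1 \<le> lookup m x \<and> weight D y \<le> lookup m y}"

lemma edge_mons_add: "m \<in> edge_mons D \<Longrightarrow> a + m \<in> edge_mons D"
  unfolding edge_mons_def by (auto simp: lookup_add intro: trans_le_add2)

lemma variable_power: "variable y ^ n = (single (single y n) 1 :: ('v, 'k::field) mpoly)"
proof (induction n)
  case (Suc n)
  have "single y (Suc 0) + single y n = single y (Suc n)" by (simp flip: single_add)
  then show ?case using Suc by (simp add: variable_def mult_single)
qed simp

lemma edge_ideal_eq:
  assumes "weighted_oriented_graph D"
  shows "edge_ideal D = (mideal (verts D) (edge_mons D) :: ('v, 'k::field) mpoly set)"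
proof -
  let ?V = "verts D" and ?R = "polynomial_ring (verts D) :: (('v, 'k) mpoly) ring"
  let ?G = "{variable x * variable y ^ weight D y | x y. (x, y) \<in> arcs D} :: ('v, 'k) mpoly set"
  interpret cring ?R by (rule cring_polynomial_ring)
  have gen: "variable x * variable y ^ n = (single (single x 1 + single y n) 1 :: ('v, 'k) mpoly)" for x y n
    by (simp add: variable_power) (simp add: variable_def mult_single)
  have arc: "x \<in> ?V" "y \<in> ?V" "x \<noteq> y" if "(x, y) \<in> arcs D" for x y
    using assms that by (auto simp: weighted_oriented_graph_def)
  have inm: "?G \<subseteq> mideal ?V (edge_mons D)"
  proof
    fix g assume "g \<in> ?G"
    then obtain x y where xy: "(x, y) \<in> arcs D" and g: "g = variable x * variable y ^ weight D y" by blast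
    have "single x 1 + single y (weight D y) \<in> edge_mons D"
      unfolding edge_mons_def using xy arc[OF xy]
      by (intro CollectI bexI[of _ "(x, y)"]) (auto simp: lookup_add lookup_single)
    moreover have "single x 1 + single y (weight D y) \<in> mons ?V"
      using arc[OF xy] by (simp add: mons_add) (simp add: mons_def)
    ultimately show "g \<in> mideal ?V (edge_mons D)" unfolding g gen by (simp add: mideal_def)
  qed
  have sub: "?G \<subseteq> carrier ?R" using inm by (auto simp: mideal_def polys_def)
  have id: "ideal (mideal ?V (edge_mons D) :: ('v, 'k) mpoly set) ?R"
    by (rule ideal_mideal) (rule edge_mons_add)
  interpret I: ideal "edge_ideal D" ?R unfolding edge_ideal_def by (rule genideal_ideal[OF sub])
  have GI: "?G \<subseteq> edge_ideal D" unfolding edge_ideal_def by (rule genideal_self[OF sub])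
  have mon: "single m c \<in> (edge_ideal D :: ('v, 'k) mpoly set)" if m: "m \<in> mons ?V \<inter> edge_mons D" for m and c :: 'k
  proof -
    obtain x y where xy: "(x, y) \<in> arcs D" "1 \<le> lookup m x" "weight D y \<le> lookup m y"
      using m by (auto simp: edge_mons_def)
    define r where "r = m - (single x 1 + single y (weight D y))"
    have m_eq: "m = r + (single x 1 + single y (weight D y))"
      by (rule poly_mapping_eqI)
        (use xy arc[OF xy(1)] in \<open>auto simp: r_def lookup_add lookup_minus lookup_single when_def\<close>)
    have r: "single r c \<in> carrier ?R" using m m_eq mons_add[of r] by (auto simp: polys_closed)
    have "single r c * (variable x * variable y ^ weight D y) \<in> edge_ideal D"
      using I.I_l_closed[OF _ r] GI xy(1) by auto
    moreover have "single r c * single (single x 1 + single y (weight D y)) 1 = single m c"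
      by (simp only: mult_single mult_1_right flip: m_eq)
    ultimately show ?thesis unfolding gen by simp
  qed
  have sum: "(\<Sum>m\<in>M. single m (g m)) \<in> (edge_ideal D :: ('v, 'k) mpoly set)"
    if "finite M" "M \<subseteq> mons ?V \<inter> edge_mons D" for M and g :: "_ \<Rightarrow> 'k"
    using that
  proof (induction M)
    case empty
    then show ?case using I.zero_closed by simp
  next
    case (insert m M)
    then show ?case using I.a_closed[of "single m (g m)" "\<Sum>m\<in>M. single m (g m)"] mon[of m "g m"] by simp
  qed
  show ?thesis
  proof
    show "edge_ideal D \<subseteq> (mideal ?V (edge_mons D) :: ('v, 'k) mpoly set)"
      unfolding edge_ideal_def by (rule genideal_minimal[OF id inm])
    show "(mideal ?V (edge_mons D) :: ('v, 'k) mpoly set) \<subseteq> edge_ideal D"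
    proof
      fix p :: "('v, 'k) mpoly" assume "p \<in> mideal ?V (edge_mons D)"
      then have "(\<Sum>m\<in>keys p. single m (lookup p m)) \<in> edge_ideal D" by (intro sum) (auto simp: mideal_def)
      then show "p \<in> edge_ideal D" using poly_expand[of p] by simp
    qed
  qed
qed

section \<open>Colon ideals of monomials and strong covers\<close>

definition isolates :: "'v set \<Rightarrow> ('v \<Rightarrow>\<^sub>0 nat) set \<Rightarrow> 'v set \<Rightarrow> ('v \<Rightarrow>\<^sub>0 nat) \<Rightarrow> bool" where
  "isolates V U C b \<longleftrightarrow> b \<in> mons V \<and> (\<forall>x\<in>C. single x 1 + b \<in> U) \<and> (\<forall>a\<in>mons (V - C). a + b \<notin> U)"

lemma keys_single_mult: "keys (single b 1 * (p :: ('v, 'k::field) mpoly)) = (\<lambda>a. a + b) ` keys p"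
proof
  show "keys (single b 1 * p) \<subseteq> (\<lambda>a. a + b) ` keys p"
    using keys_mult[of "single b 1" p] by (auto simp: add.commute)
  show "(\<lambda>a. a + b) ` keys p \<subseteq> keys (single b 1 * p)"
  proof
    fix m assume "m \<in> (\<lambda>a. a + b) ` keys p"
    then obtain a where a: "a \<in> keys p" "m = b + a" by (auto simp: add.commute)
    show "m \<in> keys (single b 1 * p)" unfolding a(2) by (rule lookup_mult_unique) (use a(1) in auto)
  qed
qed

lemma isolates_colon:
  assumes U: "\<And>a m. m \<in> U \<Longrightarrow> a + m \<in> U" and "isolates V U C b" "C \<subseteq> V"
  shows "variable_ideal V C = {g \<in> polys V. g * single b 1 \<in> (mideal V U :: ('v, 'k::field) mpoly set)}"
proof -
  have b: "b \<in> mons V" "\<And>x. x \<in> C \<Longrightarrow> single x 1 + b \<in> U" "\<And>a. a \<in> mons (V - C) \<Longrightarrow> a + b \<notin> U"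
    using assms(2) by (auto simp: isolates_def)
  have iff: "a + b \<in> U \<longleftrightarrow> a \<in> meets C" if a: "a \<in> mons V" for a
  proof
    assume "a + b \<in> U"
    then have "a \<notin> mons (V - C)" using b(3) by blast
    then show "a \<in> meets C" using a by (auto simp: mons_def meets_def)
  next
    assume "a \<in> meets C"
    then obtain x where x: "x \<in> C" "x \<in> keys a" by (auto simp: meets_def)
    have "a = (a - single x 1) + single x 1"
      by (rule poly_mapping_eqI) (use x(2) in \<open>auto simp: lookup_add lookup_minus lookup_single when_def in_keys_iff\<close>)
    then show "a + b \<in> U" using U[OF b(2)[OF x(1)], of "a - single x 1"] by (metis add.assoc)
  qed
  have "p * single b 1 \<in> mideal V U \<longleftrightarrow> p \<in> variable_ideal V C" if "p \<in> polys V" for p :: "('v, 'k) mpoly"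
  proof -
    have k: "keys (p * single b 1) = (\<lambda>a. a + b) ` keys p" using keys_single_mult[of b p] by (simp add: mult.commute)
    have "a + b \<in> mons V \<inter> U \<longleftrightarrow> a \<in> meets C" if "a \<in> keys p" for a
      using iff that \<open>p \<in> polys V\<close> b(1) by (auto simp: polys_def mons_add)
    then show ?thesis using that unfolding mideal_def variable_ideal_def polys_def mem_Collect_eq k by (auto simp: image_subset_iff)
  qed
  moreover have "variable_ideal V C \<subseteq> (polys V :: ('v, 'k) mpoly set)" by (auto simp: variable_ideal_def mideal_def polys_def)
  ultimately show ?thesis by blast
qed

text \<open>If \<open>P = (I : f)\<close> with as few monomials of \<open>f\<close> outside \<open>I\<close> as possible, no element of \<open>P\<close> can avoid
  \<open>C\<close>: a unique product of exponents would allow to replace \<open>f\<close> by a multiple with fewer such monomials.\<close>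

lemma associated_isolates:
  assumes U: "\<And>a m. m \<in> U \<Longrightarrow> a + m \<in> U"
    and P: "primeideal (P :: ('v, 'k::field) mpoly set) (polynomial_ring V)"
    and colon: "f0 \<in> polys V" "P = {g \<in> polys V. g * f0 \<in> mideal V U}"
  obtains C b where "C \<subseteq> V" "P = variable_ideal V C" "isolates V U C b"
proof -
  note facts = prime_facts[OF P]
  note PV = facts(1) and mulP = facts(5) and P1 = facts(6) and prime = facts(7)
  define outside where "outside f = card (keys f - U)" for f :: "('v, 'k) mpoly"
  define Q where "Q f \<longleftrightarrow> f \<in> polys V \<and> P = {g \<in> polys V. g * f \<in> mideal V U}" for f
  have "Q f0" using colon by (simp add: Q_def)
  then obtain f where f: "Q f" and min: "\<And>f'. Q f' \<Longrightarrow> outside f \<le> outside f'"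
    using ex_has_least_nat[of Q f0 outside] by blast
  have fV: "f \<in> polys V" and Pf: "P = {g \<in> polys V. g * f \<in> mideal V U}" using f by (auto simp: Q_def)
  define C where "C = {x \<in> V. variable x \<in> P}"
  have var: "variable x \<in> polys V \<longleftrightarrow> x \<in> V" for x by (simp add: variable_def polys_closed mons_def)
  \<comment> \<open>Such a monomial is a product of variables outside the prime \<open>P\<close>;
    induction on the degree.\<close>
  have mono: "single a 1 \<notin> P" if a: "a \<in> mons (V - C)" for a
    using a
  proof (induction "\<Sum>x\<in>keys a. lookup a x" arbitrary: a rule: less_induct)
    case less
    show ?case
    proof (cases "a = 0")
      case False
      then obtain x where x: "x \<in> keys a" by (metis keys_eq_empty all_not_in_conv)
      define a' where "a' = a - single x 1"
      have a: "a = single x 1 + a'"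
        by (rule poly_mapping_eqI) (use x in \<open>auto simp: a'_def lookup_add lookup_minus lookup_single when_def in_keys_iff\<close>)
      have "(\<Sum>x\<in>keys a'. lookup a' x) = (\<Sum>x\<in>keys a. lookup a' x)"
        using a by (intro sum.mono_neutral_left) (auto simp: keys_plus_nat in_keys_iff)
      also have "\<dots> < (\<Sum>x\<in>keys a. lookup a x)"
        by (rule sum_strict_mono_ex1) (use a x in \<open>auto simp: lookup_add lookup_single when_def intro!: bexI[of _ x]\<close>)
      finally have "single a' 1 \<notin> P" using less(1)[of a'] less(2) a by (simp add: mons_add)
      moreover have xV: "x \<in> V" "x \<notin> C" using x less(2) by (auto simp: mons_def)
      moreover have "a' \<in> mons V" using less(2) a mons_add[of "single x 1" a' "V - C"] by (auto simp: mons_def)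
      then have "single a' 1 \<in> polys V" by (simp add: polys_closed)
      moreover have "single a 1 = variable x * single a' 1" unfolding a by (simp add: variable_def mult_single)
      moreover have "variable x \<notin> P" using xV by (simp add: C_def)
      ultimately show ?thesis using prime[of "variable x" "single a' 1"] var[of x] by metis
    qed (use P1 in simp)
  qed
  \<comment> \<open>Otherwise multiplying \<open>f\<close> by the monomial of \<open>a\<close> keeps
    the colon ideal, as that monomial is not in \<open>P\<close>, and moves \<open>b\<close> into
    \<open>U\<close>, against minimality.\<close>
  have shift: "a + b \<notin> U" if a: "a \<in> mons (V - C)" and b: "b \<in> keys f - U" for a b
  proof
    assume ab: "a + b \<in> U"
    have aV: "a \<in> mons V" using a by (auto simp: mons_def)
    let ?f = "single a 1 * f"
    have sa: "single a 1 \<in> polys V" using aV by (simp add: polys_closed)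
    have "Q ?f"
      unfolding Q_def
    proof (intro conjI Set.set_eqI iffI)
      show "?f \<in> polys V" using sa fV by (rule polys_closed(2))
      fix g
      show "g \<in> {g \<in> polys V. g * ?f \<in> mideal V U}" if "g \<in> P"
        using mulP[OF sa that] that PV unfolding Pf by (auto simp: ac_simps)
      show "g \<in> P" if "g \<in> {g \<in> polys V. g * ?f \<in> mideal V U}"
      proof -
        have "g * single a 1 \<in> P" "g \<in> polys V" using that sa polys_closed(2)[of g V "single a 1"] unfolding Pf by (auto simp: ac_simps)
        then show ?thesis using prime[of g "single a 1"] sa mono[OF a] by blast
      qed
    qed
    then have "outside f \<le> outside ?f" by (rule min)
    have sub: "keys ?f - U \<subseteq> (\<lambda>c. c + a) ` (keys f - U - {b})"
    proof
      fix m assume m: "m \<in> keys ?f - U"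
      then obtain c where c: "c \<in> keys f" "m = c + a" unfolding keys_single_mult by blast
      have "c \<noteq> b" using m ab c(2) by (auto simp: add.commute)
      moreover have "c \<notin> U" using U[of c a] m c(2) by (auto simp: add.commute)
      ultimately show "m \<in> (\<lambda>c. c + a) ` (keys f - U - {b})" using c by blast
    qed
    have "outside ?f \<le> card ((\<lambda>c. c + a) ` (keys f - U - {b}))"
      unfolding outside_def by (rule card_mono[OF _ sub]) simp
    also have "\<dots> \<le> card (keys f - U - {b})" by (rule card_image_le) simp
    also have "\<dots> < outside f" unfolding outside_def by (rule psubset_card_mono) (use b in auto)
    finally show False using \<open>outside f \<le> outside ?f\<close> by simp
  qed
  have sub_P: "variable_ideal V C \<subseteq> P"
  proof
    fix p :: "('v, 'k) mpoly" assume p: "p \<in> variable_ideal V C"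
    have "(\<Sum>m\<in>M. single m (lookup p m)) \<in> P" if "finite M" "M \<subseteq> keys p" for M
      using that
    proof (induction M)
      case empty
      then show ?case using facts(2) by simp
    next
      case (insert m M)
      have "m \<in> mons V" "m \<in> meets C" using p insert(4) by (auto simp: variable_ideal_def mideal_def)
      then obtain x where x: "x \<in> C" "x \<in> keys m" by (auto simp: meets_def)
      define m' where "m' = m - single x 1"
      have m: "m = m' + single x 1"
        by (rule poly_mapping_eqI) (use x(2) in \<open>auto simp: m'_def lookup_add lookup_minus lookup_single when_def in_keys_iff\<close>)
      have "single m' (lookup p m) \<in> polys V" using \<open>m \<in> mons V\<close> m mons_add[of m' "single x 1" V] by (simp add: polys_closed)
      then have "single m' (lookup p m) * variable x \<in> P" using mulP x(1) by (simp add: C_def)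
      moreover have "single m' (lookup p m) * variable x = single m (lookup p m)"
        by (simp only: variable_def mult_single mult_1_right flip: m)
      ultimately show ?case using insert facts(3)[of "single m (lookup p m)"] by simp
    qed
    then show "p \<in> P" using poly_expand[of p] by (metis finite_keys order_refl)
  qed
  have "P \<subseteq> variable_ideal V C"
  proof (rule subsetI, rule ccontr)
    fix g assume g: "g \<in> P" "g \<notin> variable_ideal V C"
    have gV: "g \<in> polys V" using g(1) PV by blast
    define A where "A = {a \<in> keys g. a \<notin> meets C}"
    \<comment> \<open>Subtracting an element of \<open>variable_ideal V C\<close> reduces
      \<open>g\<close> to the part \<open>h\<close> whose exponents avoid \<open>C\<close>.\<close>
    define h where "h = (\<Sum>m\<in>A. single m (lookup g m))"
    have fin: "finite A" by (simp add: A_def)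
    have lh: "lookup h k = (if k \<in> A then lookup g k else 0)" for k
      unfolding h_def lookup_sum lookup_single when_def using fin by simp
    have kh: "keys h = A" by (auto simp: in_keys_iff lh A_def)
    have "keys (g - h) \<subseteq> keys g - A" by (auto simp: in_keys_iff lookup_minus lh A_def)
    then have gh: "g - h \<in> variable_ideal V C" using gV by (auto simp: variable_ideal_def mideal_def polys_def A_def)
    then have "g - h \<in> P" using sub_P by blast
    then have "- (g - h) \<in> P" by (rule facts(4))
    then have hP: "h \<in> P" using facts(3)[of g "- (g - h)"] g(1) by simp
    have "A \<noteq> {}" using g(2) gV by (auto simp: A_def variable_ideal_def mideal_def polys_def)
    have "f \<notin> mideal V U" using P1 polys_closed(4) unfolding Pf by auto
    then have "keys f - U \<noteq> {}" using fV by (auto simp: mideal_def polys_def)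
    then obtain a b where ab: "a \<in> A" "b \<in> keys f - U"
      "\<And>a' b'. a' \<in> A \<Longrightarrow> b' \<in> keys f - U \<Longrightarrow> a' + b' = a + b \<Longrightarrow> a' = a \<and> b' = b"
      using unique_product[of A "keys f - U"] fin \<open>A \<noteq> {}\<close> by (metis finite_Diff finite_keys)
    have "a \<in> mons (V - C)" using ab(1) gV by (auto simp: A_def mons_def meets_def polys_def)
    then have nU: "a + b \<notin> U" using shift ab(2) by blast
    have "a + b \<in> keys (h * f)"
    proof (rule lookup_mult_unique)
      fix a' b' assume k: "a' \<in> keys h" "b' \<in> keys f" "a' + b' = a + b"
      then have "b' \<notin> U" using nU U[of b' a'] by auto
      then show "a' = a \<and> b' = b" using ab(3) k kh by blast
    qed (use ab kh in auto)
    then show False using hP nU unfolding Pf by (auto simp: mideal_def)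
  qed
  then have P_eq: "P = variable_ideal V C" using sub_P by blast
  have "f \<notin> mideal V U" using P1 polys_closed(4) unfolding Pf by auto
  then obtain b where b: "b \<in> keys f - U" using fV by (auto simp: mideal_def polys_def)
  have "isolates V U C b"
    unfolding isolates_def
  proof (intro conjI ballI)
    show "b \<in> mons V" using b fV by (auto simp: polys_def)
    show "a + b \<notin> U" if "a \<in> mons (V - C)" for a using shift[OF that b] .
    fix x assume "x \<in> C"
    then have "variable x * f \<in> mideal V U" unfolding C_def Pf by blast
    then have "keys (variable x * f) \<subseteq> U" by (simp add: mideal_def)
    then show "single x 1 + b \<in> U" unfolding variable_def keys_single_mult using b by (auto simp: add.commute)
  qed
  moreover have "C \<subseteq> V" by (auto simp: C_def)
  ultimately show thesis using that P_eq by blast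
qed

lemma lookup_sum_single: "finite V \<Longrightarrow> lookup (\<Sum>x\<in>V. single x (g x)) y = (if y \<in> V then g y else 0)"
  by (simp add: lookup_sum lookup_single when_def)

lemma isolates_iff:
  assumes D: "weighted_oriented_graph D" and CV: "C \<subseteq> verts D"
  shows "(\<exists>b. isolates (verts D) (edge_mons D) C b) \<longleftrightarrow> strong_cover D C"
proof
  have arc: "x \<in> verts D" "y \<in> verts D" "x \<noteq> y" "1 \<le> weight D y" if "(x, y) \<in> arcs D" for x y
    using D that unfolding weighted_oriented_graph_def by blast+
  have fin: "finite (verts D)" using D by (simp add: weighted_oriented_graph_def)
  \<comment> \<open>Large enough to meet both requirements of \<open>edge_mons\<close> at any
    vertex.\<close>
  define N where "N = Suc (\<Sum>x\<in>verts D. weight D x)"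
  have N: "1 \<le> N" "weight D x \<le> N" if "x \<in> verts D" for x
    using member_le_sum[of x "verts D" "weight D"] that fin by (auto simp: N_def)
  {
    assume "\<exists>b. isolates (verts D) (edge_mons D) C b"
    then obtain b0 where b0: "b0 \<in> mons (verts D)" "\<And>x. x \<in> C \<Longrightarrow> single x 1 + b0 \<in> edge_mons D"
      "\<And>a. a \<in> mons (verts D - C) \<Longrightarrow> a + b0 \<notin> edge_mons D" unfolding isolates_def by blast
    \<comment> \<open>By the last clause of \<open>isolates\<close> the variables outside
      \<open>C\<close> may be raised to high powers without entering the ideal. Then every
      requirement at an uncovered vertex holds automatically.\<close>
    define e where "e = (\<Sum>x\<in>verts D - C. single x N)"
    define b where "b = e + b0"
    have e: "lookup e y = (if y \<in> verts D - C then N else 0)" for y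
      unfolding e_def using fin by (intro lookup_sum_single) auto
    have eV: "e \<in> mons (verts D - C)" by (auto simp: mons_def in_keys_iff e split: if_splits)
    have b1: "single x 1 + b \<in> edge_mons D" if "x \<in> C" for x
      using edge_mons_add[OF b0(2)[OF that], of e] by (simp add: b_def ac_simps)
    have b2: "b \<notin> edge_mons D" using b0(3)[OF eV] by (simp add: b_def)
    have big: "1 \<le> lookup b y" "weight D y \<le> lookup b y" if "y \<in> verts D" "y \<notin> C" for y
      using N[OF that(1)] that by (auto simp: b_def lookup_add e)
    have nb: False if "(x, y) \<in> arcs D" "1 \<le> lookup b x" "weight D y \<le> lookup b y" for x y
      using b2 that unfolding edge_mons_def by blast
    have new: "(\<exists>y. (x, y) \<in> arcs D \<and> weight D y \<le> lookup b y) \<or>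
        (\<exists>y. (y, x) \<in> arcs D \<and> 1 \<le> lookup b y)" if xC: "x \<in> C" for x
    proof -
      obtain u v where uv: "(u, v) \<in> arcs D" "1 \<le> lookup (single x 1 + b) u" "weight D v \<le> lookup (single x 1 + b) v"
        using b1[OF xC] unfolding edge_mons_def by blast
      have ne: "u \<noteq> v" using arc[OF uv(1)] by simp
      consider "u = x" | "v = x" "u \<noteq> x" | "u \<noteq> x" "v \<noteq> x" by blast
      then show ?thesis
      proof cases
        case 1
        then have "weight D v \<le> lookup b v" using uv(3) ne by (simp add: lookup_add lookup_single)
        then show ?thesis using uv(1) 1 by blast
      next
        case 2
        then have "1 \<le> lookup b u" using uv(2) ne by (simp add: lookup_add lookup_single)
        then show ?thesis using uv(1) 2 by blast
      next
        case 3
        then show ?thesis using uv nb[OF uv(1)] by (simp add: lookup_add lookup_single)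
      qed
    qed
    have small: "lookup b v < weight D v" if v: "v \<in> C" for v
    proof (rule ccontr)
      assume n: "\<not> lookup b v < weight D v"
      then have w: "weight D v \<le> lookup b v" by simp
      have "1 \<le> weight D v" using v CV D unfolding weighted_oriented_graph_def by blast
      then show False using new[OF v] w nb by (meson order_trans)
    qed
    show "strong_cover D C"
      unfolding strong_cover_def
    proof (intro conjI allI impI ballI)
      fix x y assume a: "(x, y) \<in> arcs D"
      show "x \<in> C \<or> y \<in> C"
        using nb[OF a] big(1)[of x] big(2)[of y] arc[OF a] by blast
    next
      fix x assume x: "x \<in> C" "\<forall>y. dadj D x y \<longrightarrow> y \<in> C"
      from new[OF x(1)] show "\<exists>y\<in>C - L1 D C. (y, x) \<in> arcs D \<and> 1 < weight D y"
      proof (elim disjE exE conjE)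
        fix y assume y: "(x, y) \<in> arcs D" "weight D y \<le> lookup b y"
        then have "y \<in> C" using x(2) by (simp add: dadj_def)
        then show ?thesis using small[of y] y(2) by simp
      next
        fix y assume y: "(y, x) \<in> arcs D" "1 \<le> lookup b y"
        then have yC: "y \<in> C" using x(2) by (simp add: dadj_def)
        have "y \<notin> L1 D C"
        proof
          assume "y \<in> L1 D C"
          then obtain t where t: "(y, t) \<in> arcs D" "t \<notin> C" by (auto simp: L1_def)
          then show False using nb[OF t(1) y(2)] big(2)[of t] arc[OF t(1)] by blast
        qed
        then show ?thesis using small[OF yC] y yC by (intro bexI[of _ y]) auto
      qed
    qed (rule CV)
  }
  assume C: "strong_cover D C"
  have cover: "x \<in> C \<or> y \<in> C" if "(x, y) \<in> arcs D" for x y using C that by (auto simp: strong_cover_def)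
  \<comment> \<open>On \<open>L1\<close> the exponent must vanish, since exponent one at the tail of
    an arc to an uncovered vertex already enters the ideal. Elsewhere in \<open>C\<close> it is one
    short of the weight, so that one more factor completes an arc into that vertex.\<close>
  define g where "g x = (if x \<notin> C then N else if x \<in> L1 D C then 0 else weight D x - 1)" for x
  define b where "b = (\<Sum>x\<in>verts D. single x (g x))"
  have b: "lookup b y = (if y \<in> verts D then g y else 0)" for y
    unfolding b_def using fin by (rule lookup_sum_single)
  have "isolates (verts D) (edge_mons D) C b"
    unfolding isolates_def
  proof (intro conjI ballI)
    show "b \<in> mons (verts D)" by (auto simp: mons_def in_keys_iff b split: if_splits)
    show "a + b \<notin> edge_mons D" if a: "a \<in> mons (verts D - C)" for a
    proof
      assume "a + b \<in> edge_mons D"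
      then obtain u v where uv: "(u, v) \<in> arcs D" "1 \<le> lookup (a + b) u" "weight D v \<le> lookup (a + b) v"
        unfolding edge_mons_def by blast
      note A = arc[OF uv(1)]
      have aC: "lookup a y = 0" if "y \<in> C" for y using a that by (auto simp: mons_def in_keys_iff)
      have "v \<notin> C"
      proof
        assume "v \<in> C"
        then have "lookup (a + b) v \<le> weight D v - 1" using aC A by (simp add: lookup_add b g_def)
        then show False using uv(3) A(4) by simp
      qed
      then have "u \<in> C" "u \<in> L1 D C" using cover[OF uv(1)] uv(1) by (auto simp: L1_def)
      then show False using uv(2) aC by (simp add: lookup_add b g_def split: if_splits)
    qed
    fix x assume x: "x \<in> C"
    then have xV: "x \<in> verts D" using CV by blast
    have mem: "single x 1 + b \<in> edge_mons D" if "(u, v) \<in> arcs D" "1 \<le> lookup (single x 1 + b) u" "weight D v \<le> lookup (single x 1 + b) v"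
      for u v using that unfolding edge_mons_def by blast
    show "single x 1 + b \<in> edge_mons D"
    proof (cases "x \<in> L1 D C")
      case True
      then obtain y where y: "(x, y) \<in> arcs D" "y \<notin> C" by (auto simp: L1_def)
      show ?thesis
        by (rule mem[OF y(1)]) (use y arc[OF y(1)] N in \<open>auto simp: lookup_add lookup_single b g_def trans_le_add2\<close>)
    next
      case False
      have w: "weight D x \<le> lookup (single x 1 + b) x"
        using False x xV by (simp add: lookup_add lookup_single b g_def)
      have "\<exists>y. (y, x) \<in> arcs D \<and> 1 \<le> lookup b y"
      proof (cases "\<forall>y. dadj D x y \<longrightarrow> y \<in> C")
        case True
        then obtain y where y: "y \<in> C - L1 D C" "(y, x) \<in> arcs D" "1 < weight D y"
          using C x unfolding strong_cover_def by blast
        then have "1 \<le> lookup b y" using arc[OF y(2)] by (simp add: b g_def)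
        then show ?thesis using y(2) by blast
      next
        case n: False
        then obtain y where y: "dadj D x y" "y \<notin> C" by blast
        then have a: "(y, x) \<in> arcs D" using False x by (auto simp: dadj_def L1_def)
        then have "1 \<le> lookup b y" using arc[OF a] y(2) N(1) by (simp add: b g_def)
        then show ?thesis using a by blast
      qed
      then obtain y where y: "(y, x) \<in> arcs D" "1 \<le> lookup b y" by blast
      show ?thesis by (rule mem[OF y(1) _ w]) (use y(2) in \<open>simp add: lookup_add\<close>)
    qed
  qed
  then show "\<exists>b. isolates (verts D) (edge_mons D) C b" by blast
qed

lemma associated_primes_edge_ideal:
  assumes D: "weighted_oriented_graph D"
  shows "associated_primes (polynomial_ring (verts D)) (edge_ideal D :: ('v, 'k::field) mpoly set) =
    variable_ideal (verts D) ` {C. strong_cover D C}" (is "?l = ?r")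
proof -
  let ?V = "verts D" and ?R = "polynomial_ring (verts D) :: (('v, 'k) mpoly) ring"
  have CV: "C \<subseteq> ?V" if "strong_cover D C" for C using that by (simp add: strong_cover_def)
  show ?thesis
  proof
    show "?l \<subseteq> ?r"
    proof
      fix P :: "('v, 'k) mpoly set" assume "P \<in> ?l"
      then obtain f where f: "primeideal P ?R" "f \<in> polys ?V" "P = {g \<in> polys ?V. g * f \<in> mideal ?V (edge_mons D)}"
        unfolding associated_primes_def edge_ideal_eq[OF D] by auto
      from associated_isolates[OF edge_mons_add f] obtain C b where
        "C \<subseteq> ?V" "P = variable_ideal ?V C" "isolates ?V (edge_mons D) C b" .
      then show "P \<in> ?r" using isolates_iff[OF D] by blast
    qed
    show "?r \<subseteq> ?l"
    proof
      fix P :: "('v, 'k) mpoly set" assume "P \<in> ?r"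
      then obtain C where C: "strong_cover D C" "P = variable_ideal ?V C" by blast
      then obtain b where b: "isolates ?V (edge_mons D) C b" using isolates_iff[OF D CV] by blast
      have "single b 1 \<in> carrier ?R" using b by (simp add: isolates_def polys_closed)
      moreover have "P = {g \<in> carrier ?R. g \<otimes>\<^bsub>?R\<^esub> single b 1 \<in> edge_ideal D}"
        using isolates_colon[OF edge_mons_add b CV[OF C(1)]] C(2) by (simp add: edge_ideal_eq[OF D])
      moreover have "primeideal P ?R" unfolding C(2) by (rule primeideal_variable_ideal)
      ultimately show "P \<in> ?l" unfolding associated_primes_def by blast
    qed
  qed
qed

section \<open>Heights of variable ideals\<close>

fun pmon :: "('v, 'k::field) mpoly list \<Rightarrow> nat list \<Rightarrow> ('v, 'k) mpoly" where
  "pmon (f # fs) (j # l) = f ^ j * pmon fs l"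
| "pmon _ _ = 1"

definition exps :: "nat \<Rightarrow> nat \<Rightarrow> nat list set" where
  "exps n s = {l. set l \<subseteq> {..<s} \<and> length l = n}"

text \<open>A chain of primes from \<open>Q\<close> upwards, recorded by elements that enter at each
  step; they later serve as independent generators.\<close>

fun pchain :: "'v set \<Rightarrow> ('v, 'k::field) mpoly set \<Rightarrow> ('v, 'k) mpoly list \<Rightarrow> bool" where
  "pchain V Q [] \<longleftrightarrow> primeideal Q (polynomial_ring V)"
| "pchain V Q (f # fs) \<longleftrightarrow> primeideal Q (polynomial_ring V) \<and> f \<in> polys V \<and> f \<notin> Q \<and>
     (\<exists>Q'. Q \<subseteq> Q' \<and> f \<in> Q' \<and> pchain V Q' fs)"

lemma pchain_prime: "pchain V Q fs \<Longrightarrow> primeideal Q (polynomial_ring V)"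
  by (cases fs) auto

lemma pchain_polys: "pchain V Q fs \<Longrightarrow> set fs \<subseteq> polys V"
  by (induction fs arbitrary: Q) auto

lemma power_polys: "f \<in> polys V \<Longrightarrow> f ^ j \<in> polys V"
  by (induction j) (auto intro: polys_closed)

lemma sum_polys: "(\<And>i. i \<in> A \<Longrightarrow> f i \<in> polys V) \<Longrightarrow> sum f A \<in> polys V"
  by (induction A rule: infinite_finite_induct) (auto intro: polys_closed)

lemma pmon_polys: "set fs \<subseteq> polys V \<Longrightarrow> pmon fs l \<in> polys V"
  by (induction fs l rule: pmon.induct) (auto intro: polys_closed power_polys)

lemma finite_exps: "finite (exps n s)" and card_exps: "card (exps n s) = s ^ n"
  unfolding exps_def by (simp_all add: finite_lists_length_eq card_lists_length_eq)

lemma exps_Suc: "exps (Suc n) s = (\<lambda>(j, l). j # l) ` ({..<s} \<times> exps n s)"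
  unfolding exps_def by (auto simp: length_Suc_conv image_iff)

text \<open>The products of powers are linearly independent even modulo the smallest prime of the chain;
  counting the monomials of bounded degree then bounds the length of the chain by the number of variables.\<close>

lemma pmon_independent:
  assumes "pchain V (Q :: ('v, 'k::field) mpoly set) fs"
    and "(\<Sum>l\<in>exps (length fs) s. single 0 (c l) * pmon fs l) \<in> Q" "l \<in> exps (length fs) s"
  shows "c l = 0"
  using assms
proof (induction fs arbitrary: Q c l)
  case Nil
  have e: "exps 0 s = {[]}" by (auto simp: exps_def)
  note P = prime_facts[OF pchain_prime[OF Nil(1)]]
  show ?case
  proof (rule ccontr)
    assume "c l \<noteq> 0"
    then have "single 0 (inverse (c l)) * single 0 (c l) = (1 :: ('v, 'k) mpoly)" by (simp add: mult_single)
    moreover have "single 0 (inverse (c l)) \<in> (polys V :: ('v, 'k) mpoly set)" by (simp add: polys_closed mons_def)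
    moreover have "single 0 (c l) \<in> Q" using Nil(2,3) by (simp add: e)
    ultimately show False using P(5,6) by metis
  qed
next
  case (Cons f fs)
  let ?n = "length fs"
  note P = prime_facts[OF pchain_prime[OF Cons.prems(1)]]
  obtain Q' where Q': "Q \<subseteq> Q'" "f \<in> Q'" "pchain V Q' fs" and f: "f \<in> polys V" "f \<notin> Q" using Cons.prems(1) by auto
  note P' = prime_facts[OF pchain_prime[OF Q'(3)]]
  have fsV: "set fs \<subseteq> polys V" using pchain_polys[OF Q'(3)] .
  define g where "g j = (\<Sum>l\<in>exps ?n s. single 0 (c (j # l)) * pmon fs l)" for j
  have gV: "g j \<in> polys V" for j
    unfolding g_def by (intro sum_polys polys_closed(2) pmon_polys[OF fsV]) (simp add: polys_closed mons_def)
  have "(\<Sum>l\<in>exps (Suc ?n) s. single 0 (c l) * pmon (f # fs) l) =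
      (\<Sum>j<s. \<Sum>l\<in>exps ?n s. single 0 (c (j # l)) * (f ^ j * pmon fs l))"
    unfolding exps_Suc by (subst sum.reindex) (auto simp: inj_on_def sum.cartesian_product split_def)
  also have "\<dots> = (\<Sum>j<s. f ^ j * g j)"
    unfolding g_def sum_distrib_left by (intro sum.cong refl) (simp add: ac_simps)
  finally have T: "(\<Sum>j<s. f ^ j * g j) \<in> Q" using Cons.prems(2) by simp
  have pow: "f ^ j \<notin> Q" for j using P(6) P(7)[of f] f power_polys by (induction j) auto
  \<comment> \<open>Once the lower terms vanish, the power of \<open>f\<close> cancels because it
    lies outside the prime \<open>Q\<close>. The remaining multiples of \<open>f\<close> belong to
    \<open>Q'\<close>, which leaves \<open>g j\<close> in \<open>Q'\<close>.\<close>
  have zero: "c (j # l) = 0" if "j < s" "l \<in> exps ?n s" for j l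
    using that
  proof (induction j arbitrary: l rule: less_induct)
    case (less j)
    have g0: "g i = 0" if "i < j" for i
      unfolding g_def using less.IH[OF that] that less.prems(1) by (intro sum.neutral) simp
    define h where "h = (\<Sum>i\<in>{Suc j..<s}. f ^ (i - Suc j) * g i)"
    have hV: "h \<in> polys V" unfolding h_def by (intro sum_polys polys_closed(2) power_polys f gV)
    have "(\<Sum>i<s. f ^ i * g i) = (\<Sum>i\<in>{j..<s}. f ^ i * g i)"
      by (rule sum.mono_neutral_right) (auto simp: g0)
    also have "\<dots> = f ^ j * g j + (\<Sum>i\<in>{Suc j..<s}. f ^ i * g i)"
      using less.prems(1) by (simp add: sum.atLeast_Suc_lessThan)
    also have "(\<Sum>i\<in>{Suc j..<s}. f ^ i * g i) = (\<Sum>i\<in>{Suc j..<s}. f ^ j * (f * (f ^ (i - Suc j) * g i)))"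
    proof (intro sum.cong refl)
      fix i assume "i \<in> {Suc j..<s}"
      then have "i = j + Suc (i - Suc j)" by auto
      then have "f ^ i = f ^ j * (f * f ^ (i - Suc j))" by (metis power_Suc power_add)
      then show "f ^ i * g i = f ^ j * (f * (f ^ (i - Suc j) * g i))" by (simp add: mult.assoc)
    qed
    also have "\<dots> = f ^ j * (f * h)" unfolding h_def sum_distrib_left ..
    also have "f ^ j * g j + f ^ j * (f * h) = f ^ j * (g j + f * h)" by (simp add: distrib_left)
    finally have "f ^ j * (g j + f * h) \<in> Q" using T by simp
    then have "g j + f * h \<in> Q'"
      using P(7) pow power_polys[OF f(1)] polys_closed(1)[OF gV polys_closed(2)[OF f(1) hV]] Q'(1) by blast
    moreover have "f * h \<in> Q'" using P'(5)[OF hV Q'(2)] by (simp add: mult.commute)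
    ultimately have "(g j + f * h) + - (f * h) \<in> Q'" using P'(3)[of "g j + f * h"] P'(4) by blast
    then have "g j \<in> Q'" by simp
    then show ?case using Cons.IH[OF Q'(3), of "\<lambda>l. c (j # l)"] less.prems(2) unfolding g_def by blast
  qed
  obtain j l' where "l = j # l'" "j < s" "l' \<in> exps ?n s" using Cons.prems(3) by (auto simp: exps_Suc)
  then show ?case using zero by blast
qed

text \<open>Bounds each exponent separately instead of the total degree, so the monomials over
  \<open>V\<close> within the bound \<open>B\<close> number \<open>(B + 1) ^ card V\<close>.\<close>

definition deg_le :: "nat \<Rightarrow> ('v, 'k::field) mpoly \<Rightarrow> bool" where
  "deg_le B p \<longleftrightarrow> (\<forall>m\<in>keys p. \<forall>x. lookup m x \<le> B)"

lemma deg_le_mult: "deg_le a p \<Longrightarrow> deg_le b q \<Longrightarrow> deg_le (a + b) (p * q)"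
proof -
  assume d: "deg_le a p" "deg_le b q"
  show ?thesis
    unfolding deg_le_def
  proof (intro ballI allI)
    fix m x assume "m \<in> keys (p * q)"
    then obtain m1 m2 where "m1 \<in> keys p" "m2 \<in> keys q" "m = m1 + m2" using keys_mult[of p q] by blast
    then show "lookup m x \<le> a + b" using d by (auto simp: deg_le_def lookup_add add_mono)
  qed
qed

lemma deg_le_mono: "deg_le a p \<Longrightarrow> a \<le> b \<Longrightarrow> deg_le b p"
  by (auto simp: deg_le_def intro: le_trans)

lemma deg_le_one: "deg_le a 1"
  by (simp add: deg_le_def)

lemma deg_le_power: "deg_le d f \<Longrightarrow> deg_le (j * d) (f ^ j)"
  by (induction j) (auto simp: deg_le_one intro: deg_le_mult)

lemma deg_le_pmon:
  assumes "\<And>f. f \<in> set fs \<Longrightarrow> deg_le d f" "l \<in> exps (length fs) s"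
  shows "deg_le (length fs * (s * d)) (pmon fs l)"
  using assms
proof (induction fs arbitrary: l)
  case (Cons f fs)
  then obtain j l' where l: "l = j # l'" "j < s" "l' \<in> exps (length fs) s" by (auto simp: exps_Suc)
  have "deg_le (s * d) (f ^ j)"
    using deg_le_power[of d f j] Cons.prems(1)[of f] l(2) by (auto intro: deg_le_mono mult_le_mono1)
  then have "deg_le (s * d + length fs * (s * d)) (f ^ j * pmon fs l')"
    using Cons.IH[OF _ l(3)] Cons.prems(1) by (intro deg_le_mult) auto
  then show ?case by (simp add: l(1))
qed (simp add: deg_le_one)

interpretation poly_vs: vector_space "\<lambda>(c::'k::field) (p :: ('v, 'k) mpoly). single 0 c * p"
  by unfold_locales (simp_all add: distrib_left distrib_right single_add mult_single flip: mult.assoc)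

text \<open>The \<open>s ^ length fs\<close> independent products lie in the span of
  \<open>(B + 1) ^ card V\<close> monomials, where \<open>B\<close> is linear in \<open>s\<close>.
  For large \<open>s\<close> this bounds the number of steps by \<open>card V\<close>.\<close>

lemma pchain_length:
  assumes V: "finite V" and ch: "pchain V (Q :: ('v, 'k::field) mpoly set) fs"
  shows "length fs \<le> card V"
proof (rule ccontr)
  let ?n = "length fs" and ?N = "card V"
  assume "\<not> ?n \<le> ?N"
  then have nN: "Suc ?N \<le> ?n" by simp
  define d where "d = (\<Sum>f\<in>set fs. \<Sum>m\<in>keys f. \<Sum>x\<in>keys m. lookup m x)"
  have d: "deg_le d f" if "f \<in> set fs" for f
    unfolding deg_le_def
  proof (intro ballI allI)
    fix m x assume m: "m \<in> keys f"
    have "lookup m x \<le> (\<Sum>x\<in>keys m. lookup m x)"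
      by (cases "x \<in> keys m") (auto simp: in_keys_iff intro: member_le_sum)
    also have "\<dots> \<le> (\<Sum>m\<in>keys f. \<Sum>x\<in>keys m. lookup m x)" using m by (intro member_le_sum) auto
    also have "\<dots> \<le> d" unfolding d_def using that by (intro member_le_sum[of f]) auto
    finally show "lookup m x \<le> d" .
  qed
  \<comment> \<open>Since \<open>B + 1\<close> is at most \<open>s\<close> times the base of this
    power, the choice gives \<open>(B + 1) ^ card V < s ^ Suc (card V)\<close>.\<close>
  define s where "s = Suc ((?n * d + 1) ^ ?N)"
  define B where "B = ?n * (s * d)"
  define M where "M = {m \<in> mons V. \<forall>x. lookup m x \<le> B}"
  have inj: "inj_on (\<lambda>m. restrict (lookup m) V) M"
  proof (rule inj_onI)
    fix m m' assume m: "m \<in> M" "m' \<in> M" "restrict (lookup m) V = restrict (lookup m') V"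
    show "m = m'"
    proof (rule poly_mapping_eqI)
      fix x show "lookup m x = lookup m' x"
      proof (cases "x \<in> V")
        case True
        then show ?thesis using m(3) by (metis restrict_apply')
      next
        case False
        then have "x \<notin> keys m" "x \<notin> keys m'" using m(1,2) by (auto simp: M_def mons_def)
        then show ?thesis by (simp add: in_keys_iff)
      qed
    qed
  qed
  have im: "(\<lambda>m. restrict (lookup m) V) ` M \<subseteq> (\<Pi>\<^sub>E x\<in>V. {..B})" by (auto simp: M_def)
  have finE: "finite (\<Pi>\<^sub>E x\<in>V. {..B})" using V by (intro finite_PiE) auto
  have finM: "finite M" using inj_on_finite[OF inj im finE] .
  have cardM: "card M \<le> (B + 1) ^ ?N"
    using card_inj_on_le[OF inj im finE] V by (simp add: card_PiE)
  let ?E = "exps ?n s" and ?p = "pmon fs"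
  have ind: "c l = 0" if "(\<Sum>l\<in>?E. single 0 (c l) * ?p l) = 0" "l \<in> ?E" for c :: "nat list \<Rightarrow> 'k" and l
    using pmon_independent[OF ch, where s = s and c = c and l = l] that prime_facts(2)[OF pchain_prime[OF ch]] by simp
  have injp: "inj_on ?p ?E"
  proof (rule inj_onI, rule ccontr)
    fix l l' assume l: "l \<in> ?E" "l' \<in> ?E" "?p l = ?p l'" "l \<noteq> l'"
    define c :: "nat list \<Rightarrow> 'k" where "c k = (if k = l then 1 else if k = l' then - 1 else 0)" for k
    have "(\<Sum>k\<in>?E. single 0 (c k) * ?p k) = (\<Sum>k\<in>{l, l'}. single 0 (c k) * ?p k)"
      by (rule sum.mono_neutral_right) (use l finite_exps in \<open>auto simp: c_def\<close>)
    also have "\<dots> = 0" using l(3,4) by (simp add: c_def single_uminus)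
    finally show False using ind[of c l] l(1) by (simp add: c_def)
  qed
  have finS: "finite (?p ` ?E)" by (simp add: finite_exps)
  have indS: "poly_vs.independent (?p ` ?E)"
  proof
    assume "poly_vs.dependent (?p ` ?E)"
    then obtain u where u: "\<exists>v\<in>?p ` ?E. u v \<noteq> 0" "(\<Sum>v\<in>?p ` ?E. single 0 (u v) * v) = 0"
      unfolding poly_vs.dependent_finite[OF finS] by blast
    have "(\<Sum>l\<in>?E. single 0 (u (?p l)) * ?p l) = 0" using u(2) injp by (simp add: sum.reindex)
    then show False using ind[of "\<lambda>l. u (?p l)"] u(1) by auto
  qed
  have "?p l \<in> poly_vs.span ((\<lambda>m. single m 1) ` M)" if "l \<in> ?E" for l
  proof -
    have kM: "keys (?p l) \<subseteq> M"
      using pmon_polys[OF pchain_polys[OF ch], of l] deg_le_pmon[OF d that]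
      by (auto simp: M_def polys_def deg_le_def B_def)
    have "(\<Sum>m\<in>keys (?p l). single 0 (lookup (?p l) m) * single m 1) \<in> poly_vs.span ((\<lambda>m. single m 1) ` M)"
      by (intro poly_vs.span_sum poly_vs.span_scale poly_vs.span_base imageI subsetD[OF kM])
    then show ?thesis using poly_expand[of "?p l"] by (simp add: mult_single)
  qed
  then have "card (?p ` ?E) \<le> card ((\<lambda>m. single m (1::'k)) ` M)"
    using poly_vs.independent_span_bound[OF _ indS] finM by blast
  also have "\<dots> \<le> card M" by (rule card_image_le[OF finM])
  finally have "s ^ ?n \<le> (B + 1) ^ ?N" using cardM injp by (simp add: card_image card_exps)
  also have "B + 1 \<le> (?n * d + 1) * s" by (simp add: B_def s_def algebra_simps)
  then have "(B + 1) ^ ?N \<le> ((?n * d + 1) * s) ^ ?N" by (rule power_mono) simp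
  also have "\<dots> = (?n * d + 1) ^ ?N * s ^ ?N" by (rule power_mult_distrib)
  also have "\<dots> < s * s ^ ?N" by (rule mult_strict_right_mono) (simp_all add: s_def)
  also have "\<dots> = s ^ Suc ?N" by simp
  also have "\<dots> \<le> s ^ ?n" by (rule power_increasing[OF nN]) (simp add: s_def)
  finally show False by simp
qed

lemma variable_in_variable_ideal: "variable x \<in> (variable_ideal V C :: ('v, 'k::field) mpoly set) \<longleftrightarrow> x \<in> V \<and> x \<in> C"
  by (simp add: variable_def variable_ideal_def mideal_def mons_def meets_def)

lemma variable_ideal_mono: "C \<subseteq> C' \<Longrightarrow> variable_ideal V C \<subseteq> variable_ideal V C'"
  unfolding variable_ideal_def mideal_def meets_def by blast

lemma pchain_variable_ideal:
  assumes "distinct xs" "set xs \<subseteq> V - C"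
  shows "pchain V (variable_ideal V C :: ('v, 'k::field) mpoly set) (map variable xs)"
  using assms
proof (induction xs arbitrary: C)
  case Nil
  show ?case by (simp add: primeideal_variable_ideal)
next
  case (Cons x xs)
  have "variable x \<in> (polys V :: ('v, 'k) mpoly set)" using Cons.prems by (simp add: variable_def polys_closed mons_def)
  moreover have "pchain V (variable_ideal V (insert x C) :: ('v, 'k) mpoly set) (map variable xs)"
    using Cons.prems by (intro Cons.IH) auto
  moreover have "variable_ideal V C \<subseteq> (variable_ideal V (insert x C) :: ('v, 'k) mpoly set)" by (rule variable_ideal_mono) blast
  ultimately show ?case
    using Cons.prems by (auto simp: primeideal_variable_ideal variable_in_variable_ideal intro!: exI[of _ "variable_ideal V (insert x C)"])
qed

text \<open>A chain ending in this ideal continues by adjoining the remaining variables one at a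
  time; the bound \<open>card V\<close> for the whole leaves at most \<open>card C\<close> steps
  below. Adjoining the variables of \<open>C\<close> one at a time attains this.\<close>

lemma height_variable_ideal:
  assumes V: "finite V" and CV: "C \<subseteq> V"
  shows "height (polynomial_ring V) (variable_ideal V C :: ('v, 'k::field) mpoly set) = enat (card C)"
proof -
  let ?R = "polynomial_ring V :: (('v, 'k) mpoly) ring"
  have finC: "finite C" using CV V finite_subset by blast
  have le: "n \<le> card C" if c: "\<forall>i\<le>n. primeideal (c i) ?R" "\<forall>i<n. c i \<subset> c (Suc i)" "c n = variable_ideal V C"
    for n and c :: "nat \<Rightarrow> ('v, 'k) mpoly set"
  proof -
    obtain xs where xs: "set xs = V - C" "distinct xs" using V finite_distinct_list[of "V - C"] by blast
    have "\<exists>fs. pchain V (c i) fs \<and> length fs = n - i + length xs" if "i \<le> n" for i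
      using that
    proof (induction rule: inc_induct)
      case base
      show ?case using pchain_variable_ideal[OF xs(2), of V C] xs(1) c(3) by (intro exI[of _ "map variable xs"]) simp
    next
      case (step i)
      then obtain fs where fs: "pchain V (c (Suc i)) fs" "length fs = n - Suc i + length xs" by blast
      obtain f where f: "f \<in> c (Suc i)" "f \<notin> c i" using c(2) step(2) by blast
      have "f \<in> polys V" using f(1) prime_facts(1) c(1) step(2) by (metis Suc_leI subsetD)
      then have "pchain V (c i) (f # fs)" using f fs(1) c(1,2) step(2) by (auto intro!: exI[of _ "c (Suc i)"])
      then show ?case using fs(2) step(2) by (intro exI[of _ "f # fs"]) simp
    qed
    from this[of 0] obtain fs where "pchain V (c 0) fs" "length fs = n + length xs" by auto
    then have "n + length xs \<le> card V" using pchain_length[OF V] by metis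
    moreover have "length xs = card V - card C"
      using xs distinct_card[OF xs(2)] CV finC by (simp add: card_Diff_subset)
    moreover have "card C \<le> card V" using card_mono[OF V CV] .
    ultimately show ?thesis by simp
  qed
  obtain ys where ys: "set ys = C" "distinct ys" using finite_distinct_list[OF finC] by blast
  have len: "length ys = card C" using ys distinct_card by metis
  have "\<forall>i\<le>card C. primeideal (variable_ideal V (set (take i ys)) :: ('v, 'k) mpoly set) ?R" by (simp add: primeideal_variable_ideal)
  moreover have "\<forall>i<card C. variable_ideal V (set (take i ys)) \<subset> (variable_ideal V (set (take (Suc i) ys)) :: ('v, 'k) mpoly set)"
  proof (intro allI impI)
    fix i assume i: "i < card C"
    then have t: "take (Suc i) ys = take i ys @ [ys ! i]" using len by (simp add: take_Suc_conv_app_nth)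
    have "distinct (take (Suc i) ys)" using ys(2) by simp
    then have "ys ! i \<notin> set (take i ys)" unfolding t by simp
    moreover have "ys ! i \<in> V" using i len ys(1) CV nth_mem[of i ys] by auto
    ultimately have "variable (ys ! i) \<in> (variable_ideal V (set (take (Suc i) ys)) :: ('v, 'k) mpoly set)"
      "variable (ys ! i) \<notin> (variable_ideal V (set (take i ys)) :: ('v, 'k) mpoly set)"
      unfolding variable_in_variable_ideal t by auto
    moreover have "variable_ideal V (set (take i ys)) \<subseteq> (variable_ideal V (set (take (Suc i) ys)) :: ('v, 'k) mpoly set)"
      unfolding t by (rule variable_ideal_mono) auto
    ultimately show "variable_ideal V (set (take i ys)) \<subset> (variable_ideal V (set (take (Suc i) ys)) :: ('v, 'k) mpoly set)" by blast
  qed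
  moreover have "variable_ideal V (set (take (card C) ys)) = (variable_ideal V C :: ('v, 'k) mpoly set)" using ys(1) len by simp
  ultimately have "enat (card C) \<in> {enat n | n. \<exists>c :: nat \<Rightarrow> ('v, 'k) mpoly set.
     (\<forall>i\<le>n. primeideal (c i) ?R) \<and> (\<forall>i<n. c i \<subset> c (Suc i)) \<and> c n = variable_ideal V C}"
    by (intro CollectI exI[of _ "card C"] conjI refl exI[of _ "\<lambda>i. variable_ideal V (set (take i ys))"])
  then show ?thesis unfolding height_def by (intro antisym Sup_least Sup_upper) (use le in auto)
qed

theorem unmixed_iff_equal_covers:
  assumes D: "weighted_oriented_graph D"
  shows "unmixed (polynomial_ring (verts D) :: (('v \<Rightarrow>\<^sub>0 nat) \<Rightarrow>\<^sub>0 'k::field) ring) (edge_ideal D) \<longleftrightarrow> equal_covers D"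
proof -
  have fin: "finite (verts D)" using D by (simp add: weighted_oriented_graph_def)
  have "height (polynomial_ring (verts D)) (variable_ideal (verts D) C :: ('v, 'k) mpoly set) = enat (card C)"
    if "strong_cover D C" for C
    by (rule height_variable_ideal[OF fin]) (use that in \<open>simp add: strong_cover_def\<close>)
  then show ?thesis
    unfolding unmixed_def associated_primes_edge_ideal[OF D] equal_covers_def by auto
qed

section \<open>Unmixed edge ideals\<close>

theorem theorem5p13:
  fixes D :: "'v wograph"
  assumes "weighted_oriented_graph D"
    and sources: "\<And>x. source D x \<Longrightarrow> weight D x = 1"
    and "connected_graph (underlying D)"
    and "girth_at_least 5 (underlying D)"
  shows "unmixed (polynomial_ring (verts D) :: (('v \<Rightarrow>\<^sub>0 nat) \<Rightarrow>\<^sub>0 'k::field) ring) (edge_ideal D)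
    \<longleftrightarrow>
      ((isomorphic K\<^sub>1 (underlying D) \<or> isomorphic C\<^sub>7 (underlying D) \<or>
        isomorphic Q\<^sub>1\<^sub>3 (underlying D) \<or> isomorphic P\<^sub>1\<^sub>3 (underlying D) \<or>
        isomorphic P\<^sub>1\<^sub>4 (underlying D)) \<and>
       (\<forall>x\<in>Vplus D. sink D x))
    \<or> (\<exists>\<phi>. graph_iso P\<^sub>1\<^sub>0 (underlying D) \<phi> \<and>
         (\<forall>y\<in>Vplus D. \<not> sink D y \<longrightarrow>
            (y = \<phi> (vd 1) \<and> out_nbrs D y = {\<phi> (vg 1), \<phi> (vb 2)}) \<or>
            (y = \<phi> (vd 2) \<and> out_nbrs D y = {\<phi> (vg 2), \<phi> (vb 1)})))
    \<or> ((\<forall>x\<in>verts D. \<exists>!H. H \<in> simplexes (underlying D) \<union> basic_5_cycles (underlying D) \<and>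
           x \<in> fst H) \<and>
       (\<forall>K\<in>wo_simplexes D. \<nexists>H. generating_star_semi_forest D K H) \<and>
       (\<forall>C\<in>basic_5_cycles (underlying D). star_property D C))"
proof -
  interpret girth5_wograph D by (rule girth5_wograph.intro) (fact assms)+
  show ?thesis
    unfolding unmixed_iff_equal_covers[OF assms(1)] by (rule equal_covers_iff[OF assms(3)])
qed

end
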